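(* Let $X_1,\dots,X_q$ be real analytic vector fields on an open set $\Omega\subseteq\mathbb R^n$ which span the tangent space at every point of $\Omega$. To each $X_j$ assign a formal degree $d_j\in[1,\infty)$. Assume that for every $x\in\Omega$ there is an open neighborhood $U_x\subseteq\Omega$ of $x$ such that $[X_j,X_k]=\sum_{d_l\le d_j+d_k}c_{j,k}^{l,x}X_l$ on $U_x$ with $c_{j,k}^{l,x}\in C^\omega(U_x)$, $1\le j,k\le q$. For $x\in\Omega$ and $\delta\in(0,1]$ let $$\Lambda(x,\delta)=\max_{k_1,\dots,k_n\in\{1,\dots,q\}}\left|\det\left(\delta^{d_{k_1}}X_{k_1}(x)|\cdots|\delta^{d_{k_n}}X_{k_n}(x)\right)\right|,$$ choose $j_1=j_1(x,\delta),\dots,j_n=j_n(x,\delta)$ so that $|\det(\delta^{d_{j_1}}X_{j_1}(x)|\cdots|\delta^{d_{j_n}}X_{j_n}(x))|=\Lambda(x,\delta)$, and set $\Phi_{x,\delta}(t_1,\dots,t_n)=\exp(t_1\delta^{d_{j_1}}X_{j_1}+\cdots+t_n\delta^{d_{j_n}}X_{j_n})x$. Fix a compact set $\mathcal K\Subset\Omega$. Write $A\lesssim B$ for $A\le CB$ where $C$ is a positive constant which may depend on $\mathcal K$ but does not depend on the particular points $x\in\mathcal K$ or $u\in\mathbb R^n$, or the scale $\delta\in(0,1]$; write $A\approx B$ for $A\lesssim B$ and $B\lesssim A$. Then there exist $\eta_1,\xi_0\approx1$ such that for all $x\in\mathcal K$: (i) $\sigma_{\mathrm{Leb}}(B_{(X,d)}(x,\delta))\approx\Lambda(x,\delta)$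 for all $\delta\in(0,\xi_0]$. (ii) $\sigma_{\mathrm{Leb}}(B_{(X,d)}(x,2\delta))\lesssim\sigma_{\mathrm{Leb}}(B_{(X,d)}(x,\delta))$ for all $\delta\in(0,\xi_0/2]$. (iii) For all $\delta\in(0,1]$, $\Phi_{x,\delta}(B^n(\eta_1))\subseteq\Omega$ is open and $\Phi_{x,\delta}:B^n(\eta_1)\to\Phi_{x,\delta}(B^n(\eta_1))$ is a real analytic diffeomorphism. (iv) Define $h_{x,\delta}$ by $h_{x,\delta}\sigma_{\mathrm{Leb}}=\Phi_{x,\delta}^*\sigma_{\mathrm{Leb}}$. Then $h_{x,\delta}(t)\approx\Lambda(x,\delta)$ for all $t\in B^n(\eta_1)$, and there exists $s\approx1$ with $\|h_{x,\delta}\|_{\mathscr A^{n,s}}\lesssim\Lambda(x,\delta)$. (v) $B_{(X,d)}(x,\xi_0\delta)\subseteq\Phi_{x,\delta}(B^n(\eta_1))\subseteq B_{(X,d)}(x,\delta)$ for all $\delta\in(0,1]$. (vi) Let $Y_j^{x,\delta}:=\Phi_{x,\delta}^*\delta^{d_j}X_j$, $1\le j\le q$, so that $Y_j^{x,\delta}$ is a real analytic vector field on $B^n(\eta_1)$. Then $\|Y_j^{x,\delta}\|_{\mathscr A^{n,\eta_1}(\mathbb R^n)}\lesssim1$, $1\le j\le q$. Finally, $Y_1^{x,\delta}(u),\dots,Y_q^{x,\delta}(u)$ span $T_uB^n(\eta_1)$ uniformly in $x,\delta,u$, in the sense that $$\max_{k_1,\dots,k_n\in\{1,\dots,q\}}\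 \inf_{u\in B^n(\eta_1)}\left|\det\left(Y_{k_1}^{x,\delta}(u)|\cdots|Y_{k_n}^{x,\delta}(u)\right)\right|\approx1.$$
   Context: $B^n(r)$ is the open ball of radius $r$ centered at $0$ in $\mathbb R^n$. $A\Subset B$ means $A$ is a relatively compact subset of $B$. $\sigma_{\mathrm{Leb}}$ is the Lebesgue density (measure). Vector fields on open subsets of $\mathbb R^n$ are identified with their $\mathbb R^n$-valued coefficient functions. For a list $W=W_1,\dots,W_q$ of $C^1$ vector fields on $\Omega$, $B_W(x,\delta)$ is the set of $y\in\Omega$ for which there is an absolutely continuous $\gamma:[0,1]\to\Omega$ with $\gamma(0)=x$, $\gamma(1)=y$, $\gamma'(t)=\sum_ja_j(t)\delta W_j(\gamma(t))$ for a.e. $t$, $a_j\in L^\infty([0,1])$, $\|\sum_j|a_j|^2\|_{L^\infty}<1$. $\delta^dX$ is the list $\delta^{d_1}X_1,\dots,\delta^{d_q}X_q$ and $B_{(X,d)}(x,\delta):=B_{\delta^dX}(x,1)$. $\exp(W)x=e^Wx$ is the time-one flow of the vector field $W$ starting at $x$. For $U\subseteq\mathbb R^n$ open, $C^{\omega}(U)=\bigcup_{r>0}C^{\omega,r}(U)$, where $C^{\omega,r}(U)$ consists of $f\in C^\infty(U)$ with $\sum_{\alpha\in\mathbb N^n}\frac{r^{|\alpha|}}{\alpha!}\sup_U|\partial_x^\alpha f|<\infty$. For a Banach space $E$, $\mathscr A^{n,r}(E)$ is the space of bounded continuous $f:B^n(r)\to E$ of the form $f(t)=\sum_{\alpha\in\mathbb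 N^n}\frac{c_\alpha}{\alpha!}t^\alpha$ with $\|f\|_{\mathscr A^{n,r}(E)}=\sum_\alpha\frac{\|c_\alpha\|_E}{\alpha!}r^{|\alpha|}<\infty$; $\mathscr A^{n,r}=\mathscr A^{n,r}(\mathbb C)$. *)

theory Defs
  imports "HOL-Analysis.Analysis" "HOL-Probability.Essential_Supremum"
begin

definition partial_deriv ::
  "'n::finite \<Rightarrow> (real^'n \<Rightarrow> 'b::real_normed_vector) \<Rightarrow> real^'n \<Rightarrow> 'b" where
  "partial_deriv i f x = vector_derivative (\<lambda>t. f (x + t *\<^sub>R axis i 1)) (at 0)"

text \<open>For open \<open>U\<close>: all iterated partial derivatives are (Frechet) differentiable on \<open>U\<close>.\<close>

definition smooth_on :: "(real^'n::finite) set \<Rightarrow> (real^'n \<Rightarrow> 'b::real_normed_vector) \<Rightarrow> bool" where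
  "smooth_on U f \<longleftrightarrow> (\<forall>ks. \<forall>x\<in>U. foldr partial_deriv ks f differentiable (at x))"

text \<open>Multi-indices are functions \<open>'n \<Rightarrow> nat\<close>.  The index type carries no order, so the order
  in which the partial derivatives are taken is left to Hilbert choice; for functions smooth
  on an open set it is immaterial.\<close>

definition mpartial ::
  "('n::finite \<Rightarrow> nat) \<Rightarrow> (real^'n \<Rightarrow> 'b::real_normed_vector) \<Rightarrow> real^'n \<Rightarrow> 'b" where
  "mpartial \<alpha> f = foldr partial_deriv (SOME ks. \<forall>i. count_list ks i = \<alpha> i) f"

definition mabs :: "('n::finite \<Rightarrow> nat) \<Rightarrow> nat" where
  "mabs \<alpha> = (\<Sum>i\<in>UNIV. \<alpha> i)"

definition mfact :: "('n::finite \<Rightarrow> nat) \<Rightarrow> real" where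
  "mfact \<alpha> = (\<Prod>i\<in>UNIV. fact (\<alpha> i))"

definition mpow :: "real^'n::finite \<Rightarrow> ('n \<Rightarrow> nat) \<Rightarrow> real" where
  "mpow t \<alpha> = (\<Prod>i\<in>UNIV. (t $ i) ^ \<alpha> i)"

text \<open>\<open>C\<^sup>\<omega>\<^sup>,\<^sup>r(U)\<close> and \<open>C\<^sup>\<omega>(U)\<close>; the sum is taken in \<open>[0,\<infinity>]\<close>.\<close>

definition C_omega_r ::
  "real \<Rightarrow> (real^'n::finite) set \<Rightarrow> (real^'n \<Rightarrow> 'b::real_normed_vector) set" where
  "C_omega_r r U = {f. smooth_on U f \<and>
     (\<Sum>\<^sub>\<infinity>\<alpha>. ennreal (r ^ mabs \<alpha> / mfact \<alpha>) *
        (SUP x\<in>U. ennreal (norm (mpartial \<alpha> f x)))) < \<infinity>}"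

definition C_omega :: "(real^'n::finite) set \<Rightarrow> (real^'n \<Rightarrow> 'b::real_normed_vector) set" where
  "C_omega U = (\<Union>r\<in>{0<..}. C_omega_r r U)"

text \<open>Membership in \<open>C_omega U\<close> includes uniform bounds on all of \<open>U\<close>; real analyticity in the
  usual sense is the local version.\<close>

definition real_analytic_on ::
  "(real^'n::finite) set \<Rightarrow> (real^'n \<Rightarrow> 'b::real_normed_vector) \<Rightarrow> bool" where
  "real_analytic_on U f \<longleftrightarrow> (\<forall>x\<in>U. \<exists>V. open V \<and> x \<in> V \<and> V \<subseteq> U \<and> f \<in> C_omega V)"

definition real_analytic_diffeo ::
  "(real^'n::finite) set \<Rightarrow> (real^'m::finite) set \<Rightarrow> (real^'n \<Rightarrow> real^'m) \<Rightarrow> bool" where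
  "real_analytic_diffeo U V f \<longleftrightarrow> open U \<and> open V \<and> bij_betw f U V \<and>
     real_analytic_on U f \<and> real_analytic_on V (inv_into U f)"

definition scrA_coeffs ::
  "real \<Rightarrow> (real^'n::finite \<Rightarrow> 'b::banach) \<Rightarrow> (('n \<Rightarrow> nat) \<Rightarrow> 'b) \<Rightarrow> bool" where
  "scrA_coeffs r f c \<longleftrightarrow>
     (\<forall>t\<in>ball 0 r. ((\<lambda>\<alpha>. (mpow t \<alpha> / mfact \<alpha>) *\<^sub>R c \<alpha>) has_sum f t) UNIV) \<and>
     (\<lambda>\<alpha>. norm (c \<alpha>) / mfact \<alpha> * r ^ mabs \<alpha>) summable_on UNIV"

definition scrA :: "real \<Rightarrow> (real^'n::finite \<Rightarrow> 'b::banach) set" where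
  "scrA r = {f. bounded (f ` ball 0 r) \<and> continuous_on (ball 0 r) f \<and> (\<exists>c. scrA_coeffs r f c)}"

text \<open>For \<open>r > 0\<close> the Taylor coefficients of a function in \<open>scrA r\<close> are unique.\<close>

definition scrA_norm :: "real \<Rightarrow> (real^'n::finite \<Rightarrow> 'b::banach) \<Rightarrow> real" where
  "scrA_norm r f =
     (\<Sum>\<^sub>\<infinity>\<alpha>. norm ((THE c. scrA_coeffs r f c) \<alpha>) / mfact \<alpha> * r ^ mabs \<alpha>)"

definition lie_bracket ::
  "(real^'n::finite \<Rightarrow> real^'n) \<Rightarrow> (real^'n \<Rightarrow> real^'n) \<Rightarrow> real^'n \<Rightarrow> real^'n" where
  "lie_bracket V W x =
     frechet_derivative W (at x) (V x) - frechet_derivative V (at x) (W x)"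

text \<open>\<open>is_exp \<Omega> W x y\<close>: the integral curve in \<open>\<Omega>\<close> of the vector field \<open>W\<close> on \<open>\<Omega>\<close> starting at
  \<open>x\<close> exists up to time one, where it is at \<open>y\<close>.\<close>

definition is_exp ::
  "(real^'n::finite) set \<Rightarrow> (real^'n \<Rightarrow> real^'n) \<Rightarrow> real^'n \<Rightarrow> real^'n \<Rightarrow> bool" where
  "is_exp \<Omega> W x y \<longleftrightarrow> (\<exists>\<gamma>. \<gamma> 0 = x \<and> \<gamma> 1 = y \<and>
     (\<forall>t\<in>{0..1::real}. \<gamma> t \<in> \<Omega> \<and>
        (\<gamma> has_vector_derivative W (\<gamma> t)) (at t within {0..1})))"

definition exp_vf ::
  "(real^'n::finite) set \<Rightarrow> (real^'n \<Rightarrow> real^'n) \<Rightarrow> real^'n \<Rightarrow> real^'n" where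
  "exp_vf \<Omega> W x = (THE y. is_exp \<Omega> W x y)"

definition pullback_vf ::
  "(real^'n::finite \<Rightarrow> real^'n) \<Rightarrow> (real^'n \<Rightarrow> real^'n) \<Rightarrow> real^'n \<Rightarrow> real^'n" where
  "pullback_vf \<Phi> V t = inv (frechet_derivative \<Phi> (at t)) (V (\<Phi> t))"

definition mat_of_cols :: "('n::finite \<Rightarrow> real^'n) \<Rightarrow> real^'n^'n" where
  "mat_of_cols v = (\<chi> i c. v c $ i)"

text \<open>Densities on \<open>\<real>\<^sup>n\<close> are functions of a point and an \<open>n\<close>-tuple of tangent vectors.\<close>

definition leb_density :: "real^'n::finite \<Rightarrow> ('n \<Rightarrow> real^'n) \<Rightarrow> real" where
  "leb_density x v = \<bar>det (mat_of_cols v)\<bar>"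

definition pullback_density ::
  "(real^'n::finite \<Rightarrow> real^'n) \<Rightarrow> (real^'n \<Rightarrow> ('n \<Rightarrow> real^'n) \<Rightarrow> real)
     \<Rightarrow> real^'n \<Rightarrow> ('n \<Rightarrow> real^'n) \<Rightarrow> real" where
  "pullback_density \<Phi> \<nu> t v = \<nu> (\<Phi> t) (\<lambda>c. frechet_derivative \<Phi> (at t) (v c))"

text \<open>The function \<open>h\<close> with \<open>h \<sigma>\<^sub>L\<^sub>e\<^sub>b = \<nu>\<close>.\<close>

definition density_function ::
  "(real^'n::finite \<Rightarrow> ('n \<Rightarrow> real^'n) \<Rightarrow> real) \<Rightarrow> real^'n \<Rightarrow> real" where
  "density_function \<nu> t = (THE h. \<forall>v. h * leb_density t v = \<nu> t v)"

text \<open>\<open>D\<close> ranges over finite families of nonoverlapping compact intervals.\<close>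

definition absolutely_continuous_on :: "real set \<Rightarrow> (real \<Rightarrow> 'b::real_normed_vector) \<Rightarrow> bool" where
  "absolutely_continuous_on S f \<longleftrightarrow>
     (\<forall>\<epsilon>>0. \<exists>\<rho>>0. \<forall>D. D division_of \<Union>D \<and> \<Union>D \<subseteq> S \<and> (\<Sum>k\<in>D. Sup k - Inf k) < \<rho> \<longrightarrow>
        (\<Sum>k\<in>D. norm (f (Sup k) - f (Inf k))) < \<epsilon>)"

definition L_infty :: "'a measure \<Rightarrow> ('a \<Rightarrow> real) set" where
  "L_infty M = {f \<in> borel_measurable M. esssup M (\<lambda>t. ennreal \<bar>f t\<bar>) < \<infinity>}"

definition cc_ball ::
  "(real^'n::finite) set \<Rightarrow> ('q::finite \<Rightarrow> real^'n \<Rightarrow> real^'n) \<Rightarrow> real^'n \<Rightarrow> real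
     \<Rightarrow> (real^'n) set" where
  "cc_ball \<Omega> W x \<delta> = {y \<in> \<Omega>. \<exists>\<gamma> a.
     absolutely_continuous_on {0..1} \<gamma> \<and> \<gamma> ` {0..1} \<subseteq> \<Omega> \<and> \<gamma> 0 = x \<and> \<gamma> 1 = y \<and>
     (AE t in lebesgue_on {0..1}.
        (\<gamma> has_vector_derivative (\<Sum>j\<in>UNIV. a j t *\<^sub>R \<delta> *\<^sub>R W j (\<gamma> t))) (at t)) \<and>
     (\<forall>j. a j \<in> L_infty (lebesgue_on {0..1})) \<and>
     esssup (lebesgue_on {0..1}) (\<lambda>t. ennreal (\<Sum>j\<in>UNIV. \<bar>a j t\<bar>\<^sup>2)) < 1}"

definition scale_vf ::
  "('q \<Rightarrow> real^'n::finite \<Rightarrow> real^'n) \<Rightarrow> ('q \<Rightarrow> real) \<Rightarrow> real \<Rightarrow> 'q \<Rightarrow> real^'n \<Rightarrow> real^'n" where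
  "scale_vf X d \<delta> l x = (\<delta> powr d l) *\<^sub>R X l x"

definition cc_ball_deg ::
  "(real^'n::finite) set \<Rightarrow> ('q::finite \<Rightarrow> real^'n \<Rightarrow> real^'n) \<Rightarrow> ('q \<Rightarrow> real) \<Rightarrow> real^'n \<Rightarrow> real
     \<Rightarrow> (real^'n) set" where
  "cc_ball_deg \<Omega> X d x \<delta> = cc_ball \<Omega> (scale_vf X d \<delta>) x 1"

definition Lambda ::
  "('q::finite \<Rightarrow> real^'n::finite \<Rightarrow> real^'n) \<Rightarrow> ('q \<Rightarrow> real) \<Rightarrow> real^'n \<Rightarrow> real \<Rightarrow> real" where
  "Lambda X d x \<delta> = (MAX k\<in>UNIV. \<bar>det (mat_of_cols (\<lambda>i::'n. scale_vf X d \<delta> (k i) x))\<bar>)"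

text \<open>The vector field whose time-one flow from \<open>x\<close> is \<open>\<Phi>\<^sub>x\<^sub>,\<^sub>\<delta>(t)\<close>; \<open>k\<close> is the chosen tuple
  \<open>j\<^sub>1, \<dots>, j\<^sub>n\<close>.\<close>

definition Phi_field ::
  "('q \<Rightarrow> real^'n::finite \<Rightarrow> real^'n) \<Rightarrow> ('q \<Rightarrow> real) \<Rightarrow> ('n \<Rightarrow> 'q) \<Rightarrow> real
     \<Rightarrow> real^'n \<Rightarrow> real^'n \<Rightarrow> real^'n" where
  "Phi_field X d k \<delta> t y = (\<Sum>i\<in>UNIV. (t $ i) *\<^sub>R scale_vf X d \<delta> (k i) y)"

definition Phi ::
  "(real^'n::finite) set \<Rightarrow> ('q \<Rightarrow> real^'n \<Rightarrow> real^'n) \<Rightarrow> ('q \<Rightarrow> real) \<Rightarrow> ('n \<Rightarrow> 'q)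
     \<Rightarrow> real^'n \<Rightarrow> real \<Rightarrow> real^'n \<Rightarrow> real^'n" where
  "Phi \<Omega> X d k x \<delta> t = exp_vf \<Omega> (Phi_field X d k \<delta> t) x"

end

theory Submission
  imports Defs
begin

text \<open>
  Put \<open>Z\<^sub>l = \<delta>\<^sup>d\<^sup>l X\<^sub>l\<close>.  Since the structure functions of the \<open>Z\<^sub>l\<close> carry nonnegative powers of \<open>\<delta>\<close>, all points
  of \<open>K\<close> and all scales are governed by the same bounds, and it suffices to treat a single frame.
  Cramer's rule and the maximality of the determinant write every \<open>Z\<^sub>l\<close> at \<open>x\<close> as a combination of the
  frame \<open>V\<^sub>i\<close> with coefficients in \<open>[-1, 1]\<close>.  Along the rays \<open>s \<mapsto> \<Phi>(s t)\<close> the coefficients of \<open>Z\<^sub>l\<close>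
  in the frame, the change of the frame and the differential of \<open>\<Phi>\<close> satisfy ordinary differential
  equations; in radially integrated form they are contractions in the algebra of absolutely convergent
  power series on a ball whose size depends only on the bounds.  Hence \<open>d\<Phi>\<close> is, in the frame, close to the
  identity, so that the pulled back fields are bounded, \<open>det d\<Phi> \<approx> \<Lambda>\<close>, and \<open>\<Phi>\<close> is injective because an
  orbit of a field with small derivative cannot close up.  Admissible paths of small speed lift through
  \<open>\<Phi>\<close>, which compares the balls with the images of \<open>\<Phi>\<close>; their volumes follow by a change of variables.
\<close>

text \<open>The frame degenerates as \<delta> tends to 0: \<open>det V0\<close> has no lower bound
  that is uniform in \<delta>, so no estimate may invert the frame. Bounded are only ratios of
  determinants and bracket coefficients, and every uniform estimate is phrased through them. This is
  why the frame along \<open>E\<close> is factored as H V0 U with \<open>H\<close> and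
  \<open>U\<close> near the identity, why the inverse function theorem is used only qualitatively,
  and why injectivity is argued with an orbit in the original coordinates, where the fields have
  bounded derivatives. The norm is the sum of absolute values of coefficients: it gives a Banach
  algebra closed under substitution and yields the power series norms of the conclusion directly,
  which sup norms would not. Differentiation loses part of the cube, so the fixed point maps contain
  no derivative of the unknown: each series is built from its integrated equation alone, and its
  geometric meaning is established afterwards, by Gronwall applied to the defect of the desired
  identity along rays.\<close>

notation (input) scaleR (infixr "*." 75)

abbreviation (input) sum_UNIV (binder "\<Sum>." 10) where "sum_UNIV f \<equiv> sum f UNIV"

section \<open>Multivariate power series\<close>

definition cube :: "real => (real^'n::finite) set" where
  "cube r = {u. \<forall>i. \<bar>u $ i\<bar> <= r}"

definition open_cube :: "real => (real^'n::finite) set" where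
  "open_cube r = {u. \<forall>i. \<bar>u $ i\<bar> < r}"

definition mseries :: "(('n::finite => nat) => 'b::real_normed_vector) => real^'n => 'b" where
  "mseries a u = (\<Sum>\<^sub>\<infinity>al. mpow u al *. a al)"

definition mconv :: "real => (('n::finite => nat) => 'b::real_normed_vector) => bool" where
  "mconv r a \<longleftrightarrow> (%al. r ^ mabs al * norm (a al)) summable_on UNIV"

definition mnorm :: "real => (('n::finite => nat) => 'b::real_normed_vector) => real" where
  "mnorm r a = (\<Sum>\<^sub>\<infinity>al. r ^ mabs al * norm (a al))"

definition dcoeff :: "'n => (('n::finite => nat) => 'b::real_normed_vector) => ('n => nat) => 'b" where
  "dcoeff i a al = real (Suc (al i)) *. a (al(i := Suc (al i)))"


section \<open>Coordinate cubes\<close>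

lemma open_open_cube [simp]: "open (open_cube r :: (real^'n::finite) set)"
proof -
  have "open_cube r = (\<Inter>i. {u::real^'n. \<bar>u $ i\<bar> < r})"
    by (auto simp: open_cube_def)
  moreover have "open {u::real^'n. \<bar>u $ i\<bar> < r}" for i
    by (intro open_Collect_less continuous_intros)
  ultimately show ?thesis
    by (metis (no_types, lifting) finite open_INT)
qed

lemma convex_cube [simp]: "convex (cube r)"
  unfolding convex_def cube_def
proof (clarsimp)
  fix x y :: "real^'n" and u v i
  assume *: "\<forall>i. \<bar>x $ i\<bar> <= r" "\<forall>i. \<bar>y $ i\<bar> <= r" "0 <= u" "0 <= v" "u + v = (1::real)"
  have "\<bar>u * x $ i + v * y $ i\<bar> <= u * \<bar>x $ i\<bar> + v * \<bar>y $ i\<bar>"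
    using * by (metis abs_mult abs_of_nonneg abs_triangle_ineq)
  also have "\<dots> <= u * r + v * r"
    using * by (intro add_mono mult_left_mono) auto
  finally show "\<bar>u * x $ i + v * y $ i\<bar> <= r"
    using * by (metis distrib_right mult_1)
qed

lemma cube_mono: "r <= s ==> cube r \<subseteq> cube s"
  unfolding cube_def using order_trans by blast

lemma open_cube_subset_cube: "open_cube r \<subseteq> cube r"
  by (auto simp: open_cube_def cube_def intro: less_imp_le)

lemma cube_subset_open_cube: "r < s ==> cube r \<subseteq> open_cube s"
  by (auto simp: cube_def open_cube_def intro: le_less_trans)

lemma cball_subset_cube: "cball 0 r \<subseteq> cube r"
  using component_le_norm_cart order_trans by (fastforce simp: cube_def)

lemma ball_subset_open_cube: "ball 0 r \<subseteq> open_cube r"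
  using component_le_norm_cart le_less_trans by (fastforce simp: open_cube_def)

lemma norm_le_of_cube: "u \<in> cube r ==> norm (u :: real^'n::finite) <= real CARD('n) * r"
proof -
  assume "u \<in> cube r"
  then have "(\<Sum>.i. \<bar>u $ i\<bar>) <= (\<Sum>i\<in>(UNIV::'n set). r)"
    by (intro sum_mono) (auto simp: cube_def)
  then show ?thesis
    using norm_le_l1_cart[of u] by simp
qed

text \<open>Differentiated series converge only on strictly smaller cubes, so a point of an open
  cube is first enclosed in a smaller one.\<close>

lemma open_cube_margin:
  assumes "u \<in> open_cube R"
  obtains r where "0 < r" "r < R" "u \<in> open_cube r"
proof -
  define m where "m = Max (range (%i. \<bar>u $ i\<bar>))"
  have m: "\<bar>u $ i\<bar> <= m" for i
    unfolding m_def by (intro Max_ge) auto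
  have "m < R"
    unfolding m_def using assms by (subst Max_less_iff) (auto simp: open_cube_def)
  moreover have "0 <= m"
    using m[of undefined] by linarith
  moreover have "\<bar>u $ i\<bar> < (m + R) / 2" for i
    using m[of i] \<open>m < R\<close> by simp
  ultimately have "0 < (m + R) / 2" "(m + R) / 2 < R" "u \<in> open_cube ((m + R) / 2)"
    by (auto simp: open_cube_def)
  then show ?thesis using that by blast
qed

section \<open>Arithmetic of multi-indices and monomials\<close>

lemma mabs_upd: "mabs (al(i := k)) + al i = mabs al + k"
proof -
  have "mabs (al(i := k)) = k + (\<Sum>j\<in>UNIV - {i}. al j)"
    unfolding mabs_def by (subst sum.remove[of _ i]) (auto intro!: sum.cong)
  moreover have "mabs al = al i + (\<Sum>j\<in>UNIV - {i}. al j)"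
    unfolding mabs_def by (subst sum.remove[of _ i]) auto
  ultimately show ?thesis by simp
qed

lemma mabs_Suc [simp]: "mabs (al(i := Suc (al i))) = Suc (mabs al)"
  using mabs_upd[of al i "Suc (al i)"] by simp

lemma mabs_add: "mabs (%i. al i + \<beta> i) = mabs al + mabs \<beta>"
  by (simp add: mabs_def sum.distrib)

lemma mpow_add: "mpow u (%i. al i + \<beta> i) = mpow u al * mpow u \<beta>"
  by (simp add: mpow_def power_add prod.distrib)

lemma mpow_scaleR: "mpow (c *. u) al = c ^ mabs al * mpow u al"
  by (simp add: mpow_def mabs_def power_mult_distrib prod.distrib power_sum)

lemma mpow_Suc: "mpow u (al(i := Suc (al i))) = u $ i * mpow u al"
proof -
  have "mpow u (al(i := Suc (al i))) = (u $ i) ^ Suc (al i) * (\<Prod>j\<in>UNIV - {i}. (u $ j) ^ al j)"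
    unfolding mpow_def by (subst prod.remove[of _ i]) (auto intro!: prod.cong)
  moreover have "mpow u al = (u $ i) ^ al i * (\<Prod>j\<in>UNIV - {i}. (u $ j) ^ al j)"
    unfolding mpow_def by (subst prod.remove[of _ i]) auto
  ultimately show ?thesis by simp
qed

lemma abs_mpow_le:
  assumes "u \<in> cube r"
  shows "\<bar>mpow u al\<bar> <= r ^ mabs al"
proof -
  have "\<bar>mpow u al\<bar> = (\<Prod>i\<in>UNIV. \<bar>u $ i\<bar> ^ al i)"
    by (simp add: mpow_def abs_prod power_abs)
  also have "\<dots> <= (\<Prod>i\<in>UNIV. r ^ al i)"
    using assms by (intro prod_mono) (auto simp: cube_def intro: power_mono)
  finally show ?thesis by (simp add: mabs_def power_sum)
qed

lemma mpow_0: "mpow (0::real^'n::finite) al = (if al = (%_. 0) then 1 else 0)"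
  by (auto simp: mpow_def power_0_left fun_eq_iff)

section \<open>Weighted coefficient norms and the sums that they control\<close>

lemma mnorm_nonneg: "0 <= r ==> 0 <= mnorm r a"
  unfolding mnorm_def by (intro infsum_nonneg) simp

lemma mconv_mono:
  assumes "mconv R a" "0 <= r" "r <= R"
  shows "mconv r a"
  unfolding mconv_def
proof (rule summable_on_comparison_test)
  show "(%al. R ^ mabs al * norm (a al)) summable_on UNIV"
    using assms by (simp add: mconv_def)
qed (use assms in \<open>auto intro!: mult_right_mono power_mono\<close>)

lemma mnorm_mono:
  assumes "mconv R a" "0 <= r" "r <= R"
  shows "mnorm r a <= mnorm R a"
  unfolding mnorm_def using mconv_mono[OF assms] assms unfolding mconv_def
  by (intro infsum_mono) (auto intro!: mult_right_mono power_mono)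

lemma coeff_le_mnorm:
  assumes "mconv r a" "0 <= r"
  shows "r ^ mabs al * norm (a al) <= mnorm r a"
  using finite_sum_le_infsum[OF assms(1)[unfolded mconv_def], of "{al}"] assms(2)
  by (simp add: mnorm_def)

lemma mseries_abs_summable:
  assumes "mconv r a" "u \<in> cube r"
  shows "(%al. norm (mpow u al *. a al)) summable_on UNIV"
proof (rule summable_on_comparison_test)
  show "(%al. r ^ mabs al * norm (a al)) summable_on UNIV"
    using assms by (simp add: mconv_def)
qed (use abs_mpow_le[OF assms(2)] in \<open>auto intro!: mult_right_mono\<close>)

lemma mseries_has_sum:
  fixes a :: "('n::finite => nat) => 'b::banach"
  assumes "mconv r a" "u \<in> cube r"
  shows "((%al. mpow u al *. a al) has_sum mseries a u) UNIV"
  unfolding mseries_def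
  by (rule has_sum_infsum[OF abs_summable_summable[OF mseries_abs_summable[OF assms]]])

lemma norm_mseries_le:
  assumes "mconv r a" "u \<in> cube r"
  shows "norm (mseries a u) <= mnorm r a"
proof -
  have "norm (mseries a u) <= (\<Sum>\<^sub>\<infinity>al. norm (mpow u al *. a al))"
    unfolding mseries_def by (intro norm_infsum_bound mseries_abs_summable[OF assms])
  also have "\<dots> <= mnorm r a"
    unfolding mnorm_def using mseries_abs_summable[OF assms] assms(1) abs_mpow_le[OF assms(2)]
    by (intro infsum_mono) (auto simp: mconv_def intro!: mult_right_mono)
  finally show ?thesis .
qed

lemma mseries_0: "mseries a 0 = a (%_. 0)"
proof -
  have "mseries a 0 = (\<Sum>\<^sub>\<infinity>al\<in>{%_. 0}. mpow 0 al *. a al)"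
    unfolding mseries_def by (rule infsum_cong_neutral) (auto simp: mpow_0)
  then show ?thesis by (simp add: mpow_0)
qed

subsection \<open>Termwise differentiation\<close>

text \<open>Finitely many terms are differentiated exactly; the remaining ones are Lipschitz on the
  convex set, by the mean value inequality, with a constant that is a tail of
  \<open>M\<close>.\<close>

lemma has_derivative_infsum:
  fixes f :: "'i => 'a::real_normed_vector => 'b::banach"
  assumes "convex S" and x: "x \<in> S"
    and der: "!!i y. y \<in> S ==> (f i has_derivative f' i y) (at y within S)"
    and bound: "!!i y h. y \<in> S ==> norm (f' i y h) <= M i * norm h"
    and M: "M summable_on UNIV" and M0: "!!i. 0 <= M i"
    and summ: "!!y. y \<in> S ==> (%i. norm (f i y)) summable_on UNIV"
  shows "((%y. \<Sum>\<^sub>\<infinity>i. f i y) has_derivative (%h. \<Sum>\<^sub>\<infinity>i. f' i x h)) (at x within S)"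
proof -
  have sum': "(%i. norm (f' i x h)) summable_on UNIV" for h
    by (rule summable_on_comparison_test[of "%i. M i * norm h"])
      (use bound[OF x] M in \<open>auto intro: summable_on_cmult_left\<close>)
  note fsum = abs_summable_summable[OF summ] and f'sum = abs_summable_summable[OF sum']
  have lin: "bounded_linear (f' i x)" for i
    using der[OF x] has_derivative_bounded_linear by blast
  have bl: "bounded_linear (%h. \<Sum>\<^sub>\<infinity>i. f' i x h)"
  proof (rule bounded_linear_intro[where K = "infsum M UNIV"])
    show "(\<Sum>\<^sub>\<infinity>i. f' i x (g + h)) = (\<Sum>\<^sub>\<infinity>i. f' i x g) + (\<Sum>\<^sub>\<infinity>i. f' i x h)" for g h
      using f'sum by (simp add: linear_add[OF bounded_linear.linear[OF lin]] infsum_add)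
    show "(\<Sum>\<^sub>\<infinity>i. f' i x (c *. h)) = c *. (\<Sum>\<^sub>\<infinity>i. f' i x h)" for c h
      by (simp add: linear_scale[OF bounded_linear.linear[OF lin]] infsum_scaleR_right)
    fix h
    have "norm (\<Sum>\<^sub>\<infinity>i. f' i x h) <= (\<Sum>\<^sub>\<infinity>i. norm (f' i x h))"
      by (intro norm_infsum_bound sum')
    also have "\<dots> <= (\<Sum>\<^sub>\<infinity>i. M i * norm h)"
      using sum' bound[OF x] M by (intro infsum_mono summable_on_cmult_left) auto
    finally show "norm (\<Sum>\<^sub>\<infinity>i. f' i x h) <= norm h * infsum M UNIV"
      using M by (simp add: infsum_cmult_left mult.commute)
  qed
  have "\<exists>d>0. \<forall>y\<in>S. norm (y - x) < d -->
      norm ((\<Sum>\<^sub>\<infinity>i. f i y) - (\<Sum>\<^sub>\<infinity>i. f i x) - (\<Sum>\<^sub>\<infinity>i. f' i x (y - x))) <= e * norm (y - x)"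
    if e: "e > 0" for e
  proof -
    \<comment> \<open>The tail enters twice, through the increments and through the linear parts,
      hence the quarter: \<open>2 * (e / 4)\<close> leaves \<open>e / 2\<close> for the finite
      part.\<close>
    obtain F where F: "finite F" "dist (sum M F) (infsum M UNIV) <= e / 4"
      using infsum_finite_approximation[OF M, of "e / 4"] e by auto
    have tail: "infsum M (- F) <= e / 4"
    proof -
      have "infsum M UNIV = sum M F + infsum M (- F)"
        using infsum_Un_disjoint[of M F "- F"] F(1) M summable_on_subset[OF M]
        by (simp add: Compl_partition)
      then show ?thesis
        using F(2) by (auto simp: dist_real_def)
    qed
    have "((%y. \<Sum>i\<in>F. f i y) has_derivative (%h. \<Sum>i\<in>F. f' i x h)) (at x within S)"
      by (intro has_derivative_sum der x)
    then obtain d where "d > 0" and d: "!!y. y \<in> S ==> norm (y - x) < d ==>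
        norm ((\<Sum>i\<in>F. f i y) - (\<Sum>i\<in>F. f i x) - (\<Sum>i\<in>F. f' i x (y - x))) <= e / 2 * norm (y - x)"
      using e unfolding has_derivative_within_alt by (meson half_gt_zero)
    have "norm ((\<Sum>\<^sub>\<infinity>i. f i y) - (\<Sum>\<^sub>\<infinity>i. f i x) - (\<Sum>\<^sub>\<infinity>i. f' i x (y - x))) <= e * norm (y - x)"
      if y: "y \<in> S" "norm (y - x) < d" for y
    proof -
      define \<rho> where "\<rho> i = f i y - f i x - f' i x (y - x)" for i
      have \<rho>hs: "(\<rho> has_sum ((\<Sum>\<^sub>\<infinity>i. f i y) - (\<Sum>\<^sub>\<infinity>i. f i x) - (\<Sum>\<^sub>\<infinity>i. f' i x (y - x)))) UNIV"
        unfolding \<rho>_def diff_conv_add_uminus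
        by (intro has_sum_add) (use fsum x y f'sum in \<open>simp_all add: has_sum_uminus\<close>)
      then have \<rho>sum: "\<rho> summable_on UNIV"
        by (rule has_sum_imp_summable)
      have \<rho>b: "norm (\<rho> i) <= 2 * norm (y - x) * M i" for i
      proof -
        have "norm (f i y - f i x) <= M i * norm (y - x)"
          by (rule differentiable_bound[OF \<open>convex S\<close>, where f' = "f' i"])
            (use der bound x y M0 in \<open>auto intro!: onorm_bound\<close>)
        then show ?thesis
          using bound[OF x, of i "y - x"] norm_triangle_ineq4[of "f i y - f i x" "f' i x (y - x)"]
          unfolding \<rho>_def by (simp add: algebra_simps)
      qed
      have sM: "(%i. 2 * norm (y - x) * M i) summable_on (- F)"
        using summable_on_subset[OF M] by (intro summable_on_cmult_right) auto
      have s\<rho>: "(%i. norm (\<rho> i)) summable_on (- F)"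
        by (rule summable_on_comparison_test[OF sM]) (use \<rho>b in auto)
      have "norm (infsum \<rho> (- F)) <= (\<Sum>\<^sub>\<infinity>i\<in>-F. norm (\<rho> i))"
        by (rule norm_infsum_bound) (rule s\<rho>)
      also have "\<dots> <= (\<Sum>\<^sub>\<infinity>i\<in>-F. 2 * norm (y - x) * M i)"
        using s\<rho> sM \<rho>b by (intro infsum_mono) auto
      also have "\<dots> = 2 * norm (y - x) * infsum M (- F)"
        by (intro infsum_cmult_right) (use summable_on_subset[OF M] in auto)
      also have "\<dots> <= 2 * norm (y - x) * (e / 4)"
        using tail by (intro mult_left_mono) auto
      finally have 1: "norm (infsum \<rho> (- F)) <= e / 2 * norm (y - x)" by simp
      have "infsum \<rho> UNIV = sum \<rho> F + infsum \<rho> (- F)"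
        using infsum_Un_disjoint[of \<rho> F "- F"] F(1) \<rho>sum summable_on_subset_banach[OF \<rho>sum]
        by (simp add: Compl_partition)
      moreover have "norm (sum \<rho> F) <= e / 2 * norm (y - x)"
        using d[OF y] by (simp add: \<rho>_def sum_subtractf)
      ultimately have "norm (infsum \<rho> UNIV) <= e * norm (y - x)"
        using 1 norm_triangle_ineq[of "sum \<rho> F" "infsum \<rho> (- F)"] by simp
      moreover have "infsum \<rho> UNIV = (\<Sum>\<^sub>\<infinity>i. f i y) - (\<Sum>\<^sub>\<infinity>i. f i x) - (\<Sum>\<^sub>\<infinity>i. f' i x (y - x))"
        using \<rho>hs by (rule infsumI)
      ultimately show ?thesis by simp
    qed
    then show ?thesis using \<open>d > 0\<close> by blast
  qed
  then show ?thesis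
    unfolding has_derivative_within_alt using bl by blast
qed

text \<open>The elementary form of the Cauchy estimate, a weakening of
  \<open>k * r ^ (k - 1) * (R - r) <= R ^ k - r ^ k\<close>: one derivative is paid for by a loss of
  radius.\<close>

lemma nat_mult_power_le:
  assumes "0 <= r" "r < (R::real)"
  shows "real k * r ^ (k - 1) <= R ^ k / (R - r)"
proof -
  have "real k * r ^ (k - 1) * (R - r) <= R ^ k"
  proof (induction k)
    case (Suc k)
    show ?case
    proof (cases k)
      case (Suc k')
      have "real (Suc k) * r ^ (Suc k - 1) * (R - r) = r * (real k * r ^ (k - 1) * (R - r)) + r ^ k * (R - r)"
        using Suc by (simp add: algebra_simps)
      also have "\<dots> <= r * R ^ k + R ^ k * (R - r)"
        using assms Suc.IH by (intro add_mono mult_left_mono mult_right_mono power_mono) auto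
      finally show ?thesis by (simp add: algebra_simps)
    qed (use assms in auto)
  qed (use assms in auto)
  then show ?thesis using assms by (simp add: pos_le_divide_eq)
qed

lemma bij_upd_Suc: "bij_betw (%al. al(i := Suc (al i))) UNIV {al. al i \<noteq> 0}"
  by (rule bij_betw_byWitness[where f' = "%al. al(i := al i - 1)"]) (auto simp: fun_eq_iff)

text \<open>The shift by one in slot \<open>i\<close> is a bijection onto the indices with nonzero
  \<open>i\<close>-th entry. Differentiated series have this shape: the factor \<open>al i\<close>
  kills the indices that the shift misses.\<close>

lemma infsum_upd_Suc:
  assumes "!!al. al i = 0 ==> f al = 0"
  shows "(\<Sum>\<^sub>\<infinity>al. f (al(i := Suc (al i)))) = (\<Sum>\<^sub>\<infinity>al. f al)"
proof -
  have "(\<Sum>\<^sub>\<infinity>al. f (al(i := Suc (al i)))) = infsum f {al. al i \<noteq> 0}"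
    by (rule infsum_reindex_bij_betw[OF bij_upd_Suc])
  also have "\<dots> = infsum f UNIV"
    by (rule infsum_cong_neutral) (use assms in auto)
  finally show ?thesis .
qed

lemma summable_on_upd_Suc:
  assumes "!!al. al i = 0 ==> f al = 0"
  shows "(%al. f (al(i := Suc (al i)))) summable_on UNIV \<longleftrightarrow> f summable_on UNIV"
proof -
  have "(%al. f (al(i := Suc (al i)))) summable_on UNIV \<longleftrightarrow> f summable_on {al. al i \<noteq> 0}"
    by (rule summable_on_reindex_bij_betw[OF bij_upd_Suc])
  also have "\<dots> \<longleftrightarrow> f summable_on UNIV"
    by (rule summable_on_cong_neutral) (use assms in auto)
  finally show ?thesis .
qed

lemma le_mabs: "al i <= mabs al"
  unfolding mabs_def by (rule member_le_sum) auto

lemma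
  fixes a :: "('n::finite => nat) => 'b::real_normed_vector"
  assumes a: "mconv R a" and r: "0 <= r" "r < R"
  shows mconv_dcoeff: "mconv r (dcoeff i a)"
    and mnorm_dcoeff_le: "mnorm r (dcoeff i a) <= mnorm R a / (R - r)"
proof -
  \<comment> \<open>The truncated subtraction is harmless: it can only matter at
    \<open>al = 0\<close>, where the factor \<open>al i\<close> vanishes.\<close>
  define f where "f al = r ^ (mabs al - 1) * norm (real (al i) *. a al)" for al :: "'n => nat"
  define g where "g al = R ^ mabs al * norm (a al) * inverse (R - r)" for al :: "'n => nat"
  have eq: "r ^ mabs al * norm (dcoeff i a al) = f (al(i := Suc (al i)))" for al
    by (simp add: f_def dcoeff_def)
  have "f al <= g al" for al
  proof -
    have "f al = real (al i) * r ^ (mabs al - 1) * norm (a al)"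
      by (simp add: f_def)
    also have "\<dots> <= real (mabs al) * r ^ (mabs al - 1) * norm (a al)"
      using r le_mabs[of al i] by (intro mult_right_mono) auto
    also have "\<dots> <= R ^ mabs al / (R - r) * norm (a al)"
      using r by (intro mult_right_mono nat_mult_power_le) auto
    finally show ?thesis by (simp add: g_def divide_inverse mult_ac)
  qed
  moreover have "g summable_on UNIV"
    unfolding g_def using a by (intro summable_on_cmult_left) (simp add: mconv_def)
  moreover have "0 <= f al" for al
    using r by (simp add: f_def)
  ultimately have f: "f summable_on UNIV" "infsum f UNIV <= infsum g UNIV"
    by (auto intro: summable_on_comparison_test intro!: infsum_mono)
  have f0: "f al = 0" if "al i = 0" for al
    using that by (simp add: f_def)
  show "mconv r (dcoeff i a)"
    unfolding mconv_def eq using summable_on_upd_Suc[of i f, OF f0] f by simp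
  show "mnorm r (dcoeff i a) <= mnorm R a / (R - r)"
    unfolding mnorm_def eq using infsum_upd_Suc[of i f, OF f0] f(2) a
      infsum_cmult_left[of "inverse (R - r)" "%al. R ^ mabs al * norm (a al)" UNIV]
    by (simp add: g_def[abs_def] mconv_def divide_inverse)
qed

lemma has_sum_finite_sum:
  fixes f :: "'i => 'a => 'b::real_normed_vector"
  assumes "finite I" "!!i. i \<in> I ==> (f i has_sum s i) A"
  shows "((%x. \<Sum>i\<in>I. f i x) has_sum (\<Sum>i\<in>I. s i)) A"
  using assms by (induction I rule: finite_induct) (auto intro: has_sum_add)

lemma mseries_has_derivative:
  fixes a :: "('n::finite => nat) => 'b::banach"
  assumes a: "mconv R a" and u: "u \<in> open_cube R"
  shows "(mseries a has_derivative (%h. \<Sum>.i. (h $ i) *. mseries (dcoeff i a) u)) (at u)"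
proof -
  \<comment> \<open>The closed cube of radius \<open>r\<close> is a neighbourhood of
    \<open>u\<close> on which the derivatives of all terms are dominated by a summable family; the
    difference \<open>R - r\<close> pays for the factor \<open>al i\<close>.\<close>
  obtain r where r: "0 < r" "r < R" "u \<in> open_cube r"
    using open_cube_margin[OF u] .
  define f' where "f' al v h = (\<Sum>.i. (h $ i) *. (real (al i) * mpow v (al(i := al i - 1))) *. a al)"
    for al and v h :: "real^'n"
  have der: "((%v. mpow v al *. a al) has_derivative f' al v) (at v within S)" for al v S
  proof -
    have p: "real (al i) * mpow v (al(i := al i - 1)) =
        real (al i) * (v $ i) ^ (al i - 1) * (\<Prod>j\<in>UNIV - {i}. (v $ j) ^ al j)" for i
      unfolding mpow_def by (subst prod.remove[of _ i]) (auto intro!: prod.cong)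
    have "((%v. mpow v al) has_derivative
      (%h. \<Sum>.i. h $ i * (real (al i) * (v $ i) ^ (al i - 1)) * (\<Prod>j\<in>UNIV - {i}. (v $ j) ^ al j)))
      (at v within S)"
      unfolding mpow_def
      by (rule has_derivative_prod)
        (auto intro!: derivative_eq_intros bounded_linear_imp_has_derivative bounded_linear_vec_nth
          simp: fun_eq_iff)
    then have "((%v. mpow v al *. a al) has_derivative
      (%h. (\<Sum>.i. h $ i * (real (al i) * (v $ i) ^ (al i - 1)) * (\<Prod>j\<in>UNIV - {i}. (v $ j) ^ al j)) *. a al))
      (at v within S)"
      by (rule has_derivative_scaleR_left)
    then show ?thesis
      unfolding f'_def p by (simp add: scaleR_sum_left mult.assoc)
  qed
  define M where "M al = R ^ mabs al * norm (a al) * (real CARD('n) / (R - r))" for al :: "'n => nat"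
  have b1: "\<bar>real (al i) * mpow v (al(i := al i - 1))\<bar> <= R ^ mabs al / (R - r)"
    if "v \<in> cube r" for v :: "real^'n" and al i
  proof -
    have "\<bar>real (al i) * mpow v (al(i := al i - 1))\<bar> <= real (al i) * r ^ mabs (al(i := al i - 1))"
      unfolding abs_mult using abs_mpow_le[OF that, of "al(i := al i - 1)"]
      by (intro mult_mono) auto
    also have "\<dots> <= real (mabs al) * r ^ (mabs al - 1)"
    proof (cases "al i = 0")
      case False
      then have "mabs (al(i := al i - 1)) = mabs al - 1"
        using mabs_upd[of al i "al i - 1"] by linarith
      then show ?thesis
        using le_mabs[of al i] r by (auto intro!: mult_right_mono)
    qed (use r in auto)
    also have "\<dots> <= R ^ mabs al / (R - r)"
      using r by (intro nat_mult_power_le) auto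
    finally show ?thesis .
  qed
  have "norm (f' al v h) <= M al * norm h" if v: "v \<in> cube r" for al v h
  proof -
    have "norm (f' al v h) <= (\<Sum>i\<in>(UNIV::'n set). norm h * (R ^ mabs al / (R - r)) * norm (a al))"
      unfolding f'_def
    proof (intro sum_norm_le)
      fix i :: 'n
      have "norm (h $ i *. (real (al i) * mpow v (al(i := al i - 1))) *. a al)
          = \<bar>h $ i\<bar> * \<bar>real (al i) * mpow v (al(i := al i - 1))\<bar> * norm (a al)"
        by (simp add: abs_mult)
      also have "\<dots> <= norm h * (R ^ mabs al / (R - r)) * norm (a al)"
        using component_le_norm_cart[of h i] b1[OF v] by (intro mult_right_mono mult_mono) auto
      finally show "norm (h $ i *. (real (al i) * mpow v (al(i := al i - 1))) *. a al)
          <= norm h * (R ^ mabs al / (R - r)) * norm (a al)" .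
    qed
    then show ?thesis by (simp add: M_def mult_ac)
  qed
  moreover have "M summable_on UNIV"
    unfolding M_def using a by (intro summable_on_cmult_left) (simp add: mconv_def)
  moreover have "0 <= M al" for al
    using r by (simp add: M_def)
  moreover have "u \<in> cube r"
    using r(3) open_cube_subset_cube by blast
  moreover have "(%al. norm (mpow v al *. a al)) summable_on UNIV" if "v \<in> cube r" for v
    by (rule mseries_abs_summable[OF mconv_mono[OF a]]) (use r that in auto)
  ultimately have "((%v. \<Sum>\<^sub>\<infinity>al. mpow v al *. a al) has_derivative (%h. \<Sum>\<^sub>\<infinity>al. f' al u h)) (at u within cube r)"
    by (intro has_derivative_infsum[where M = M] der convex_cube)
  moreover have "at u within cube r = at u"
    by (rule at_within_open_subset[OF r(3) open_open_cube open_cube_subset_cube])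
  moreover have "(%al. f' al u h) = (%al. \<Sum>.i. (h $ i) *. (real (al i) * mpow u (al(i := al i - 1))) *. a al)" for h
    by (simp add: f'_def)
  moreover have hs: "((%al. (real (al i) * mpow u (al(i := al i - 1))) *. a al) has_sum mseries (dcoeff i a) u) UNIV" for i
  proof -
    define g where "g al = (real (al i) * mpow u (al(i := al i - 1))) *. a al" for al
    have eq: "mpow u al *. dcoeff i a al = g (al(i := Suc (al i)))" for al
      by (simp add: g_def dcoeff_def fun_upd_idem)
    have g0: "g al = 0" if "al i = 0" for al
      using that by (simp add: g_def)
    have "((%al. mpow u al *. dcoeff i a al) has_sum mseries (dcoeff i a) u) UNIV"
      by (rule mseries_has_sum[OF mconv_dcoeff[OF a, of r]]) (use r \<open>u \<in> cube r\<close> in auto)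
    then have "g summable_on UNIV" "infsum g UNIV = mseries (dcoeff i a) u"
      unfolding eq using summable_on_upd_Suc[of i g, OF g0] infsum_upd_Suc[of i g, OF g0]
      by (auto simp: has_sum_iff)
    then show ?thesis
      unfolding g_def has_sum_iff by blast
  qed
  moreover have "(\<Sum>\<^sub>\<infinity>al. \<Sum>.i. (h $ i) *. (real (al i) * mpow u (al(i := al i - 1))) *. a al)
      = (\<Sum>.i. (h $ i) *. mseries (dcoeff i a) u)" for h
    by (intro infsumI has_sum_finite_sum has_sum_scaleR hs) auto
  ultimately show ?thesis
    unfolding mseries_def[abs_def] by simp
qed


subsection \<open>Iterated partial derivatives\<close>

lemma partial_deriv_eq:
  assumes "(f has_derivative f') (at x)"
  shows "partial_deriv i f x = f' (axis i 1)"
proof -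
  have "((%t. x + t *. axis i 1) has_vector_derivative axis i 1) (at 0)"
    by (auto intro!: derivative_eq_intros)
  then have "((f \<circ> (%t. x + t *. axis i 1)) has_vector_derivative f' (axis i 1)) (at 0)"
    using vector_derivative_diff_chain_within[of "%t. x + t *. axis i 1" "axis i 1" 0 UNIV f f']
      assms by (auto intro: has_derivative_at_withinI)
  then show ?thesis
    unfolding partial_deriv_def comp_def by (rule vector_derivative_at)
qed

text \<open>\<open>partial_deriv\<close> sees only values near \<open>x\<close>. Iterated partial
  derivatives can therefore be rewritten on an open set although nothing is known about the
  functions outside.\<close>

lemma partial_deriv_cong_open:
  assumes "open S" "x \<in> S" and eq: "!!y. y \<in> S ==> f y = g y"
  shows "partial_deriv i f x = partial_deriv i g x"
proof -
  have "((%t. x + t *. axis i 1) \<longlongrightarrow> x + 0 *. axis i 1) (at (0::real))"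
    by (intro tendsto_intros)
  then have "\<forall>\<^sub>F t in at (0::real). x + t *. axis i 1 \<in> S"
    using assms(1,2) by (metis add.right_neutral scaleR_zero_left topological_tendstoD)
  then have "\<forall>\<^sub>F t in nhds (0::real). x + t *. axis i 1 \<in> S"
    using assms(2) by (simp add: eventually_nhds_conv_at)
  then have "\<forall>\<^sub>F t in nhds (0::real). t \<in> UNIV --> f (x + t *. axis i 1) = g (x + t *. axis i 1)"
    by eventually_elim (simp add: eq)
  then show ?thesis
    unfolding partial_deriv_def by (rule vector_derivative_cong_eq) simp_all
qed

text \<open>Every further derivative uses half of the radius that is left, so any number of them
  still converges at the given \<open>r\<close>.\<close>

lemma mconv_foldr_dcoeff:
  assumes "mconv R a" "0 <= r" "r < R"
  shows "mconv r (foldr dcoeff ks a)"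
  using assms(2,3)
proof (induction ks arbitrary: r)
  case (Cons k ks)
  then show ?case
    using mconv_dcoeff[of "(r + R) / 2" "foldr dcoeff ks a" r k] by simp
next
  case Nil
  then show ?case using mconv_mono[OF assms(1)] by auto
qed

lemma mseries_translate_has_derivative:
  fixes a :: "('n::finite => nat) => 'b::banach"
  assumes "mconv R a" and "x - x0 \<in> open_cube R"
  shows "((%x. mseries a (x - x0)) has_derivative
     (%h. \<Sum>.i. (h $ i) *. mseries (dcoeff i a) (x - x0))) (at x)"
proof -
  have "((%x. x - x0) has_derivative (%h. h)) (at x)"
    by (auto intro!: derivative_eq_intros)
  from diff_chain_at[OF this mseries_has_derivative[OF assms]] show ?thesis
    by (simp add: comp_def)
qed

lemma foldr_dcoeff_has_derivative:
  fixes a :: "('n::finite => nat) => 'b::banach"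
  assumes a: "mconv R a" and x: "x - x0 \<in> open_cube R"
  shows "((%x. mseries (foldr dcoeff ks a) (x - x0)) has_derivative
     (%h. \<Sum>.i. (h $ i) *. mseries (foldr dcoeff (i # ks) a) (x - x0))) (at x)"
proof -
  obtain r where "0 < r" "r < R" "x - x0 \<in> open_cube r"
    using open_cube_margin[OF x] .
  then show ?thesis
    using mseries_translate_has_derivative[OF mconv_foldr_dcoeff[OF a, of r ks], of x x0] by simp
qed

lemma foldr_partial_deriv_mseries:
  fixes a :: "('n::finite => nat) => 'b::banach"
  assumes a: "mconv R a" and V: "open V" "!!x. x \<in> V ==> x - x0 \<in> open_cube R"
    and f: "!!x. x \<in> V ==> f x = mseries a (x - x0)" and x: "x \<in> V"
  shows "foldr partial_deriv ks f x = mseries (foldr dcoeff ks a) (x - x0)"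
  using x
proof (induction ks arbitrary: x)
  case (Cons k ks)
  have "foldr partial_deriv (k # ks) f x =
      partial_deriv k (%x. mseries (foldr dcoeff ks a) (x - x0)) x"
    using partial_deriv_cong_open[OF V(1) Cons.prems Cons.IH] by simp
  also have "\<dots> = (\<Sum>.i. (axis k 1 $ i) *. mseries (foldr dcoeff (i # ks) a) (x - x0))"
    by (rule partial_deriv_eq[OF foldr_dcoeff_has_derivative[OF a V(2)[OF Cons.prems]]])
  also have "\<dots> = mseries (foldr dcoeff (k # ks) a) (x - x0)"
    by (subst sum.remove[of _ k]) (auto simp: axis_def intro!: sum.neutral)
  finally show ?case .
qed (simp add: f)

lemma mfact_0 [simp]: "mfact (%_. 0) = 1"
  by (simp add: mfact_def)

lemma mfact_pos: "mfact al > 0"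
  by (simp add: mfact_def prod_pos)

lemma mfact_Suc: "mfact (al(i := Suc (al i))) = real (Suc (al i)) * mfact al"
proof -
  have "mfact (al(i := Suc (al i))) = fact (Suc (al i)) * (\<Prod>j\<in>UNIV - {i}. fact (al j))"
    unfolding mfact_def by (subst prod.remove[of _ i]) (auto intro!: prod.cong)
  moreover have "mfact al = fact (al i) * (\<Prod>j\<in>UNIV - {i}. fact (al j))"
    unfolding mfact_def by (subst prod.remove[of _ i]) auto
  ultimately show ?thesis by simp
qed

text \<open>Iterated differentiation multiplies by a quotient of factorials that depends only on the
  counts in \<open>ks\<close>; at \<open>al = 0\<close> this is the usual rule for reading
  coefficients off derivatives.\<close>

lemma foldr_dcoeff:
  "foldr dcoeff ks a al =
     (mfact (%i. al i + count_list ks i) / mfact al) *. a (%i. al i + count_list ks i)"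
proof (induction ks arbitrary: al)
  case (Cons k ks)
  let ?al = "al(k := Suc (al k))"
  have "(%i. ?al i + count_list ks i) = (%i. al i + count_list (k # ks) i)"
    by auto
  then show ?case
    using mfact_pos[of al] Cons[of ?al]
    by (simp add: dcoeff_def mfact_Suc del: fun_upd_apply count_list.simps of_nat_Suc)
next
  case Nil
  show ?case using mfact_pos[of al] by simp
qed

lemma ex_count_list: "\<exists>ks. \<forall>i::'n::finite. count_list ks i = \<kappa> i"
proof -
  obtain ks where "mset ks = Abs_multiset \<kappa>"
    using ex_mset by blast
  then have "count_list ks i = \<kappa> i" for i
    by (metis count_Abs_multiset count_mset finite)
  then show ?thesis by blast
qed

text \<open>The coefficient at \<kappa> is recovered, up to the factor
  \<open>mfact \<kappa>\<close>, from a partial derivative at 0, which depends only on the sum near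
  0.\<close>

lemma mseries_coeff_unique:
  fixes a b :: "('n::finite => nat) => 'b::banach"
  assumes "mconv R a" "mconv R b" "0 < R" "0 < r"
    and eq: "!!t. t \<in> ball 0 r ==> mseries a t = mseries b t"
  shows "a = b"
proof
  fix \<kappa> :: "'n => nat"
  obtain ks where ks: "!!i. count_list ks i = \<kappa> i"
    using ex_count_list by metis
  define V where "V = (ball 0 r \<inter> open_cube R :: (real^'n) set)"
  have V: "open V" "0 \<in> V"
    using assms by (auto simp: V_def) (auto simp: open_cube_def)
  have "foldr partial_deriv ks (mseries a) 0 = mseries (foldr dcoeff ks a) 0"
    using foldr_partial_deriv_mseries[OF assms(1) V(1), of 0 "mseries a" 0 ks] V
    by (auto simp: V_def)
  moreover have "foldr partial_deriv ks (mseries a) 0 = mseries (foldr dcoeff ks b) 0"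
    using foldr_partial_deriv_mseries[OF assms(2) V(1), of 0 "mseries a" 0 ks] V eq
    by (auto simp: V_def)
  ultimately show "a \<kappa> = b \<kappa>"
    using mfact_pos[of \<kappa>] by (simp add: mseries_0 foldr_dcoeff ks)
qed

subsection \<open>Sums of power series are of class \<open>C_omega\<close>\<close>

text \<open>A finite set of multi-indices lies in a box, over which the sum is a product of
  geometric sums.\<close>

lemma sum_power_mabs_le:
  fixes F :: "('n::finite => nat) set" and q :: real
  assumes "0 <= q" "q < 1" "finite F"
  shows "(\<Sum>al\<in>F. q ^ mabs al) <= (1 / (1 - q)) ^ CARD('n)"
proof -
  define N where "N = Suc (Max (insert 0 (mabs ` F)))"
  have "mabs al < N" if "al \<in> F" for al
    unfolding N_def using assms(3) that by (simp add: less_Suc_eq_le Max_ge)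
  then have "F \<subseteq> PiE UNIV (%_. {..<N})"
    using le_mabs le_less_trans by (fastforce simp: PiE_def Pi_def)
  then have "(\<Sum>al\<in>F. q ^ mabs al) <= (\<Sum>al\<in>PiE UNIV (%_::'n. {..<N}). q ^ mabs al)"
    using assms by (intro sum_mono2 finite_PiE) auto
  also have "\<dots> = (\<Prod>i\<in>(UNIV::'n set). \<Sum>k<N. q ^ k)"
    by (subst prod_sum_PiE) (auto simp: mabs_def power_sum)
  also have "\<dots> <= (\<Prod>i\<in>(UNIV::'n set). 1 / (1 - q))"
  proof (rule prod_mono)
    have "(\<Sum>k<N. q ^ k) <= (\<Sum>k. q ^ k)"
      using assms by (intro sum_le_suminf summable_geometric) auto
    then show "0 <= (\<Sum>k<N. q ^ k) \<and> (\<Sum>k<N. q ^ k) <= 1 / (1 - q)" for i :: 'n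
      using assms by (auto simp: suminf_geometric intro: sum_nonneg)
  qed
  finally show ?thesis by simp
qed

lemma summable_power_mabs:
  fixes q :: real
  assumes "0 <= q" "q < 1"
  shows "(%al::'n::finite => nat. q ^ mabs al) summable_on UNIV"
proof (rule nonneg_bdd_above_summable_on)
  show "bdd_above (sum (%al::'n => nat. q ^ mabs al) ` {F. F \<subseteq> UNIV \<and> finite F})"
    using sum_power_mabs_le[OF assms] by (auto intro!: bdd_aboveI)
qed (use assms in auto)

lemma mfact_add_le: "mfact (%i. al i + \<beta> i) <= 2 ^ (mabs al + mabs \<beta>) * mfact al * mfact \<beta>"
proof -
  have "fact (m + n) <= (2 ^ (m + n) * fact m * fact n :: real)" for m n :: nat
  proof -
    have "fact (m + n) = (real (m + n choose m) * fact m * fact n :: real)"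
      by (simp add: binomial_fact)
    also have "\<dots> <= 2 ^ (m + n) * fact m * fact n"
      using binomial_le_pow2[of "m + n" m]
      by (intro mult_right_mono) (auto simp: of_nat_le_numeral_power_cancel_iff)
    finally show ?thesis .
  qed
  then have "mfact (%i. al i + \<beta> i) <= (\<Prod>i\<in>UNIV. 2 ^ (al i + \<beta> i) * fact (al i) * fact (\<beta> i))"
    unfolding mfact_def by (intro prod_mono) auto
  also have "\<dots> = 2 ^ (mabs al + mabs \<beta>) * mfact al * mfact \<beta>"
    by (simp add: prod.distrib mfact_def mabs_def power_add power_sum)
  finally show ?thesis .
qed

lemma infsum_ennreal_finite:
  assumes "f summable_on UNIV" "!!x. 0 <= f x"
  shows "(\<Sum>\<^sub>\<infinity>x. ennreal (f x)) < \<infinity>"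
proof -
  have "(f has_sum infsum f UNIV) UNIV"
    using assms(1) by simp
  then have "((%F. ennreal (sum f F)) \<longlongrightarrow> ennreal (infsum f UNIV)) (finite_subsets_at_top UNIV)"
    unfolding has_sum_def by (rule tendsto_ennrealI)
  moreover have "(%F. ennreal (sum f F)) = sum (%x. ennreal (f x))"
    using assms(2) by (simp add: fun_eq_iff sum_ennreal)
  ultimately have "((%x. ennreal (f x)) has_sum ennreal (infsum f UNIV)) UNIV"
    unfolding has_sum_def by simp
  then show ?thesis
    using infsumI by fastforce
qed

text \<open>The quotient of factorials costs at most a factor 2 per degree of \<beta> and of
  \<kappa>. On the cube of radius \<open>R / 4\<close> the sum over \<beta> keeps the ratio
  \<open>(R / 4) * (2 / R) = 1 / 2\<close>, and what is left over is
  \<open>(2 / R) ^ mabs \<kappa>\<close>.\<close>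

lemma norm_foldr_dcoeff_le:
  fixes a :: "('n::finite => nat) => 'b::banach"
  assumes a: "mconv R a" and "0 < R" and u: "u \<in> cube (R / 4)"
    and ks: "!!i. count_list ks i = \<kappa> i"
  shows "norm (mseries (foldr dcoeff ks a) u) <=
    mfact \<kappa> * mnorm R a * (2 / R) ^ mabs \<kappa> * (\<Sum>\<^sub>\<infinity>\<beta>::'n => nat. (1 / 2) ^ mabs \<beta>)"
proof -
  let ?b = "foldr dcoeff ks a" and ?N = "mnorm R a"
  have conv: "mconv (R / 4) ?b"
    using assms by (intro mconv_foldr_dcoeff[OF a]) auto
  have "(R / 4) ^ mabs \<beta> * norm (?b \<beta>) <= mfact \<kappa> * ?N * (2 / R) ^ mabs \<kappa> * (1 / 2) ^ mabs \<beta>" for \<beta>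
  proof -
    have 1: "norm (a (%i. \<beta> i + \<kappa> i)) <= ?N / R ^ (mabs \<beta> + mabs \<kappa>)"
      using coeff_le_mnorm[OF a, of "%i. \<beta> i + \<kappa> i"] \<open>0 < R\<close>
      by (simp add: mabs_add pos_le_divide_eq mult.commute)
    have "norm (?b \<beta>) = (mfact (%i. \<beta> i + \<kappa> i) / mfact \<beta>) * norm (a (%i. \<beta> i + \<kappa> i))"
      using mfact_pos[of \<beta>] mfact_pos[of "%i. \<beta> i + \<kappa> i"] by (simp add: foldr_dcoeff ks)
    also have "\<dots> <= (2 ^ (mabs \<beta> + mabs \<kappa>) * mfact \<kappa>) * (?N / R ^ (mabs \<beta> + mabs \<kappa>))"
      using mfact_add_le[of \<beta> \<kappa>] mfact_pos[of \<beta>] mfact_pos[of \<kappa>] mfact_pos[of "%i. \<beta> i + \<kappa> i"] 1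
      by (intro mult_mono) (auto simp: pos_divide_le_eq mult_ac)
    finally have "(R / 4) ^ mabs \<beta> * norm (?b \<beta>) <=
        (R / 4) ^ mabs \<beta> * ((2 ^ (mabs \<beta> + mabs \<kappa>) * mfact \<kappa>) * (?N / R ^ (mabs \<beta> + mabs \<kappa>)))"
      using \<open>0 < R\<close> by (intro mult_left_mono) auto
    also have "\<dots> = mfact \<kappa> * ?N * (2 / R) ^ mabs \<kappa> * ((R / 4) ^ mabs \<beta> * (2 / R) ^ mabs \<beta>)"
      by (simp add: power_add power_divide)
    also have "(R / 4) ^ mabs \<beta> * (2 / R) ^ mabs \<beta> = (1 / 2) ^ mabs \<beta>"
      using \<open>0 < R\<close> by (simp flip: power_mult_distrib)
    finally show ?thesis .
  qed
  then have "mnorm (R / 4) ?b <= (\<Sum>\<^sub>\<infinity>\<beta>::'n => nat. mfact \<kappa> * ?N * (2 / R) ^ mabs \<kappa> * (1 / 2) ^ mabs \<beta>)"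
    unfolding mnorm_def using conv
    by (intro infsum_mono) (auto simp: mconv_def mnorm_def intro!: summable_on_cmult_right summable_power_mabs)
  also have "\<dots> = mfact \<kappa> * ?N * (2 / R) ^ mabs \<kappa> * (\<Sum>\<^sub>\<infinity>\<beta>::'n => nat. (1 / 2) ^ mabs \<beta>)"
    by (intro infsum_cmult_right summable_power_mabs) auto
  finally show ?thesis
    using norm_mseries_le[OF conv u] by linarith
qed

text \<open>Derivatives of order \<kappa> grow like
  \<open>mfact \<kappa> * (2 / R) ^ mabs \<kappa>\<close>, so with the radius \<open>R / 4\<close>
  the defining sum of \<open>C_omega_r\<close> is dominated by powers of 1/2.\<close>

lemma mseries_C_omega:
  fixes a :: "('n::finite => nat) => 'b::banach"
  assumes a: "mconv R a" and R: "0 < R" and V: "open V" "!!x. x \<in> V ==> x - x0 \<in> cube (R / 4)"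
    and f: "!!x. x \<in> V ==> f x = mseries a (x - x0)"
  shows "f \<in> C_omega V"
proof -
  have V': "x - x0 \<in> open_cube R" if "x \<in> V" for x
    using V(2)[OF that] cube_subset_open_cube[of "R / 4" R] R by auto
  have fd: "foldr partial_deriv ks f x = mseries (foldr dcoeff ks a) (x - x0)" if "x \<in> V" for ks x
    by (rule foldr_partial_deriv_mseries[OF a V(1)]) (use V' f that in auto)
  have "smooth_on V f"
    unfolding smooth_on_def
  proof (intro allI ballI)
    fix ks x assume x: "x \<in> V"
    have "(foldr partial_deriv ks f has_derivative
       (%h. \<Sum>.i. (h $ i) *. mseries (foldr dcoeff (i # ks) a) (x - x0))) (at x)"
      by (rule has_derivative_transform_within_open[OF foldr_dcoeff_has_derivative[OF a V'[OF x]] V(1) x])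
        (simp add: fd)
    then show "foldr partial_deriv ks f differentiable at x"
      unfolding differentiable_def by blast
  qed
  define S where "S = (\<Sum>\<^sub>\<infinity>\<beta>::'n => nat. (1 / 2) ^ mabs \<beta> :: real)"
  have "S \<ge> 0"
    unfolding S_def by (intro infsum_nonneg) auto
  have "ennreal ((R / 4) ^ mabs \<kappa> / mfact \<kappa>) * (SUP x\<in>V. ennreal (norm (mpartial \<kappa> f x)))
      <= ennreal (mnorm R a * S * (1 / 2) ^ mabs \<kappa>)" for \<kappa>
  proof -
    define ks where "ks = (SOME ks. \<forall>i. count_list ks i = \<kappa> i)"
    have ks: "count_list ks i = \<kappa> i" for i
      using someI_ex[OF ex_count_list[of \<kappa>]] by (simp add: ks_def)
    have "norm (mpartial \<kappa> f x) <= mfact \<kappa> * mnorm R a * (2 / R) ^ mabs \<kappa> * S" if "x \<in> V" for x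
      unfolding mpartial_def ks_def[symmetric] fd[OF that] S_def
      by (rule norm_foldr_dcoeff_le[OF a R V(2)[OF that] ks])
    then have "(SUP x\<in>V. ennreal (norm (mpartial \<kappa> f x))) <=
        ennreal (mfact \<kappa> * mnorm R a * (2 / R) ^ mabs \<kappa> * S)"
      by (intro SUP_least ennreal_leI)
    then have "ennreal ((R / 4) ^ mabs \<kappa> / mfact \<kappa>) * (SUP x\<in>V. ennreal (norm (mpartial \<kappa> f x))) <=
        ennreal ((R / 4) ^ mabs \<kappa> / mfact \<kappa>) * ennreal (mfact \<kappa> * mnorm R a * (2 / R) ^ mabs \<kappa> * S)"
      by (rule mult_left_mono) simp
    also have "\<dots> = ennreal (((R / 4) ^ mabs \<kappa> / mfact \<kappa>) * (mfact \<kappa> * mnorm R a * (2 / R) ^ mabs \<kappa> * S))"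
      using R mfact_pos[of \<kappa>] by (intro ennreal_mult'[symmetric]) auto
    also have "((R / 4) ^ mabs \<kappa> / mfact \<kappa>) * (mfact \<kappa> * mnorm R a * (2 / R) ^ mabs \<kappa> * S)
        = mnorm R a * S * ((R / 4) ^ mabs \<kappa> * (2 / R) ^ mabs \<kappa>)"
      using mfact_pos[of \<kappa>] by simp
    also have "(R / 4) ^ mabs \<kappa> * (2 / R) ^ mabs \<kappa> = (1 / 2) ^ mabs \<kappa>"
      using R by (simp flip: power_mult_distrib)
    finally show ?thesis .
  qed
  then have "(\<Sum>\<^sub>\<infinity>al. ennreal ((R / 4) ^ mabs al / mfact al) * (SUP x\<in>V. ennreal (norm (mpartial al f x))))
      <= (\<Sum>\<^sub>\<infinity>al::'n => nat. ennreal (mnorm R a * S * (1 / 2) ^ mabs al))"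
    by (intro infsum_mono nonneg_summable_on_complete) auto
  also have "\<dots> < \<infinity>"
    using \<open>S \<ge> 0\<close> mnorm_nonneg[of R a] R
    by (intro infsum_ennreal_finite[OF summable_on_cmult_right[OF summable_power_mabs]]) auto
  finally have "f \<in> C_omega_r (R / 4) V"
    using \<open>smooth_on V f\<close> by (simp add: C_omega_r_def)
  then show ?thesis
    using R unfolding C_omega_def by (intro UN_I[of "R / 4"]) auto
qed

subsection \<open>Symmetry of mixed partial derivatives\<close>

lemma line_has_real_derivative:
  fixes f :: "real^'n::finite => real"
  assumes "f differentiable (at (y + t *. axis i 1))"
  shows "((%t. f (y + t *. axis i 1)) has_real_derivative partial_deriv i f (y + t *. axis i 1)) (at t within S)"
proof -
  obtain f' where f': "(f has_derivative f') (at (y + t *. axis i 1))"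
    using assms differentiable_def by blast
  have "((%t. y + t *. axis i 1) has_vector_derivative axis i 1) (at t within S)"
    by (auto intro!: derivative_eq_intros)
  from vector_derivative_diff_chain_within[OF this, of f f'] f'
  have "((%t. f (y + t *. axis i 1)) has_vector_derivative f' (axis i 1)) (at t within S)"
    by (auto simp: comp_def intro: has_derivative_at_withinI)
  then show ?thesis
    using partial_deriv_eq[OF f'] by (simp add: has_real_derivative_iff_has_vector_derivative)
qed

text \<open>The mean value theorem in direction \<open>j\<close> turns the second difference into an
  increment of \<open>partial_deriv j f\<close> over the displacement \<open>s\<close> in direction
  \<open>i\<close>; differentiability of that derivative at \<open>x\<close> evaluates the
  increment.\<close>

lemma second_difference_bound:
  fixes f :: "real^'n::finite => real"
  assumes U: "open U" "x \<in> U" and f: "!!y. y \<in> U ==> f differentiable (at y)"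
    and g: "partial_deriv j f differentiable (at x)" and e: "e > 0"
  shows "\<exists>d>0. \<forall>s. 0 < s \<and> s < d -->
    \<bar>f (x + s *. axis i 1 + s *. axis j 1) - f (x + s *. axis i 1) - f (x + s *. axis j 1) + f x
      - s\<^sup>2 * partial_deriv i (partial_deriv j f) x\<bar> <= e * s\<^sup>2"
proof -
  let ?g = "partial_deriv j f"
  obtain g' where g': "(?g has_derivative g') (at x)"
    using g differentiable_def by blast
  obtain d1 where d1: "d1 > 0" "ball x d1 \<subseteq> U"
    using U openE by blast
  \<comment> \<open>The two evaluation points lie within \<open>2 * s\<close> and \<open>s\<close>
    of \<open>x\<close>, so the two errors add up to \<open>e * s\<close>.\<close>
  obtain d2 where d2: "d2 > 0" "!!y. norm (y - x) < d2 ==>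
      norm (?g y - ?g x - g' (y - x)) <= (e / 3) * norm (y - x)"
    using g' e unfolding has_derivative_within_alt by (meson UNIV_I divide_pos_pos zero_less_numeral)
  define d where "d = min d1 d2 / 2"
  have "\<bar>f (x + s *. axis i 1 + s *. axis j 1) - f (x + s *. axis i 1) - f (x + s *. axis j 1) + f x
      - s\<^sup>2 * partial_deriv i (partial_deriv j f) x\<bar> <= e * s\<^sup>2" if s: "0 < s" "s < d" for s
  proof -
    let ?x' = "x + s *. axis i 1 :: real^'n"
    have in1: "norm (x + t *. axis j 1 - x) <= s" if "0 <= t" "t <= s" for t
      using that by simp
    have in2: "norm (?x' + t *. axis j 1 - x) <= 2 * s" if "0 <= t" "t <= s" for t
      using that s norm_triangle_ineq[of "s *. axis i 1 :: real^'n" "t *. axis j 1"]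
      by (simp add: algebra_simps)
    have U1: "x + t *. axis j 1 \<in> U" if "0 <= t" "t <= s" for t
      using in1[OF that] s d1 by (auto simp: d_def dist_norm norm_minus_commute subset_iff)
    have U2: "?x' + t *. axis j 1 \<in> U" if "0 <= t" "t <= s" for t
    proof -
      have "norm (?x' + t *. axis j 1 - x) < d1"
        using in2[OF that] s by (simp add: d_def)
      then show ?thesis
        using d1(2) by (auto simp: dist_norm norm_minus_commute subset_iff)
    qed
    define \<phi> where "\<phi> t = f (?x' + t *. axis j 1) - f (x + t *. axis j 1)" for t
    have "\<exists>\<theta>>0. \<theta> < s \<and> \<phi> s - \<phi> 0 = (s - 0) * (?g (?x' + \<theta> *. axis j 1) - ?g (x + \<theta> *. axis j 1))"
      using s(1) unfolding \<phi>_def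
      by (intro MVT2 derivative_intros line_has_real_derivative f U1 U2) auto
    then obtain \<theta> where \<theta>: "0 < \<theta>" "\<theta> < s"
      and eq: "\<phi> s - \<phi> 0 = s * (?g (?x' + \<theta> *. axis j 1) - ?g (x + \<theta> *. axis j 1))"
      by auto
    have b1: "\<bar>?g (?x' + \<theta> *. axis j 1) - ?g x - g' (?x' + \<theta> *. axis j 1 - x)\<bar> <= e / 3 * (2 * s)"
    proof -
      have "norm (?x' + \<theta> *. axis j 1 - x) <= 2 * s"
        using in2[of \<theta>] \<theta> by simp
      moreover have "2 * s < d2" using s by (simp add: d_def)
      ultimately show ?thesis
        using d2(2)[of "?x' + \<theta> *. axis j 1"] e
        by (smt (verit) mult_left_mono real_norm_def divide_nonneg_nonneg)
    qed
    have b2: "\<bar>?g (x + \<theta> *. axis j 1) - ?g x - g' (x + \<theta> *. axis j 1 - x)\<bar> <= e / 3 * s"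
    proof -
      have "norm (x + \<theta> *. axis j 1 - x) <= s"
        using in1[of \<theta>] \<theta> by simp
      moreover have "s < d2" using s \<theta> by (simp add: d_def)
      ultimately show ?thesis
        using d2(2)[of "x + \<theta> *. axis j 1"] e
        by (smt (verit) mult_left_mono real_norm_def divide_nonneg_nonneg)
    qed
    have "g' (?x' + \<theta> *. axis j 1 - x) - g' (x + \<theta> *. axis j 1 - x) = g' (s *. axis i 1)"
      using linear_diff[OF has_derivative_linear[OF g'], symmetric] by simp
    also have "\<dots> = s * partial_deriv i ?g x"
      using linear_scale[OF has_derivative_linear[OF g'], of s "axis i 1"] partial_deriv_eq[OF g', of i]
      by simp
    finally have "\<bar>?g (?x' + \<theta> *. axis j 1) - ?g (x + \<theta> *. axis j 1) - s * partial_deriv i ?g x\<bar> <= e * s"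
      using b1 b2 by linarith
    then have "s * \<bar>?g (?x' + \<theta> *. axis j 1) - ?g (x + \<theta> *. axis j 1) - s * partial_deriv i ?g x\<bar> <= s * (e * s)"
      using s by (intro mult_left_mono) auto
    also have "s * \<bar>?g (?x' + \<theta> *. axis j 1) - ?g (x + \<theta> *. axis j 1) - s * partial_deriv i ?g x\<bar>
        = \<bar>s * (?g (?x' + \<theta> *. axis j 1) - ?g (x + \<theta> *. axis j 1) - s * partial_deriv i ?g x)\<bar>"
      using s by (simp add: abs_mult)
    also have "s * (?g (?x' + \<theta> *. axis j 1) - ?g (x + \<theta> *. axis j 1) - s * partial_deriv i ?g x)
        = \<phi> s - \<phi> 0 - s\<^sup>2 * partial_deriv i ?g x"
      unfolding eq by (simp add: right_diff_distrib power2_eq_square)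
    finally show ?thesis
      by (simp add: \<phi>_def power2_eq_square mult_ac algebra_simps)
  qed
  moreover have "d > 0" using d1 d2 by (simp add: d_def)
  ultimately show ?thesis by blast
qed

text \<open>The second difference is symmetric in the two directions, and divided by
  \<open>s\<^sup>2\<close> it tends to both mixed derivatives.\<close>

lemma partial_deriv_commute:
  fixes f :: "real^'n::finite => real"
  assumes U: "open U" "x \<in> U" and f: "!!y. y \<in> U ==> f differentiable (at y)"
    and g: "!!k. partial_deriv k f differentiable (at x)"
  shows "partial_deriv i (partial_deriv j f) x = partial_deriv j (partial_deriv i f) x"
proof (rule ccontr)
  let ?a = "partial_deriv i (partial_deriv j f) x" and ?b = "partial_deriv j (partial_deriv i f) x"
  assume "?a \<noteq> ?b"
  define e where "e = \<bar>?a - ?b\<bar> / 3"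
  have e: "e > 0" using \<open>?a \<noteq> ?b\<close> by (simp add: e_def)
  obtain d1 where d1: "d1 > 0" "!!s. 0 < s ==> s < d1 ==>
    \<bar>f (x + s *. axis i 1 + s *. axis j 1) - f (x + s *. axis i 1) - f (x + s *. axis j 1) + f x - s\<^sup>2 * ?a\<bar> <= e * s\<^sup>2"
    using second_difference_bound[OF U f g e, of i] by blast
  obtain d2 where d2: "d2 > 0" "!!s. 0 < s ==> s < d2 ==>
    \<bar>f (x + s *. axis j 1 + s *. axis i 1) - f (x + s *. axis j 1) - f (x + s *. axis i 1) + f x - s\<^sup>2 * ?b\<bar> <= e * s\<^sup>2"
    using second_difference_bound[OF U f g e, of j] by blast
  define s where "s = min d1 d2 / 2"
  have s: "0 < s" "s < d1" "s < d2" using d1 d2 by (auto simp: s_def)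
  have "x + s *. axis j 1 + s *. axis i 1 = x + s *. axis i 1 + s *. axis j 1"
    by (simp add: algebra_simps)
  then have "\<bar>s\<^sup>2 * ?a - s\<^sup>2 * ?b\<bar> <= 2 * (e * s\<^sup>2)"
    using d1(2)[of s] d2(2)[of s] s by (smt (verit))
  then have "s\<^sup>2 * \<bar>?a - ?b\<bar> <= s\<^sup>2 * (2 * e)"
    by (simp add: right_diff_distrib[symmetric] abs_mult mult_ac)
  then have "\<bar>?a - ?b\<bar> <= 2 * e"
    using s by (simp add: mult_le_cancel_left_pos)
  then show False using e by (simp add: e_def)
qed

lemma foldr_partial_deriv_perm:
  fixes f :: "real^'n::finite => real"
  assumes U: "open U" and f: "smooth_on U f"
    and "mset ks = mset ks'" "x \<in> U"
  shows "foldr partial_deriv ks f x = foldr partial_deriv ks' f x"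
  using assms(3,4)
proof (induction ks arbitrary: ks' x)
  case (Cons k ks)
  \<comment> \<open>\<open>k\<close> moves to the front by adjacent transpositions, each of which is
    a commutation of two derivatives of a smooth function.\<close>
  have swap: "foldr partial_deriv (as @ k # bs) f y = foldr partial_deriv (k # as @ bs) f y"
    if "y \<in> U" for as bs y
    using that
  proof (induction as arbitrary: y)
    case (Cons a as)
    let ?g = "foldr partial_deriv (as @ bs) f"
    have "foldr partial_deriv ((a # as) @ k # bs) f y = partial_deriv a (partial_deriv k ?g) y"
      using partial_deriv_cong_open[OF U Cons.prems Cons.IH] by simp
    also have "\<dots> = partial_deriv k (partial_deriv a ?g) y"
    proof (rule partial_deriv_commute[OF U Cons.prems])
      show "?g differentiable (at z)" if "z \<in> U" for z
        using f that unfolding smooth_on_def by blast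
      show "partial_deriv l ?g differentiable (at y)" for l
        using f Cons.prems unfolding smooth_on_def by (metis foldr.simps(2) comp_apply)
    qed
    finally show ?case by simp
  qed simp
  have "k \<in> set ks'"
    using Cons.prems(1) by (metis list.set_intros(1) mset_eq_setD)
  then obtain as bs where ks': "ks' = as @ k # bs"
    by (meson split_list)
  then have ms: "mset ks = mset (as @ bs)"
    using Cons.prems(1) by simp
  have "partial_deriv k (foldr partial_deriv ks f) x = partial_deriv k (foldr partial_deriv (as @ bs) f) x"
    by (rule partial_deriv_cong_open[OF U Cons.prems(2) Cons.IH[OF ms]])
  then have "foldr partial_deriv (k # ks) f x = foldr partial_deriv (k # as @ bs) f x"
    by simp
  then show ?case
    using swap[OF Cons.prems(2)] ks' by simp
qed simp

subsection \<open>Taylor series of functions of class \<open>C_omega\<close>\<close>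

text \<open>The order of differentiation inside \<open>mpartial\<close> is an arbitrary choice, made
  separately for each multi-index; symmetry of the derivatives reconciles the two choices.\<close>

lemma partial_deriv_mpartial:
  fixes f :: "real^'n::finite => real"
  assumes "open U" "smooth_on U f" "x \<in> U"
  shows "partial_deriv i (mpartial al f) x = mpartial (al(i := Suc (al i))) f x"
proof -
  let ?P = "%al ks. \<forall>i. count_list ks i = al i"
  define ks where "ks = (SOME ks. ?P al ks)"
  define ks' where "ks' = (SOME ks. ?P (al(i := Suc (al i))) ks)"
  have ks: "?P al ks"
    unfolding ks_def by (rule someI_ex[OF ex_count_list])
  have ks': "?P (al(i := Suc (al i))) ks'"
    unfolding ks'_def by (rule someI_ex[OF ex_count_list])
  have "mset (i # ks) = mset ks'"
  proof (rule multiset_eqI)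
    fix x
    show "count (mset (i # ks)) x = count (mset ks') x"
      unfolding count_mset using ks ks' by simp
  qed
  then have "foldr partial_deriv (i # ks) f x = foldr partial_deriv ks' f x"
    by (rule foldr_partial_deriv_perm[OF assms(1,2) _ assms(3)])
  then show ?thesis
    by (simp add: mpartial_def ks_def ks'_def)
qed

lemma finite_mabs_eq: "finite {al::'n::finite => nat. mabs al = m}"
proof (rule finite_subset)
  show "{al::'n => nat. mabs al = m} \<subseteq> PiE UNIV (%_. {..m})"
    using le_mabs by (auto simp: PiE_def Pi_def)
qed (intro finite_PiE, auto)

lemma finite_mabs_less: "finite {al::'n::finite => nat. mabs al < m}"
proof -
  have "{al::'n => nat. mabs al < m} = (\<Union>k<m. {al. mabs al = k})" by auto
  then show ?thesis using finite_mabs_eq[where 'n = 'n] by simp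
qed

text \<open>The \<open>m\<close>-th derivative of s \<mapsto> f (y + s h), divided by m!.\<close>

definition taylor_term :: "(real^'n::finite => real) => real^'n => real^'n => nat => real => real" where
  "taylor_term f y h m s = (\<Sum>al | mabs al = m. mpow h al / mfact al * mpartial al f (y + s *. h))"

lemma taylor_term_has_derivative:
  fixes f :: "real^'n::finite => real"
  assumes U: "open U" and f: "smooth_on U f" and x: "y + s *. h \<in> U"
  shows "(taylor_term f y h m has_real_derivative (real (Suc m) * taylor_term f y h (Suc m) s)) (at s)"
proof -
  have der: "((%s. mpartial al f (y + s *. h)) has_real_derivative
      (\<Sum>.i. h $ i * mpartial (al(i := Suc (al i))) f (y + s *. h))) (at s)" for al
  proof -
    have "mpartial al f differentiable (at (y + s *. h))"
      unfolding mpartial_def using f x by (simp add: smooth_on_def)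
    then obtain f' where f': "(mpartial al f has_derivative f') (at (y + s *. h))"
      using differentiable_def by blast
    have "((%s. y + s *. h) has_vector_derivative h) (at s)"
      by (auto intro!: derivative_eq_intros)
    from vector_derivative_diff_chain_within[OF this, of "mpartial al f" f'] f'
    have "((%s. mpartial al f (y + s *. h)) has_vector_derivative f' h) (at s)"
      by (auto simp: comp_def intro: has_derivative_at_withinI)
    moreover have "f' h = (\<Sum>.i. h $ i * mpartial (al(i := Suc (al i))) f (y + s *. h))"
    proof -
      have "f' h = f' (\<Sum>.i. h $ i *. axis i 1)"
        using basis_expansion[of h] by (simp add: scalar_mult_eq_scaleR)
      also have "\<dots> = (\<Sum>.i. h $ i * f' (axis i 1))"
        by (simp add: linear_sum[OF has_derivative_linear[OF f']] linear_scale[OF has_derivative_linear[OF f']])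
      finally show ?thesis
        using partial_deriv_eq[OF f'] partial_deriv_mpartial[OF U f x] by simp
    qed
    ultimately show ?thesis
      by (simp add: has_real_derivative_iff_has_vector_derivative)
  qed
  have "(taylor_term f y h m has_real_derivative
      (\<Sum>al | mabs al = m. mpow h al / mfact al *
         (\<Sum>.i. h $ i * mpartial (al(i := Suc (al i))) f (y + s *. h)))) (at s)"
    unfolding taylor_term_def[abs_def] by (intro derivative_intros DERIV_cmult der)
  also have "(\<Sum>al | mabs al = m. mpow h al / mfact al *
         (\<Sum>.i. h $ i * mpartial (al(i := Suc (al i))) f (y + s *. h)))
    = (\<Sum>.i. \<Sum>al | mabs al = m. mpow h al / mfact al * (h $ i * mpartial (al(i := Suc (al i))) f (y + s *. h)))"
    unfolding sum_distrib_left by (rule sum.swap)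
  \<comment> \<open>With \<beta> as the raised index, the quotients of monomials and factorials turn
    \<open>h $ i\<close> into the factor \<open>\<beta> i\<close>; summed over \<open>i\<close>
    these factors give the degree \<open>Suc m\<close>.\<close>
  also have "\<dots> = (\<Sum>.i. \<Sum>\<beta> | mabs \<beta> = Suc m. real (\<beta> i) * (mpow h \<beta> / mfact \<beta> * mpartial \<beta> f (y + s *. h)))"
  proof (rule sum.cong[OF refl])
    fix i :: 'n
    define F where "F \<beta> = real (\<beta> i) * (mpow h \<beta> / mfact \<beta> * mpartial \<beta> f (y + s *. h))" for \<beta>
    have "(\<Sum>al | mabs al = m. mpow h al / mfact al * (h $ i * mpartial (al(i := Suc (al i))) f (y + s *. h)))
        = (\<Sum>al | mabs al = m. F (al(i := Suc (al i))))"
    proof (rule sum.cong[OF refl])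
      fix al
      show "mpow h al / mfact al * (h $ i * mpartial (al(i := Suc (al i))) f (y + s *. h)) = F (al(i := Suc (al i)))"
        using mfact_pos[of al] by (simp add: F_def mpow_Suc mfact_Suc divide_simps del: of_nat_Suc)
    qed
    also have "\<dots> = sum F {\<beta>. mabs \<beta> = Suc m \<and> \<beta> i \<noteq> 0}"
    proof (rule sum.reindex_bij_witness[where j = "%al. al(i := Suc (al i))" and i = "%\<beta>. \<beta>(i := \<beta> i - 1)"])
      fix b :: "'n => nat" assume "b \<in> {\<beta>. mabs \<beta> = Suc m \<and> \<beta> i \<noteq> 0}"
      then show "b(i := b i - 1) \<in> {al. mabs al = m}" "b(i := b i - 1, i := Suc ((b(i := b i - 1)) i)) = b"
        using mabs_upd[of b i "b i - 1"] by (auto simp: fun_eq_iff)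
    qed auto
    also have "\<dots> = sum F {\<beta>. mabs \<beta> = Suc m}"
      by (rule sum.mono_neutral_left) (auto simp: finite_mabs_eq F_def)
    finally show "(\<Sum>al | mabs al = m. mpow h al / mfact al * (h $ i * mpartial (al(i := Suc (al i))) f (y + s *. h)))
        = (\<Sum>\<beta> | mabs \<beta> = Suc m. real (\<beta> i) * (mpow h \<beta> / mfact \<beta> * mpartial \<beta> f (y + s *. h)))"
      by (simp add: F_def)
  qed
  also have "\<dots> = (\<Sum>\<beta> | mabs \<beta> = Suc m. \<Sum>.i. real (\<beta> i) * (mpow h \<beta> / mfact \<beta> * mpartial \<beta> f (y + s *. h)))"
    by (rule sum.swap)
  also have "\<dots> = (\<Sum>\<beta> | mabs \<beta> = Suc m. real (Suc m) * (mpow h \<beta> / mfact \<beta> * mpartial \<beta> f (y + s *. h)))"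
  proof (rule sum.cong[OF refl])
    fix \<beta> :: "'n => nat" assume "\<beta> \<in> {\<beta>. mabs \<beta> = Suc m}"
    then have "(\<Sum>.i. real (\<beta> i)) = real (Suc m)"
      by (simp add: mabs_def flip: of_nat_sum)
    then show "(\<Sum>.i. real (\<beta> i) * (mpow h \<beta> / mfact \<beta> * mpartial \<beta> f (y + s *. h)))
        = real (Suc m) * (mpow h \<beta> / mfact \<beta> * mpartial \<beta> f (y + s *. h))"
      unfolding sum_distrib_right[symmetric] by simp
  qed
  finally show ?thesis
    unfolding taylor_term_def[of f y h "Suc m" s] sum_distrib_left .
qed

text \<open>Lagrange's form of the remainder on the segment. The intermediate point is unknown, but
  \<open>K\<close> bounds the derivatives at all points of \<open>U\<close>.\<close>

lemma taylor_remainder_bound: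
  fixes f :: "real^'n::finite => real"
  assumes U: "open U" and f: "smooth_on U f" and seg: "!!s. 0 <= s ==> s <= 1 ==> y + s *. h \<in> U"
    and n: "0 < n" and h: "h \<in> cube r"
    and K: "!!al x. x \<in> U ==> r ^ mabs al / mfact al * \<bar>mpartial al f x\<bar> <= K al"
  shows "\<bar>f (y + h) - (\<Sum>al | mabs al < n. mpow h al * (mpartial al f y / mfact al))\<bar> <= (\<Sum>al | mabs al = n. K al)"
proof -
  define diff where "diff m s = fact m * taylor_term f y h m s" for m s
  have "mpartial (%_::'n. 0) f = f"
  proof -
    have "(SOME ks. \<forall>i::'n. count_list ks i = 0) = []"
    proof (rule some_equality)
      fix ks :: "'n list"
      assume "\<forall>i. count_list ks i = 0"
      then show "ks = []" by (metis count_list_0_iff list.set_intros(1) neq_Nil_conv)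
    qed simp
    then show ?thesis by (simp add: mpartial_def)
  qed
  moreover have "{al::'n => nat. mabs al = 0} = {%_. 0}"
    by (auto simp: mabs_def)
  ultimately have diff0: "diff 0 s = f (y + s *. h)" for s
    by (simp add: diff_def taylor_term_def mpow_def)
  have "\<exists>t. 0 < t \<and> t < 1 \<and> f (y + 1 *. h) =
      (\<Sum>m<n. diff m 0 / fact m * 1 ^ m) + diff n t / fact n * 1 ^ n"
  proof (rule Maclaurin[of 1 n diff "%s. f (y + s *. h)"])
    show "\<forall>m t. m < n \<and> 0 <= t \<and> t <= 1 --> DERIV (diff m) t :> diff (Suc m) t"
    proof (intro allI impI)
      fix m t assume "m < n \<and> 0 <= t \<and> t <= (1::real)"
      then have "(taylor_term f y h m has_real_derivative (real (Suc m) * taylor_term f y h (Suc m) t)) (at t)"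
        using taylor_term_has_derivative[OF U f seg] by blast
      from DERIV_cmult[OF this, of "fact m"] show "DERIV (diff m) t :> diff (Suc m) t"
        by (simp add: diff_def[abs_def] mult_ac del: of_nat_Suc)
    qed
  qed (use n diff0 in auto)
  then obtain t where t: "0 < t" "t < 1" and eq: "f (y + h) =
      (\<Sum>m<n. taylor_term f y h m 0) + taylor_term f y h n t"
    by (auto simp: diff_def)
  have "(\<Sum>m<n. taylor_term f y h m 0) = (\<Sum>al | mabs al < n. mpow h al * (mpartial al f y / mfact al))"
  proof -
    have "(\<Sum>al | mabs al < n. mpow h al * (mpartial al f y / mfact al))
        = (\<Sum>m<n. \<Sum>al | al \<in> {al. mabs al < n} \<and> mabs al = m. mpow h al * (mpartial al f y / mfact al))"
      by (rule sum.group[symmetric]) (auto simp: finite_mabs_less)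
    also have "\<dots> = (\<Sum>m<n. taylor_term f y h m 0)"
      unfolding taylor_term_def by (intro sum.cong) auto
    finally show ?thesis by simp
  qed
  moreover have "\<bar>taylor_term f y h n t\<bar> <= (\<Sum>al | mabs al = n. K al)"
    unfolding taylor_term_def
  proof (rule order_trans[OF sum_abs], rule sum_mono)
    fix al :: "'n => nat"
    have "\<bar>mpow h al / mfact al * mpartial al f (y + t *. h)\<bar> = \<bar>mpow h al\<bar> / mfact al * \<bar>mpartial al f (y + t *. h)\<bar>"
      using mfact_pos[of al] by (simp add: abs_mult)
    also have "\<dots> <= r ^ mabs al / mfact al * \<bar>mpartial al f (y + t *. h)\<bar>"
      using mfact_pos[of al] abs_mpow_le[OF h] by (intro mult_right_mono divide_right_mono) auto
    also have "\<dots> <= K al"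
      using K seg t by auto
    finally show "\<bar>mpow h al / mfact al * mpartial al f (y + t *. h)\<bar> <= K al" .
  qed
  ultimately show ?thesis using eq by simp
qed

text \<open>The remainder of order \<open>n\<close> is bounded by the part of degree
  \<open>n\<close> of a summable family, which becomes arbitrarily small. Radius and bound come from
  suprema over \<open>V\<close> and so are the same for all centres \<open>y\<close>; this is the
  source of uniformity over compact sets. Segments are required to stay in \<open>V\<close> because
  \<open>V\<close> need not be convex.\<close>

lemma C_omega_taylor:
  fixes f :: "real^'n::finite => real"
  assumes V: "open V" and f: "f \<in> C_omega V"
  obtains r B where "0 < r" "!!y. y \<in> V ==> \<exists>a. mconv r a \<and> mnorm r a <= B \<and>
      (\<forall>h\<in>cube r. (\<forall>s. 0 <= s \<and> s <= 1 --> y + s *. h \<in> V) --> f (y + h) = mseries a h)"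
proof -
  obtain r where r: "0 < r" and sm: "smooth_on V f"
    and fin: "(\<Sum>\<^sub>\<infinity>al. ennreal (r ^ mabs al / mfact al) * (SUP x\<in>V. ennreal (norm (mpartial al f x)))) < \<infinity>"
    using f by (auto simp: C_omega_def C_omega_r_def)
  define E where "E al = ennreal (r ^ mabs al / mfact al) * (SUP x\<in>V. ennreal (norm (mpartial al f x)))" for al
  define K where "K al = enn2real (E al)" for al
  have sumE: "sum E F <= infsum E UNIV" if "finite F" for F
  proof -
    have "infsum E F <= infsum E UNIV"
      by (rule infsum_mono_neutral) (auto intro: nonneg_summable_on_complete)
    then show ?thesis using that by simp
  qed
  have Efin: "infsum E UNIV < \<infinity>"
    using fin by (simp add: E_def[abs_def])
  have EK: "E al = ennreal (K al)" for al
    using sumE[of "{al}"] Efin by (simp add: K_def)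
  have K0: "0 <= K al" for al by (simp add: K_def)
  have sumK: "sum K F <= enn2real (infsum E UNIV)" if "finite F" for F
  proof -
    have "ennreal (sum K F) <= infsum E UNIV"
      using sumE[OF that] K0 by (simp add: EK)
    then show ?thesis
      using Efin by (metis K0 enn2real_ennreal enn2real_mono infinity_ennreal_def sum_nonneg)
  qed
  have Ksum: "K summable_on UNIV"
    by (rule nonneg_bdd_above_summable_on) (use K0 sumK in \<open>auto intro!: bdd_aboveI\<close>)
  have Kb: "r ^ mabs al / mfact al * \<bar>mpartial al f x\<bar> <= K al" if "x \<in> V" for al x
  proof -
    have "ennreal (r ^ mabs al / mfact al * \<bar>mpartial al f x\<bar>) = ennreal (r ^ mabs al / mfact al) * ennreal (norm (mpartial al f x))"
      using r mfact_pos[of al] unfolding real_norm_def by (intro ennreal_mult') auto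
    also have "\<dots> <= E al"
      unfolding E_def using that by (intro mult_left_mono SUP_upper) auto
    finally show ?thesis
      using EK K0 by (simp add: ennreal_le_iff)
  qed
  have "\<exists>a. mconv r a \<and> mnorm r a <= infsum K UNIV \<and>
      (\<forall>h\<in>cube r. (\<forall>s. 0 <= s \<and> s <= 1 --> y + s *. h \<in> V) --> f (y + h) = mseries a h)"
    if y: "y \<in> V" for y
  proof -
    define a where "a al = mpartial al f y / mfact al" for al
    have aK: "r ^ mabs al * norm (a al) <= K al" for al
      using Kb[OF y, of al] mfact_pos[of al] by (simp add: a_def)
    have conv: "mconv r a"
      unfolding mconv_def by (rule summable_on_comparison_test[OF Ksum]) (use aK r in auto)
    moreover have "mnorm r a <= infsum K UNIV"
      unfolding mnorm_def using conv Ksum aK by (intro infsum_mono) (auto simp: mconv_def)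
    moreover have "f (y + h) = mseries a h"
      if h: "h \<in> cube r" and seg: "\<forall>s. 0 <= s \<and> s <= 1 --> y + s *. h \<in> V" for h
    proof -
      have ms: "((%al. mpow h al *. a al) has_sum mseries a h) UNIV"
        by (rule mseries_has_sum[OF conv h])
      have "\<bar>f (y + h) - mseries a h\<bar> <= 3 * e" if e: "e > 0" for e
      proof -
        obtain F where F: "finite F" "dist (sum K F) (infsum K UNIV) <= e"
          using infsum_finite_approximation[OF Ksum e] by auto
        have "\<forall>\<^sub>F G in finite_subsets_at_top UNIV. dist (\<Sum>al\<in>G. mpow h al *. a al) (mseries a h) < e"
          using ms e unfolding has_sum_def by (rule tendstoD)
        then obtain F' where F': "finite F'" "!!G. finite G ==> F' \<subseteq> G ==>
            dist (\<Sum>al\<in>G. mpow h al *. a al) (mseries a h) < e"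
          unfolding eventually_finite_subsets_at_top by auto
        \<comment> \<open>All degrees in \<open>F\<close> and \<open>F'\<close> lie below
          \<open>n\<close>: the part of degree \<open>n\<close> misses \<open>F\<close> and is at
          most the tail \<open>e\<close>, while the partial sum below degree \<open>n\<close>
          contains \<open>F'\<close>.\<close>
        define n where "n = Suc (Max (insert 0 (mabs ` (F \<union> F'))))"
        have n: "mabs al < n" if "al \<in> F \<union> F'" for al
          unfolding n_def less_Suc_eq_le using F F' that by (intro Max_ge) auto
        have "\<bar>f (y + h) - (\<Sum>al | mabs al < n. mpow h al * (mpartial al f y / mfact al))\<bar> <= (\<Sum>al | mabs al = n. K al)"
          by (rule taylor_remainder_bound[OF V sm _ _ h Kb]) (use seg in \<open>auto simp: n_def\<close>)
        moreover have "(\<Sum>al | mabs al = n. K al) <= e"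
        proof -
          have "sum K F + (\<Sum>al | mabs al = n. K al) = sum K (F \<union> {al. mabs al = n})"
            using F n by (intro sum.union_disjoint[symmetric]) (auto simp: finite_mabs_eq)
          also have "\<dots> <= infsum K UNIV"
            using F Ksum K0 by (intro finite_sum_le_infsum) (auto simp: finite_mabs_eq)
          finally show ?thesis
            using F(2) by (auto simp: dist_real_def)
        qed
        moreover have "\<bar>(\<Sum>al | mabs al < n. mpow h al * (mpartial al f y / mfact al)) - mseries a h\<bar> < e"
          using F'(2)[OF finite_mabs_less[of n]] n by (auto simp: dist_real_def a_def)
        ultimately show ?thesis by linarith
      qed
      then have "\<bar>f (y + h) - mseries a h\<bar> <= 0 + e" if "e > 0" for e
        using that by (metis add_0 divide_pos_pos nonzero_mult_div_cancel_left times_divide_eq_right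
            zero_less_numeral zero_neq_numeral)
      from field_le_epsilon[OF this] show ?thesis by simp
    qed
    ultimately show ?thesis by blast
  qed
  then show ?thesis using that r by blast
qed

lemma C_omega_component:
  fixes f :: "real^'n::finite => real^'m::finite"
  assumes V: "open V" and f: "f \<in> C_omega V"
  shows "(%x. f x $ k) \<in> C_omega V"
proof -
  obtain r where r: "0 < r" and sm: "smooth_on V f"
    and fin: "(\<Sum>\<^sub>\<infinity>al. ennreal (r ^ mabs al / mfact al) * (SUP x\<in>V. ennreal (norm (mpartial al f x)))) < \<infinity>"
    using f by (auto simp: C_omega_def C_omega_r_def)
  have comp: "((%x. g x $ k) has_derivative (%h. g' h $ k)) (at x)" if "(g has_derivative g') (at x)"
    for g :: "real^'n => real^'m" and g' x
    by (rule bounded_linear.has_derivative[OF bounded_linear_vec_nth that])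
  have eq: "foldr partial_deriv ks (%x. f x $ k) x = foldr partial_deriv ks f x $ k" if "x \<in> V" for ks x
    using that
  proof (induction ks arbitrary: x)
    case (Cons i ks)
    obtain g' where g': "(foldr partial_deriv ks f has_derivative g') (at x)"
      using sm Cons.prems unfolding smooth_on_def differentiable_def by blast
    have "partial_deriv i (foldr partial_deriv ks (%x. f x $ k)) x = partial_deriv i (%x. foldr partial_deriv ks f x $ k) x"
      by (rule partial_deriv_cong_open[OF V Cons.prems Cons.IH])
    then show ?case
      using partial_deriv_eq[OF comp[OF g']] partial_deriv_eq[OF g'] by simp
  qed simp
  have "smooth_on V (%x. f x $ k)"
    unfolding smooth_on_def
  proof (intro allI ballI)
    fix ks x assume x: "x \<in> V"
    obtain g' where g': "(foldr partial_deriv ks f has_derivative g') (at x)"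
      using sm x unfolding smooth_on_def differentiable_def by blast
    show "foldr partial_deriv ks (%x. f x $ k) differentiable at x"
      using has_derivative_transform_within_open[OF comp[OF g'] V x, of "foldr partial_deriv ks (%x. f x $ k)"] eq
      unfolding differentiable_def by metis
  qed
  moreover have "norm (mpartial al (%x. f x $ k) x) <= norm (mpartial al f x)" if "x \<in> V" for al x
    using that by (simp add: mpartial_def eq component_le_norm_cart)
  then have "(\<Sum>\<^sub>\<infinity>al. ennreal (r ^ mabs al / mfact al) * (SUP x\<in>V. ennreal (norm (mpartial al (%x. f x $ k) x))))
    <= (\<Sum>\<^sub>\<infinity>al. ennreal (r ^ mabs al / mfact al) * (SUP x\<in>V. ennreal (norm (mpartial al f x))))"
    by (intro infsum_mono nonneg_summable_on_complete mult_left_mono SUP_mono) (auto intro: ennreal_leI)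
  ultimately have "(%x. f x $ k) \<in> C_omega_r r V"
    using fin by (auto simp: C_omega_r_def intro: le_less_trans)
  then show ?thesis using r by (auto simp: C_omega_def)
qed

section \<open>The Wiener algebra of absolutely convergent power series on the unit cube\<close>

text \<open>Coefficient form of the radial mean: the new series is the integral of a (s u) over s in
  [0, 1].\<close>

definition scoeff :: "(('n::finite => nat) => 'b::real_normed_vector) => ('n => nat) => 'b" where
  "scoeff a al = a al /\<^sub>R real (Suc (mabs al))"

lemma mconv_scoeff:
  assumes "mconv r a" "0 <= r"
  shows "mconv r (scoeff a)"
  unfolding mconv_def
proof (rule summable_on_comparison_test[OF assms(1)[unfolded mconv_def]])
  fix al
  have "norm (scoeff a al) <= norm (a al)"
    by (auto simp: scoeff_def divide_simps mult_le_cancel_left1)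
  then show "r ^ mabs al * norm (scoeff a al) <= r ^ mabs al * norm (a al)"
    using assms(2) by (intro mult_left_mono) auto
qed (use assms in auto)

lemma scaleR_mem_cube:
  assumes "u \<in> cube R" "0 <= s" "s <= 1"
  shows "s *. u \<in> cube R"
  unfolding cube_def
proof (clarsimp)
  fix i
  have "\<bar>s * u $ i\<bar> <= 1 * \<bar>u $ i\<bar>"
    unfolding abs_mult using assms by (intro mult_right_mono) auto
  then show "\<bar>s * u $ i\<bar> <= R"
    using assms by (auto simp: cube_def intro: order_trans)
qed

lemma scoeff_ray_derivative:
  fixes a :: "('n::finite => nat) => 'b::banach"
  assumes a: "mconv R a" and R: "0 <= R" and u: "u \<in> cube R" and s: "s \<in> {0..1}"
  shows "((%s. s *. mseries (scoeff a) (s *. u)) has_vector_derivative mseries a (s *. u))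
    (at s within {0..1})"
proof -
  define f where "f al s = (s ^ Suc (mabs al) / real (Suc (mabs al))) *. (mpow u al *. a al)"
    for al and s :: real
  define f' where "f' al s h = (h * s ^ mabs al) *. (mpow u al *. a al)" for al and s h :: real
  have M: "(%al. norm (mpow u al *. a al)) summable_on UNIV"
    by (rule mseries_abs_summable[OF a u])
  have feq: "f al s = s *. (mpow (s *. u) al *. scoeff a al)" for al s
    by (simp add: f_def scoeff_def mpow_scaleR divide_inverse del: of_nat_Suc)
  have f'eq: "f' al s h = h *. (mpow (s *. u) al *. a al)" for al s h
    by (simp add: f'_def mpow_scaleR)
  have "((%s. \<Sum>\<^sub>\<infinity>al. f al s) has_derivative (%h. \<Sum>\<^sub>\<infinity>al. f' al s h)) (at s within {0..1})"
  proof (rule has_derivative_infsum[OF _ s _ _ M])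
    show "(f al has_derivative f' al y) (at y within {0..1})" for al y
    proof -
      have "((%s. s ^ Suc (mabs al) / real (Suc (mabs al))) has_derivative (%h. h * y ^ mabs al)) (at y within {0..1})"
        by (rule has_derivative_eq_rhs, rule derivative_intros, rule derivative_intros, rule derivative_intros)
          (auto simp: fun_eq_iff divide_simps simp del: of_nat_Suc)
      then show ?thesis
        unfolding f_def f'_def by (rule has_derivative_scaleR_left)
    qed
    show "norm (f' al y h) <= norm (mpow u al *. a al) * norm h" if "y \<in> {0..1}" for al y h
    proof -
      have "\<bar>h\<bar> * y ^ mabs al <= \<bar>h\<bar> * 1"
        using that by (intro mult_left_mono power_le_one) auto
      then have "\<bar>h\<bar> * y ^ mabs al * norm (mpow u al *. a al) <= \<bar>h\<bar> * norm (mpow u al *. a al)"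
        by (intro mult_right_mono) auto
      then show ?thesis
        using that by (simp add: f'_def abs_mult power_abs mult_ac)
    qed
    show "(%al. norm (f al y)) summable_on UNIV" if "y \<in> {0..1}" for y
    proof (rule summable_on_comparison_test[OF M])
      fix al :: "'n => nat"
      have "\<bar>y ^ Suc (mabs al) / real (Suc (mabs al))\<bar> <= 1"
        using that power_le_one[of y "Suc (mabs al)"] by (auto simp: divide_simps simp del: power_Suc)
      then have "\<bar>y ^ Suc (mabs al) / real (Suc (mabs al))\<bar> * norm (mpow u al *. a al) <= 1 * norm (mpow u al *. a al)"
        by (rule mult_right_mono) simp
      then show "norm (f al y) <= norm (mpow u al *. a al)"
        by (simp add: f_def abs_mult mult_ac)
    qed auto
  qed auto
  moreover have "(%s. \<Sum>\<^sub>\<infinity>al. f al s) = (%s. s *. mseries (scoeff a) (s *. u))"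
    unfolding feq mseries_def by (simp only: infsum_scaleR_right)
  moreover have "(%h. \<Sum>\<^sub>\<infinity>al. f' al s h) = (%h. h *. mseries a (s *. u))"
    unfolding f'eq mseries_def by (simp only: infsum_scaleR_right)
  ultimately show ?thesis
    by (simp add: has_vector_derivative_def)
qed

text \<open>Coefficients are normalised to radius one, so that one Banach algebra serves all centres
  and scales; other radii enter only through \<open>wseries\<close> and
  \<open>unscale\<close>.\<close>

typedef ('n::finite) wiener = "{a::('n => nat) => real. (%al. \<bar>a al\<bar>) summable_on UNIV}"
  morphisms wcoeff Wiener
  by (rule exI[of _ "%_. 0"]) simp

setup_lifting type_definition_wiener

lemma wiener_eq_iff: "a = b \<longleftrightarrow> (\<forall>al. wcoeff a al = wcoeff b al)"
  by transfer auto

lemma wcoeff_summable: "(%al. \<bar>wcoeff a al\<bar>) summable_on UNIV"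
  by transfer

lemma mconv_wcoeff [simp]: "mconv 1 (wcoeff a)"
  using wcoeff_summable[of a] by (simp add: mconv_def)

lemma abs_summable_add:
  fixes a b :: "'i => real"
  assumes "(%al. \<bar>a al\<bar>) summable_on A" "(%al. \<bar>b al\<bar>) summable_on A"
  shows "(%al. \<bar>a al + b al\<bar>) summable_on A"
  by (rule summable_on_comparison_test[OF summable_on_add[OF assms]]) auto

instantiation wiener :: (finite) real_vector
begin

lift_definition zero_wiener :: "'a wiener" is "%_. 0" by simp
lift_definition plus_wiener :: "'a wiener => 'a wiener => 'a wiener" is "%a b al. a al + b al"
  by (rule abs_summable_add)
lift_definition uminus_wiener :: "'a wiener => 'a wiener" is "%a al. - a al" by simp
lift_definition minus_wiener :: "'a wiener => 'a wiener => 'a wiener" is "%a b al. a al - b al"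
  using abs_summable_add[of _ UNIV "%al. - b al" for b] by simp
lift_definition scaleR_wiener :: "real => 'a wiener => 'a wiener" is "%c a al. c * a al"
  by (simp add: abs_mult summable_on_cmult_right)
instance
  by (standard; transfer; simp add: algebra_simps)

end

instantiation wiener :: (finite) real_normed_vector
begin

lift_definition norm_wiener :: "'a wiener => real" is "%a. \<Sum>\<^sub>\<infinity>al. \<bar>a al\<bar>" .
definition dist_wiener :: "'a wiener => 'a wiener => real" where "dist_wiener a b = norm (a - b)"
definition sgn_wiener :: "'a wiener => 'a wiener" where "sgn_wiener a = a /\<^sub>R norm a"
definition uniformity_wiener :: "('a wiener \<times> 'a wiener) filter" where
  "uniformity_wiener = (INF e\<in>{0<..}. principal {(x, y). dist x y < e})"
definition open_wiener :: "'a wiener set => bool" where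
  "open_wiener S \<longleftrightarrow> (\<forall>x\<in>S. \<forall>\<^sub>F (x', y) in uniformity. x' = x --> y \<in> S)"

instance
proof
  fix a b :: "'a wiener" and r :: real
  show "(norm a = 0) = (a = 0)"
  proof (transfer; intro iffI)
    fix a :: "('a => nat) => real"
    assume "(%al. \<bar>a al\<bar>) summable_on UNIV" "(\<Sum>\<^sub>\<infinity>al. \<bar>a al\<bar>) = 0"
    then have "\<bar>a al\<bar> = 0" for al
      using nonneg_infsum_le_0D[of "%al. \<bar>a al\<bar>" UNIV al] by simp
    then show "a = (%_. 0)" by auto
  qed simp
  show "norm (a + b) <= norm a + norm b"
  proof transfer
    fix a b :: "('a => nat) => real"
    assume ab: "(%al. \<bar>a al\<bar>) summable_on UNIV" "(%al. \<bar>b al\<bar>) summable_on UNIV"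
    have "(\<Sum>\<^sub>\<infinity>al. \<bar>a al + b al\<bar>) <= (\<Sum>\<^sub>\<infinity>al. \<bar>a al\<bar> + \<bar>b al\<bar>)"
      by (intro infsum_mono abs_summable_add summable_on_add ab) auto
    then show "(\<Sum>\<^sub>\<infinity>al. \<bar>a al + b al\<bar>) <= (\<Sum>\<^sub>\<infinity>al. \<bar>a al\<bar>) + (\<Sum>\<^sub>\<infinity>al. \<bar>b al\<bar>)"
      using ab by (simp add: infsum_add)
  qed
  show "norm (r *. a) = \<bar>r\<bar> * norm a"
    by transfer (simp add: abs_mult infsum_cmult_right)
qed (simp_all add: dist_wiener_def sgn_wiener_def uniformity_wiener_def open_wiener_def)

end

lemma wcoeff_simps [simp]:
  "wcoeff 0 al = 0" "wcoeff (a + b) al = wcoeff a al + wcoeff b al"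
  "wcoeff (a - b) al = wcoeff a al - wcoeff b al" "wcoeff (- a) al = - wcoeff a al"
  "wcoeff (c *. a) al = c * wcoeff a al"
  by (transfer; simp)+

lemma norm_wiener_eq: "norm a = (\<Sum>\<^sub>\<infinity>al. \<bar>wcoeff a al\<bar>)"
  by transfer simp

lemma mnorm_wcoeff: "mnorm 1 (wcoeff a) = norm a"
  by (simp add: mnorm_def norm_wiener_eq)

lemma sum_wcoeff_le_norm: "finite F ==> (\<Sum>al\<in>F. \<bar>wcoeff a al\<bar>) <= norm a"
  unfolding norm_wiener_eq by (intro finite_sum_le_infsum wcoeff_summable) auto

lemma abs_wcoeff_le_norm: "\<bar>wcoeff a al\<bar> <= norm a"
  using sum_wcoeff_le_norm[of "{al}" a] by simp

lemma norm_wiener_leI: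
  assumes "!!F. finite F ==> (\<Sum>al\<in>F. \<bar>wcoeff a al\<bar>) <= B"
  shows "norm a <= B"
  unfolding norm_wiener_eq using assms wcoeff_summable by (intro infsum_le_finite_sums) auto

instance wiener :: (finite) banach
proof
  fix X :: "nat => 'a wiener"
  assume X: "Cauchy X"
  have Cau: "Cauchy (%n. wcoeff (X n) al)" for al
  proof (rule metric_CauchyI)
    fix e :: real assume "0 < e"
    then obtain M where M: "!!m n. m \<ge> M ==> n \<ge> M ==> dist (X m) (X n) < e"
      using X metric_CauchyD by blast
    have "dist (wcoeff (X m) al) (wcoeff (X n) al) < e" if "m \<ge> M" "n \<ge> M" for m n
      using abs_wcoeff_le_norm[of "X m - X n" al] M[OF that] by (simp add: dist_norm)
    then show "\<exists>M. \<forall>m\<ge>M. \<forall>n\<ge>M. dist (wcoeff (X m) al) (wcoeff (X n) al) < e"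
      by blast
  qed
  define L where "L al = lim (%n. wcoeff (X n) al)" for al
  have L: "(%n. wcoeff (X n) al) \<longlonglongrightarrow> L al" for al
    using Cauchy_convergent[OF Cau[of al]] by (simp add: L_def convergent_LIMSEQ_iff)
  \<comment> \<open>The Cauchy bound passes to the limit on finite index sets, uniformly in the set;
    this suffices because the norm is the supremum of finite sums.\<close>
  have *: "\<exists>N. \<forall>n\<ge>N. \<forall>F. finite F --> (\<Sum>al\<in>F. \<bar>wcoeff (X n) al - L al\<bar>) <= e" if "e > 0" for e
  proof -
    obtain M where M: "!!m n. m \<ge> M ==> n \<ge> M ==> norm (X m - X n) < e"
      using metric_CauchyD[OF X \<open>e > 0\<close>] unfolding dist_norm by blast
    have "(\<Sum>al\<in>F. \<bar>wcoeff (X n) al - L al\<bar>) <= e" if "n \<ge> M" "finite F" for n F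
    proof (rule tendsto_upperbound)
      show "(%m. \<Sum>al\<in>F. \<bar>wcoeff (X n) al - wcoeff (X m) al\<bar>) \<longlonglongrightarrow> (\<Sum>al\<in>F. \<bar>wcoeff (X n) al - L al\<bar>)"
        by (intro tendsto_intros L)
      show "\<forall>\<^sub>F m in sequentially. (\<Sum>al\<in>F. \<bar>wcoeff (X n) al - wcoeff (X m) al\<bar>) <= e"
        using eventually_ge_at_top[of M]
      proof eventually_elim
        case (elim m)
        show ?case
          using sum_wcoeff_le_norm[OF \<open>finite F\<close>, of "X n - X m"] M[OF \<open>n \<ge> M\<close> elim] by simp
      qed
    qed simp
    then show ?thesis by blast
  qed
  obtain N where N: "!!n F. n \<ge> N ==> finite F ==> (\<Sum>al\<in>F. \<bar>wcoeff (X n) al - L al\<bar>) <= 1"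
    using *[of 1] by auto
  have "(%al. \<bar>L al\<bar>) summable_on UNIV"
  proof -
    have "(%al. \<bar>wcoeff (X N) al - L al\<bar>) summable_on UNIV"
      by (rule nonneg_bdd_above_summable_on) (use N in \<open>auto intro!: bdd_aboveI\<close>)
    then have "(%al. \<bar>wcoeff (X N) al\<bar> + \<bar>wcoeff (X N) al - L al\<bar>) summable_on UNIV"
      by (intro summable_on_add wcoeff_summable)
    then show ?thesis
      by (rule summable_on_comparison_test) auto
  qed
  then have Leq: "wcoeff (Wiener L) al = L al" for al
    by (simp add: Wiener_inverse)
  have "X \<longlonglongrightarrow> Wiener L"
  proof (rule metric_LIMSEQ_I)
    fix e :: real assume "e > 0"
    then obtain N where N: "!!n F. n \<ge> N ==> finite F ==> (\<Sum>al\<in>F. \<bar>wcoeff (X n) al - L al\<bar>) <= e / 2"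
      using *[of "e / 2"] by auto
    have "norm (X n - Wiener L) <= e / 2" if "n \<ge> N" for n
      by (rule norm_wiener_leI) (use N[OF that] Leq in simp)
    then show "\<exists>no. \<forall>n\<ge>no. dist (X n) (Wiener L) < e"
      using \<open>e > 0\<close> by (intro exI[of _ N]) (force simp: dist_norm)
  qed
  then show "convergent X"
    by (auto simp: convergent_def)
qed

definition ev :: "'n::finite wiener => real^'n => real" where
  "ev a u = mseries (wcoeff a) u"

lemma ev_has_sum: "u \<in> cube 1 ==> ((%al. mpow u al * wcoeff a al) has_sum ev a u) UNIV"
  using mseries_has_sum[of 1 "wcoeff a" u] by (simp add: ev_def)

lemma abs_ev_le: "u \<in> cube 1 ==> \<bar>ev a u\<bar> <= norm a"
  using norm_mseries_le[of 1 "wcoeff a" u] by (simp add: ev_def mnorm_wcoeff)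

lemma ev_at_0: "ev a 0 = wcoeff a (%_. 0)"
  by (simp add: ev_def mseries_0)

text \<open>An identity in the algebra may be checked pointwise on the cube. The ring laws below are
  inherited from the reals in this way instead of being computed with convolutions.\<close>

lemma ev_eqI:
  assumes "!!u. u \<in> cube 1 ==> ev a u = ev b u"
  shows "a = b"
proof -
  have "wcoeff a = wcoeff b"
  proof (rule mseries_coeff_unique[of 1 _ _ 1])
    fix t :: "real^'a" assume "t \<in> ball 0 1"
    then have "t \<in> cube 1"
      using ball_subset_open_cube open_cube_subset_cube by blast
    then show "mseries (wcoeff a) t = mseries (wcoeff b) t"
      using assms[of t] by (simp add: ev_def)
  qed auto
  then show ?thesis by (simp add: wiener_eq_iff)
qed

lemma bounded_linear_ev: "u \<in> cube 1 ==> bounded_linear (%a. ev a u)"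
proof (rule bounded_linear_intro[where K = 1])
  assume u: "u \<in> cube 1"
  fix a b :: "'a wiener" and r :: real
  show "ev (a + b) u = ev a u + ev b u"
    by (rule has_sum_unique[OF ev_has_sum[OF u]])
      (use has_sum_add[OF ev_has_sum[OF u] ev_has_sum[OF u], of a b] in \<open>simp add: algebra_simps\<close>)
  show "ev (r *. a) u = r *. ev a u"
    by (rule has_sum_unique[OF ev_has_sum[OF u]])
      (use has_sum_cmult_right[OF ev_has_sum[OF u], of r a] in \<open>simp add: algebra_simps\<close>)
qed (use abs_ev_le in auto)

lemma ev_add: "u \<in> cube 1 ==> ev (a + b) u = ev a u + ev b u"
  and ev_diff: "u \<in> cube 1 ==> ev (a - b) u = ev a u - ev b u"
  and ev_scaleR: "u \<in> cube 1 ==> ev (c *. a) u = c * ev a u"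
  and ev_sum: "u \<in> cube 1 ==> ev (sum f A) u = (\<Sum>x\<in>A. ev (f x) u)"
  and ev_zero: "u \<in> cube 1 ==> ev 0 u = 0"
  using linear_add[OF bounded_linear.linear[OF bounded_linear_ev], of u a b]
    linear_diff[OF bounded_linear.linear[OF bounded_linear_ev], of u a b]
    linear_scale[OF bounded_linear.linear[OF bounded_linear_ev], of u c a]
    linear_0[OF bounded_linear.linear[OF bounded_linear_ev], of u]
  by (auto simp: linear_sum[OF bounded_linear.linear[OF bounded_linear_ev]])

subsection \<open>Multiplication\<close>

definition msplit :: "('n::finite => nat) => (('n => nat) \<times> ('n => nat)) set" where
  "msplit \<gamma> = {(al, \<beta>). (%i. al i + \<beta> i) = \<gamma>}"

lemma finite_msplit [simp]: "finite (msplit \<gamma>)"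
proof -
  have "finite (PiE UNIV (%i. {..\<gamma> i}))"
    by (intro finite_PiE) auto
  moreover have "msplit \<gamma> \<subseteq> PiE UNIV (%i. {..\<gamma> i}) \<times> PiE UNIV (%i. {..\<gamma> i})"
    by (auto simp: msplit_def)
  ultimately show ?thesis
    by (meson finite_SigmaI finite_subset)
qed

text \<open>Regroups a double series by the sum of the two multi-indices, the step behind the Cauchy
  product.\<close>

lemma has_sum_msplit:
  fixes F :: "('n::finite => nat) \<times> ('n => nat) => real"
  assumes "(F has_sum S) UNIV"
  shows "((%\<gamma>. \<Sum>p\<in>msplit \<gamma>. F p) has_sum S) UNIV"
proof (rule has_sum_Sigma')
  have "bij_betw snd (SIGMA \<gamma>:UNIV. msplit \<gamma>) (UNIV :: (('n => nat) \<times> ('n => nat)) set)"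
    by (rule bij_betw_byWitness[where f' = "%p. (%i. fst p i + snd p i, p)"]) (auto simp: msplit_def)
  then show "((%q. F (snd q)) has_sum S) (SIGMA \<gamma>:UNIV. msplit \<gamma>)"
    using assms by (subst has_sum_reindex_bij_betw)
  show "((%p. F (snd (\<gamma>, p))) has_sum (\<Sum>p\<in>msplit \<gamma>. F p)) (msplit \<gamma>)" for \<gamma>
    by (intro has_sum_finiteI) auto
qed

lemma has_sum_pair_mult:
  fixes f :: "'a => real" and g :: "'b => real"
  assumes f: "(f has_sum s) UNIV" and g: "(g has_sum t) UNIV"
  shows "((%p. f (fst p) * g (snd p)) has_sum (s * t)) UNIV"
proof -
  have f': "(%x. \<bar>f x\<bar>) summable_on UNIV" and g': "(%x. \<bar>g x\<bar>) summable_on UNIV"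
    using summable_on_iff_abs_summable_on_real[of f UNIV] summable_on_iff_abs_summable_on_real[of g UNIV]
      f g has_sum_imp_summable by auto
  have "(%p. \<bar>f (fst p)\<bar> * \<bar>g (snd p)\<bar>) summable_on (UNIV \<times> UNIV)"
  proof (rule summable_on_SigmaI)
    show "((%y. \<bar>f (fst (x, y))\<bar> * \<bar>g (snd (x, y))\<bar>) has_sum \<bar>f x\<bar> * (\<Sum>\<^sub>\<infinity>y. \<bar>g y\<bar>)) UNIV" for x
      using g' by (auto intro!: has_sum_cmult_right)
    show "(%x. \<bar>f x\<bar> * (\<Sum>\<^sub>\<infinity>y. \<bar>g y\<bar>)) summable_on UNIV"
      using f' by (rule summable_on_cmult_left)
  qed auto
  then have "(%p. f (fst p) * g (snd p)) summable_on (UNIV \<times> UNIV)"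
    using summable_on_iff_abs_summable_on_real[of "%p. f (fst p) * g (snd p)" "UNIV \<times> UNIV"]
    by (simp add: abs_mult)
  then have "((%p. f (fst p) * g (snd p)) has_sum infsum (%p. f (fst p) * g (snd p)) (UNIV \<times> UNIV)) (UNIV \<times> UNIV)"
    by simp
  moreover from this have "((%x. f x * t) has_sum infsum (%p. f (fst p) * g (snd p)) (UNIV \<times> UNIV)) UNIV"
    by (rule has_sum_Sigma') (use g in \<open>auto intro!: has_sum_cmult_right\<close>)
  then have "infsum (%p. f (fst p) * g (snd p)) (UNIV \<times> UNIV) = s * t"
    using has_sum_cmult_left[OF f, of t] has_sum_unique by blast
  ultimately show ?thesis by simp
qed

definition mconvolve :: "(('n::finite => nat) => real) => (('n => nat) => real) => ('n => nat) => real" where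
  "mconvolve a b \<gamma> = (\<Sum>p\<in>msplit \<gamma>. a (fst p) * b (snd p))"

lemma mconvolve_bound:
  assumes "(%al. \<bar>a al\<bar>) summable_on UNIV" "(%al. \<bar>b al\<bar>) summable_on UNIV"
  shows "(%\<gamma>. \<bar>mconvolve a b \<gamma>\<bar>) summable_on UNIV"
    and "(\<Sum>\<^sub>\<infinity>\<gamma>. \<bar>mconvolve a b \<gamma>\<bar>) <= (\<Sum>\<^sub>\<infinity>al. \<bar>a al\<bar>) * (\<Sum>\<^sub>\<infinity>al. \<bar>b al\<bar>)"
proof -
  have hs: "((%\<gamma>. \<Sum>p\<in>msplit \<gamma>. \<bar>a (fst p)\<bar> * \<bar>b (snd p)\<bar>) has_sum
      ((\<Sum>\<^sub>\<infinity>al. \<bar>a al\<bar>) * (\<Sum>\<^sub>\<infinity>al. \<bar>b al\<bar>))) UNIV"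
    using has_sum_msplit[OF has_sum_pair_mult, of "%al. \<bar>a al\<bar>" _ "%al. \<bar>b al\<bar>"] assms by auto
  have le: "\<bar>mconvolve a b \<gamma>\<bar> <= (\<Sum>p\<in>msplit \<gamma>. \<bar>a (fst p)\<bar> * \<bar>b (snd p)\<bar>)" for \<gamma>
    unfolding mconvolve_def by (rule order_trans[OF sum_abs]) (simp add: abs_mult)
  show s: "(%\<gamma>. \<bar>mconvolve a b \<gamma>\<bar>) summable_on UNIV"
    by (rule summable_on_comparison_test[OF has_sum_imp_summable[OF hs]]) (use le in auto)
  show "(\<Sum>\<^sub>\<infinity>\<gamma>. \<bar>mconvolve a b \<gamma>\<bar>) <= (\<Sum>\<^sub>\<infinity>al. \<bar>a al\<bar>) * (\<Sum>\<^sub>\<infinity>al. \<bar>b al\<bar>)"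
    using has_sum_mono[OF has_sum_infsum[OF s] hs] le by auto
qed

instantiation wiener :: (finite) "{one, times}"
begin

lift_definition one_wiener :: "'a wiener" is "%al. if al = (%_. 0) then 1 else 0"
proof -
  have "finite {al::'a => nat. al = (%_. 0)}" by simp
  then show "(%al::'a => nat. \<bar>if al = (%_. 0) then 1 else 0 :: real\<bar>) summable_on UNIV"
    by (intro finite_nonzero_values_imp_summable_on) (simp add: if_distrib cong: if_cong)
qed

lift_definition times_wiener :: "'a wiener => 'a wiener => 'a wiener" is mconvolve
  by (rule mconvolve_bound)

instance ..

end

lemma ev_mult:
  assumes "u \<in> cube 1"
  shows "ev (a * b) u = ev a u * ev b u"
proof (rule has_sum_unique[OF ev_has_sum[OF assms]])
  have "((%\<gamma>. \<Sum>p\<in>msplit \<gamma>. (mpow u (fst p) * wcoeff a (fst p)) * (mpow u (snd p) * wcoeff b (snd p)))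
      has_sum (ev a u * ev b u)) UNIV"
    by (intro has_sum_msplit has_sum_pair_mult[of "%al. mpow u al * wcoeff a al" _ "%al. mpow u al * wcoeff b al"]
        ev_has_sum assms)
  moreover have "(\<Sum>p\<in>msplit \<gamma>. (mpow u (fst p) * wcoeff a (fst p)) * (mpow u (snd p) * wcoeff b (snd p)))
      = mpow u \<gamma> * wcoeff (a * b) \<gamma>" for \<gamma>
  proof -
    have "mpow u (fst p) * mpow u (snd p) = mpow u \<gamma>" if "p \<in> msplit \<gamma>" for p
      using that mpow_add[of u "fst p" "snd p"] by (auto simp: msplit_def)
    then show ?thesis
      unfolding times_wiener.rep_eq mconvolve_def sum_distrib_left
      by (intro sum.cong) (auto simp: mult_ac)
  qed
  ultimately show "((%\<gamma>. mpow u \<gamma> * wcoeff (a * b) \<gamma>) has_sum (ev a u * ev b u)) UNIV"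
    by simp
qed

lemma ev_one: "u \<in> cube 1 ==> ev 1 u = 1"
proof -
  assume u: "u \<in> cube 1"
  have "((%al. mpow u al * wcoeff 1 al) has_sum 1) UNIV"
    by (rule has_sum_finite_neutralI[of "{%_. 0}"]) (auto simp: one_wiener.rep_eq mpow_def)
  then show ?thesis
    using ev_has_sum[OF u] has_sum_unique by blast
qed

instance wiener :: (finite) "{real_normed_algebra_1, comm_ring_1}"
proof
  fix a b c :: "'a wiener" and r :: real
  show "a * b * c = a * (b * c)" "a * b = b * a" "1 * a = a" "a * 1 = a"
    "(a + b) * c = a * c + b * c" "a * (b + c) = a * b + a * c"
    "r *. a * b = r *. (a * b)" "a * r *. b = r *. (a * b)"
    by (rule ev_eqI; simp add: ev_mult ev_add ev_one ev_scaleR algebra_simps)+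
  show "(0::'a wiener) \<noteq> 1"
    by (simp add: wiener_eq_iff one_wiener.rep_eq exI[of _ "%_. 0"])
  show "norm (a * b) <= norm a * norm b"
    by transfer (rule mconvolve_bound)
  show "norm (1::'a wiener) = 1"
  proof -
    have "((%al. \<bar>wcoeff (1::'a wiener) al\<bar>) has_sum 1) UNIV"
      by (rule has_sum_finite_neutralI[of "{%_. 0}"]) (auto simp: one_wiener.rep_eq)
    then show ?thesis
      unfolding norm_wiener_eq by (rule infsumI)
  qed
qed

lemma ev_power: "u \<in> cube 1 ==> ev (a ^ k) u = ev a u ^ k"
  by (induction k) (simp_all add: ev_one ev_mult)

lemma ev_prod: "u \<in> cube 1 ==> ev (prod f A) u = (\<Prod>x\<in>A. ev (f x) u)"
  by (induction A rule: infinite_finite_induct) (simp_all add: ev_one ev_mult)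


subsection \<open>Rescaled series, variables and radial integration\<close>

definition wseries :: "real => (('n::finite => nat) => real) => 'n wiener" where
  "wseries r a = Wiener (%al. r ^ mabs al * a al)"

lemma
  assumes "mconv r a" "0 <= r"
  shows wcoeff_wseries: "wcoeff (wseries r a) al = r ^ mabs al * a al"
    and norm_wseries: "norm (wseries r a) = mnorm r a"
    and ev_wseries: "ev (wseries r a) u = mseries a (r *. u)"
proof -
  have *: "\<bar>r ^ mabs al * a al\<bar> = r ^ mabs al * norm (a al)" for al
    using assms(2) by (simp add: abs_mult)
  then have **: "wcoeff (wseries r a) = (%al. r ^ mabs al * a al)"
    using assms(1) unfolding wseries_def mconv_def by (intro Wiener_inverse) simp
  then show "wcoeff (wseries r a) al = r ^ mabs al * a al" by simp
  show "norm (wseries r a) = mnorm r a"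
    by (simp add: norm_wiener_eq mnorm_def ** *)
  show "ev (wseries r a) u = mseries a (r *. u)"
    by (simp add: ev_def mseries_def ** mpow_scaleR mult_ac)
qed

definition wvar :: "'n::finite => 'n wiener" where
  "wvar i = Wiener (%al. if al = (%_. 0)(i := 1) then 1 else 0)"

lemma wcoeff_wvar: "wcoeff (wvar i) = (%al. if al = (%_. 0)(i := 1) then 1 else 0)"
proof -
  have "(%al::'a => nat. \<bar>if al = (%_. 0)(i := 1) then 1 else 0 :: real\<bar>) summable_on UNIV"
    by (intro finite_nonzero_values_imp_summable_on) (simp add: if_distrib cong: if_cong)
  then show ?thesis
    unfolding wvar_def by (intro Wiener_inverse) simp
qed

lemma ev_wvar: "u \<in> cube 1 ==> ev (wvar i) u = u $ i"
proof -
  assume u: "u \<in> cube 1"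
  have "mpow u ((%_. 0)(i := 1)) = u $ i"
    unfolding mpow_def by (subst prod.remove[of _ i]) auto
  then have "((%al. mpow u al * wcoeff (wvar i) al) has_sum u $ i) UNIV"
    by (intro has_sum_finite_neutralI[of "{(%_. 0)(i := 1)}"]) (auto simp: wcoeff_wvar)
  then show ?thesis
    using ev_has_sum[OF u] has_sum_unique by blast
qed

lemma norm_wvar: "norm (wvar i) = 1"
  unfolding norm_wiener_eq
  by (intro infsumI has_sum_finite_neutralI[of "{(%_. 0)(i := 1)}"]) (auto simp: wcoeff_wvar)

lift_definition wint :: "'n::finite wiener => 'n wiener" is scoeff
proof -
  fix a :: "('n => nat) => real"
  assume "(%al. \<bar>a al\<bar>) summable_on UNIV"
  then show "(%al. \<bar>scoeff a al\<bar>) summable_on UNIV"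
    using mconv_scoeff[of 1 a] by (simp add: mconv_def)
qed

lemma linear_wint: "linear (wint :: 'n::finite wiener => 'n wiener)"
  by (rule linearI; simp add: wiener_eq_iff wint.rep_eq scoeff_def algebra_simps)

lemma norm_wint_le: "norm (wint a) <= norm a"
proof -
  have "\<bar>scoeff (wcoeff a) al\<bar> <= \<bar>wcoeff a al\<bar>" for al
    by (auto simp: scoeff_def abs_mult divide_simps mult_le_cancel_left1)
  then show ?thesis
    unfolding norm_wiener_eq using wcoeff_summable[of "wint a"] wcoeff_summable[of a]
    by (intro infsum_mono) (auto simp: wint.rep_eq)
qed

lemma wint_ray_derivative:
  assumes "u \<in> cube 1" "s \<in> {0..1}"
  shows "((%s. s * ev (wint a) (s *. u)) has_vector_derivative ev a (s *. u)) (at s within {0..1})"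
  using scoeff_ray_derivative[OF mconv_wcoeff _ assms, of a] by (simp add: ev_def wint.rep_eq)

text \<open>The radial integration of \<open>u $ i * a u\<close>: along a ray \<open>s \<mapsto> s u\<close> its derivative is
  \<open>u $ i * a (s u)\<close>.  It is the integral operator in all the fixed point equations below.\<close>

definition wrad :: "'n => 'n::finite wiener => 'n wiener" where
  "wrad i a = wvar i * wint a"

lemma linear_wrad: "linear (wrad i)"
  unfolding wrad_def by (rule linearI)
    (simp_all add: linear_add[OF linear_wint] linear_scale[OF linear_wint] algebra_simps)

lemma norm_wrad_le: "norm (wrad i a) <= norm a"
  using norm_mult_ineq[of "wvar i" "wint a"] norm_wint_le[of a] by (simp add: wrad_def norm_wvar)

lemma wrad_ray_derivative:
  assumes u: "u \<in> cube 1" and s: "s \<in> {0..1}"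
  shows "((%s. ev (wrad i a) (s *. u)) has_vector_derivative u $ i * ev a (s *. u)) (at s within {0..1})"
proof -
  have "((%s. u $ i * (s * ev (wint a) (s *. u))) has_vector_derivative u $ i * ev a (s *. u)) (at s within {0..1})"
    using bounded_linear.has_vector_derivative[OF bounded_linear_mult_right wint_ray_derivative[OF assms]] .
  moreover have "u $ i * (s * ev (wint a) (s *. u)) = ev (wrad i a) (s *. u)" if "s \<in> {0..1}" for s
    using scaleR_mem_cube[OF u, of s] that by (simp add: wrad_def ev_mult ev_wvar)
  ultimately show ?thesis
    using s by (rule_tac has_vector_derivative_transform[OF s]) auto
qed

lemma ev_wrad_0: "ev (wrad i a) 0 = 0"
  by (simp add: wrad_def ev_mult ev_wvar cube_def)

lemma cube_0 [simp]: "0 \<in> cube r \<longleftrightarrow> 0 <= r"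
  by (simp add: cube_def)

lemma ev_of_real: "u \<in> cube 1 ==> ev (of_real c) u = c"
  by (simp add: of_real_def ev_scaleR ev_one)

subsection \<open>Composition\<close>

text \<open>Substitution of the series \<open>w\<close> for the variables of \<open>v\<close>; the
  sum converges absolutely once all entries of \<open>w\<close> have norm at most one.\<close>

definition wcomp :: "'m::finite wiener => ('n::finite wiener)^'m => 'n wiener" where
  "wcomp v w = (\<Sum>\<^sub>\<infinity>al. wcoeff v al *. (\<Prod>i\<in>UNIV. (w $ i) ^ al i))"

lemma norm_prod_power_le:
  fixes w :: "('n::finite wiener)^'m::finite"
  assumes "!!i. norm (w $ i) <= 1"
  shows "norm (\<Prod>i\<in>UNIV. (w $ i) ^ al i) <= 1"
proof -
  have "norm (\<Prod>i\<in>UNIV. (w $ i) ^ al i) <= (\<Prod>i\<in>UNIV. norm ((w $ i) ^ al i))"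
    by (rule norm_prod_le)
  also have "\<dots> <= (\<Prod>i\<in>(UNIV::'m set). 1)"
    using assms by (intro prod_mono conjI norm_ge_zero order_trans[OF norm_power_ineq power_le_one]) auto
  finally show ?thesis by simp
qed

lemma wcomp_summable:
  fixes w :: "('n::finite wiener)^'m::finite"
  assumes "!!i. norm (w $ i) <= 1"
  shows "(%al. norm (wcoeff v al *. (\<Prod>i\<in>UNIV. (w $ i) ^ al i))) summable_on UNIV"
  by (rule summable_on_comparison_test[OF wcoeff_summable[of v]])
    (use norm_prod_power_le[OF assms] in \<open>auto intro!: mult_left_le\<close>)

lemma norm_wcomp_le:
  fixes w :: "('n::finite wiener)^'m::finite"
  assumes "!!i. norm (w $ i) <= 1"
  shows "norm (wcomp v w) <= norm v"
proof -
  have "norm (wcomp v w) <= (\<Sum>\<^sub>\<infinity>al. norm (wcoeff v al *. (\<Prod>i\<in>UNIV. (w $ i) ^ al i)))"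
    unfolding wcomp_def by (rule norm_infsum_bound[OF wcomp_summable[OF assms]])
  also have "\<dots> <= (\<Sum>\<^sub>\<infinity>al. \<bar>wcoeff v al\<bar>)"
    using norm_prod_power_le[OF assms]
    by (intro infsum_mono wcomp_summable[OF assms] wcoeff_summable) (auto intro!: mult_left_le)
  finally show ?thesis by (simp add: norm_wiener_eq)
qed

lemma ev_vec_in_cube:
  fixes w :: "('n::finite wiener)^'m::finite"
  assumes "!!i. norm (w $ i) <= r" "u \<in> cube 1"
  shows "(\<chi> i. ev (w $ i) u) \<in> cube r"
  using assms(1) abs_ev_le[OF assms(2)] by (auto simp: cube_def intro: order_trans)

lemma ev_wcomp:
  fixes w :: "('n::finite wiener)^'m::finite"
  assumes "!!i. norm (w $ i) <= 1" and u: "u \<in> cube 1"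
  shows "ev (wcomp v w) u = ev v (\<chi> i. ev (w $ i) u)"
proof -
  have "((%al. wcoeff v al *. (\<Prod>i\<in>UNIV. (w $ i) ^ al i)) has_sum wcomp v w) UNIV"
    unfolding wcomp_def by (rule has_sum_infsum[OF abs_summable_summable[OF wcomp_summable[OF assms(1)]]])
  from has_sum_bounded_linear[OF bounded_linear_ev[OF u] this]
  have "((%al. mpow (\<chi> i. ev (w $ i) u) al * wcoeff v al) has_sum ev (wcomp v w) u) UNIV"
    by (simp add: ev_scaleR u ev_prod ev_power mpow_def mult.commute)
  then show ?thesis
    using ev_has_sum[OF ev_vec_in_cube[OF assms]] has_sum_unique by blast
qed

text \<open>For entries of norm at most 1/2, a monomial of degree \<open>k\<close> has Lipschitz
  constant at most \<open>2 * k / 2 ^ k <= 1\<close>. With entries of norm one the degree would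
  remain as a factor, which need not be summable against \<open>v\<close>.\<close>

lemma wcomp_lipschitz:
  fixes w w' :: "('n::finite wiener)^'m::finite"
  assumes w: "!!i. norm (w $ i) <= 1 / 2" and w': "!!i. norm (w' $ i) <= 1 / 2"
  shows "norm (wcomp v w - wcomp v w') <= norm v * (\<Sum>.i. norm (w $ i - w' $ i))"
proof -
  let ?D = "\<Sum>.i. norm (w $ i - w' $ i)"
  let ?p = "%w al. \<Prod>i\<in>UNIV. (w $ i) ^ al i :: 'n wiener"
  have w1: "norm (w $ i) <= 1" "norm (w' $ i) <= 1" for i
    using w[of i] w'[of i] by auto
  have tm: "norm (?p w al - ?p w' al) <= ?D" for al :: "'m => nat"
  proof -
    \<comment> \<open>Doubling the entries brings them to norm at most one, where differences of
      products are controlled factor by factor; the powers of 1/2 are kept in front.\<close>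
    have scale: "?p z al = (1 / 2) ^ mabs al *. (\<Prod>i\<in>UNIV. (2 *. z $ i) ^ al i)" for z :: "('n wiener)^'m"
    proof -
      have "(\<Prod>i\<in>A. (2 *. z $ i) ^ al i) = 2 ^ sum al A *. (\<Prod>i\<in>A. (z $ i) ^ al i)" for A
        by (induction A rule: infinite_finite_induct) (simp_all add: scaleR_power power_add mult_ac)
      then show ?thesis
        by (simp add: mabs_def power_one_over)
    qed
    have "norm ((\<Prod>i\<in>UNIV. (2 *. w $ i) ^ al i) - (\<Prod>i\<in>UNIV. (2 *. w' $ i) ^ al i))
        <= (\<Sum>.i. norm ((2 *. w $ i) ^ al i - (2 *. w' $ i) ^ al i))"
      using w w' by (intro norm_prod_diff order_trans[OF norm_power_ineq power_le_one]) (auto simp: mult.commute)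
    also have "\<dots> <= (\<Sum>.i. real (mabs al) * (2 * norm (w $ i - w' $ i)))"
    proof (rule sum_mono)
      fix i
      have "norm ((2 *. w $ i) ^ al i - (2 *. w' $ i) ^ al i) <= real (al i) * norm (2 *. w $ i - 2 *. w' $ i)"
        using w[of i] w'[of i] by (intro norm_power_diff) auto
      also have "\<dots> = real (al i) * (2 * norm (w $ i - w' $ i))"
        by (simp flip: scaleR_diff_right)
      also have "\<dots> <= real (mabs al) * (2 * norm (w $ i - w' $ i))"
        using le_mabs[of al i] by (intro mult_right_mono) auto
      finally show "norm ((2 *. w $ i) ^ al i - (2 *. w' $ i) ^ al i) <= real (mabs al) * (2 * norm (w $ i - w' $ i))" .
    qed
    also have "\<dots> = 2 * real (mabs al) * ?D"
      by (simp add: sum_distrib_left mult_ac)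
    finally have "norm (?p w al - ?p w' al) <= (1 / 2) ^ mabs al * (2 * real (mabs al) * ?D)"
      unfolding scale by (simp flip: scaleR_diff_right add: mult_left_mono)
    also have "\<dots> = ((1 / 2) ^ mabs al * (2 * real (mabs al))) * ?D" by simp
    also have "\<dots> <= 1 * ?D"
    proof (intro mult_right_mono sum_nonneg)
      have "2 * real k <= 2 ^ k" for k
      proof (induction k)
        case (Suc k)
        then show ?case by (cases k) auto
      qed simp
      from this[of "mabs al"] show "(1 / 2) ^ mabs al * (2 * real (mabs al)) <= 1"
        by (simp add: power_one_over divide_simps)
    qed auto
    finally show ?thesis by simp
  qed
  have hs: "((%al. wcoeff v al *. ?p z al) has_sum wcomp v z) UNIV" if "!!i. norm (z $ i) <= 1" for z
    unfolding wcomp_def by (rule has_sum_infsum[OF abs_summable_summable[OF wcomp_summable[OF that]]])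
  have "((%al. wcoeff v al *. ?p w al + - (wcoeff v al *. ?p w' al)) has_sum (wcomp v w + - wcomp v w')) UNIV"
    by (intro has_sum_add) (use hs w1 in \<open>auto simp: has_sum_uminus\<close>)
  then have hs': "((%al. wcoeff v al *. (?p w al - ?p w' al)) has_sum (wcomp v w - wcomp v w')) UNIV"
    by (simp add: scaleR_diff_right)
  have le: "norm (wcoeff v al *. (?p w al - ?p w' al)) <= \<bar>wcoeff v al\<bar> * ?D" for al
    using tm by (simp add: mult_left_mono)
  have s1: "(%al. \<bar>wcoeff v al\<bar> * ?D) summable_on UNIV"
    by (rule summable_on_cmult_left[OF wcoeff_summable])
  have s2: "(%al. norm (wcoeff v al *. (?p w al - ?p w' al))) summable_on UNIV"
    by (rule summable_on_comparison_test[OF s1]) (use le in auto)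
  have "norm (wcomp v w - wcomp v w') <= (\<Sum>\<^sub>\<infinity>al. norm (wcoeff v al *. (?p w al - ?p w' al)))"
    using norm_infsum_bound[OF s2] infsumI[OF hs'] by simp
  also have "\<dots> <= (\<Sum>\<^sub>\<infinity>al. \<bar>wcoeff v al\<bar> * ?D)"
    by (rule infsum_mono[OF s2 s1]) (rule le)
  also have "\<dots> = norm v * ?D"
    unfolding norm_wiener_eq by (rule infsum_cmult_left) (use wcoeff_summable in auto)
  finally show ?thesis .
qed

definition wderiv :: "'n::finite => 'n wiener => 'n wiener" where
  "wderiv i a = wseries (1 / 2) (dcoeff i (wcoeff a))"

text \<open>The derivative lives on the cube of half the size: \<open>wderiv i a\<close> represents
  \<open>u \<mapsto> (\<partial>\<^sub>i a) (u / 2)\<close>.\<close>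

lemma ev_wderiv: "ev (wderiv i a) u = mseries (dcoeff i (wcoeff a)) ((1 / 2) *. u)"
  unfolding wderiv_def by (rule ev_wseries[OF mconv_dcoeff[OF mconv_wcoeff]]) auto

lemma norm_wderiv_le: "norm (wderiv i a) <= 2 * norm a"
proof -
  have "norm (wderiv i a) = mnorm (1 / 2) (dcoeff i (wcoeff a))"
    unfolding wderiv_def by (rule norm_wseries[OF mconv_dcoeff[OF mconv_wcoeff]]) auto
  then show ?thesis
    using mnorm_dcoeff_le[OF mconv_wcoeff, of "1/2" i a] by (simp add: mnorm_wcoeff)
qed

lemma ev_has_derivative:
  assumes "u \<in> cube (1 / 2)"
  shows "(ev a has_derivative (%h. \<Sum>.i. h $ i * ev (wderiv i a) (2 *. u))) (at u)"
proof -
  have "u \<in> open_cube 1"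
    using assms cube_subset_open_cube[of "1/2" 1] by auto
  from mseries_has_derivative[OF mconv_wcoeff this, of a] show ?thesis
    unfolding ev_wderiv by (simp add: ev_def[abs_def])
qed

section \<open>Fixed points and linear differential equations for finite families\<close>

text \<open>Banach's theorem on a closed product of balls. Each of the \<open>CARD('k)\<close>
  components differs by at most \<open>L\<close> times a sum of \<open>CARD('k)\<close> norms, hence
  the square in the contraction constant.\<close>

lemma family_fixpoint:
  fixes F :: "('k::finite => 'a::banach) => 'k => 'a"
  assumes R: "0 <= R" and L: "0 <= L" "L * (real CARD('k))\<^sup>2 < 1"
    and maps: "!!v i. (!!i. norm (v i - v0 i) <= R) ==> norm (F v i - v0 i) <= R"
    and lip: "!!v v' i. (!!i. norm (v i - v0 i) <= R) ==> (!!i. norm (v' i - v0 i) <= R) ==>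
       norm (F v i - F v' i) <= L * (\<Sum>.j. norm (v j - v' j))"
  obtains v where "!!i. norm (v i - v0 i) <= R" "F v = v"
proof -
  define S where "S = {v :: 'a^'k. \<forall>i. norm (v $ i - v0 i) <= R}"
  define \<Phi> where "\<Phi> v = (\<chi> i. F (%i. v $ i) i)" for v :: "'a^'k"
  have "S = (\<Inter>i. {v :: 'a^'k. norm (v $ i - v0 i) <= R})"
    by (auto simp: S_def)
  moreover have "closed {v :: 'a^'k. norm (v $ i - v0 i) <= R}" for i
    by (intro closed_Collect_le continuous_intros)
  ultimately have "closed S" by (simp add: closed_INT)
  then have "complete S"
    using complete_eq_closed by blast
  moreover have "(\<chi> i. v0 i) \<in> S" using R by (simp add: S_def)
  then have "S \<noteq> {}" by blast
  moreover have "\<Phi> ` S \<subseteq> S"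
    using maps by (auto simp: S_def \<Phi>_def)
  moreover have "dist (\<Phi> v) (\<Phi> v') <= (L * (real CARD('k))\<^sup>2) * dist v v'" if "v \<in> S" "v' \<in> S" for v v'
  proof -
    have "norm (\<Phi> v - \<Phi> v') <= (\<Sum>.i. norm ((\<Phi> v - \<Phi> v') $ i))"
      unfolding norm_vec_def by (rule L2_set_le_sum) auto
    also have "\<dots> <= (\<Sum>i\<in>(UNIV::'k set). L * (\<Sum>j\<in>(UNIV::'k set). norm (v - v')))"
    proof (rule sum_mono)
      fix i :: 'k
      have "norm ((\<Phi> v - \<Phi> v') $ i) <= L * (\<Sum>.j. norm (v $ j - v' $ j))"
        using lip[of "%i. v $ i" "%i. v' $ i" i] that by (simp add: \<Phi>_def S_def)
      also have "\<dots> <= L * (\<Sum>j\<in>(UNIV::'k set). norm (v - v'))"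
        using L Finite_Cartesian_Product.norm_nth_le[of "v - v'"]
        by (intro mult_left_mono sum_mono) auto
      finally show "norm ((\<Phi> v - \<Phi> v') $ i) <= L * (\<Sum>j\<in>(UNIV::'k set). norm (v - v'))" .
    qed
    finally show ?thesis
      by (simp add: dist_norm power2_eq_square mult_ac)
  qed
  ultimately obtain v where v: "v \<in> S" "\<Phi> v = v"
    using Banach_fix[of S "L * (real CARD('k))\<^sup>2" \<Phi>] L by auto
  have "F (%i. v $ i) i = v $ i" for i
    using v(2) by (metis \<Phi>_def vec_lambda_beta)
  then show ?thesis
    using that[of "%i. v $ i"] v(1) by (auto simp: S_def)
qed

lemma matrix_fixpoint:
  fixes F :: "('p::finite => 'k::finite => 'a::banach) => 'p => 'k => 'a"
  assumes R: "0 <= R" and L: "0 <= L" "L * (real CARD('p) * real CARD('k))\<^sup>2 < 1"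
    and maps: "!!v i j. (!!i j. norm (v i j - v0 i j) <= R) ==> norm (F v i j - v0 i j) <= R"
    and lip: "!!v v' i j. (!!i j. norm (v i j - v0 i j) <= R) ==> (!!i j. norm (v' i j - v0 i j) <= R) ==>
       norm (F v i j - F v' i j) <= L * (\<Sum>.p. \<Sum>.q. norm (v p q - v' p q))"
  obtains v where "!!i j. norm (v i j - v0 i j) <= R" "F v = v"
proof -
  have "(real CARD('p) * real CARD('k)) = real CARD('p \<times> 'k)"
    by simp
  then have L': "L * (real CARD('p \<times> 'k))\<^sup>2 < 1"
    using L(2) by simp
  have s: "(\<Sum>j\<in>(UNIV::('p \<times> 'k) set). f j) = (\<Sum>.p. \<Sum>.q. f (p, q))" for f :: "'p \<times> 'k => real"
    by (simp add: sum.cartesian_product)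
  obtain v where v: "!!i. norm (v i - (%(p, q). v0 p q) i) <= R"
    "(%v (p, q). F (%p q. v (p, q)) p q) v = v"
  proof (rule family_fixpoint[OF R L(1) L', of "%(p, q). v0 p q" "%v (p, q). F (%p q. v (p, q)) p q"])
    fix v :: "'p \<times> 'k => 'a" and i
    assume "!!i. norm (v i - (case i of (p, q) => v0 p q)) <= R"
    from this[of "(p, q)" for p q]
    show "norm ((case i of (p, q) => F (%p q. v (p, q)) p q) - (case i of (p, q) => v0 p q)) <= R"
      using maps[of "%p q. v (p, q)"] by (auto split: prod.split)
  next
    fix v v' :: "'p \<times> 'k => 'a" and i
    assume 1: "!!i. norm (v i - (case i of (p, q) => v0 p q)) <= R"
      and 2: "!!i. norm (v' i - (case i of (p, q) => v0 p q)) <= R"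
    from 1[of "(p, q)" for p q] 2[of "(p, q)" for p q]
    show "norm ((case i of (p, q) => F (%p q. v (p, q)) p q) - (case i of (p, q) => F (%p q. v' (p, q)) p q))
        <= L * (\<Sum>.j. norm (v j - v' j))"
      using lip[of "%p q. v (p, q)" "%p q. v' (p, q)"] unfolding s by (auto split: prod.split)
  qed blast
  show ?thesis
  proof (rule that[of "%p q. v (p, q)"])
    show "norm (v (i, j) - v0 i j) <= R" for i j
      using v(1)[of "(i, j)"] by simp
    show "F (%p q. v (p, q)) = (%p q. v (p, q))"
      using fun_cong[OF v(2)] by (auto simp: fun_eq_iff)
  qed
qed

text \<open>Gronwall: the sum of squares \<phi> has derivative at most \<open>c * \<phi>\<close>, so
  \<open>exp (- c * s) * \<phi> s\<close> does not increase from its value 0. The geometric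
  identities for the constructed series are obtained by applying this to their defects.\<close>

lemma linear_ode_family_zero:
  fixes E :: "'k::finite => real => 'e::real_inner"
  assumes der: "!!k s. s \<in> {0..1} ==> (E k has_vector_derivative E' k s) (at s within {0..1})"
    and bound: "!!k s. s \<in> {0..1} ==> norm (E' k s) <= L * (\<Sum>.j. norm (E j s))"
    and zero: "!!k. E k 0 = 0" and s: "s \<in> {0..1}"
  shows "E k s = 0"
proof (cases "s = 0")
  case False
  define \<phi> where "\<phi> s = (\<Sum>.k. E k s \<bullet> E k s)" for s
  \<comment> \<open>The cardinality comes from Cauchy-Schwarz, which bounds the square of the sum of
    norms by \<open>CARD('k)\<close> times the sum of squares.\<close>
  define c where "c = 2 * \<bar>L\<bar> * real CARD('k)"
  define \<psi> where "\<psi> s = exp (- c * s) * \<phi> s" for s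
  have d\<phi>: "(\<phi> has_real_derivative (\<Sum>.k. 2 * (E k s \<bullet> E' k s))) (at s within {0..1})" if "s \<in> {0..1}" for s
  proof -
    have "((%s. E k s \<bullet> E k s) has_vector_derivative (E k s \<bullet> E' k s + E' k s \<bullet> E k s)) (at s within {0..1})" for k
      by (rule bounded_bilinear.has_vector_derivative[OF bounded_bilinear_inner der[OF that] der[OF that]])
    then have "((%s. E k s \<bullet> E k s) has_real_derivative 2 * (E k s \<bullet> E' k s)) (at s within {0..1})" for k
      by (simp add: has_real_derivative_iff_has_vector_derivative inner_commute)
    then show ?thesis
      unfolding \<phi>_def by (intro derivative_intros)
  qed
  have d\<psi>: "(\<psi> has_real_derivative exp (- c * s) * (\<Sum>.k. 2 * (E k s \<bullet> E' k s)) + (exp (- c * s) * (- c)) * \<phi> s)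
      (at s within {0..1})" if "s \<in> {0..1}" for s
    unfolding \<psi>_def by (rule derivative_eq_intros d\<phi>[OF that] refl | simp)+
  have neg: "(\<Sum>.k. 2 * (E k s \<bullet> E' k s)) <= c * \<phi> s" if "s \<in> {0..1}" for s
  proof -
    let ?n = "%k. norm (E k s)"
    have "(\<Sum>.k. 2 * (E k s \<bullet> E' k s)) <= (\<Sum>.k. 2 * (?n k * (\<bar>L\<bar> * (\<Sum>.j. ?n j))))"
    proof (rule sum_mono)
      fix k
      have "E k s \<bullet> E' k s <= ?n k * norm (E' k s)"
        by (rule norm_cauchy_schwarz)
      also have "\<dots> <= ?n k * (\<bar>L\<bar> * (\<Sum>.j. ?n j))"
      proof (intro mult_left_mono order_trans[OF bound[OF that]] mult_right_mono)
      qed (auto intro: sum_nonneg)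
      finally show "2 * (E k s \<bullet> E' k s) <= 2 * (?n k * (\<bar>L\<bar> * (\<Sum>.j. ?n j)))" by simp
    qed
    also have "\<dots> = 2 * \<bar>L\<bar> * (\<Sum>.j. ?n j)\<^sup>2"
      by (simp add: power2_eq_square sum_distrib_left sum_distrib_right mult_ac)
    also have "\<dots> <= 2 * \<bar>L\<bar> * (real CARD('k) * (\<Sum>.j. (?n j)\<^sup>2))"
      using sum_squared_le_sum_of_squares[of ?n UNIV] by (intro mult_left_mono) (auto simp: mult.commute)
    also have "\<dots> = c * \<phi> s"
      by (simp add: c_def \<phi>_def power2_norm_eq_inner)
    finally show ?thesis .
  qed
  have "\<psi> s <= \<psi> 0"
  proof (rule DERIV_nonpos_imp_decreasing_open[of 0 s \<psi>])
    show "0 <= s" using s by simp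
    show "continuous_on {0..s} \<psi>"
    proof (rule continuous_on_subset)
      show "continuous_on {0..1} \<psi>"
        using d\<psi> has_field_derivative_imp_has_derivative by (intro has_derivative_continuous_on) blast
    qed (use s in auto)
    fix t assume t: "0 < t" "t < s"
    then have "at t within {0..1} = at t"
      using s by (intro at_within_Icc_at) auto
    moreover have "exp (- c * t) * (\<Sum>.k. 2 * (E k t \<bullet> E' k t)) + (exp (- c * t) * (- c)) * \<phi> t <= 0"
      using neg[of t] t s by (simp flip: right_diff_distrib add: mult_le_0_iff algebra_simps)
    ultimately show "\<exists>y. (\<psi> has_real_derivative y) (at t) \<and> y <= 0"
      using d\<psi>[of t] t s by auto
  qed
  then have "\<phi> s <= 0"
    by (simp add: \<psi>_def \<phi>_def zero mult_le_0_iff)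
  moreover have "E k s \<bullet> E k s <= \<phi> s"
    unfolding \<phi>_def by (rule member_le_sum) auto
  ultimately show ?thesis
    by (metis inner_gt_zero_iff leD order_trans)
qed (simp add: zero)

section \<open>Componentwise derivatives\<close>

lemma vec_lambda_eq_sum: "(\<chi> a. g a) = (\<Sum>.a. g a *. axis a (1::real))"
  using basis_expansion[of "\<chi> a. g a"] by (simp add: scalar_mult_eq_scaleR)

lemma has_derivative_vec:
  fixes g :: "'n::finite => 'a::real_normed_vector => real"
  assumes "!!a. (g a has_derivative g' a) F"
  shows "((%s. \<chi> a. g a s) has_derivative (%h. \<chi> a. g' a h)) F"
  unfolding vec_lambda_eq_sum by (intro has_derivative_sum has_derivative_scaleR_left assms)

lemma has_vector_derivative_vec:
  fixes g :: "'n::finite => real => real"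
  assumes "!!a. (g a has_vector_derivative g' a) F"
  shows "((%s. \<chi> a. g a s) has_vector_derivative (\<chi> a. g' a)) F"
proof -
  have "((%s. \<chi> a. g a s) has_derivative (%h. \<chi> a. h *. g' a)) F"
    using assms unfolding has_vector_derivative_def by (rule has_derivative_vec)
  moreover have "(%h. \<chi> a. h *. g' a) = (%h. h *. (\<chi> a. g' a))"
    by (simp add: fun_eq_iff vec_eq_iff)
  ultimately show ?thesis by (simp add: has_vector_derivative_def)
qed

subsection \<open>Determinants over the Wiener algebra\<close>

lemma ev_det:
  fixes M :: "('n::finite wiener)^'m^'m::finite"
  assumes u: "u \<in> cube 1"
  shows "ev (det M) u = det (\<chi> i j. ev (M $ i $ j) u)"
proof -
  have "ev (of_int (sign p)) u = of_int (sign p)" for p :: "'m => 'm"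
    using ev_of_real[OF u, of "of_int (sign p)"] by simp
  then show ?thesis
    unfolding det_def by (simp add: ev_sum ev_mult ev_prod u)
qed

lemma norm_det_wiener_le:
  fixes M :: "('n::finite wiener)^'m^'m::finite"
  assumes "!!i j. norm (M $ i $ j) <= c"
  shows "norm (det M) <= fact CARD('m) * c ^ CARD('m)"
proof -
  have c: "0 <= c" using assms norm_ge_zero order_trans by blast
  have "norm (det M) <= (\<Sum>p | p permutes (UNIV::'m set). c ^ CARD('m))"
    unfolding det_def
  proof (rule sum_norm_le)
    fix p :: "'m => 'm"
    have "norm (\<Prod>i\<in>UNIV. M $ i $ p i) <= (\<Prod>i\<in>UNIV. norm (M $ i $ p i))"
      by (rule norm_prod_le)
    also have "\<dots> <= (\<Prod>i\<in>(UNIV::'m set). c)"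
      using assms by (intro prod_mono) auto
    finally have "norm (\<Prod>i\<in>UNIV. M $ i $ p i) <= c ^ CARD('m)" by simp
    moreover have "norm (of_int (sign p) * (\<Prod>i\<in>UNIV. M $ i $ p i)) = norm (\<Prod>i\<in>UNIV. M $ i $ p i)"
      by (auto simp: sign_def)
    ultimately show "norm (of_int (sign p) * (\<Prod>i\<in>UNIV. M $ i $ p i)) <= c ^ CARD('m)" by simp
  qed
  then show ?thesis
    by (simp add: card_permutations)
qed

lemma abs_det_real_le:
  fixes M :: "real^'m^'m::finite"
  assumes "!!i j. \<bar>M $ i $ j\<bar> <= c"
  shows "\<bar>det M\<bar> <= fact CARD('m) * c ^ CARD('m)"
proof -
  have c: "0 <= c" using assms abs_ge_zero order_trans by blast
  have "norm (det M) <= (\<Sum>p | p permutes (UNIV::'m set). c ^ CARD('m))"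
    unfolding det_def
  proof (rule sum_norm_le)
    fix p :: "'m => 'm"
    have "\<bar>\<Prod>i\<in>UNIV. M $ i $ p i\<bar> <= (\<Prod>i\<in>(UNIV::'m set). c)"
      unfolding abs_prod using assms by (intro prod_mono) auto
    then show "norm (of_int (sign p) * (\<Prod>i\<in>UNIV. M $ i $ p i)) <= c ^ CARD('m)"
      by (auto simp: sign_def)
  qed
  then show ?thesis
    by (simp add: card_permutations)
qed

lemma det_near_identity:
  obtains e where "0 < e" "!!M :: real^'n^'n::finite. (!!i j. \<bar>M $ i $ j - mat 1 $ i $ j\<bar> <= e) ==>
    1 / 2 <= det M \<and> det M <= 2"
proof -
  have "continuous (at (mat 1)) (det :: real^'n^'n => real)"
    unfolding det_def[abs_def] by (intro continuous_intros)
  then obtain d where d: "d > 0" "!!M :: real^'n^'n. dist M (mat 1) < d ==> dist (det M) (det (mat 1 :: real^'n^'n)) < 1 / 2"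
    unfolding continuous_at_eps_delta by (metis half_gt_zero zero_less_one)
  define e where "e = d / (2 * (real CARD('n))\<^sup>2)"
  have n: "real CARD('n) > 0" by simp
  have "1 / 2 <= det M \<and> det M <= 2" if M: "!!i j. \<bar>M $ i $ j - mat 1 $ i $ j\<bar> <= e" for M :: "real^'n^'n"
  proof -
    have "norm ((M - mat 1) $ i) <= real CARD('n) * e" for i
      using norm_le_l1_cart[of "(M - mat 1) $ i"] sum_mono[of UNIV "%j. \<bar>(M - mat 1) $ i $ j\<bar>" "%_. e"] M
      by simp
    then have "(\<Sum>.i. norm ((M - mat 1) $ i)) <= (\<Sum>i\<in>(UNIV::'n set). real CARD('n) * e)"
      by (intro sum_mono)
    moreover have "norm (M - mat 1) <= (\<Sum>.i. norm ((M - mat 1) $ i))"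
      unfolding norm_vec_def by (rule L2_set_le_sum) auto
    ultimately have "norm (M - mat 1) <= (real CARD('n))\<^sup>2 * e"
      by (simp add: power2_eq_square)
    also have "\<dots> < d"
      using d n by (simp add: e_def)
    finally show ?thesis
      using d(2)[of M] by (auto simp: dist_norm abs_if split: if_splits)
  qed
  moreover have "e > 0" using d n by (simp add: e_def)
  ultimately show ?thesis using that by blast
qed

text \<open>Multiplication by a variable raises the degree by one, so the denominator
  \<open>Suc (mabs _)\<close> in \<open>wint\<close> becomes the degree of the product. At degree 0
  both sides vanish, since no split of 0 contains the unit index.\<close>

lemma wcoeff_wvar_mult_wint:
  "wcoeff (wvar m * wint a) al = wcoeff (wvar m * a) al / real (mabs al)"
proof -
  have "wcoeff (wvar m) (fst p) * wcoeff (wint a) (snd p) =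
      wcoeff (wvar m) (fst p) * wcoeff a (snd p) / real (mabs al)" if "p \<in> msplit al" for p
  proof (cases "fst p = (%_. 0)(m := 1)")
    case True
    have "mabs ((%_. 0)(m := 1::nat)) = 1"
      using mabs_upd[of "%_. 0" m 1] by (simp add: mabs_def)
    moreover have "mabs al = mabs (fst p) + mabs (snd p)"
      using that mabs_add[of "fst p" "snd p"] by (auto simp: msplit_def)
    ultimately have "mabs al = Suc (mabs (snd p))"
      using True by simp
    then show ?thesis
      by (simp add: wint.rep_eq scoeff_def divide_inverse)
  qed (simp add: wcoeff_wvar)
  then show ?thesis
    unfolding times_wiener.rep_eq mconvolve_def sum_divide_distrib by (intro sum.cong) auto
qed

text \<open>Radial integration commutes with \<open>\<partial>\<^sub>i\<close> up to the degree shift, which is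
  absorbed by passing to \<open>s \<mapsto> s \<partial>\<^sub>i f(s u)\<close>.\<close>

lemma wrad_partial_ray_derivative:
  assumes u: "u \<in> cube (1 / 2)" and s: "s \<in> {0..1}"
  shows "((%s. s * ev (wderiv i (wrad m a)) (2 *. s *. u)) has_vector_derivative
    ev (wderiv i (wvar m * a)) (2 *. s *. u)) (at s within {0..1})"
proof -
  let ?d = "dcoeff i (wcoeff (wvar m * a))"
  have "dcoeff i (wcoeff (wrad m a)) = scoeff ?d"
    unfolding fun_eq_iff wrad_def dcoeff_def scoeff_def wcoeff_wvar_mult_wint divide_inverse mabs_Suc
    by (simp add: mult_ac del: of_nat_Suc)
  moreover have "mconv (1 / 2) ?d"
    by (rule mconv_dcoeff[OF mconv_wcoeff]) auto
  from scoeff_ray_derivative[OF this _ u s]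
  have "((%s. s *. mseries (scoeff ?d) (s *. u)) has_vector_derivative mseries ?d (s *. u)) (at s within {0..1})"
    by simp
  ultimately show ?thesis
    by (simp add: ev_wderiv)
qed

lemma ev_wderiv_wvar_mult:
  assumes u: "u \<in> cube (1 / 2)"
  shows "ev (wderiv i (wvar m * a)) (2 *. u) = (if i = m then ev a u else 0) + u $ m * ev (wderiv i a) (2 *. u)"
proof -
  have o: "u \<in> open_cube 1"
    using u cube_subset_open_cube[of "1/2" 1] by auto
  have "((%u. u $ m * ev a u) has_derivative
      (%h. u $ m * (\<Sum>.i. h $ i * ev (wderiv i a) (2 *. u)) + h $ m * ev a u)) (at u)"
    by (rule has_derivative_mult bounded_linear_imp_has_derivative bounded_linear_vec_nth ev_has_derivative u)+
  then have "(ev (wvar m * a) has_derivative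
      (%h. u $ m * (\<Sum>.i. h $ i * ev (wderiv i a) (2 *. u)) + h $ m * ev a u)) (at u)"
    by (rule has_derivative_transform_within_open[OF _ open_open_cube o])
      (use open_cube_subset_cube[of 1] in \<open>auto simp: ev_mult ev_wvar subset_iff\<close>)
  from has_derivative_unique[OF this ev_has_derivative[OF u]]
  have "u $ m * (\<Sum>.k. axis i 1 $ k * ev (wderiv k a) (2 *. u)) + axis i 1 $ m * ev a u
    = (\<Sum>.k. axis i 1 $ k * ev (wderiv k (wvar m * a)) (2 *. u))"
    by (rule fun_cong)
  moreover have "(\<Sum>.k. axis i 1 $ k * f k) = f i" for f :: "'a => real"
    by (subst sum.remove[of _ i]) (auto simp: axis_def intro!: sum.neutral)
  ultimately show ?thesis
    by (auto simp: axis_def)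
qed

section \<open>Exponential coordinates adapted to a maximal frame\<close>

lemma norm_mult_le: "norm a <= c ==> norm b <= d ==> norm (a * b :: 'a::real_normed_algebra) <= c * d"
  by (meson mult_mono norm_ge_zero norm_mult_ineq order_trans)

text \<open>Solves X = I + N X for a small additive \<open>N\<close>. Within distance
  \<open>R <= 1\<close> of the identity all entries have norm at most 2, which is where
  \<open>2 * \<kappa> <= R\<close> comes from.\<close>

lemma near_identity_fixpoint:
  fixes N :: "('n::finite => 'n => 'a::{real_normed_algebra_1, banach}) => 'n => 'n => 'a"
  assumes diff: "!!X X' i j. N X i j - N X' i j = N (%i j. X i j - X' i j) i j"
    and bound: "!!X c i j. (!!i j. norm (X i j) <= c) ==> norm (N X i j) <= \<kappa> * c"
    and \<kappa>: "0 <= \<kappa>" "2 * \<kappa> <= R" "R <= 1" "\<kappa> * (real CARD('n) * real CARD('n))\<^sup>2 < 1"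
  obtains X where "!!i j. norm (X i j - (if i = j then 1 else 0)) <= R"
    "!!i j. X i j = (if i = j then 1 else 0) + N X i j"
proof -
  let ?\<delta> = "%i j::'n. if i = j then 1 else 0 :: 'a"
  obtain X where X: "!!i j. norm (X i j - ?\<delta> i j) <= R" "(%X i j. ?\<delta> i j + N X i j) X = X"
  proof (rule matrix_fixpoint[of R \<kappa> ?\<delta> "%X i j. ?\<delta> i j + N X i j"])
    fix X :: "'n => 'n => 'a" and i j
    assume X: "!!i j. norm (X i j - ?\<delta> i j) <= R"
    have "norm (X i j) <= 2" for i j
      using X[of i j] norm_triangle_ineq[of "X i j - ?\<delta> i j" "?\<delta> i j"] \<kappa>(3) by (auto split: if_splits)
    from bound[of X 2, OF this, of i j] \<kappa>(2) show "norm (?\<delta> i j + N X i j - ?\<delta> i j) <= R"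
      by simp
  next
    fix X X' :: "'n => 'n => 'a" and i j
    have "norm (X i j - X' i j) <= (\<Sum>.p. \<Sum>.q. norm (X p q - X' p q))" for i j :: 'n
    proof -
      have "norm (X i j - X' i j) <= (\<Sum>.q. norm (X i q - X' i q))"
        by (rule member_le_sum) auto
      also have "\<dots> <= (\<Sum>.p. \<Sum>.q. norm (X p q - X' p q))"
        by (rule member_le_sum) (auto intro: sum_nonneg)
      finally show ?thesis .
    qed
    from bound[of "%i j. X i j - X' i j", OF this, of i j]
    show "norm (?\<delta> i j + N X i j - (?\<delta> i j + N X' i j)) <= \<kappa> * (\<Sum>.p. \<Sum>.q. norm (X p q - X' p q))"
      using diff by simp
  qed (use \<kappa> in auto)
  show ?thesis
    using that[of X] X(1) fun_cong[OF fun_cong[OF X(2)]] by metis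
qed

locale scaled_frame =
  fixes \<Omega> :: "(real^'n::finite) set" and x :: "real^'n" and \<rho> T \<epsilon> \<eta> :: real
    and Z :: "'q::finite => real^'n => real^'n" and k :: "'n => 'q"
    and zc :: "'q => 'n => 'n wiener" and cc :: "'q => 'q => 'q => 'n wiener"
  assumes rho: "0 < \<rho>" "\<rho> <= 1" "inverse \<rho> <= T"
    and card_n: "real CARD('n) <= T" and card_q: "real CARD('q) <= T"
    and norm_zc: "!!l a. norm (zc l a) <= T" and norm_cc: "!!p l m. norm (cc p l m) <= T"
    and cube_subset: "!!z. z \<in> cube 1 ==> x + \<rho> *. z \<in> \<Omega>"
    and Z_rep: "!!z l a. z \<in> cube 1 ==> Z l (x + \<rho> *. z) $ a = ev (zc l a) z"
    and bracket: "!!z p l. z \<in> cube (1 / 2) ==> lie_bracket (Z p) (Z l) (x + \<rho> *. z) =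
      (\<Sum>.m. ev (cc p l m) z *. Z m (x + \<rho> *. z))"
    and frame_det: "det (mat_of_cols (%i. Z (k i) x)) \<noteq> 0"
    and frame_max: "!!k'. \<bar>det (mat_of_cols (%i. Z (k' i) x))\<bar> <= \<bar>det (mat_of_cols (%i. Z (k i) x))\<bar>"
    and eps: "0 < \<epsilon>" "100 * T ^ 5 * \<epsilon> <= 1"
    and eps_det: "!!M :: real^'n^'n. (!!i j. \<bar>M $ i $ j - mat 1 $ i $ j\<bar> <= 2 * T * \<epsilon>) ==> 1 / 2 <= det M \<and> det M <= 2"
    and eta: "0 < \<eta>" "100 * T ^ 10 * \<eta> <= \<epsilon>"
begin

lemma T_ge_1: "1 <= T"
proof -
  have "1 <= real CARD('n)" by (simp add: Suc_le_eq)
  then show ?thesis using card_n by linarith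
qed

lemma eta_bound:
  assumes "c <= 100" "m <= 10"
  shows "c * T ^ m * \<eta> <= \<epsilon>"
proof -
  have "c * T ^ m * \<eta> <= 100 * T ^ 10 * \<eta>"
    using assms T_ge_1 eta(1) by (intro mult_right_mono mult_mono power_increasing) auto
  then show ?thesis using eta(2) by linarith
qed

lemma eps_bound:
  assumes "c <= 100" "m <= 5"
  shows "c * T ^ m * \<epsilon> <= 1"
proof -
  have "c * T ^ m * \<epsilon> <= 100 * T ^ 5 * \<epsilon>"
    using assms T_ge_1 eps(1) by (intro mult_right_mono mult_mono power_increasing) auto
  then show ?thesis using eps(2) by linarith
qed

lemma eps_le: "\<epsilon> <= 1 / 100"
  using eps_bound[of 100 0] by simp

lemma norm_sum_n_le:
  fixes f :: "'n => 'e::real_normed_vector"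
  assumes "!!i. norm (f i) <= c"
  shows "norm (\<Sum>.i. f i) <= T * c"
proof -
  have c: "0 <= c" using assms norm_ge_zero order_trans by blast
  have "norm (\<Sum>.i. f i) <= (\<Sum>i\<in>(UNIV::'n set). c)"
    by (intro sum_norm_le assms)
  also have "\<dots> <= T * c"
    using card_n c by (simp add: mult_right_mono)
  finally show ?thesis .
qed

lemma norm_sum_q_le:
  fixes f :: "'q => 'e::real_normed_vector"
  assumes "!!i. norm (f i) <= c"
  shows "norm (\<Sum>.i. f i) <= T * c"
proof -
  have c: "0 <= c" using assms norm_ge_zero order_trans by blast
  have "norm (\<Sum>.i. f i) <= (\<Sum>i\<in>(UNIV::'q set). c)"
    by (intro sum_norm_le assms)
  also have "\<dots> <= T * c"
    using card_q c by (simp add: mult_right_mono)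
  finally show ?thesis .
qed

lemma norm_wrad_sum_le:
  fixes f :: "'n => 'n wiener"
  assumes "!!m. norm (f m) <= c"
  shows "norm (\<Sum>.m. wrad m (f m)) <= T * c"
  by (rule norm_sum_n_le) (rule order_trans[OF norm_wrad_le assms])

lemma wrad_sum_diff:
  "(\<Sum>.m. wrad m (f m)) - (\<Sum>.m. wrad m (g m)) = (\<Sum>.m. wrad m (f m - g m))"
  by (simp add: linear_diff[OF linear_wrad] sum_subtractf)

subsection \<open>The exponential map\<close>

text \<open>The flow equation in radially integrated form: x + \<rho> w is the point reached, the
  factor \<eta> rescales the coordinates t = \<eta> u to the unit cube, and on the ray through
  \<open>u\<close> each \<open>wrad i\<close> integrates \<open>u $ i\<close> times its
  argument.\<close>

definition w_eqn :: "('n => 'n wiener) => 'n => 'n wiener" where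
  "w_eqn v a = (\<eta> / \<rho>) *. (\<Sum>.i. wrad i (wcomp (zc (k i) a) (\<chi> a. v a)))"

lemma w_exists: "\<exists>v. (\<forall>a. norm (v a) <= 1 / 4) \<and> w_eqn v = v"
proof -
  have er: "0 <= \<eta> / \<rho>" "\<eta> / \<rho> <= T * \<eta>"
    using rho eta by (auto simp: divide_inverse intro: mult_right_mono)
  have T: "0 < T" using T_ge_1 by linarith
  \<comment> \<open>The bound 1/4 keeps the curve inside the half cube, where the fields can be
    differentiated, and within the range of \<open>wcomp_lipschitz\<close>.\<close>
  obtain v where v: "!!a. norm (v a - 0) <= 1 / 4" "w_eqn v = v"
  proof (rule family_fixpoint[of "1/4" "T ^ 3 * \<eta>" "%_. 0" w_eqn])
    show "T ^ 3 * \<eta> * (real CARD('n))\<^sup>2 < 1"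
    proof -
      have "T ^ 3 * \<eta> * (real CARD('n))\<^sup>2 <= T ^ 3 * \<eta> * T\<^sup>2"
        using T eta card_n by (intro mult_left_mono power_mono) auto
      also have "\<dots> = 1 * T ^ 5 * \<eta>" by (simp add: power_numeral_reduce)
      also have "\<dots> <= \<epsilon>" by (rule eta_bound) auto
      finally show ?thesis using eps_le by simp
    qed
    fix v :: "'n => 'n wiener" and i
    assume v: "!!i. norm (v i - 0) <= 1 / 4"
    have *: "norm ((\<chi> a. v a) $ i) <= 1" for i
      using v[of i] by simp
    have n: "norm (wcomp (zc (k m) i) (\<chi> a. v a)) <= T" for m
      by (rule order_trans[OF norm_wcomp_le[OF *] norm_zc])
    have "norm (w_eqn v i) <= \<eta> / \<rho> * (T * T)"
      unfolding w_eqn_def norm_scaleR abs_of_nonneg[OF er(1)]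
      by (rule mult_left_mono[OF norm_wrad_sum_le[OF n] er(1)])
    also have "\<dots> <= T * \<eta> * (T * T)"
      using er T by (intro mult_right_mono) auto
    also have "\<dots> = 1 * T ^ 3 * \<eta>" by (simp add: power_numeral_reduce)
    also have "\<dots> <= \<epsilon>" by (rule eta_bound) auto
    finally show "norm (w_eqn v i - 0) <= 1 / 4" using eps_le by simp
  next
    fix v v' :: "'n => 'n wiener" and i
    assume v: "!!i. norm (v i - 0) <= 1 / 4" "!!i. norm (v' i - 0) <= 1 / 4"
    have *: "norm ((\<chi> a. v a) $ i) <= 1 / 2" "norm ((\<chi> a. v' a) $ i) <= 1 / 2" for i
      using v(1)[of i] v(2)[of i] by simp_all
    let ?D = "\<Sum>.j. norm (v j - v' j)"
    have n: "norm (wcomp (zc (k m) i) (\<chi> a. v a) - wcomp (zc (k m) i) (\<chi> a. v' a)) <= T * ?D" for m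
    proof -
      have "norm (zc (k m) i) * ?D <= T * ?D"
        by (intro mult_right_mono norm_zc sum_nonneg) auto
      then show ?thesis
        using wcomp_lipschitz[OF *, of "zc (k m) i"] by simp
    qed
    have "norm (w_eqn v i - w_eqn v' i) <= \<eta> / \<rho> * (T * (T * ?D))"
      unfolding w_eqn_def scaleR_diff_right[symmetric] wrad_sum_diff norm_scaleR abs_of_nonneg[OF er(1)]
      by (rule mult_left_mono[OF norm_wrad_sum_le[OF n] er(1)])
    also have "\<dots> <= T * \<eta> * (T * (T * ?D))"
      using er T by (intro mult_right_mono mult_nonneg_nonneg sum_nonneg) auto
    finally show "norm (w_eqn v i - w_eqn v' i) <= T ^ 3 * \<eta> * ?D"
      by (simp add: power_numeral_reduce mult_ac)
  qed (use eta T in auto)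
  then show ?thesis by auto
qed

definition w :: "'n => 'n wiener" where
  "w = (SOME v. (\<forall>a. norm (v a) <= 1 / 4) \<and> w_eqn v = v)"

lemma norm_w: "norm (w a) <= 1 / 4" and w_fix: "w_eqn w = w"
  using someI_ex[OF w_exists] by (auto simp: w_def)

definition wv :: "('n wiener)^'n" where "wv = (\<chi> a. w a)"

lemma norm_wv: "norm (wv $ a) <= 1 / 4" "norm (wv $ a) <= 1 / 2" "norm (wv $ a) <= 1"
  using norm_w[of a] by (auto simp: wv_def)

definition zz :: "real^'n => real^'n" where "zz u = (\<chi> a. ev (w a) u)"

definition pt :: "real^'n => real^'n" where "pt u = x + \<rho> *. zz u"

lemma zz_in: "u \<in> cube 1 ==> zz u \<in> cube (1 / 4)"
  using order_trans[OF abs_ev_le norm_w] by (auto simp: zz_def cube_def)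

lemma zz_in': "u \<in> cube 1 ==> zz u \<in> cube (1 / 2)" "u \<in> cube 1 ==> zz u \<in> cube 1"
  using zz_in[of u] cube_mono[of "1/4" "1/2"] cube_mono[of "1/4" 1] by auto

lemma pt_in: "u \<in> cube 1 ==> pt u \<in> \<Omega>"
  unfolding pt_def by (intro cube_subset zz_in')

lemma ev_wcomp_wv: "u \<in> cube 1 ==> ev (wcomp v wv) u = ev v (zz u)"
  using ev_wcomp[of wv u v] norm_wv by (simp add: zz_def wv_def)

lemma Z_pt: "u \<in> cube 1 ==> Z l (pt u) $ a = ev (wcomp (zc l a) wv) u"
  using Z_rep[OF zz_in'(2)] by (simp add: pt_def ev_wcomp_wv)

lemma w_eq: "w a = (\<eta> / \<rho>) *. (\<Sum>.i. wrad i (wcomp (zc (k i) a) wv))"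
  using fun_cong[OF w_fix, of a] by (simp add: w_eqn_def wv_def)

lemma ev_w_0: "ev (w a) 0 = 0"
  unfolding w_eq by (simp add: ev_scaleR ev_sum ev_wrad_0)

lemma pt_0: "pt 0 = x"
  by (simp add: pt_def zz_def ev_w_0 vec_eq_iff)

definition field :: "real^'n => real^'n => real^'n" where
  "field u y = (\<Sum>.i. u $ i *. Z (k i) y)"

lemma pt_ray_derivative:
  assumes u: "u \<in> cube 1" and s: "s \<in> {0..1}"
  shows "((%s. pt (s *. u)) has_vector_derivative \<eta> *. field u (pt (s *. u))) (at s within {0..1})"
proof -
  have su: "s *. u \<in> cube 1" if "s \<in> {0..1}" for s
    using scaleR_mem_cube[OF u] that by auto
  have d: "((%s. (\<eta> / \<rho>) * (\<Sum>.i. ev (wrad i (wcomp (zc (k i) a) wv)) (s *. u))) has_vector_derivative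
      (\<eta> / \<rho>) * (\<Sum>.i. u $ i * ev (wcomp (zc (k i) a) wv) (s *. u))) (at s within {0..1})" for a
    by (intro has_vector_derivative_mult_right has_vector_derivative_sum wrad_ray_derivative u s)
  have "((%s. ev (w a) (s *. u)) has_vector_derivative
      (\<eta> / \<rho>) * (\<Sum>.i. u $ i * Z (k i) (pt (s *. u)) $ a)) (at s within {0..1})" for a
    unfolding Z_pt[OF su[OF s]]
    by (rule has_vector_derivative_transform[OF s _ d]) (simp add: w_eq ev_scaleR ev_sum su)
  then have "((%s. zz (s *. u)) has_vector_derivative
      (\<chi> a. (\<eta> / \<rho>) * (\<Sum>.i. u $ i * Z (k i) (pt (s *. u)) $ a))) (at s within {0..1})"
    unfolding zz_def by (rule has_vector_derivative_vec)
  from has_vector_derivative_add[OF has_vector_derivative_const[of x]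
      bounded_linear.has_vector_derivative[OF bounded_linear_scaleR_right[of \<rho>] this]]
  have "((%s. pt (s *. u)) has_vector_derivative
      \<rho> *. (\<chi> a. (\<eta> / \<rho>) * (\<Sum>.i. u $ i * Z (k i) (pt (s *. u)) $ a))) (at s within {0..1})"
    by (simp add: pt_def)
  moreover have "\<rho> *. (\<chi> a. (\<eta> / \<rho>) * (\<Sum>.i. u $ i * Z (k i) (pt (s *. u)) $ a)) =
      \<eta> *. field u (pt (s *. u))"
    using rho by (simp add: vec_eq_iff field_def)
  ultimately show ?thesis by simp
qed

definition dZ :: "'q => real^'n => real^'n => real^'n" where
  "dZ l z h = (\<chi> a. inverse \<rho> * (\<Sum>.c. h $ c * ev (wderiv c (zc l a)) (2 *. z)))"

lemma Z_has_derivative: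
  assumes z: "z \<in> cube (1 / 2)"
  shows "(Z l has_derivative dZ l z) (at (x + \<rho> *. z))"
proof -
  let ?g = "%y. inverse \<rho> *. (y - x)"
  have g: "?g (x + \<rho> *. z) = z" using rho by simp
  have dg: "(?g has_derivative (%h. inverse \<rho> *. h)) (at (x + \<rho> *. z))"
    by (auto intro!: derivative_eq_intros)
  have "(ev (zc l a) has_derivative (%h. \<Sum>.i. h $ i * ev (wderiv i (zc l a)) (2 *. z))) (at (?g (x + \<rho> *. z)))" for a
    unfolding g by (rule ev_has_derivative[OF z])
  from has_derivative_compose[OF dg this]
  have "((%y. ev (zc l a) (?g y)) has_derivative
      (%h. inverse \<rho> * (\<Sum>.i. h $ i * ev (wderiv i (zc l a)) (2 *. z)))) (at (x + \<rho> *. z))" for a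
    by (simp add: sum_distrib_left mult.assoc)
  then have d: "((%y. \<chi> a. ev (zc l a) (?g y)) has_derivative dZ l z) (at (x + \<rho> *. z))"
    unfolding dZ_def[abs_def] by (rule has_derivative_vec)
  let ?S = "?g -` open_cube 1"
  have "open ?S"
    by (intro open_vimage continuous_intros open_open_cube)
  moreover have "x + \<rho> *. z \<in> ?S"
    using g z cube_subset_open_cube[of "1/2" 1] by auto
  moreover have "(\<chi> a. ev (zc l a) (?g y)) = Z l y" if "y \<in> ?S" for y
  proof -
    have "?g y \<in> cube 1" using that open_cube_subset_cube[of 1] by auto
    from Z_rep[OF this] show ?thesis
      using rho by (simp add: vec_eq_iff)
  qed
  ultimately show ?thesis
    using has_derivative_transform_within_open[OF d] by blast
qed

text \<open>The four factors \<open>T\<close> come from the sum over components, from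
  \<open>inverse \<rho>\<close>, from the sum over directions and from the norm of the series; the 2
  is the loss in \<open>wderiv\<close>.\<close>

lemma norm_dZ_le:
  assumes z: "z \<in> cube (1 / 2)"
  shows "norm (dZ l z h) <= 2 * T ^ 4 * norm h"
proof -
  have z2: "2 *. z \<in> cube 1" using z by (auto simp: cube_def abs_mult mult.commute)
  have "norm (dZ l z h) <= (\<Sum>.a. \<bar>dZ l z h $ a\<bar>)"
    by (rule norm_le_l1_cart)
  also have "\<dots> <= T * (T * (T * (norm h * (2 * T))))"
  proof -
    have "norm (h $ c * ev (wderiv c (zc l a)) (2 *. z)) <= norm h * (2 * T)" for c a
    proof (rule norm_mult_le)
      show "norm (h $ c) <= norm h" by (simp add: component_le_norm_cart)
      show "norm (ev (wderiv c (zc l a)) (2 *. z)) <= 2 * T"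
        using abs_ev_le[OF z2, of "wderiv c (zc l a)"] norm_wderiv_le[of c "zc l a"] norm_zc[of l a] by simp
    qed
    then have "\<bar>\<Sum>.c. h $ c * ev (wderiv c (zc l a)) (2 *. z)\<bar> <= T * (norm h * (2 * T))" for a
      using norm_sum_n_le[of "%c. h $ c * ev (wderiv c (zc l a)) (2 *. z)"] by simp
    then have "norm (dZ l z h $ a) <= T * (T * (norm h * (2 * T)))" for a
      unfolding dZ_def using rho T_ge_1 by (auto simp: abs_mult intro!: mult_mono)
    then show ?thesis
      using norm_sum_n_le[of "%a. \<bar>dZ l z h $ a\<bar>"] by (simp add: sum_nonneg)
  qed
  finally show ?thesis by (simp add: power_numeral_reduce mult_ac)
qed

definition dZp :: "'q => real^'n => real^'n => real^'n" where "dZp l u = dZ l (zz u)"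

lemma Z_pt_has_derivative: "u \<in> cube 1 ==> (Z l has_derivative dZp l u) (at (pt u))"
  unfolding pt_def dZp_def by (rule Z_has_derivative) (rule zz_in')

lemma norm_dZp_le: "u \<in> cube 1 ==> norm (dZp l u h) <= 2 * T ^ 4 * norm h"
  unfolding dZp_def by (rule norm_dZ_le) (rule zz_in')

lemma linear_dZp: "u \<in> cube 1 ==> linear (dZp l u)"
  using Z_pt_has_derivative has_derivative_linear by blast

definition cw :: "'q => 'q => 'q => 'n wiener" where "cw p l m = wcomp (cc p l m) wv"

lemma norm_cw: "norm (cw p l m) <= T"
  unfolding cw_def by (rule order_trans[OF norm_wcomp_le norm_cc]) (rule norm_wv)

lemma abs_ev_cw: "u \<in> cube 1 ==> \<bar>ev (cw p l m) u\<bar> <= T"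
  using abs_ev_le norm_cw order_trans by blast

text \<open>Exchanges the derivative of Z_l in direction Z_p for that of Z_p in direction Z_l, up to
  bounded multiples of the fields. This closes the differential equations below: after the exchange,
  the only derivatives left are the linear maps \<open>dZp (k m)\<close>, which act on whole
  defects.\<close>

lemma bracket_pt:
  assumes "u \<in> cube 1"
  shows "dZp l u (Z p (pt u)) = (\<Sum>.m. ev (cw p l m) u *. Z m (pt u)) + dZp p u (Z l (pt u))"
proof -
  have "frechet_derivative (Z l) (at (pt u)) = dZp l u" for l
    using frechet_derivative_at[OF Z_pt_has_derivative[OF assms]] by simp
  then have "lie_bracket (Z p) (Z l) (pt u) = dZp l u (Z p (pt u)) - dZp p u (Z l (pt u))"
    by (simp add: lie_bracket_def)
  moreover have "lie_bracket (Z p) (Z l) (pt u) = (\<Sum>.m. ev (cw p l m) u *. Z m (pt u))"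
    using bracket[OF zz_in'(1)[OF assms]] ev_wcomp_wv[OF assms] by (simp add: pt_def cw_def)
  ultimately show ?thesis by simp
qed

lemma Z_ray_derivative:
  assumes u: "u \<in> cube 1" and s: "s \<in> {0..1}"
  shows "((%s. Z l (pt (s *. u))) has_vector_derivative
    \<eta> *. (\<Sum>.m. u $ m *. dZp l (s *. u) (Z (k m) (pt (s *. u))))) (at s within {0..1})"
proof -
  have su: "s *. u \<in> cube 1"
    using scaleR_mem_cube[OF u] s by auto
  have "((%s. Z l (pt (s *. u))) has_vector_derivative dZp l (s *. u) (\<eta> *. field u (pt (s *. u)))) (at s within {0..1})"
    using vector_derivative_diff_chain_within[OF pt_ray_derivative[OF u s]
        has_derivative_at_withinI[OF Z_pt_has_derivative[OF su]]] by (simp add: comp_def)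
  then show ?thesis
    by (simp add: field_def linear_scale[OF linear_dZp[OF su]] linear_sum[OF linear_dZp[OF su]])
qed

end

context scaled_frame
begin

subsection \<open>The coefficients of all fields in the frame\<close>

definition V0 :: "real^'n^'n" where "V0 = (\<chi> i a. Z (k i) x $ a)"

lemma V0_eq: "V0 = transpose (mat_of_cols (%i. Z (k i) x))"
  by (simp add: V0_def mat_of_cols_def transpose_def)

lemma det_V0: "det V0 = det (mat_of_cols (%i. Z (k i) x))"
  by (simp add: V0_eq)

lemma frame_coeffs_exist: "\<exists>b0. (\<forall>l j. \<bar>b0 l j\<bar> <= (1::real)) \<and> (\<forall>l. Z l x = (\<Sum>.j. b0 l j *. Z (k j) x))"
proof -
  define A where "A = mat_of_cols (%i. Z (k i) x)"
  have dA: "det A \<noteq> 0" using frame_det by (simp add: A_def)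
  have "\<exists>c. (\<forall>j. \<bar>c j\<bar> <= (1::real)) \<and> Z l x = (\<Sum>.j. c j *. Z (k j) x)" for l
  proof -
    define v where "v = (\<chi> m. det (\<chi> i j. if j = m then Z l x $ i else A $ i $ j) / det A)"
    have "A *v v = Z l x"
      using cramer[OF dA, of v "Z l x"] by (simp add: v_def)
    moreover have "A *v v = (\<Sum>.j. v $ j *. Z (k j) x)"
      by (simp add: vec_eq_iff matrix_vector_mult_def A_def mat_of_cols_def mult.commute)
    moreover have "\<bar>v $ m\<bar> <= 1" for m
    proof -
      \<comment> \<open>Replacing column \<open>m\<close> by Z_l gives another tuple of fields, so
        maximality compares the numerator of Cramer's formula with its denominator.\<close>
      have "(\<chi> i j. if j = m then Z l x $ i else A $ i $ j) = mat_of_cols (%i. Z ((k(m := l)) i) x)"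
        by (simp add: vec_eq_iff mat_of_cols_def A_def)
      then have "\<bar>det (\<chi> i j. if j = m then Z l x $ i else A $ i $ j)\<bar> <= \<bar>det A\<bar>"
        using frame_max by (simp add: A_def)
      then show ?thesis
        using dA by (simp add: v_def divide_le_eq)
    qed
    ultimately have "(\<forall>j. \<bar>v $ j\<bar> <= 1) \<and> Z l x = (\<Sum>.j. v $ j *. Z (k j) x)" by simp
    then show ?thesis by (rule exI[of _ "%j. v $ j"])
  qed
  then have "\<forall>l. \<exists>c. (\<forall>j. \<bar>c j\<bar> <= (1::real)) \<and> Z l x = (\<Sum>.j. c j *. Z (k j) x)" ..
  from choice[OF this] show ?thesis by blast
qed

definition b0 :: "'q => 'n => real" where
  "b0 = (SOME b0. (\<forall>l j. \<bar>b0 l j\<bar> <= 1) \<and> (\<forall>l. Z l x = (\<Sum>.j. b0 l j *. Z (k j) x)))"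

lemma abs_b0: "\<bar>b0 l j\<bar> <= 1" and b0_rep: "Z l x = (\<Sum>.j. b0 l j *. Z (k j) x)"
  using someI_ex[OF frame_coeffs_exist] unfolding b0_def[symmetric] by blast+

text \<open>Right-hand side of a Riccati equation for the coefficients of Z_l in the frame V.
  Differentiating the expansion in direction V_m leaves the coefficients of [V_m, Z_l] minus those
  of the brackets [V_m, V_i] weighted by \<open>b l i\<close>; the derivatives of V_m itself
  cancel.\<close>

definition b_term :: "('q => 'n => 'n wiener) => 'q => 'n => 'n => 'n wiener" where
  "b_term b l j m = (\<Sum>.p. cw (k m) l p * b p j) -
     (\<Sum>.i. b l i * (\<Sum>.p. cw (k m) (k i) p * b p j))"

definition b_eqn :: "('q => 'n => 'n wiener) => 'q => 'n => 'n wiener" where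
  "b_eqn b l j = of_real (b0 l j) + \<eta> *. (\<Sum>.m. wrad m (b_term b l j m))"

lemma b_exists: "\<exists>b. (\<forall>l j. norm (b l j) <= 2) \<and> b_eqn b = b"
proof -
  have T: "1 <= T" "0 < T" "0 <= \<eta>" using T_ge_1 eta by auto
  have cb: "norm (\<Sum>.p. cw i l p * y p) <= T * (T * c)" if "!!p. norm (y p) <= c" for i l y c
    by (intro norm_sum_q_le norm_mult_le norm_cw that)
  \<comment> \<open>Radius 1 about initial values of size at most 1; hence the bound 2 on the
    solution.\<close>
  obtain b where b: "!!l j. norm (b l j - of_real (b0 l j)) <= 1" "b_eqn b = b"
  proof (rule matrix_fixpoint[of 1 "5 * T ^ 4 * \<eta>" "%l j. of_real (b0 l j)" b_eqn])
    have "5 * T ^ 4 * \<eta> * (real CARD('q) * real CARD('n))\<^sup>2 <= 5 * T ^ 4 * \<eta> * (T * T)\<^sup>2"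
      using T card_n card_q by (intro mult_left_mono power_mono mult_mono) auto
    also have "\<dots> = 5 * T ^ 8 * \<eta>" by (simp add: power2_eq_square power_numeral_reduce)
    also have "\<dots> <= \<epsilon>" by (rule eta_bound) auto
    finally show "5 * T ^ 4 * \<eta> * (real CARD('q) * real CARD('n))\<^sup>2 < 1" using eps_le by simp
  next
    fix b :: "'q => 'n => 'n wiener" and l j
    assume *: "!!l j. norm (b l j - of_real (b0 l j)) <= 1"
    have b2: "norm (b l j) <= 2" for l j
      using *[of l j] abs_b0[of l j] norm_triangle_ineq[of "b l j - of_real (b0 l j)" "of_real (b0 l j)"] by simp
    have "norm (b_term b l j m) <= T * (T * 2) + T * (2 * (T * (T * 2)))" for m
      unfolding b_term_def
      by (intro order_trans[OF norm_triangle_ineq4] add_mono cb norm_sum_n_le norm_mult_le b2)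
    then have "norm (\<Sum>.m. wrad m (b_term b l j m)) <= T * (T * (T * 2) + T * (2 * (T * (T * 2))))"
      by (rule norm_wrad_sum_le)
    then have "\<eta> * norm (\<Sum>.m. wrad m (b_term b l j m)) <= \<eta> * (T * (T * (T * 2) + T * (2 * (T * (T * 2)))))"
      using T by (intro mult_left_mono) auto
    also have "\<dots> = 2 * T ^ 3 * \<eta> + 4 * T ^ 4 * \<eta>" by (simp add: power_numeral_reduce algebra_simps)
    also have "\<dots> <= \<epsilon> + \<epsilon>" by (intro add_mono eta_bound) auto
    finally show "norm (b_eqn b l j - of_real (b0 l j)) <= 1"
      using T eps_le by (simp add: b_eqn_def)
  next
    fix b b' :: "'q => 'n => 'n wiener" and l j
    assume *: "!!l j. norm (b l j - of_real (b0 l j)) <= 1" "!!l j. norm (b' l j - of_real (b0 l j)) <= 1"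
    have b2: "norm (b l j) <= 2" "norm (b' l j) <= 2" for l j
      using *(1)[of l j] *(2)[of l j] abs_b0[of l j] norm_triangle_ineq[of "b l j - of_real (b0 l j)" "of_real (b0 l j)"]
        norm_triangle_ineq[of "b' l j - of_real (b0 l j)" "of_real (b0 l j)"] by simp_all
    define D where "D = (\<Sum>.p. \<Sum>.q. norm (b p q - b' p q))"
    have D: "norm (b p q - b' p q) <= D" for p q
    proof -
      have "norm (b p q - b' p q) <= (\<Sum>.q. norm (b p q - b' p q))"
        by (rule member_le_sum) auto
      also have "\<dots> <= D"
        unfolding D_def by (rule member_le_sum) (auto intro: sum_nonneg)
      finally show ?thesis .
    qed
    have D0: "0 <= D" using D norm_ge_zero order_trans by blast
    have "norm (b_term b l j m - b_term b' l j m) <= 5 * T ^ 3 * D" for m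
    proof -
      let ?S = "%b i. \<Sum>.p. cw (k m) (k i) p * b p j"
      have eq: "b_term b l j m - b_term b' l j m = (\<Sum>.p. cw (k m) l p * (b p j - b' p j)) -
          (\<Sum>.i. (b l i - b' l i) * ?S b i + b' l i * (\<Sum>.p. cw (k m) (k i) p * (b p j - b' p j)))"
        unfolding b_term_def right_diff_distrib sum_subtractf by (simp add: algebra_simps sum.distrib sum_subtractf)
      have "norm (b_term b l j m - b_term b' l j m) <= T * (T * D) + T * (D * (T * (T * 2)) + 2 * (T * (T * D)))"
        unfolding eq
        by (intro order_trans[OF norm_triangle_ineq4] order_trans[OF norm_triangle_ineq] add_mono cb norm_sum_n_le norm_mult_le b2 D)
      also have "\<dots> = 1 * T\<^sup>2 * D + 4 * T ^ 3 * D" by (simp add: power_numeral_reduce algebra_simps)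
      also have "\<dots> <= 1 * T ^ 3 * D + 4 * T ^ 3 * D"
        using T D0 by (intro add_mono mult_right_mono mult_left_mono power_increasing) auto
      finally show ?thesis by (simp add: mult_ac)
    qed
    then have "norm (\<Sum>.m. wrad m (b_term b l j m - b_term b' l j m)) <= T * (5 * T ^ 3 * D)"
      by (rule norm_wrad_sum_le)
    then have "\<eta> * norm (\<Sum>.m. wrad m (b_term b l j m - b_term b' l j m)) <= \<eta> * (T * (5 * T ^ 3 * D))"
      using T by (intro mult_left_mono) auto
    then show "norm (b_eqn b l j - b_eqn b' l j) <= 5 * T ^ 4 * \<eta> * (\<Sum>.p. \<Sum>.q. norm (b p q - b' p q))"
      using T unfolding D_def[symmetric]
      by (simp add: b_eqn_def wrad_sum_diff power_numeral_reduce mult_ac flip: scaleR_diff_right)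
  qed (use T in auto)
  have "norm (b l j) <= 2" for l j
    using b(1)[of l j] abs_b0[of l j] norm_triangle_ineq[of "b l j - of_real (b0 l j)" "of_real (b0 l j)"] by simp
  then show ?thesis using b(2) by blast
qed

definition b :: "'q => 'n => 'n wiener" where
  "b = (SOME b. (\<forall>l j. norm (b l j) <= 2) \<and> b_eqn b = b)"

lemma norm_b: "norm (b l j) <= 2" and b_fix: "b_eqn b = b"
  using someI_ex[OF b_exists] unfolding b_def[symmetric] by blast+

lemma b_eq: "b l j = of_real (b0 l j) + \<eta> *. (\<Sum>.m. wrad m (b_term b l j m))"
  using fun_cong[OF fun_cong[OF b_fix], of l j] unfolding b_eqn_def[of b l j] by (rule sym)

lemma abs_ev_b: "u \<in> cube 1 ==> \<bar>ev (b l j) u\<bar> <= 2"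
  using abs_ev_le norm_b order_trans by blast

lemma radial_eqn_derivative:
  assumes u: "u \<in> cube 1" and s: "s \<in> {0..1}"
    and a: "a = of_real c + \<eta> *. (\<Sum>.m. wrad m (F m))"
  shows "((%s. ev a (s *. u)) has_vector_derivative \<eta> * (\<Sum>.m. u $ m * ev (F m) (s *. u))) (at s within {0..1})"
    and "ev a 0 = c"
proof -
  have su: "s *. u \<in> cube 1" if "s \<in> {0..1}" for s
    using scaleR_mem_cube[OF u] that by auto
  have "((%s. c + \<eta> * (\<Sum>.m. ev (wrad m (F m)) (s *. u))) has_vector_derivative
      0 + \<eta> * (\<Sum>.m. u $ m * ev (F m) (s *. u))) (at s within {0..1})"
    by (intro has_vector_derivative_add has_vector_derivative_const has_vector_derivative_mult_right
        has_vector_derivative_sum wrad_ray_derivative u s)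
  then show "((%s. ev a (s *. u)) has_vector_derivative \<eta> * (\<Sum>.m. u $ m * ev (F m) (s *. u))) (at s within {0..1})"
    by (intro has_vector_derivative_transform[OF s, of "%s. ev a (s *. u)"])
      (auto simp: a ev_add ev_of_real ev_scaleR ev_sum su)
  show "ev a 0 = c"
    by (simp add: a ev_add ev_of_real ev_scaleR ev_sum ev_wrad_0)
qed

text \<open>\<open>b\<close> was built from its equation alone. The defect of the expansion vanishes
  at the centre by the choice of \<open>b0\<close>, and by \<open>bracket_pt\<close> its derivative
  along the ray is linear in the defects of all the fields, so it vanishes throughout.\<close>

lemma Z_frame:
  assumes u: "u \<in> cube 1"
  shows "Z l (pt u) = (\<Sum>.j. ev (b l j) u *. Z (k j) (pt u))"
proof -
  define E where "E l s = Z l (pt (s *. u)) - (\<Sum>.j. ev (b l j) (s *. u) *. Z (k j) (pt (s *. u)))" for l s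
  \<comment> \<open>What survives of the derivative of the defect: bracket terms and the linear map
    of V_m, each applied to defects only.\<close>
  define G where "G l m s = (\<Sum>.p. ev (cw (k m) l p) (s *. u) *. E p s) + dZp (k m) (s *. u) (E l s)
      - (\<Sum>.i. ev (b l i) (s *. u) *. (\<Sum>.p. ev (cw (k m) (k i) p) (s *. u) *. E p s))" for l m s
  define L where "L = \<eta> * (T * (T * T + 2 * T ^ 4 + T * (2 * (T * T))))"
  have T: "1 <= T" "0 < T" "0 <= \<eta>" using T_ge_1 eta by auto
  have "E l 1 = 0"
  proof (rule linear_ode_family_zero[where E' = "%l s. \<eta> *. (\<Sum>.m. u $ m *. G l m s)" and L = L])
    fix l s assume s: "s \<in> {0..1::real}"
    have su: "s *. u \<in> cube 1"
      using scaleR_mem_cube[OF u] s by auto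
    let ?e = "%a. ev a (s *. u)" and ?Z = "%l. Z l (pt (s *. u))"
    have bd: "((%s. ev (b l j) (s *. u)) has_vector_derivative \<eta> * (\<Sum>.m. u $ m * ?e (b_term b l j m))) (at s within {0..1})" for j
      by (rule radial_eqn_derivative(1)[OF u s b_eq])
    have "(E l has_vector_derivative \<eta> *. (\<Sum>.m. u $ m *. dZp l (s *. u) (?Z (k m)))
        - (\<Sum>.j. ?e (b l j) *. (\<eta> *. (\<Sum>.m. u $ m *. dZp (k j) (s *. u) (?Z (k m))))
          + (\<eta> * (\<Sum>.m. u $ m * ?e (b_term b l j m))) *. ?Z (k j))) (at s within {0..1})"
      unfolding E_def
      by (intro has_vector_derivative_diff has_vector_derivative_sum Z_ray_derivative u s
          bounded_bilinear.has_vector_derivative[OF bounded_bilinear_scaleR bd])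
    also have "\<eta> *. (\<Sum>.m. u $ m *. dZp l (s *. u) (?Z (k m)))
        - (\<Sum>.j. ?e (b l j) *. (\<eta> *. (\<Sum>.m. u $ m *. dZp (k j) (s *. u) (?Z (k m))))
          + (\<eta> * (\<Sum>.m. u $ m * ?e (b_term b l j m))) *. ?Z (k j))
        = \<eta> *. (\<Sum>.m. u $ m *. (dZp l (s *. u) (?Z (k m)) -
            (\<Sum>.j. ?e (b l j) *. dZp (k j) (s *. u) (?Z (k m)) + ?e (b_term b l j m) *. ?Z (k j))))"
    proof -
      have "(\<Sum>.j. ?e (b l j) *. (\<eta> *. (\<Sum>.m. u $ m *. dZp (k j) (s *. u) (?Z (k m))))
          + (\<eta> * (\<Sum>.m. u $ m * ?e (b_term b l j m))) *. ?Z (k j))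
        = (\<Sum>.j. \<Sum>.m. \<eta> *. u $ m *. (?e (b l j) *. dZp (k j) (s *. u) (?Z (k m)) + ?e (b_term b l j m) *. ?Z (k j)))"
        by (simp add: scaleR_sum_right scaleR_sum_left sum_distrib_left sum.distrib scaleR_add_right mult_ac)
      also have "\<dots> = \<eta> *. (\<Sum>.m. u $ m *. (\<Sum>.j. ?e (b l j) *. dZp (k j) (s *. u) (?Z (k m)) + ?e (b_term b l j m) *. ?Z (k j)))"
        by (subst sum.swap) (simp only: scaleR_sum_right)
      finally show ?thesis
        by (simp only: scaleR_diff_right sum_subtractf)
    qed
    also have "(%m. dZp l (s *. u) (?Z (k m)) -
            (\<Sum>.j. ?e (b l j) *. dZp (k j) (s *. u) (?Z (k m)) + ?e (b_term b l j m) *. ?Z (k j))) = (%m. G l m s)"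
    proof
      fix m
      define S1 where "S1 = (\<Sum>.p. ?e (cw (k m) l p) *. ?Z p)"
      define S2 where "S2 = (\<Sum>.p. ?e (cw (k m) l p) *. (\<Sum>.j. ?e (b p j) *. ?Z (k j)))"
      define S3 where "S3 i = (\<Sum>.p. ?e (cw (k m) (k i) p) *. ?Z p)" for i
      define S4 where "S4 i = (\<Sum>.p. ?e (cw (k m) (k i) p) *. (\<Sum>.j. ?e (b p j) *. ?Z (k j)))" for i
      define dm where "dm = dZp (k m) (s *. u)"
      have lin: "linear dm" unfolding dm_def by (rule linear_dZp[OF su])
      have 1: "dZp l (s *. u) (?Z (k m)) = S1 + dm (?Z l)"
        unfolding S1_def dm_def by (rule bracket_pt[OF su])
      have 2: "dZp (k j) (s *. u) (?Z (k m)) = S3 j + dm (?Z (k j))" for j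
        unfolding S3_def dm_def by (rule bracket_pt[OF su])
      have s2: "(\<Sum>.j. (\<Sum>.p. ?e (cw (k m) l p) * ?e (b p j)) *. ?Z (k j)) = S2"
        if "S2 = (\<Sum>.p. ?e (cw (k m) l p) *. (\<Sum>.j. ?e (b p j) *. ?Z (k j)))" for l S2
        unfolding that scaleR_sum_left scaleR_sum_right by (subst sum.swap) simp
      have 3: "(\<Sum>.j. ?e (b_term b l j m) *. ?Z (k j)) = S2 - (\<Sum>.i. ?e (b l i) *. S4 i)"
      proof -
        have gen: "(\<Sum>.j. (r j - (\<Sum>.i. c i * t i j)) *. z j) =
            (\<Sum>.j. r j *. z j) - (\<Sum>.j. \<Sum>.i. c i *. t i j *. z j)"
          for r c :: "'n => real" and t :: "'n => 'n => real" and z :: "'n => real^'n"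
          by (simp add: scaleR_diff_left sum_subtractf scaleR_sum_left)
        have "?e (b_term b l j m) = (\<Sum>.p. ?e (cw (k m) l p) * ?e (b p j)) -
            (\<Sum>.i. ?e (b l i) * (\<Sum>.p. ?e (cw (k m) (k i) p) * ?e (b p j)))" for j
          by (simp add: b_term_def ev_diff ev_sum ev_mult su)
        then have "(\<Sum>.j. ?e (b_term b l j m) *. ?Z (k j)) =
            (\<Sum>.j. (\<Sum>.p. ?e (cw (k m) l p) * ?e (b p j)) *. ?Z (k j)) -
            (\<Sum>.j. \<Sum>.i. ?e (b l i) *. (\<Sum>.p. ?e (cw (k m) (k i) p) * ?e (b p j)) *. ?Z (k j))"
          by (simp only: gen)
        also have "(\<Sum>.j. \<Sum>.i. ?e (b l i) *. (\<Sum>.p. ?e (cw (k m) (k i) p) * ?e (b p j)) *. ?Z (k j))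
            = (\<Sum>.i. ?e (b l i) *. (\<Sum>.j. (\<Sum>.p. ?e (cw (k m) (k i) p) * ?e (b p j)) *. ?Z (k j)))"
          by (subst sum.swap) (simp only: scaleR_sum_right)
        finally show ?thesis
          by (simp only: s2[OF S2_def] s2[OF S4_def])
      qed
      have 4: "G l m s = (S1 - S2) + dm (?Z l) - (\<Sum>.j. ?e (b l j) *. dm (?Z (k j)))
          - (\<Sum>.i. ?e (b l i) *. (S3 i - S4 i))"
        unfolding G_def E_def S1_def S2_def S3_def S4_def dm_def[symmetric]
        by (simp add: linear_diff[OF lin] linear_sum[OF lin] linear_scale[OF lin] scaleR_diff_right sum_subtractf)
      show "dZp l (s *. u) (?Z (k m)) -
            (\<Sum>.j. ?e (b l j) *. dZp (k j) (s *. u) (?Z (k m)) + ?e (b_term b l j m) *. ?Z (k j)) = G l m s"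
        unfolding 1 2 4 sum.distrib 3 by (simp add: scaleR_diff_right scaleR_add_right sum_subtractf sum.distrib)
    qed
    finally show "(E l has_vector_derivative \<eta> *. (\<Sum>.m. u $ m *. G l m s)) (at s within {0..1})" .
    define D where "D = (\<Sum>.j. norm (E j s))"
    have D: "norm (E p s) <= D" for p
      unfolding D_def by (rule member_le_sum) auto
    have cE: "norm (\<Sum>.p. ?e (cw i l p) *. E p s) <= T * (T * D)" for i l
      using abs_ev_cw[OF su] D T by (intro norm_sum_q_le) (auto intro!: mult_mono)
    have G: "norm (G l m s) <= T * (T * D) + 2 * T ^ 4 * D + T * (2 * (T * (T * D)))" for m
      unfolding G_def
    proof (intro order_trans[OF norm_triangle_ineq4] order_trans[OF norm_triangle_ineq] add_mono cE norm_sum_n_le)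
      show "norm (dZp (k m) (s *. u) (E l s)) <= 2 * T ^ 4 * D"
        using T D by (intro order_trans[OF norm_dZp_le[OF su]] mult_left_mono) auto
      show "norm (?e (b l i) *. (\<Sum>.p. ?e (cw (k m) (k i) p) *. E p s)) <= 2 * (T * (T * D))" for i
        using abs_ev_b[OF su] cE by (auto intro!: mult_mono)
    qed
    have "norm (u $ m *. G l m s) <= T * (T * D) + 2 * T ^ 4 * D + T * (2 * (T * (T * D)))" for m
    proof -
      have "\<bar>u $ m\<bar> * norm (G l m s) <= 1 * norm (G l m s)"
        using u by (intro mult_right_mono) (auto simp: cube_def)
      then show ?thesis using G[of m] by simp
    qed
    then have "norm (\<Sum>.m. u $ m *. G l m s) <= T * (T * (T * D) + 2 * T ^ 4 * D + T * (2 * (T * (T * D))))"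
      by (rule norm_sum_n_le)
    then have "\<eta> * norm (\<Sum>.m. u $ m *. G l m s) <= \<eta> * (T * (T * (T * D) + 2 * T ^ 4 * D + T * (2 * (T * (T * D)))))"
      using T by (intro mult_left_mono) auto
    also have "\<dots> = L * D" by (simp add: L_def algebra_simps)
    finally show "norm (\<eta> *. (\<Sum>.m. u $ m *. G l m s)) <= L * (\<Sum>.j. norm (E j s))"
      using T by (simp add: D_def)
  next
    show "E l 0 = 0" for l
    proof -
      have "ev (b l j) 0 = b0 l j" for j
        using radial_eqn_derivative(2)[OF u _ b_eq, of 0] by simp
      then show ?thesis
        using b0_rep[of l] by (simp add: E_def pt_0)
    qed
  qed auto
  then show ?thesis by (simp add: E_def)
qed

end

context scaled_frame
begin

subsection \<open>The frame along the exponential map\<close>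

text \<open>Structure coefficients of the frame itself: after expanding with \<open>Z_frame\<close>,
  [V_m, V_i] is the sum of the \<open>Cm m i j\<close> times V_j.\<close>

definition Cm :: "'n => 'n => 'n => 'n wiener" where
  "Cm m i j = (\<Sum>.p. cw (k m) (k i) p * b p j)"

lemma norm_Cm: "norm (Cm m i j) <= T * (T * 2)"
  unfolding Cm_def by (intro norm_sum_q_le norm_mult_le norm_cw norm_b)

lemma bracket_frame:
  assumes "u \<in> cube 1"
  shows "dZp (k i) u (Z (k m) (pt u)) =
    (\<Sum>.l. ev (Cm m i l) u *. Z (k l) (pt u)) + dZp (k m) u (Z (k i) (pt u))"
proof -
  have "(\<Sum>.p. ev (cw (k m) (k i) p) u *. Z p (pt u)) =
      (\<Sum>.p. \<Sum>.l. (ev (cw (k m) (k i) p) u * ev (b p l) u) *. Z (k l) (pt u))"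
    by (subst Z_frame[OF assms]) (simp add: scaleR_sum_right)
  also have "\<dots> = (\<Sum>.l. ev (Cm m i l) u *. Z (k l) (pt u))"
    by (subst sum.swap) (simp add: Cm_def ev_sum ev_mult assms scaleR_sum_left)
  finally show ?thesis
    using bracket_pt[OF assms, of "k i" "k m"] by simp
qed

text \<open>The Jacobian matrix of V_m at the point reached from \<open>u\<close>.
  \<open>2 *. wv\<close> undoes the halving in \<open>wderiv\<close>, and
  \<open>inverse \<rho>\<close> comes from the normalised variable.\<close>

definition Mm :: "'n => 'n => 'n => 'n wiener" where
  "Mm m c a = inverse \<rho> *. wcomp (wderiv c (zc (k m) a)) (2 *. wv)"

lemma norm_Mm: "norm (Mm m c a) <= T * (T * 2)"
proof -
  have "norm (wcomp (wderiv c (zc (k m) a)) (2 *. wv)) <= norm (wderiv c (zc (k m) a))"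
    by (rule norm_wcomp_le) (use norm_wv(2) in \<open>simp add: mult.commute\<close>)
  also have "\<dots> <= T * 2"
    using norm_wderiv_le[of c "zc (k m) a"] norm_zc[of "k m" a] by simp
  finally show ?thesis
    unfolding Mm_def norm_scaleR using rho T_ge_1 by (intro mult_mono) auto
qed

lemma dZp_eq:
  assumes u: "u \<in> cube 1"
  shows "dZp (k m) u h $ a = (\<Sum>.c. h $ c * ev (Mm m c a) u)"
proof -
  have "ev (wcomp v (2 *. wv)) u = ev v (2 *. zz u)" for v
  proof -
    have "(\<chi> i. ev ((2 *. wv) $ i) u) = 2 *. zz u"
      by (simp add: vec_eq_iff zz_def wv_def ev_scaleR u)
    then show ?thesis
      using ev_wcomp[of "2 *. wv" u v] norm_wv(2) u by (simp add: mult.commute)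
  qed
  then show ?thesis
    by (simp add: dZp_def dZ_def Mm_def ev_scaleR u sum_distrib_left mult_ac)
qed

lemma power_card_bound: "0 <= \<kappa> ==> \<kappa> * (real CARD('n) * real CARD('n))\<^sup>2 <= T ^ 4 * \<kappa>"
proof -
  assume \<kappa>: "0 <= \<kappa>"
  have "\<kappa> * (real CARD('n) * real CARD('n))\<^sup>2 <= \<kappa> * (T * T)\<^sup>2"
    using \<kappa> card_n T_ge_1 by (intro mult_left_mono power_mono mult_mono) auto
  then show ?thesis by (simp add: power_numeral_reduce power2_eq_square mult_ac)
qed

text \<open>The bound collects \<eta>, the sum over directions, the inner sum and a coefficient of
  norm at most \<open>2 * T\<^sup>2\<close>: the common shape of the equations for \<open>H\<close>,
  \<open>U\<close> and \<open>G\<close>.\<close>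

lemma eta_fixpoint:
  assumes "!!X X' i j. N X i j - N X' i j = N (%i j. X i j - X' i j) i j"
    and bound: "!!X c i j. (!!i j. norm (X i j) <= c) ==> norm (N X i j) <= \<eta> * (T * (T * ((T * (T * 2)) * c)))"
  shows "\<exists>X :: 'n => 'n => 'n wiener. (\<forall>i j. norm (X i j - (if i = j then 1 else 0)) <= \<epsilon>) \<and>
    (\<forall>i j. X i j = (if i = j then 1 else 0) + N X i j)"
proof -
  have \<kappa>: "\<eta> * (T * (T * ((T * (T * 2)) * c))) = (2 * T ^ 4 * \<eta>) * c" for c
    by (simp add: power_numeral_reduce)
  have 0: "0 <= 2 * T ^ 4 * \<eta>"
    using T_ge_1 eta by simp
  have 1: "2 * (2 * T ^ 4 * \<eta>) <= \<epsilon>"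
    using eta_bound[of 4 4] by simp
  have "2 * T ^ 4 * \<eta> * (real CARD('n) * real CARD('n))\<^sup>2 <= T ^ 4 * (2 * T ^ 4 * \<eta>)"
    by (rule power_card_bound[OF 0])
  also have "\<dots> = 2 * T ^ 8 * \<eta>" by (simp add: power_numeral_reduce)
  also have "\<dots> <= \<epsilon>" by (rule eta_bound) auto
  finally have 2: "2 * T ^ 4 * \<eta> * (real CARD('n) * real CARD('n))\<^sup>2 < 1"
    using eps_le by simp
  have 3: "\<epsilon> <= 1" using eps_le by simp
  obtain X :: "'n => 'n => 'n wiener" where "!!i j. norm (X i j - (if i = j then 1 else 0)) <= \<epsilon>"
    "!!i j. X i j = (if i = j then 1 else 0) + N X i j"
  proof (rule near_identity_fixpoint[of N "2 * T ^ 4 * \<eta>" \<epsilon>])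
    show "norm (N X i j) <= 2 * T ^ 4 * \<eta> * c" if "!!i j. norm (X i j) <= c"
      for X :: "'n => 'n => 'n wiener" and c i j
      by (rule bound[unfolded \<kappa>]) (rule that)
    show "N X i j - N X' i j = N (%i j. X i j - X' i j) i j" for X X' i j
      by (rule assms(1))
    show "0 <= 2 * T ^ 4 * \<eta>" by (rule 0)
    show "2 * (2 * T ^ 4 * \<eta>) <= \<epsilon>" by (rule 1)
    show "\<epsilon> <= 1" by (rule 3)
    show "2 * T ^ 4 * \<eta> * (real CARD('n) * real CARD('n))\<^sup>2 < 1" by (rule 2)
  qed blast
  then show ?thesis by blast
qed

text \<open>Expresses the frame at the endpoint through the frame at \<open>x\<close> transported by
  the linearised flow. Its equation contains only structure coefficients and no derivatives of the
  fields.\<close>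

definition H :: "'n => 'n => 'n wiener" where
  "H = (SOME X. (\<forall>i j. norm (X i j - (if i = j then 1 else 0)) <= \<epsilon>) \<and>
    (\<forall>i j. X i j = (if i = j then 1 else 0) + \<eta> *. (\<Sum>.m. wrad m (\<Sum>.l. Cm m i l * X l j))))"

text \<open>Row \<open>i\<close> is the image of the i-th unit vector under the flow linearised
  along the ray; this matrix lives in the original coordinates and has the Jacobians
  \<open>Mm\<close> as coefficients.\<close>

definition U :: "'n => 'n => 'n wiener" where
  "U = (SOME X. (\<forall>i j. norm (X i j - (if i = j then 1 else 0)) <= \<epsilon>) \<and>
    (\<forall>i j. X i j = (if i = j then 1 else 0) + \<eta> *. (\<Sum>.m. wrad m (\<Sum>.c. X i c * Mm m c j))))"

text \<open>The matrix of the differential of the exponential map in the frame. The natural unknown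
  is s G (s u), whose derivative is I - \<eta> \<Sum> u_m s G C_m; the extra factor s makes
  \<open>wint\<close> stand outside the variable, in contrast to \<open>wrad\<close>.\<close>

definition G :: "'n => 'n => 'n wiener" where
  "G = (SOME X. (\<forall>i j. norm (X i j - (if i = j then 1 else 0)) <= \<epsilon>) \<and>
    (\<forall>i j. X i j = (if i = j then 1 else 0) + - (\<eta> *. wint (\<Sum>.m. wvar m * (\<Sum>.l. X i l * Cm m l j)))))"

lemma H_ex: "\<exists>X. (\<forall>i j. norm (X i j - (if i = j then 1 else 0)) <= \<epsilon>) \<and>
    (\<forall>i j. X i j = (if i = j then 1 else 0) + \<eta> *. (\<Sum>.m. wrad m (\<Sum>.l. Cm m i l * X l j)))"
proof (rule eta_fixpoint)
  show "\<eta> *. (\<Sum>.m. wrad m (\<Sum>.l. Cm m i l * X l j)) - \<eta> *. (\<Sum>.m. wrad m (\<Sum>.l. Cm m i l * X' l j)) =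
    \<eta> *. (\<Sum>.m. wrad m (\<Sum>.l. Cm m i l * (X l j - X' l j)))" for X X' i j
    by (simp add: wrad_sum_diff right_diff_distrib sum_subtractf flip: scaleR_diff_right)
  show "norm (\<eta> *. (\<Sum>.m. wrad m (\<Sum>.l. Cm m i l * X l j))) <= \<eta> * (T * (T * ((T * (T * 2)) * c)))"
    if "!!i j. norm (X i j) <= c" for X c i j
    unfolding norm_scaleR using eta
    by (intro mult_mono norm_wrad_sum_le norm_sum_n_le norm_mult_le norm_Cm that) auto
qed

lemma U_ex: "\<exists>X. (\<forall>i j. norm (X i j - (if i = j then 1 else 0)) <= \<epsilon>) \<and>
    (\<forall>i j. X i j = (if i = j then 1 else 0) + \<eta> *. (\<Sum>.m. wrad m (\<Sum>.c. X i c * Mm m c j)))"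
proof (rule eta_fixpoint)
  show "\<eta> *. (\<Sum>.m. wrad m (\<Sum>.c. X i c * Mm m c j)) - \<eta> *. (\<Sum>.m. wrad m (\<Sum>.c. X' i c * Mm m c j)) =
    \<eta> *. (\<Sum>.m. wrad m (\<Sum>.c. (X i c - X' i c) * Mm m c j))" for X X' i j
    by (simp add: wrad_sum_diff left_diff_distrib sum_subtractf flip: scaleR_diff_right)
  show "norm (\<eta> *. (\<Sum>.m. wrad m (\<Sum>.l. X i l * Mm m l j))) <= \<eta> * (T * (T * ((T * (T * 2)) * c)))"
    if X: "!!i j. norm (X i j) <= c" for X c i j
    unfolding norm_scaleR mult.commute[of "X _ _"] using eta
    by (intro mult_mono norm_wrad_sum_le norm_sum_n_le norm_mult_le norm_Mm X) auto
qed

lemma G_ex: "\<exists>X. (\<forall>i j. norm (X i j - (if i = j then 1 else 0)) <= \<epsilon>) \<and>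
    (\<forall>i j. X i j = (if i = j then 1 else 0) + - (\<eta> *. wint (\<Sum>.m. wvar m * (\<Sum>.l. X i l * Cm m l j))))"
proof (rule eta_fixpoint)
  have "\<eta> *. wint (\<Sum>.m. wvar m * (\<Sum>.l. X i l * Cm m l j)) - \<eta> *. wint (\<Sum>.m. wvar m * (\<Sum>.l. X' i l * Cm m l j))
     = \<eta> *. wint (\<Sum>.m. wvar m * (\<Sum>.l. (X i l - X' i l) * Cm m l j))" for X X' :: "'n => 'n => 'n wiener" and i j
    by (simp add: linear_diff[OF linear_wint, symmetric] left_diff_distrib right_diff_distrib sum_subtractf flip: scaleR_diff_right)
  note gen = this
  show "- (\<eta> *. wint (\<Sum>.m. wvar m * (\<Sum>.l. X i l * Cm m l j))) -
      - (\<eta> *. wint (\<Sum>.m. wvar m * (\<Sum>.l. X' i l * Cm m l j))) =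
    - (\<eta> *. wint (\<Sum>.m. wvar m * (\<Sum>.l. (X i l - X' i l) * Cm m l j)))" for X X' :: "'n => 'n => 'n wiener" and i j
    unfolding minus_diff_minus gen[where X = X and X' = X' and i = i and j = j] ..
  show "norm (- (\<eta> *. wint (\<Sum>.m. wvar m * (\<Sum>.l. X i l * Cm m l j)))) <= \<eta> * (T * (T * ((T * (T * 2)) * c)))"
    if X: "!!i j. norm (X i j) <= c" for X c i j
  proof -
    have "norm (\<Sum>.m. wvar m * (\<Sum>.l. X i l * Cm m l j)) <= T * (1 * (T * ((T * (T * 2)) * c)))"
      unfolding mult.commute[of "X _ _"]
      by (intro norm_sum_n_le norm_mult_le norm_Cm X) (simp add: norm_wvar)
    from order_trans[OF norm_wint_le this]
    show ?thesis
      unfolding norm_minus_cancel norm_scaleR mult_1_left using eta by (intro mult_mono) auto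
  qed
qed

lemma H_near: "norm (H i j - (if i = j then 1 else 0)) <= \<epsilon>"
  and H_eq: "H i j = (if i = j then 1 else 0) + \<eta> *. (\<Sum>.m. wrad m (\<Sum>.l. Cm m i l * H l j))"
  using someI_ex[OF H_ex] unfolding H_def[symmetric] by blast+

lemma U_near: "norm (U i j - (if i = j then 1 else 0)) <= \<epsilon>"
  and U_eq: "U i j = (if i = j then 1 else 0) + \<eta> *. (\<Sum>.m. wrad m (\<Sum>.c. U i c * Mm m c j))"
  using someI_ex[OF U_ex] unfolding U_def[symmetric] by blast+

lemma H_eq': "H i j = of_real (if i = j then 1 else 0) + \<eta> *. (\<Sum>.m. wrad m (\<Sum>.l. Cm m i l * H l j))"
  using H_eq[of i j] by simp

lemma U_eq': "U i j = of_real (if i = j then 1 else 0) + \<eta> *. (\<Sum>.m. wrad m (\<Sum>.c. U i c * Mm m c j))"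
  using U_eq[of i j] by simp

lemma G_near: "norm (G i j - (if i = j then 1 else 0)) <= \<epsilon>"
  and G_eq: "G i j = (if i = j then 1 else 0) + - (\<eta> *. wint (\<Sum>.m. wvar m * (\<Sum>.l. G i l * Cm m l j)))"
  using someI_ex[OF G_ex] unfolding G_def[symmetric] by blast+

text \<open>A = I - A (G - I) says that A G = I. The matrix product costs a factor \<open>T\<close>,
  and entries of norm at most 2 account for the rest of \<open>2 * T * \<epsilon>\<close>.\<close>

lemma A_ex: "\<exists>X :: 'n => 'n => 'n wiener. (\<forall>i j. norm (X i j - (if i = j then 1 else 0)) <= 2 * T * \<epsilon>) \<and>
    (\<forall>i j. X i j = (if i = j then 1 else 0) + - (\<Sum>.l. X i l * (G l j - (if l = j then 1 else 0))))"
proof -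
  have 0: "0 <= T * \<epsilon>" using T_ge_1 eps by simp
  have 1: "2 * (T * \<epsilon>) <= 2 * T * \<epsilon>" by simp
  have 2: "2 * T * \<epsilon> <= 1" using eps_bound[of 2 1] by simp
  have "T * \<epsilon> * (real CARD('n) * real CARD('n))\<^sup>2 <= T ^ 4 * (T * \<epsilon>)"
    by (rule power_card_bound[OF 0])
  also have "\<dots> = T ^ 5 * \<epsilon>" by (simp add: power_numeral_reduce)
  also have "\<dots> < 1"
    using eps(2) by (simp add: mult.assoc)
  finally have 3: "T * \<epsilon> * (real CARD('n) * real CARD('n))\<^sup>2 < 1" .
  obtain X :: "'n => 'n => 'n wiener" where "!!i j. norm (X i j - (if i = j then 1 else 0)) <= 2 * T * \<epsilon>"
    "!!i j. X i j = (if i = j then 1 else 0) + - (\<Sum>.l. X i l * (G l j - (if l = j then 1 else 0)))"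
  proof (rule near_identity_fixpoint[OF _ _ 0 1 2 3,
        where N = "%X i j. - (\<Sum>.l. X i l * (G l j - (if l = j then 1 else 0)))"])
    show "- (\<Sum>.l. X i l * (G l j - (if l = j then 1 else 0))) - - (\<Sum>.l. X' i l * (G l j - (if l = j then 1 else 0)))
      = - (\<Sum>.l. (X i l - X' i l) * (G l j - (if l = j then 1 else 0)))" for X X' i j
      by (simp add: left_diff_distrib sum_subtractf)
    show "norm (- (\<Sum>.l. X i l * (G l j - (if l = j then 1 else 0)))) <= T * \<epsilon> * c"
      if X: "!!i j. norm (X i j) <= c" for X c i j
    proof -
      have "norm (\<Sum>.l. X i l * (G l j - (if l = j then 1 else 0))) <= T * (c * \<epsilon>)"
        by (intro norm_sum_n_le norm_mult_le X G_near)
      then show ?thesis by (simp add: mult_ac)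
    qed
  qed blast
  then show ?thesis by blast
qed

definition A :: "'n => 'n => 'n wiener" where
  "A = (SOME X. (\<forall>i j. norm (X i j - (if i = j then 1 else 0)) <= 2 * T * \<epsilon>) \<and>
    (\<forall>i j. X i j = (if i = j then 1 else 0) + - (\<Sum>.l. X i l * (G l j - (if l = j then 1 else 0)))))"

lemma A_near: "norm (A i j - (if i = j then 1 else 0)) <= 2 * T * \<epsilon>"
  and A_eq: "A i j = (if i = j then 1 else 0) + - (\<Sum>.l. A i l * (G l j - (if l = j then 1 else 0)))"
  using someI_ex[OF A_ex] unfolding A_def[symmetric] by blast+

lemma A_mult_G: "(\<Sum>.l. A i l * G l j) = (if i = j then 1 else 0)"
proof -
  have "A i l * (G l j - (if l = j then 1 else 0)) = A i l * G l j - (if l = j then A i l else 0)" for l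
    by (simp add: right_diff_distrib)
  then have "(\<Sum>.l. A i l * (G l j - (if l = j then 1 else 0))) = (\<Sum>.l. A i l * G l j) - A i j"
    by (simp add: sum_subtractf)
  then show ?thesis using A_eq[of i j] by simp
qed

definition Uv :: "'n => real^'n => real^'n" where "Uv a u = (\<chi> c. ev (U a c) u)"

text \<open>The frame vector V_j (x) carried to the endpoint by the linearised flow.\<close>

definition yv :: "'n => real^'n => real^'n" where "yv j u = (\<Sum>.a. Z (k j) x $ a *. Uv a u)"

lemma yv_ray_derivative:
  assumes u: "u \<in> cube 1" and s: "s \<in> {0..1}"
  shows "((%s. yv j (s *. u)) has_vector_derivative
    \<eta> *. (\<Sum>.m. u $ m *. dZp (k m) (s *. u) (yv j (s *. u)))) (at s within {0..1})"
proof -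
  have su: "s *. u \<in> cube 1"
    using scaleR_mem_cube[OF u] s by auto
  have "((%s. Uv a (s *. u)) has_vector_derivative
     (\<chi> c. \<eta> * (\<Sum>.m. u $ m * ev (\<Sum>c'\<in>UNIV. U a c' * Mm m c' c) (s *. u)))) (at s within {0..1})" for a
    unfolding Uv_def by (intro has_vector_derivative_vec radial_eqn_derivative(1)[OF u s U_eq'])
  moreover have "(\<chi> c. \<eta> * (\<Sum>.m. u $ m * ev (\<Sum>c'\<in>UNIV. U a c' * Mm m c' c) (s *. u)))
     = \<eta> *. (\<Sum>.m. u $ m *. dZp (k m) (s *. u) (Uv a (s *. u)))" for a
    by (simp add: vec_eq_iff dZp_eq[OF su] ev_sum ev_mult su Uv_def)
  ultimately have "((%s. yv j (s *. u)) has_vector_derivative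
     (\<Sum>.a. Z (k j) x $ a *. (\<eta> *. (\<Sum>.m. u $ m *. dZp (k m) (s *. u) (Uv a (s *. u)))))) (at s within {0..1})"
    unfolding yv_def
    by (intro has_vector_derivative_sum bounded_linear.has_vector_derivative[OF bounded_linear_scaleR_right]) simp
  also have "(\<Sum>.a. Z (k j) x $ a *. (\<eta> *. (\<Sum>.m. u $ m *. dZp (k m) (s *. u) (Uv a (s *. u)))))
      = (\<Sum>.a. \<Sum>.m. \<eta> *. u $ m *. (Z (k j) x $ a *. dZp (k m) (s *. u) (Uv a (s *. u))))"
    by (simp add: scaleR_sum_right mult_ac)
  also have "\<dots> = \<eta> *. (\<Sum>.m. u $ m *. dZp (k m) (s *. u) (yv j (s *. u)))"
    by (subst sum.swap) (simp add: yv_def linear_sum[OF linear_dZp[OF su]] linear_scale[OF linear_dZp[OF su]] scaleR_sum_right)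
  finally show ?thesis .
qed

text \<open>By \<open>bracket_frame\<close>, V_i changes along the ray by structure coefficients
  plus the linearised flow, and these are the equations of \<open>H\<close> and of
  \<open>yv\<close>; the defect solves a homogeneous linear system. In matrix form the frame is H V0
  U, so its possibly tiny determinant is \<open>det V0\<close> up to bounded factors.\<close>

lemma V_pt:
  assumes u: "u \<in> cube 1"
  shows "Z (k i) (pt u) = (\<Sum>.j. ev (H i j) u *. yv j u)"
proof -
  define E where "E i s = Z (k i) (pt (s *. u)) - (\<Sum>.j. ev (H i j) (s *. u) *. yv j (s *. u))" for i s
  define F where "F i m s = (\<Sum>.l. ev (Cm m i l) (s *. u) *. E l s) + dZp (k m) (s *. u) (E i s)" for i m s
  define L where "L = \<eta> * (T * (T * (T * (T * 2)) + 2 * T ^ 4))"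
  have T: "1 <= T" "0 < T" "0 <= \<eta>" using T_ge_1 eta by auto
  have "E i 1 = 0"
  proof (rule linear_ode_family_zero[where E' = "%i s. \<eta> *. (\<Sum>.m. u $ m *. F i m s)" and L = L])
    fix i s assume s: "s \<in> {0..1::real}"
    have su: "s *. u \<in> cube 1"
      using scaleR_mem_cube[OF u] s by auto
    let ?e = "%a. ev a (s *. u)" and ?V = "%l. Z (k l) (pt (s *. u))" and ?d = "%m. dZp (k m) (s *. u)"
    have "(E i has_vector_derivative \<eta> *. (\<Sum>.m. u $ m *. ?d i (?V m))
        - (\<Sum>.j. ?e (H i j) *. (\<eta> *. (\<Sum>.m. u $ m *. ?d m (yv j (s *. u))))
          + (\<eta> * (\<Sum>.m. u $ m * ?e (\<Sum>.l. Cm m i l * H l j))) *. yv j (s *. u))) (at s within {0..1})"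
      unfolding E_def
      by (intro has_vector_derivative_diff has_vector_derivative_sum Z_ray_derivative u s yv_ray_derivative
          bounded_bilinear.has_vector_derivative[OF bounded_bilinear_scaleR radial_eqn_derivative(1)[OF u s H_eq']])
    also have "\<eta> *. (\<Sum>.m. u $ m *. ?d i (?V m))
        - (\<Sum>.j. ?e (H i j) *. (\<eta> *. (\<Sum>.m. u $ m *. ?d m (yv j (s *. u))))
          + (\<eta> * (\<Sum>.m. u $ m * ?e (\<Sum>.l. Cm m i l * H l j))) *. yv j (s *. u))
        = \<eta> *. (\<Sum>.m. u $ m *. (?d i (?V m) -
            (\<Sum>.j. ?e (H i j) *. ?d m (yv j (s *. u)) + ?e (\<Sum>.l. Cm m i l * H l j) *. yv j (s *. u))))"
    proof -
      have "(\<Sum>.j. ?e (H i j) *. (\<eta> *. (\<Sum>.m. u $ m *. ?d m (yv j (s *. u))))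
          + (\<eta> * (\<Sum>.m. u $ m * ?e (\<Sum>.l. Cm m i l * H l j))) *. yv j (s *. u))
        = (\<Sum>.j. \<Sum>.m. \<eta> *. u $ m *. (?e (H i j) *. ?d m (yv j (s *. u)) + ?e (\<Sum>.l. Cm m i l * H l j) *. yv j (s *. u)))"
        by (simp add: scaleR_sum_right scaleR_sum_left[of _ UNIV "yv _ _"] sum_distrib_left sum.distrib scaleR_add_right mult_ac)
      also have "\<dots> = \<eta> *. (\<Sum>.m. u $ m *. (\<Sum>.j. ?e (H i j) *. ?d m (yv j (s *. u)) + ?e (\<Sum>.l. Cm m i l * H l j) *. yv j (s *. u)))"
        by (subst sum.swap) (simp only: scaleR_sum_right)
      finally show ?thesis
        by (simp only: scaleR_diff_right sum_subtractf)
    qed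
    also have "(%m. ?d i (?V m) -
            (\<Sum>.j. ?e (H i j) *. ?d m (yv j (s *. u)) + ?e (\<Sum>.l. Cm m i l * H l j) *. yv j (s *. u))) = (%m. F i m s)"
    proof
      fix m
      have lin: "linear (?d m)" by (rule linear_dZp[OF su])
      have 1: "(\<Sum>.j. ?e (\<Sum>.l. Cm m i l * H l j) *. yv j (s *. u)) =
          (\<Sum>.l. ?e (Cm m i l) *. (\<Sum>.j. ?e (H l j) *. yv j (s *. u)))"
        unfolding ev_sum[OF su] ev_mult[OF su] scaleR_sum_left scaleR_sum_right by (subst sum.swap) simp
      show "?d i (?V m) -
            (\<Sum>.j. ?e (H i j) *. ?d m (yv j (s *. u)) + ?e (\<Sum>.l. Cm m i l * H l j) *. yv j (s *. u)) = F i m s"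
        unfolding bracket_frame[OF su, of i m] sum.distrib 1 F_def E_def
        by (simp add: linear_diff[OF lin] linear_sum[OF lin] linear_scale[OF lin] scaleR_diff_right sum_subtractf)
    qed
    finally show "(E i has_vector_derivative \<eta> *. (\<Sum>.m. u $ m *. F i m s)) (at s within {0..1})" .
    define D where "D = (\<Sum>.j. norm (E j s))"
    have D: "norm (E p s) <= D" for p
      unfolding D_def by (rule member_le_sum) auto
    have cE: "norm (?e (Cm m i l) *. E l s) <= (T * (T * 2)) * D" for m l
      unfolding norm_scaleR using T D order_trans[OF abs_ev_le[OF su] norm_Cm] by (intro mult_mono) auto
    have F: "norm (F i m s) <= T * ((T * (T * 2)) * D) + 2 * T ^ 4 * D" for m
      unfolding F_def
    proof (intro order_trans[OF norm_triangle_ineq] add_mono norm_sum_n_le cE)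
      show "norm (dZp (k m) (s *. u) (E i s)) <= 2 * T ^ 4 * D"
        using T D by (intro order_trans[OF norm_dZp_le[OF su]] mult_left_mono) auto
    qed
    have "norm (u $ m *. F i m s) <= T * ((T * (T * 2)) * D) + 2 * T ^ 4 * D" for m
    proof -
      have "\<bar>u $ m\<bar> * norm (F i m s) <= 1 * norm (F i m s)"
        using u by (intro mult_right_mono) (auto simp: cube_def)
      then show ?thesis using F[of m] by simp
    qed
    then have "norm (\<Sum>.m. u $ m *. F i m s) <= T * (T * ((T * (T * 2)) * D) + 2 * T ^ 4 * D)"
      by (rule norm_sum_n_le)
    then have "\<eta> * norm (\<Sum>.m. u $ m *. F i m s) <= \<eta> * (T * (T * ((T * (T * 2)) * D) + 2 * T ^ 4 * D))"
      using T by (intro mult_left_mono) auto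
    also have "\<dots> = L * D" by (simp add: L_def algebra_simps)
    finally show "norm (\<eta> *. (\<Sum>.m. u $ m *. F i m s)) <= L * (\<Sum>.j. norm (E j s))"
      using T by (simp add: D_def)
  next
    show "E i 0 = 0" for i
    proof -
      have h0: "ev (H i j) 0 = (if i = j then 1 else 0)" for j
        using radial_eqn_derivative(2)[OF u _ H_eq', of 0] by simp
      have u0: "ev (U a c) 0 = (if a = c then 1 else 0)" for a c
        using radial_eqn_derivative(2)[OF u _ U_eq', of 0] by simp
      have "yv j 0 = Z (k j) x" for j
        by (simp add: yv_def Uv_def u0 vec_eq_iff if_distrib cong: if_cong)
      then show ?thesis
        by (simp add: E_def pt_0 h0 if_distrib[of "%c. c *. _"] cong: if_cong)
    qed
  qed auto
  then show ?thesis by (simp add: E_def)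
qed

end

lemma linear_wderiv: "linear (wderiv i)"
proof -
  have "wcoeff (wderiv i a) al = (1 / 2) ^ mabs al * dcoeff i (wcoeff a) al" for a and al :: "'a => nat"
    unfolding wderiv_def by (rule wcoeff_wseries[OF mconv_dcoeff[OF mconv_wcoeff]]) auto
  then show ?thesis
    by (intro linearI) (simp_all add: wiener_eq_iff dcoeff_def algebra_simps)
qed

lemma sum_axis: "(\<Sum>.k. axis i 1 $ k *. f k) = (f i :: 'a::real_vector)"
  by (subst sum.remove[of _ i]) (auto simp: axis_def intro!: sum.neutral)

context scaled_frame
begin

subsection \<open>The derivative of the exponential map\<close>

text \<open>The i-th partial derivative of \<open>pt\<close>; doubling \<open>u\<close> compensates
  the halving in \<open>wderiv\<close>.\<close>

definition pd :: "'n => real^'n => real^'n" where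
  "pd i u = \<rho> *. (\<chi> a. ev (wderiv i (w a)) (2 *. u))"

lemma pt_has_derivative_pd:
  assumes u: "u \<in> cube (1 / 2)"
  shows "(pt has_derivative (%h. \<Sum>.i. h $ i *. pd i u)) (at u)"
proof -
  have "(zz has_derivative (%h. \<chi> a. \<Sum>.i. h $ i * ev (wderiv i (w a)) (2 *. u))) (at u)"
    unfolding zz_def[abs_def] by (intro has_derivative_vec ev_has_derivative u)
  then have "(pt has_derivative (%h. 0 + \<rho> *. (\<chi> a. \<Sum>.i. h $ i * ev (wderiv i (w a)) (2 *. u)))) (at u)"
    unfolding pt_def[abs_def] by (intro has_derivative_add has_derivative_const has_derivative_scaleR_right)
  moreover have "(%h. 0 + \<rho> *. (\<chi> a. \<Sum>.i. h $ i * ev (wderiv i (w a)) (2 *. u))) =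
      (%h. \<Sum>.i. h $ i *. pd i u)"
    by (simp add: fun_eq_iff vec_eq_iff pd_def sum_distrib_left mult_ac)
  ultimately show ?thesis by simp
qed

lemma ev_wderiv_Z:
  assumes u: "u \<in> cube (1 / 2)"
  shows "ev (wderiv i (wcomp (zc l a) wv)) (2 *. u) = dZp l u (pd i u) $ a"
proof -
  have u1: "u \<in> cube 1" using u cube_mono[of "1/2" 1] by auto
  have o: "u \<in> open_cube 1"
    using u cube_subset_open_cube[of "1/2" 1] by auto
  have "((%u. Z l (pt u)) has_derivative (%h. dZp l u (\<Sum>.i. h $ i *. pd i u))) (at u)"
    using diff_chain_at[OF pt_has_derivative_pd[OF u] Z_pt_has_derivative[OF u1]] by (simp add: comp_def)
  from bounded_linear.has_derivative[OF bounded_linear_vec_nth this, of a]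
  have "(ev (wcomp (zc l a) wv) has_derivative (%h. dZp l u (\<Sum>.i. h $ i *. pd i u) $ a)) (at u)"
    by (rule has_derivative_transform_within_open[OF _ open_open_cube o])
      (use Z_pt open_cube_subset_cube[of 1] in auto)
  from fun_cong[OF has_derivative_unique[OF this ev_has_derivative[OF u]], of "axis i 1"]
  show ?thesis
    using sum_axis[of i "%i. pd i u"] sum_axis[of i "%i. ev (wderiv i (wcomp (zc l a) wv)) (2 *. u)"] by simp
qed

text \<open>The flow equation differentiated with respect to \<open>u $ i\<close>. The derivative of
  u \<mapsto> pt (s u) is s times \<open>pd i (s *. u)\<close>, hence the factor s; the
  inhomogeneous term V_i comes from the coefficient \<open>u $ i\<close> of the field.\<close>

lemma pd_ray_derivative:
  assumes u: "u \<in> cube (1 / 2)" and s: "s \<in> {0..1}"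
  shows "((%s. s *. pd i (s *. u)) has_vector_derivative
    \<eta> *. Z (k i) (pt (s *. u)) + \<eta> *. (\<Sum>.m. u $ m *. dZp (k m) (s *. u) (s *. pd i (s *. u))))
    (at s within {0..1})"
proof -
  have u1: "u \<in> cube 1" using u cube_mono[of "1/2" 1] by auto
  have su: "s *. u \<in> cube (1 / 2)" if "s \<in> {0..1}" for s
    using scaleR_mem_cube[OF u] that by auto
  have su1: "s *. u \<in> cube 1" if "s \<in> {0..1}" for s
    using scaleR_mem_cube[OF u1] that by auto
  have su2: "2 *. s *. u \<in> cube 1" if "s \<in> {0..1}" for s
    using su[OF that] by (auto simp: cube_def abs_mult mult_ac)
  let ?F = "%m a. wcomp (zc (k m) a) wv"
  have wd: "ev (wderiv i (w a)) (2 *. s *. u) = (\<eta> / \<rho>) * (\<Sum>.m. ev (wderiv i (wrad m (?F m a))) (2 *. s *. u))"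
    if "s \<in> {0..1}" for s a
    unfolding w_eq linear_scale[OF linear_wderiv] linear_sum[OF linear_wderiv]
    by (simp only: ev_scaleR[OF su2[OF that]] ev_sum[OF su2[OF that]])
  have d: "((%s. \<eta> * (\<Sum>.m. s * ev (wderiv i (wrad m (?F m a))) (2 *. s *. u))) has_vector_derivative
      \<eta> * (\<Sum>.m. ev (wderiv i (wvar m * ?F m a)) (2 *. s *. u))) (at s within {0..1})" for a
    by (intro has_vector_derivative_mult_right has_vector_derivative_sum wrad_partial_ray_derivative u s)
  have "((%s. \<chi> a. \<eta> * (\<Sum>.m. s * ev (wderiv i (wrad m (?F m a))) (2 *. s *. u))) has_vector_derivative
      (\<chi> a. \<eta> * (\<Sum>.m. ev (wderiv i (wvar m * ?F m a)) (2 *. s *. u)))) (at s within {0..1})"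
    by (intro has_vector_derivative_vec d)
  then have d': "((%s. s *. pd i (s *. u)) has_vector_derivative
      (\<chi> a. \<eta> * (\<Sum>.m. ev (wderiv i (wvar m * ?F m a)) (2 *. s *. u)))) (at s within {0..1})"
  proof (rule has_vector_derivative_transform[OF s, rotated])
    fix s :: real assume s': "s \<in> {0..1}"
    show "s *. pd i (s *. u) = (\<chi> a. \<eta> * (\<Sum>.m. s * ev (wderiv i (wrad m (?F m a))) (2 *. s *. u)))"
      unfolding vec_eq_iff pd_def vector_scaleR_component vec_lambda_beta wd[OF s'] real_scaleR_def
        sum_distrib_left[symmetric] using rho by simp
  qed
  have "(\<chi> a. \<eta> * (\<Sum>.m. ev (wderiv i (wvar m * ?F m a)) (2 *. s *. u))) =
    \<eta> *. Z (k i) (pt (s *. u)) + \<eta> *. (\<Sum>.m. u $ m *. dZp (k m) (s *. u) (s *. pd i (s *. u)))"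
  proof (subst vec_eq_iff, rule allI)
    fix a
    have "(\<Sum>.m. ev (wderiv i (wvar m * ?F m a)) (2 *. s *. u)) =
        (\<Sum>.m. (if i = m then ev (?F m a) (s *. u) else 0)) +
        (\<Sum>.m. (s *. u) $ m * ev (wderiv i (?F m a)) (2 *. s *. u))"
      by (simp only: ev_wderiv_wvar_mult[OF su[OF s]] sum.distrib)
    also have "\<dots> = Z (k i) (pt (s *. u)) $ a + (\<Sum>.m. u $ m * dZp (k m) (s *. u) (s *. pd i (s *. u)) $ a)"
      unfolding ev_wderiv_Z[OF su[OF s]] Z_pt[OF su1[OF s], symmetric]
      by (simp add: linear_scale[OF linear_dZp[OF su1[OF s]]] mult_ac)
    finally show "(\<chi> a. \<eta> * (\<Sum>.m. ev (wderiv i (wvar m * ?F m a)) (2 *. s *. u))) $ a =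
      (\<eta> *. Z (k i) (pt (s *. u)) + \<eta> *. (\<Sum>.m. u $ m *. dZp (k m) (s *. u) (s *. pd i (s *. u)))) $ a"
      by (simp add: distrib_left)
  qed
  then show ?thesis using d' by simp
qed

text \<open>s times the partial derivative and \<eta> s G V solve the same inhomogeneous linear
  equation with value 0 at s = 0, so their difference solves the homogeneous one.\<close>

lemma pd_eq:
  assumes u: "u \<in> cube (1 / 2)"
  shows "pd i u = \<eta> *. (\<Sum>.j. ev (G i j) u *. Z (k j) (pt u))"
proof -
  have u1: "u \<in> cube 1" using u cube_mono[of "1/2" 1] by auto
  define g where "g i s = \<eta> *. (\<Sum>.j. (s * ev (G i j) (s *. u)) *. Z (k j) (pt (s *. u)))" for i s
  define E where "E i s = s *. pd i (s *. u) - g i s" for i s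
  define L where "L = \<eta> * (T * (2 * T ^ 4))"
  have T: "1 <= T" "0 < T" "0 <= \<eta>" using T_ge_1 eta by auto
  have "E i 1 = 0"
  proof (rule linear_ode_family_zero[where L = L and
        E' = "%i s. \<eta> *. (\<Sum>.m. u $ m *. dZp (k m) (s *. u) (E i s))"])
    fix i s assume s: "s \<in> {0..1::real}"
    have su1: "s *. u \<in> cube 1" if "s \<in> {0..1}" for s
      using scaleR_mem_cube[OF u1] that by auto
    note su = su1[OF s]
    let ?e = "%a. ev a (s *. u)" and ?V = "%l. Z (k l) (pt (s *. u))" and ?d = "%m. dZp (k m) (s *. u)"
    let ?K = "%j. \<Sum>.m. wvar m * (\<Sum>.l. G i l * Cm m l j)"
    define c where "c m j = (\<Sum>.l. ?e (G i l) * ?e (Cm m l j))" for m j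
    have dG: "((%s. s * ev (G i j) (s *. u)) has_vector_derivative ((if i = j then 1 else 0) - \<eta> * ?e (?K j))) (at s within {0..1})" for j
    proof (rule has_vector_derivative_transform[OF s])
      show "((%s. s * (if i = j then 1 else 0) - \<eta> * (s * ev (wint (?K j)) (s *. u))) has_vector_derivative
          ((if i = j then 1 else 0) - \<eta> * ?e (?K j))) (at s within {0..1})"
      proof (intro has_vector_derivative_diff has_vector_derivative_mult_right wint_ray_derivative u1 s)
        show "((%s. s * (if i = j then 1 else 0)) has_vector_derivative (if i = j then 1 else 0)) (at s within {0..1})"
          by (auto intro: derivative_eq_intros)
      qed
      show "r * ev (G i j) (r *. u) = r * (if i = j then 1 else 0) - \<eta> * (r * ev (wint (?K j)) (r *. u))"
        if "r \<in> {0..1}" for r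
      proof -
        have "ev (if i = j then 1 else 0) (r *. u) = (if i = j then 1 else 0)"
          using su1[OF that] by (simp add: ev_one ev_zero)
        then show ?thesis
          by (subst G_eq) (simp add: ev_diff ev_scaleR su1[OF that] right_diff_distrib)
      qed
    qed
    have "(g i has_vector_derivative \<eta> *. (\<Sum>.j. (s * ?e (G i j)) *. (\<eta> *. (\<Sum>.m. u $ m *. ?d j (?V m)))
        + ((if i = j then 1 else 0) - \<eta> * ?e (?K j)) *. ?V j)) (at s within {0..1})"
      unfolding g_def
      by (intro bounded_linear.has_vector_derivative[OF bounded_linear_scaleR_right] has_vector_derivative_sum
          bounded_bilinear.has_vector_derivative[OF bounded_bilinear_scaleR dG] Z_ray_derivative u1 s)
    also have "(\<Sum>.j. (s * ?e (G i j)) *. (\<eta> *. (\<Sum>.m. u $ m *. ?d j (?V m)))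
        + ((if i = j then 1 else 0) - \<eta> * ?e (?K j)) *. ?V j)
      = ?V i + (\<Sum>.m. u $ m *. ?d m (g i s))"
    proof -
      have K: "?e (?K j) = (\<Sum>.m. s * u $ m * c m j)" for j
        by (simp add: ev_sum ev_mult ev_wvar su c_def)
      have 1: "(\<Sum>.j. (s * ?e (G i j)) *. (\<eta> *. (\<Sum>.m. u $ m *. ?d j (?V m))))
          = (\<Sum>.m. u $ m *. (\<eta> * s) *. (\<Sum>.j. ?e (G i j) *. ?d j (?V m)))"
        unfolding scaleR_sum_right by (subst sum.swap) (simp add: mult_ac)
      have 2: "(\<Sum>.j. ((if i = j then 1 else 0) - \<eta> * ?e (?K j)) *. ?V j)
          = ?V i - (\<Sum>.m. u $ m *. (\<eta> * s) *. (\<Sum>.j. c m j *. ?V j))"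
      proof -
        have "(\<Sum>.j. (if i = j then 1 else 0) *. ?V j) = ?V i"
          by (simp add: if_distrib[of "%c. c *. _"] cong: if_cong)
        moreover have "(\<Sum>.j. (\<eta> * ?e (?K j)) *. ?V j) = (\<Sum>.m. u $ m *. (\<eta> * s) *. (\<Sum>.j. c m j *. ?V j))"
          unfolding K unfolding scaleR_sum_right sum_distrib_left scaleR_sum_left by (subst sum.swap) (simp add: mult_ac)
        ultimately show ?thesis
          by (simp only: scaleR_diff_left sum_subtractf)
      qed
      \<comment> \<open>Exchanging directions by \<open>bracket_frame\<close> produces exactly the
        structure coefficients that the equation of \<open>G\<close> subtracts, and only the linear
        map of V_m remains.\<close>
      have 3: "(\<Sum>.j. ?e (G i j) *. ?d j (?V m)) - (\<Sum>.j. c m j *. ?V j) = (\<Sum>.j. ?e (G i j) *. ?d m (?V j))" for m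
      proof -
        have "(\<Sum>.j. ?e (G i j) *. ?d j (?V m)) =
            (\<Sum>.j. ?e (G i j) *. ((\<Sum>.l. ?e (Cm m j l) *. ?V l) + ?d m (?V j)))"
          by (rule sum.cong[OF refl]) (rule arg_cong[OF bracket_frame[OF su]])
        also have "\<dots> = (\<Sum>.j. \<Sum>.l. (?e (G i j) * ?e (Cm m j l)) *. ?V l) + (\<Sum>.j. ?e (G i j) *. ?d m (?V j))"
          by (simp add: scaleR_add_right sum.distrib scaleR_sum_right)
        also have "(\<Sum>.j. \<Sum>.l. (?e (G i j) * ?e (Cm m j l)) *. ?V l) = (\<Sum>.l. c m l *. ?V l)"
          by (subst sum.swap) (simp add: c_def scaleR_sum_left)
        finally show ?thesis by simp
      qed
      have "(\<Sum>.m. u $ m *. (\<eta> * s) *. (\<Sum>.j. ?e (G i j) *. ?d j (?V m)))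
          - (\<Sum>.m. u $ m *. (\<eta> * s) *. (\<Sum>.j. c m j *. ?V j))
          = (\<Sum>.m. u $ m *. ?d m (g i s))"
      proof -
        have "?d m (g i s) = (\<eta> * s) *. ((\<Sum>.j. ?e (G i j) *. ?d j (?V m)) - (\<Sum>.j. c m j *. ?V j))" for m
          unfolding 3
          by (simp add: g_def linear_sum[OF linear_dZp[OF su]] linear_scale[OF linear_dZp[OF su]] scaleR_sum_right mult.assoc)
        then show ?thesis
          by (simp only: scaleR_diff_right sum_subtractf)
      qed
      then show ?thesis
        unfolding sum.distrib 1 2 by (simp add: algebra_simps)
    qed
    finally have dg: "(g i has_vector_derivative \<eta> *. (?V i + (\<Sum>.m. u $ m *. ?d m (g i s)))) (at s within {0..1})" .
    have "(E i has_vector_derivative (\<eta> *. ?V i + \<eta> *. (\<Sum>.m. u $ m *. ?d m (s *. pd i (s *. u))))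
        - \<eta> *. (?V i + (\<Sum>.m. u $ m *. ?d m (g i s)))) (at s within {0..1})"
      unfolding E_def by (intro has_vector_derivative_diff pd_ray_derivative u s dg[unfolded has_vector_derivative_def, folded has_vector_derivative_def])
    moreover have "(\<eta> *. ?V i + \<eta> *. (\<Sum>.m. u $ m *. ?d m (s *. pd i (s *. u))))
        - \<eta> *. (?V i + (\<Sum>.m. u $ m *. ?d m (g i s))) = \<eta> *. (\<Sum>.m. u $ m *. ?d m (E i s))"
      by (simp add: E_def linear_diff[OF linear_dZp[OF su]] scaleR_diff_right scaleR_add_right sum_subtractf)
    ultimately show "(E i has_vector_derivative \<eta> *. (\<Sum>.m. u $ m *. ?d m (E i s))) (at s within {0..1})"
      by simp
    define D where "D = (\<Sum>.j. norm (E j s))"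
    have D: "norm (E p s) <= D" for p
      unfolding D_def by (rule member_le_sum) auto
    have "norm (u $ m *. ?d m (E i s)) <= 2 * T ^ 4 * D" for m
    proof -
      have "\<bar>u $ m\<bar> * norm (?d m (E i s)) <= 1 * norm (?d m (E i s))"
        using u1 by (intro mult_right_mono) (auto simp: cube_def)
      also have "\<dots> <= 2 * T ^ 4 * D"
        using order_trans[OF norm_dZp_le[OF su] mult_left_mono[OF D[of i], of "2 * T ^ 4"]] T by simp
      finally show ?thesis by simp
    qed
    then have "norm (\<Sum>.m. u $ m *. ?d m (E i s)) <= T * (2 * T ^ 4 * D)"
      by (rule norm_sum_n_le)
    then have "\<eta> * norm (\<Sum>.m. u $ m *. ?d m (E i s)) <= \<eta> * (T * (2 * T ^ 4 * D))"
      using T by (intro mult_left_mono) auto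
    then show "norm (\<eta> *. (\<Sum>.m. u $ m *. ?d m (E i s))) <= L * (\<Sum>.j. norm (E j s))"
      using T by (simp add: D_def L_def mult_ac)
  next
    show "E i 0 = 0" for i
      by (simp add: E_def g_def)
  qed auto
  then show ?thesis by (simp add: E_def g_def)
qed

end

subsection \<open>Membership in \<open>scrA\<close> and real analyticity of power series\<close>

lemma norm_le_in_cube: "norm t <= r ==> t \<in> cube r"
  using cball_subset_cube[of r] by auto

text \<open>\<open>scrA_coeffs\<close> works with derivatives at 0, divided by factorials inside the
  sum, whereas \<open>mseries\<close> works with plain coefficients.\<close>

lemma scrA_coeffs_iff:
  fixes f :: "real^'n::finite => 'b::banach"
  assumes "0 < r"
  shows "scrA_coeffs r f c \<longleftrightarrow> mconv r (%al. c al /\<^sub>R mfact al) \<and> (\<forall>t\<in>ball 0 r. f t = mseries (%al. c al /\<^sub>R mfact al) t)"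
proof -
  have conv: "(%al. norm (c al) / mfact al * r ^ mabs al) summable_on UNIV \<longleftrightarrow> mconv r (%al. c al /\<^sub>R mfact al)"
  proof -
    have "norm (c al) / mfact al * r ^ mabs al = r ^ mabs al * norm (c al /\<^sub>R mfact al)" for al
      using mfact_pos[of al] by (simp add: divide_inverse mult_ac)
    then show ?thesis by (simp add: mconv_def)
  qed
  have "((%al. (mpow t al / mfact al) *. c al) has_sum f t) UNIV \<longleftrightarrow> f t = mseries (%al. c al /\<^sub>R mfact al) t"
    if "mconv r (%al. c al /\<^sub>R mfact al)" "t \<in> ball 0 r" for t
  proof -
    have "t \<in> cube r"
      using that(2) ball_subset_open_cube open_cube_subset_cube by blast
    from mseries_has_sum[OF that(1) this]
    have "((%al. (mpow t al / mfact al) *. c al) has_sum mseries (%al. c al /\<^sub>R mfact al) t) UNIV"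
      by (simp add: divide_inverse)
    then show ?thesis
      by (auto dest: has_sum_unique)
  qed
  then show ?thesis
    unfolding scrA_coeffs_def conv by blast
qed

text \<open>Uniqueness of coefficients resolves the definite description in
  \<open>scrA_norm\<close>, so the norm can be read off from any series that represents the
  function.\<close>

lemma
  fixes f :: "real^'n::finite => 'b::banach"
  assumes r: "0 < r" and a: "mconv r a" and f: "!!t. t \<in> ball 0 r ==> f t = mseries a t"
  shows scrA_mseries: "f \<in> scrA r" and scrA_norm_mseries: "scrA_norm r f = mnorm r a"
proof -
  have inv: "(mfact al *. a al) /\<^sub>R mfact al = a al" for al
    using mfact_pos[of al] by simp
  have c: "scrA_coeffs r f (%al. mfact al *. a al)"
    unfolding scrA_coeffs_iff[OF r] inv using a f by blast
  have uniq: "c = (%al. mfact al *. a al)" if "scrA_coeffs r f c" for c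
  proof -
    have "mconv r (%al. c al /\<^sub>R mfact al)" "!!t. t \<in> ball 0 r ==> mseries (%al. c al /\<^sub>R mfact al) t = mseries a t"
      using that f unfolding scrA_coeffs_iff[OF r] by auto
    then have "(%al. c al /\<^sub>R mfact al) = a"
      using mseries_coeff_unique[OF _ a r r] by blast
    then have "c al /\<^sub>R mfact al = a al" for al
      by (rule fun_cong)
    then have "mfact al *. (c al /\<^sub>R mfact al) = mfact al *. a al" for al
      by simp
    moreover have "mfact al \<noteq> 0" for al :: "'n => nat"
      using mfact_pos[of al] by simp
    ultimately show ?thesis
      by (simp add: fun_eq_iff)
  qed
  have "bounded (f ` ball 0 r)"
  proof (rule boundedI)
    fix y assume "y \<in> f ` ball 0 r"
    then obtain t where t: "t \<in> ball 0 r" "y = mseries a t"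
      using f by auto
    then have "t \<in> cube r"
      using ball_subset_open_cube open_cube_subset_cube by blast
    then show "norm y <= mnorm r a"
      unfolding t(2) by (rule norm_mseries_le[OF a])
  qed
  moreover have "continuous_on (ball 0 r) f"
  proof -
    have "continuous_on (ball 0 r) (mseries a)"
      using mseries_has_derivative[OF a] ball_subset_open_cube
      by (intro has_derivative_continuous_on) (blast intro: has_derivative_at_withinI)
    then show ?thesis
      by (rule continuous_on_eq) (simp add: f)
  qed
  ultimately show "f \<in> scrA r"
    using c by (auto simp: scrA_def)
  have "(THE c. scrA_coeffs r f c) = (%al. mfact al *. a al)"
    using c uniq by (rule the_equality)
  then have "norm ((THE c. scrA_coeffs r f c) al) / mfact al * r ^ mabs al = r ^ mabs al * norm (a al)" for al
    using mfact_pos[of al] by simp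
  then show "scrA_norm r f = mnorm r a"
    by (simp add: scrA_norm_def mnorm_def)
qed

lemma mconv_vec:
  fixes a :: "'m::finite => ('n::finite => nat) => real"
  assumes a: "!!i. mconv r (a i)" and r: "0 <= r"
  shows "mconv r (%al. \<chi> i. a i al)" "mnorm r (%al. \<chi> i. a i al) <= (\<Sum>.i. mnorm r (a i))"
    and "!!u. u \<in> cube r ==> mseries (%al. \<chi> i. a i al) u = (\<chi> i. mseries (a i) u)"
proof -
  have hs: "((%al. \<Sum>.i. r ^ mabs al * norm (a i al)) has_sum (\<Sum>.i. mnorm r (a i))) UNIV"
    using a by (intro has_sum_finite_sum) (auto simp: mnorm_def mconv_def)
  have le: "r ^ mabs al * norm (\<chi> i. a i al) <= (\<Sum>.i. r ^ mabs al * norm (a i al))" for al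
    unfolding sum_distrib_left[symmetric] using r norm_le_l1_cart[of "\<chi> i. a i al"]
    by (intro mult_left_mono) auto
  show conv: "mconv r (%al. \<chi> i. a i al)"
    unfolding mconv_def by (rule summable_on_comparison_test[OF has_sum_imp_summable[OF hs]]) (use le r in auto)
  then show "mnorm r (%al. \<chi> i. a i al) <= (\<Sum>.i. mnorm r (a i))"
    unfolding mnorm_def[of r "%al. \<chi> i. a i al"] mconv_def
    using has_sum_mono[OF has_sum_infsum hs le] by simp
  show "mseries (%al. \<chi> i. a i al) u = (\<chi> i. mseries (a i) u)" if u: "u \<in> cube r" for u
  proof (subst vec_eq_iff, rule allI)
    fix i
    have "((%al. (mpow u al *. (\<chi> i. a i al)) $ i) has_sum mseries (%al. \<chi> i. a i al) u $ i) UNIV"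
      by (rule has_sum_bounded_linear[OF bounded_linear_vec_nth mseries_has_sum[OF conv u]])
    then show "mseries (%al. \<chi> i. a i al) u $ i = (\<chi> i. mseries (a i) u) $ i"
      using mseries_has_sum[OF a u, of i] has_sum_unique by fastforce
  qed
qed

text \<open>Passes back from the unit cube to the variable t = \<eta> u; the weighted norm at radius
  \<eta> is the Wiener norm.\<close>

definition unscale :: "real => 'n::finite wiener => ('n => nat) => real" where
  "unscale \<eta> a al = wcoeff a al / \<eta> ^ mabs al"

lemma
  assumes "0 < \<eta>"
  shows mconv_unscale: "mconv \<eta> (unscale \<eta> a)" and mnorm_unscale: "mnorm \<eta> (unscale \<eta> a) = norm a"
    and mseries_unscale: "mseries (unscale \<eta> a) t = ev a ((1 / \<eta>) *. t)"
proof -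
  have "\<eta> ^ mabs al * norm (unscale \<eta> a al) = \<bar>wcoeff a al\<bar>" for al
    using assms by (simp add: unscale_def)
  then show "mconv \<eta> (unscale \<eta> a)" "mnorm \<eta> (unscale \<eta> a) = norm a"
    using wcoeff_summable[of a] by (simp_all add: mconv_def mnorm_def norm_wiener_eq)
  show "mseries (unscale \<eta> a) t = ev a ((1 / \<eta>) *. t)"
    unfolding ev_def mseries_def mpow_scaleR by (simp add: unscale_def power_one_over)
qed

lemma real_analytic_on_mseries:
  fixes a :: "('n::finite => nat) => 'b::banach"
  assumes a: "mconv R a" "0 < R" and S: "open S" "!!t. t \<in> S ==> t - t0 \<in> cube (R / 4)"
    and f: "!!t. t \<in> S ==> f t = mseries a (t - t0)"
  shows "real_analytic_on S f"
  unfolding real_analytic_on_def using mseries_C_omega[OF a S f] S(1) by blast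

text \<open>A quarter of the radius of convergence is what \<open>mseries_C_omega\<close> grants for
  analyticity; the norm is estimated by its value at the full radius \<eta>.\<close>

lemma vec_ev_power_series:
  fixes y :: "'m::finite => 'n::finite wiener"
  assumes \<eta>: "0 < \<eta>" and r: "0 < r" "r <= \<eta> / 4"
    and f: "!!t. t \<in> ball 0 r ==> f t = (\<chi> i. ev (y i) ((1 / \<eta>) *. t))"
  shows "f \<in> scrA r" "scrA_norm r f <= (\<Sum>.i. norm (y i))" "real_analytic_on (ball 0 r) f"
proof -
  let ?a = "%al. \<chi> i. unscale \<eta> (y i) al"
  note v = mconv_vec[of \<eta> "%i. unscale \<eta> (y i)", OF mconv_unscale[OF \<eta>]]
  have conv: "mconv \<eta> ?a" using v(1) \<eta> by simp
  have fa: "f t = mseries ?a t" if "t \<in> ball 0 r" for t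
  proof -
    have "t \<in> cube \<eta>"
      using that r \<eta> by (intro norm_le_in_cube) auto
    then show ?thesis
      using v(3)[of t] \<eta> f[OF that] by (simp add: mseries_unscale[OF \<eta>])
  qed
  have convr: "mconv r ?a" by (rule mconv_mono[OF conv]) (use r \<eta> in auto)
  show "f \<in> scrA r" by (rule scrA_mseries[OF r(1) convr fa])
  have "scrA_norm r f = mnorm r ?a" by (rule scrA_norm_mseries[OF r(1) convr fa])
  also have "\<dots> <= mnorm \<eta> ?a" by (rule mnorm_mono[OF conv]) (use r \<eta> in auto)
  also have "\<dots> <= (\<Sum>.i. norm (y i))"
    using v(2) \<eta> by (simp add: mnorm_unscale[OF \<eta>])
  finally show "scrA_norm r f <= (\<Sum>.i. norm (y i))" .
  show "real_analytic_on (ball 0 r) f"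
  proof (rule real_analytic_on_mseries[OF conv \<eta>, where ?t0.0 = 0])
    show "t - 0 \<in> cube (\<eta> / 4)" if "t \<in> ball 0 r" for t
      using that r by (intro norm_le_in_cube) auto
  qed (use fa in auto)
qed

lemma complex_ev_power_series:
  fixes p :: "'n::finite wiener"
  assumes \<eta>: "0 < \<eta>" and r: "0 < r" "r <= \<eta>"
    and f: "!!t. t \<in> ball 0 r ==> f t = complex_of_real (c * ev p ((1 / \<eta>) *. t))"
  shows "f \<in> scrA r" "scrA_norm r f <= \<bar>c\<bar> * norm p"
proof -
  let ?a = "%al. complex_of_real (c * unscale \<eta> p al)"
  have eq: "\<eta> ^ mabs al * norm (?a al) = \<bar>c\<bar> * (\<eta> ^ mabs al * norm (unscale \<eta> p al))" for al
    by (simp add: norm_mult)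
  have conv: "mconv \<eta> ?a"
    unfolding mconv_def eq using mconv_unscale[OF \<eta>, of p] by (intro summable_on_cmult_right) (simp add: mconv_def)
  have norm: "mnorm \<eta> ?a = \<bar>c\<bar> * norm p"
    unfolding mnorm_def eq mnorm_unscale[OF \<eta>, of p, symmetric] using mconv_unscale[OF \<eta>, of p]
    by (intro infsum_cmult_right) (simp add: mconv_def)
  have fa: "f t = mseries ?a t" if t: "t \<in> ball 0 r" for t
  proof -
    have "t \<in> cube \<eta>"
      using t r \<eta> by (intro norm_le_in_cube) auto
    from mseries_has_sum[OF mconv_unscale[OF \<eta>] this, of p]
    have "((%al. complex_of_real (c * (mpow t al * unscale \<eta> p al))) has_sum complex_of_real (c * mseries (unscale \<eta> p) t)) UNIV"
      by (intro has_sum_of_real has_sum_cmult_right) simp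
    moreover have "(%al. complex_of_real (c * (mpow t al * unscale \<eta> p al))) = (%al. mpow t al *. ?a al)"
      by (simp add: fun_eq_iff scaleR_conv_of_real mult_ac)
    ultimately show ?thesis
      using mseries_has_sum[OF conv \<open>t \<in> cube \<eta>\<close>] f[OF t] has_sum_unique
      by (simp add: mseries_unscale[OF \<eta>]) blast
  qed
  have convr: "mconv r ?a" by (rule mconv_mono[OF conv]) (use r \<eta> in auto)
  show "f \<in> scrA r" by (rule scrA_mseries[OF r(1) convr fa])
  have "scrA_norm r f = mnorm r ?a" by (rule scrA_norm_mseries[OF r(1) convr fa])
  also have "\<dots> <= mnorm \<eta> ?a" by (rule mnorm_mono[OF conv]) (use r \<eta> in auto)
  finally show "scrA_norm r f <= \<bar>c\<bar> * norm p" unfolding norm .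
qed

context scaled_frame
begin

subsection \<open>Exponential coordinates in the original scale\<close>

definition us :: "real^'n => real^'n" where "us t = (1 / \<eta>) *. t"

definition E :: "real^'n => real^'n" where "E t = pt (us t)"

lemma us_in: "norm t <= \<eta> ==> us t \<in> cube 1" "norm t <= \<eta> / 2 ==> us t \<in> cube (1 / 2)"
  using eta by (auto simp: us_def divide_simps mult.commute intro!: norm_le_in_cube)

lemma E_curve:
  assumes t: "norm t <= \<eta>" and s: "s \<in> {0..1}"
  shows "((%s. E (s *. t)) has_vector_derivative (\<Sum>.i. t $ i *. Z (k i) (E (s *. t)))) (at s within {0..1})"
proof -
  have "us (s *. t) = s *. us t" for s by (simp add: us_def)
  moreover have "\<eta> *. field (us t) y = (\<Sum>.i. t $ i *. Z (k i) y)" for y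
    using eta by (simp add: field_def us_def scaleR_sum_right)
  ultimately show ?thesis
    using pt_ray_derivative[OF us_in(1)[OF t] s] by (simp add: E_def)
qed

lemma E_in: "norm t <= \<eta> ==> E t \<in> \<Omega>"
  unfolding E_def by (intro pt_in us_in)

lemma E_0: "E 0 = x"
  by (simp add: E_def us_def pt_0)

lemma E_is_exp:
  assumes t: "norm t <= \<eta>"
  shows "is_exp \<Omega> (%y. \<Sum>.i. t $ i *. Z (k i) y) x (E t)"
  unfolding is_exp_def
proof (intro exI[of _ "%s. E (s *. t)"] conjI ballI)
  fix s :: real assume s: "s \<in> {0..1}"
  then have "norm (s *. t) <= 1 * \<eta>"
    unfolding norm_scaleR using t by (intro mult_mono) auto
  then show "E (s *. t) \<in> \<Omega>" using E_in by simp
  show "((%s. E (s *. t)) has_vector_derivative (\<Sum>.i. t $ i *. Z (k i) (E (s *. t)))) (at s within {0..1})"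
    by (rule E_curve[OF t s])
qed (auto simp: E_0)

text \<open>From here on vectors are rows and matrices act on them from the right: row
  \<open>i\<close> of \<open>Vt t\<close> is V_i at \<open>E t\<close>, and
  \<open>Gt t ** Vt t\<close> is the differential of \<open>E\<close>.\<close>

definition Gt :: "real^'n => real^'n^'n" where "Gt t = (\<chi> i j. ev (G i j) (us t))"
definition Ht :: "real^'n => real^'n^'n" where "Ht t = (\<chi> i j. ev (H i j) (us t))"
definition Ut :: "real^'n => real^'n^'n" where "Ut t = (\<chi> i j. ev (U i j) (us t))"
definition At :: "real^'n => real^'n^'n" where "At t = (\<chi> i j. ev (A i j) (us t))"
definition Vt :: "real^'n => real^'n^'n" where "Vt t = (\<chi> i. Z (k i) (E t))"
definition bt :: "'q => real^'n => real^'n" where "bt l t = (\<chi> j. ev (b l j) (us t))"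

definition dE :: "real^'n => real^'n => real^'n" where "dE t h = h v* (Gt t ** Vt t)"

lemma E_has_derivative:
  assumes t: "norm t <= \<eta> / 2"
  shows "(E has_derivative dE t) (at t)"
proof -
  have "(us has_derivative us) (at t)"
    unfolding us_def[abs_def] by (intro has_derivative_scaleR_right has_derivative_ident)
  from diff_chain_at[OF this pt_has_derivative_pd[OF us_in(2)[OF t]]]
  have "(E has_derivative (%h. \<Sum>.i. us h $ i *. pd i (us t))) (at t)"
    by (simp add: comp_def E_def[abs_def])
  moreover have "(\<Sum>.i. us h $ i *. pd i (us t)) = dE t h" for h
  proof -
    have "(\<Sum>.i. us h $ i *. pd i (us t)) = (\<Sum>.i. h $ i *. (\<Sum>.j. ev (G i j) (us t) *. Z (k j) (E t)))"
    proof (rule sum.cong[OF refl])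
      fix i
      have "us h $ i * \<eta> = h $ i" using eta by (simp add: us_def)
      then show "us h $ i *. pd i (us t) = h $ i *. (\<Sum>.j. ev (G i j) (us t) *. Z (k j) (E t))"
        by (simp add: pd_eq[OF us_in(2)[OF t]] E_def)
    qed
    then show ?thesis
      by (simp add: vec_eq_iff dE_def vector_matrix_mult_def matrix_matrix_mult_def Gt_def Vt_def)
  qed
  ultimately show ?thesis by simp
qed

lemma Vt_eq:
  assumes t: "norm t <= \<eta>"
  shows "Vt t = Ht t ** V0 ** Ut t"
proof -
  have "Vt t $ i = (Ht t ** V0 ** Ut t) $ i" for i
  proof -
    have "Vt t $ i = (\<Sum>.j. \<Sum>.a. (Ht t $ i $ j * V0 $ j $ a) *. Ut t $ a)"
      using V_pt[OF us_in(1)[OF t], of i]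
      by (simp add: Vt_def E_def yv_def Uv_def Ht_def V0_def Ut_def scaleR_sum_right)
    also have "\<dots> = (\<Sum>.a. \<Sum>.j. (Ht t $ i $ j * V0 $ j $ a) *. Ut t $ a)"
      by (rule sum.swap)
    also have "\<dots> = (Ht t ** V0 ** Ut t) $ i"
      by (simp add: vec_eq_iff matrix_matrix_mult_def sum_distrib_right)
    finally show ?thesis .
  qed
  then show ?thesis by (simp add: vec_eq_iff)
qed

lemma near_identity_ev:
  assumes "norm t <= \<eta>" and M: "!!i j. norm (M i j - (if i = j then 1 else 0)) <= c"
  shows "\<bar>(\<chi> i j. ev (M i j) (us t)) $ i $ j - mat 1 $ i $ j\<bar> <= c"
proof -
  have "\<bar>ev (M i j - (if i = j then 1 else 0)) (us t)\<bar> <= c"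
    using abs_ev_le[OF us_in(1)[OF assms(1)]] M order_trans by blast
  then show ?thesis
    by (simp add: ev_diff[OF us_in(1)[OF assms(1)]] mat_def ev_one ev_zero us_in(1)[OF assms(1)] split: if_splits)
qed

lemma eps_le_2T: "\<epsilon> <= 2 * T * \<epsilon>"
  using T_ge_1 eps(1) by (simp add: mult_le_cancel_right1)

lemma det_bounds:
  assumes t: "norm t <= \<eta>"
  shows "1 / 2 <= det (Gt t)" "det (Gt t) <= 2" "1 / 2 <= det (Ht t)" "det (Ht t) <= 2"
    "1 / 2 <= det (Ut t)" "det (Ut t) <= 2" "1 / 2 <= det (At t)" "det (At t) <= 2"
  using eps_det[of "Gt t"] eps_det[of "Ht t"] eps_det[of "Ut t"] eps_det[of "At t"]
    order_trans[OF near_identity_ev[OF t G_near] eps_le_2T] order_trans[OF near_identity_ev[OF t H_near] eps_le_2T]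
    order_trans[OF near_identity_ev[OF t U_near] eps_le_2T] near_identity_ev[OF t A_near]
  unfolding Gt_def Ht_def Ut_def At_def by blast+

lemma det_V0_nz: "det V0 \<noteq> 0"
  using frame_det by (simp add: det_V0)

text \<open>The Jacobian of \<open>E\<close> relative to \<open>det V0\<close>. Each of the three
  determinants lies between 1/2 and 2, hence the bounds 1/8 and 8; as an element of the algebra it
  also carries the power series bound on the density.\<close>

definition P :: "'n wiener" where
  "P = det (\<chi> i j. G i j) * det (\<chi> i j. H i j) * det (\<chi> i j. U i j)"

lemma ev_P: "norm t <= \<eta> ==> ev P (us t) = det (Gt t) * det (Ht t) * det (Ut t)"
  using us_in(1)[of t] by (simp add: P_def ev_mult ev_det Gt_def Ht_def Ut_def)

lemma ev_P_bounds:
  assumes "norm t <= \<eta>"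
  shows "1 / 8 <= ev P (us t)" "ev P (us t) <= 8"
proof -
  note d = det_bounds[OF assms]
  have "1 / 2 * (1 / 2) * (1 / 2) <= det (Gt t) * det (Ht t) * det (Ut t)"
    using d by (intro mult_mono mult_nonneg_nonneg) linarith+
  then show "1 / 8 <= ev P (us t)" using ev_P[OF assms] by simp
  have "det (Gt t) * det (Ht t) * det (Ut t) <= 2 * 2 * 2"
    using d by (intro mult_mono mult_nonneg_nonneg) linarith+
  then show "ev P (us t) <= 8" using ev_P[OF assms] by simp
qed

lemma norm_P: "norm P <= (fact CARD('n) * 2 ^ CARD('n)) ^ 3"
proof -
  have "norm (M i j) <= 2" if "norm (M i j - (if i = j then 1 else 0)) <= \<epsilon>" for M :: "'n => 'n => 'n wiener" and i j
    using norm_triangle_ineq[of "M i j - (if i = j then 1 else 0)" "if i = j then 1 else 0"] that eps_le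
    by (auto split: if_splits)
  then have "norm (det (\<chi> i j. G i j)) <= fact CARD('n) * 2 ^ CARD('n)"
    "norm (det (\<chi> i j. H i j)) <= fact CARD('n) * 2 ^ CARD('n)"
    "norm (det (\<chi> i j. U i j)) <= fact CARD('n) * 2 ^ CARD('n)"
    using G_near H_near U_near by (auto intro!: norm_det_wiener_le)
  then have "norm P <= (fact CARD('n) * 2 ^ CARD('n)) * (fact CARD('n) * 2 ^ CARD('n)) * (fact CARD('n) * 2 ^ CARD('n))"
    unfolding P_def by (intro norm_mult_le)
  then show ?thesis by (simp add: power_numeral_reduce)
qed

lemma det_dE:
  assumes t: "norm t <= \<eta>"
  shows "det (Gt t ** Vt t) = det V0 * ev P (us t)"
  by (simp add: Vt_eq[OF t] det_mul ev_P[OF t] mult_ac)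

lemma bij_dE:
  assumes t: "norm t <= \<eta>"
  shows "bij (dE t)"
proof -
  have "det (Gt t ** Vt t) \<noteq> 0"
    using det_dE[OF t] det_V0_nz ev_P_bounds[OF t] by simp
  then have "invertible (transpose (Gt t ** Vt t))"
    by (simp add: invertible_det_nz)
  then have "bij ((*v) (transpose (Gt t ** Vt t)))"
    using invertible_eq_bij by blast
  moreover have "(*v) (transpose (Gt t ** Vt t)) = dE t"
    by (simp add: fun_eq_iff dE_def transpose_matrix_vector)
  ultimately show ?thesis by simp
qed

text \<open>Pulling back Z_l = b V by a differential with matrix G V gives b times the inverse of G,
  that is b A: the frame cancels, and with it its degeneracy.\<close>

definition yc :: "'q => 'n => 'n wiener" where "yc l i = (\<Sum>.j. b l j * A j i)"

definition Yt :: "'q => real^'n => real^'n" where "Yt l t = (\<chi> i. ev (yc l i) (us t))"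

lemma norm_A: "norm (A i j) <= 2"
  using norm_triangle_ineq[of "A i j - (if i = j then 1 else 0)" "if i = j then 1 else 0"] A_near[of i j]
    eps_bound[of 2 1] by (auto split: if_splits)

lemma norm_yc: "norm (yc l i) <= T * (2 * 2)"
  unfolding yc_def by (intro norm_sum_n_le norm_mult_le norm_b norm_A)

lemma At_Gt:
  assumes "norm t <= \<eta>"
  shows "At t ** Gt t = mat 1" "Gt t ** At t = mat 1"
proof -
  note u = us_in(1)[OF assms]
  have "(\<Sum>.l. ev (A i l) (us t) * ev (G l j) (us t)) = (if i = j then 1 else 0)" for i j
    using arg_cong[OF A_mult_G[of i j], of "%a. ev a (us t)"]
    by (simp add: ev_sum ev_mult u ev_one ev_zero split: if_splits)
  then show *: "At t ** Gt t = mat 1"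
    by (simp add: vec_eq_iff matrix_matrix_mult_def At_def Gt_def mat_def)
  then show "Gt t ** At t = mat 1"
    by (simp add: matrix_left_right_inverse)
qed

lemma dE_Yt:
  assumes t: "norm t <= \<eta>"
  shows "dE t (Yt l t) = Z l (E t)"
proof -
  have "Yt l t = bt l t v* At t"
    by (simp add: Yt_def bt_def At_def yc_def vec_eq_iff vector_matrix_mult_def ev_sum ev_mult us_in(1)[OF t] mult.commute)
  then have "dE t (Yt l t) = bt l t v* (At t ** Gt t ** Vt t)"
    by (simp add: dE_def vector_matrix_mul_assoc matrix_mul_assoc)
  also have "\<dots> = bt l t v* Vt t"
    by (simp add: At_Gt(1)[OF t])
  also have "\<dots> = Z l (E t)"
    using Z_frame[OF us_in(1)[OF t], of l]
    by (simp add: vec_eq_iff vector_matrix_mult_def bt_def Vt_def E_def mult.commute)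
  finally show ?thesis .
qed

lemma pullback_E:
  assumes t: "norm t <= \<eta> / 2"
  shows "pullback_vf E (Z l) t = Yt l t"
proof -
  have t1: "norm t <= \<eta>" using t eta by simp
  have "frechet_derivative E (at t) = dE t"
    using frechet_derivative_at[OF E_has_derivative[OF t]] by simp
  then show ?thesis
    unfolding pullback_vf_def dE_Yt[OF t1, symmetric]
    using bij_dE[OF t1] by (simp add: inv_f_f bij_is_inj)
qed

text \<open>Both vectors have the image V_i under the injective \<open>dE t\<close>. So the pulled
  back frame forms the matrix \<open>At\<close>, which is near the identity; this gives the uniform
  spanning.\<close>

lemma Yt_frame:
  assumes t: "norm t <= \<eta>"
  shows "Yt (k i) t = At t $ i"
proof -
  have "dE t (At t $ i) = Z (k i) (E t)"
  proof -
    have "At t $ i = axis i 1 v* At t"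
      by (simp add: vec_eq_iff vector_matrix_mult_def axis_def if_distrib[of "%c. c * _"] cong: if_cong)
    then have "dE t (At t $ i) = axis i 1 v* (At t ** Gt t ** Vt t)"
      by (simp add: dE_def vector_matrix_mul_assoc matrix_mul_assoc)
    also have "\<dots> = Z (k i) (E t)"
      by (simp add: At_Gt(1)[OF t] vec_eq_iff vector_matrix_mult_def Vt_def axis_def if_distrib[of "%c. c * _"] cong: if_cong)
    finally show ?thesis .
  qed
  then show ?thesis
    using dE_Yt[OF t, of "k i"] bij_dE[OF t] by (metis bij_is_inj injD)
qed

lemma density_E:
  assumes t: "norm t <= \<eta> / 2"
  shows "density_function (pullback_density E leb_density) t = \<bar>det V0\<bar> * ev P (us t)"
proof -
  have t1: "norm t <= \<eta>" using t eta by simp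
  have fd: "frechet_derivative E (at t) = dE t"
    using frechet_derivative_at[OF E_has_derivative[OF t]] by simp
  have eq: "pullback_density E leb_density t v = (\<bar>det V0\<bar> * ev P (us t)) * leb_density t v" for v
  proof -
    define W where "W = Gt t ** Vt t"
    have "mat_of_cols (%c. dE t (v c)) = transpose W ** mat_of_cols v"
      unfolding dE_def W_def[symmetric]
      by (simp add: vec_eq_iff mat_of_cols_def vector_matrix_mult_def matrix_matrix_mult_def transpose_def mult.commute)
    then have "mat_of_cols (%c. dE t (v c)) = transpose (Gt t ** Vt t) ** mat_of_cols v"
      by (simp add: W_def)
    then have "\<bar>det (mat_of_cols (%c. dE t (v c)))\<bar> = \<bar>det V0 * ev P (us t)\<bar> * \<bar>det (mat_of_cols v)\<bar>"
      by (simp only: det_mul[of "transpose (Gt t ** Vt t)"] det_transpose det_dE[OF t1] abs_mult)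
    then show ?thesis
      using ev_P_bounds[OF t1] by (simp add: pullback_density_def leb_density_def fd abs_mult)
  qed
  \<comment> \<open>Testing on the standard basis makes the factor in
    \<open>density_function\<close> unique.\<close>
  have "leb_density t (%c. axis c 1) = 1"
  proof -
    have "mat_of_cols (%c. axis c 1 :: real^'n) = mat 1"
      by (simp add: vec_eq_iff mat_of_cols_def mat_def axis_def)
    then show ?thesis by (simp add: leb_density_def)
  qed
  then show ?thesis
    unfolding density_function_def eq by (intro the_equality) (auto dest: spec[of _ "%c. axis c 1"])
qed

end

subsection \<open>The real analytic inverse function theorem\<close>

definition quad_part :: "(('n::finite => nat) => real) => ('n => nat) => real" where
  "quad_part a al = (if 2 <= mabs al then a al else 0)"

abbreviation unit_index :: "'n => 'n::finite => nat" where
  "unit_index i \<equiv> (%_. 0)(i := 1)"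

lemma mabs_unit_index [simp]: "mabs (unit_index i) = 1"
  using mabs_upd[of "%_. 0" i 1] by (simp add: mabs_def)

lemma mabs_0 [simp]: "mabs (%_. 0) = 0"
  by (simp add: mabs_def)

lemma mabs_le_1_iff: "mabs al < 2 \<longleftrightarrow> al = (%_. 0) \<or> (\<exists>i. al = unit_index i)"
proof
  assume le: "mabs al < 2"
  show "al = (%_. 0) \<or> (\<exists>i. al = unit_index i)"
  proof (cases "\<exists>i. al i \<noteq> 0")
    case True
    then obtain i where i: "al i \<noteq> 0" by blast
    have "mabs (al(i := 0)) + al i = mabs al" using mabs_upd[of al i 0] by simp
    then have *: "mabs (al(i := 0)) = 0" "al i = 1" using le i by auto
    have "al j = unit_index i j" for j
      using le_mabs[of "al(i := 0)" j] * by (cases "j = i") auto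
    then have "al = unit_index i" by blast
    then show ?thesis by blast
  qed auto
qed (auto simp del: One_nat_def)

lemma mseries_quadratic_split:
  fixes a :: "('n::finite => nat) => real"
  assumes a: "mconv r a" and r: "0 <= r" and h: "h \<in> cube r"
  shows "mseries a h = a (%_. 0) + (\<Sum>.j. h $ j * a (unit_index j)) + mseries (quad_part a) h"
proof -
  have inj: "inj (unit_index :: 'n => _)"
  proof
    fix i j :: 'n assume "unit_index i = unit_index j"
    then have "unit_index i i = unit_index j i" by simp
    then show "i = j" by (auto split: if_splits)
  qed
  have q: "mconv r (quad_part a)"
    unfolding mconv_def
    by (rule summable_on_comparison_test[OF a[unfolded mconv_def]])
      (use r in \<open>auto simp: quad_part_def\<close>)
  define l where "l al = mpow h al * (a al - quad_part a al)" for al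
  have mu: "mpow h (unit_index j) = h $ j" for j
    unfolding mpow_def by (subst prod.remove[of _ j]) auto
  have fin: "{al::'n => nat. mabs al < 2} = insert (%_. 0) (range unit_index)"
    using mabs_le_1_iff by auto
  have "(%_. 0::nat) \<notin> range (unit_index :: 'n => _)"
    by (metis mabs_0 mabs_unit_index rangeE zero_neq_one)
  then have "(\<Sum>al | mabs al < 2. l al) = l (%_. 0) + (\<Sum>.j. l (unit_index j))"
    unfolding fin using inj by (subst sum.insert) (auto simp: sum.reindex)
  then have "(\<Sum>al | mabs al < 2. l al) = a (%_. 0) + (\<Sum>.j. h $ j * a (unit_index j))"
    by (simp add: l_def quad_part_def mu mpow_def[of _ "%_. 0"] del: One_nat_def)
  moreover have "(l has_sum (\<Sum>al | mabs al < 2. l al)) UNIV"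
    by (rule has_sum_finite_neutralI[of "{al. mabs al < 2}"]) (auto simp: finite_mabs_less l_def quad_part_def)
  ultimately have "(l has_sum (a (%_. 0) + (\<Sum>.j. h $ j * a (unit_index j)))) UNIV"
    by simp
  from has_sum_add[OF this mseries_has_sum[OF q h]]
  have "((%al. mpow h al *. a al) has_sum (a (%_. 0) + (\<Sum>.j. h $ j * a (unit_index j)) + mseries (quad_part a) h)) UNIV"
    by (simp add: l_def algebra_simps)
  then show ?thesis
    using mseries_has_sum[OF a h] has_sum_unique by blast
qed

lemma mnorm_quad_part_le:
  fixes a :: "('n::finite => nat) => real"
  assumes a: "mconv R a" and r: "0 < R" "0 <= r" "r <= R"
  shows "mconv r (quad_part a)" "mnorm r (quad_part a) <= (r / R)\<^sup>2 * mnorm R a"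
proof -
  have le: "r ^ mabs al * norm (quad_part a al) <= (r / R)\<^sup>2 * (R ^ mabs al * norm (a al))" for al
  proof (cases "2 <= mabs al")
    case True
    have "(r / R) ^ mabs al <= (r / R)\<^sup>2"
      using r True by (intro power_decreasing) auto
    then have "r ^ mabs al <= (r / R)\<^sup>2 * R ^ mabs al"
      using r by (simp add: power_divide divide_simps)
    then have "r ^ mabs al * norm (a al) <= (r / R)\<^sup>2 * R ^ mabs al * norm (a al)"
      by (rule mult_right_mono) simp
    then show ?thesis using True by (simp add: quad_part_def mult_ac)
  qed (use r in \<open>simp add: quad_part_def\<close>)
  have s: "(%al. (r / R)\<^sup>2 * (R ^ mabs al * norm (a al))) summable_on UNIV"
    using a by (intro summable_on_cmult_right) (simp add: mconv_def)
  show c: "mconv r (quad_part a)"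
    unfolding mconv_def by (rule summable_on_comparison_test[OF s]) (use le r in auto)
  have "mnorm r (quad_part a) <= (\<Sum>\<^sub>\<infinity>al. (r / R)\<^sup>2 * (R ^ mabs al * norm (a al)))"
    unfolding mnorm_def by (rule infsum_mono[OF c[unfolded mconv_def] s le])
  also have "\<dots> = (r / R)\<^sup>2 * mnorm R a"
    unfolding mnorm_def using a by (intro infsum_cmult_right) (simp add: mconv_def)
  finally show "mnorm r (quad_part a) <= (r / R)\<^sup>2 * mnorm R a" .
qed

text \<open>Solves f (t0 + r z) = f (t0) + \<kappa> u for z as a power series in u. Inverting the
  linear part gives a fixed point equation for z, contracting because the terms of degree at least
  two have size of order (r / R)^2, of which the division by r removes only one factor.\<close>

lemma local_analytic_inverse:
  fixes f :: "real^'n::finite => real^'n" and a :: "'n => ('n => nat) => real"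
  assumes R: "0 < R" and a: "!!i. mconv R (a i)"
    and f: "!!h. h \<in> cube R ==> f (t0 + h) = (\<chi> i. mseries (a i) h)"
    and inv: "M ** (\<chi> i j. a i (unit_index j)) = mat 1" "(\<chi> i j. a i (unit_index j)) ** M = mat 1"
  obtains r \<kappa> :: real and g :: "'n => 'n wiener" where "0 < \<kappa>" "!!u. u \<in> cube 1 ==>
      f (t0 + r *. (\<chi> i. ev (g i) u)) = f t0 + \<kappa> *. u" "!!i. ev (g i) 0 = 0"
proof -
  define n where "n = real CARD('n)"
  have n: "1 <= n" by (simp add: n_def Suc_le_eq)
  define m where "m = 1 + (\<Sum>.i. \<Sum>.j. \<bar>M $ i $ j\<bar>)"
  have m1: "1 <= m" by (simp add: m_def sum_nonneg)
  have m: "\<bar>M $ i $ j\<bar> <= m" for i j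
  proof -
    have "\<bar>M $ i $ j\<bar> <= (\<Sum>.j. \<bar>M $ i $ j\<bar>)" by (rule member_le_sum) auto
    also have "\<dots> <= (\<Sum>.i. \<Sum>.j. \<bar>M $ i $ j\<bar>)"
      by (rule member_le_sum) (auto intro: sum_nonneg)
    finally show ?thesis by (simp add: m_def)
  qed
  define c where "c = 1 + (\<Sum>.i. mnorm R (a i))"
  have c0: "0 <= (\<Sum>.i. mnorm R (a i))" using mnorm_nonneg[OF less_imp_le[OF R]] by (intro sum_nonneg) auto
  have c1: "1 <= c" using c0 by (simp add: c_def)
  have c: "mnorm R (a i) <= c" for i
  proof -
    have "mnorm R (a i) <= (\<Sum>.i. mnorm R (a i))"
      by (rule member_le_sum) (auto intro: mnorm_nonneg[OF less_imp_le[OF R]])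
    then show ?thesis by (simp add: c_def)
  qed
  \<comment> \<open>Chosen so that the nonlinear part, of norm
    \<open>n * m * c * r / R\<^sup>2\<close> after the division by \<open>r\<close>, is at most
    \<open>1 / (8 * n ^ 3)\<close>; this is also its Lipschitz constant, which beats the squared
    cardinality in \<open>family_fixpoint\<close>.\<close>
  define r where "r = min R (R\<^sup>2 / (8 * n ^ 4 * m * c))"
  have r: "0 < r" "r <= R" "r * (8 * n ^ 4 * m * c) <= R\<^sup>2"
    using R n m1 c1 by (auto simp: r_def min_def divide_simps split: if_splits)
  define q where "q i = wseries r (quad_part (a i))" for i
  have qc: "mconv r (quad_part (a i))" and qn: "norm (q i) <= (r / R)\<^sup>2 * c" for i
  proof -
    show 1: "mconv r (quad_part (a i))" using mnorm_quad_part_le[OF a R] r by simp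
    have "norm (q i) = mnorm r (quad_part (a i))"
      unfolding q_def by (rule norm_wseries[OF 1]) (use r in auto)
    also have "\<dots> <= (r / R)\<^sup>2 * mnorm R (a i)" using mnorm_quad_part_le[OF a R] r by simp
    also have "\<dots> <= (r / R)\<^sup>2 * c" by (intro mult_left_mono c) auto
    finally show "norm (q i) <= (r / R)\<^sup>2 * c" .
  qed
  define Q where "Q i = (\<Sum>.j. (M $ i $ j / r) *. q j)" for i
  have Qn: "norm (Q i) <= 1 / (8 * n ^ 3)" for i
  proof -
    have "norm (Q i) <= (\<Sum>j\<in>(UNIV::'n set). (m / r) * ((r / R)\<^sup>2 * c))"
      unfolding Q_def
    proof (rule sum_norm_le)
      fix j
      show "norm ((M $ i $ j / r) *. q j) <= (m / r) * ((r / R)\<^sup>2 * c)"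
        unfolding norm_scaleR using m[of i j] qn[of j] r m1 by (intro mult_mono) (auto simp: divide_right_mono)
    qed
    also have "\<dots> = n * m * c * r / R\<^sup>2"
      using r by (simp add: n_def power2_eq_square)
    also have "\<dots> <= 1 / (8 * n ^ 3)"
    proof -
      have "n * m * c * r * (8 * n ^ 3) <= 1 * R\<^sup>2"
        using r(3) by (simp add: power_numeral_reduce mult_ac)
      then show ?thesis using R n by (simp add: divide_simps)
    qed
    finally show ?thesis .
  qed
  \<comment> \<open>The linear part then has norm at most 1/8, so all iterates have entries of norm
    at most 1/2, as \<open>wcomp_lipschitz\<close> requires.\<close>
  define \<kappa> where "\<kappa> = r / (8 * n * m)"
  have \<kappa>: "0 < \<kappa>" using r n m1 by (simp add: \<kappa>_def)
  define G where "G i = (\<Sum>.j. (\<kappa> * M $ i $ j / r) *. wvar j)" for i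
  have Gn: "norm (G i) <= 1 / 4" for i
  proof -
    have "norm (G i) <= (\<Sum>j\<in>(UNIV::'n set). \<kappa> * m / r)"
      unfolding G_def
    proof (rule sum_norm_le)
      fix j
      show "norm ((\<kappa> * M $ i $ j / r) *. wvar j) <= \<kappa> * m / r"
        unfolding norm_scaleR norm_wvar using m[of i j] r \<kappa>
        by (simp add: abs_mult divide_right_mono mult_left_mono)
    qed
    also have "\<dots> = 1 / 8" using r n m1 by (simp add: \<kappa>_def n_def)
    finally show ?thesis by simp
  qed
  obtain g where g: "!!i. norm (g i - G i) <= 1 / 4" "(%v i. G i - wcomp (Q i) (\<chi> i. v i)) g = g"
  proof (rule family_fixpoint[of "1/4" "1 / (8 * n ^ 3)" G "%v i. G i - wcomp (Q i) (\<chi> i. v i)"])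
    show "1 / (8 * n ^ 3) * (real CARD('n))\<^sup>2 < 1"
      using n unfolding n_def[symmetric] by (simp add: power_numeral_reduce power2_eq_square divide_simps)
    fix v i
    assume v: "!!i. norm (v i - G i) <= 1 / 4"
    have "norm ((\<chi> i. v i) $ i) <= 1" for i
      using v[of i] Gn[of i] norm_triangle_ineq[of "v i - G i" "G i"] by simp
    from norm_wcomp_le[OF this, of "Q i"] Qn[of i]
    have "norm (wcomp (Q i) (\<chi> i. v i)) <= 1 / (8 * n ^ 3)" by linarith
    also have "\<dots> <= 1 / (8 * 1)" using n one_le_power[OF n, of 3] by (intro divide_left_mono) auto
    finally show "norm (G i - wcomp (Q i) (\<chi> i. v i) - G i) <= 1 / 4" by simp
  next
    fix v v' i
    assume v: "!!i. norm (v i - G i) <= 1 / 4" "!!i. norm (v' i - G i) <= 1 / 4"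
    have "norm ((\<chi> i. v i) $ i) <= 1 / 2" "norm ((\<chi> i. v' i) $ i) <= 1 / 2" for i
      using v(1)[of i] v(2)[of i] Gn[of i] norm_triangle_ineq[of "v i - G i" "G i"] norm_triangle_ineq[of "v' i - G i" "G i"]
      by simp_all
    from wcomp_lipschitz[OF this, of "Q i"]
    have "norm (wcomp (Q i) (\<chi> i. v i) - wcomp (Q i) (\<chi> i. v' i)) <= norm (Q i) * (\<Sum>.j. norm (v j - v' j))"
      by simp
    also have "\<dots> <= 1 / (8 * n ^ 3) * (\<Sum>.j. norm (v j - v' j))"
      by (intro mult_right_mono Qn sum_nonneg) auto
    finally show "norm (G i - wcomp (Q i) (\<chi> i. v i) - (G i - wcomp (Q i) (\<chi> i. v' i))) <= 1 / (8 * n ^ 3) * (\<Sum>.j. norm (v j - v' j))"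
      by (simp add: norm_minus_commute)
  qed (use n in auto)
  have gn: "norm ((\<chi> i. g i) $ i) <= 1" for i
    using g(1)[of i] Gn[of i] norm_triangle_ineq[of "g i - G i" "G i"] by simp
  have g_eq: "g i = G i - wcomp (Q i) (\<chi> i. g i)" for i
    using fun_cong[OF g(2), of i] by simp
  define z where "z u = (\<chi> i. ev (g i) u)" for u
  have zc: "z u \<in> cube 1" if "u \<in> cube 1" for u
    using ev_vec_in_cube[OF gn that] by (simp add: z_def)
  have z_eq: "r *. z u = M *v (\<kappa> *. u - (\<chi> i. mseries (quad_part (a i)) (r *. z u)))" if u: "u \<in> cube 1" for u
  proof (subst vec_eq_iff, rule allI)
    fix i
    have "ev (g i) u = ev (G i) u - ev (Q i) (z u)"
      using ev_wcomp[of "\<chi> i. g i" u "Q i", OF gn u] by (subst g_eq) (simp add: ev_diff u z_def)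
    also have "ev (Q i) (z u) = (\<Sum>.j. M $ i $ j / r * mseries (quad_part (a j)) (r *. z u))"
      unfolding Q_def using zc[OF u] r by (simp add: ev_sum ev_scaleR q_def ev_wseries[OF qc])
    also have "ev (G i) u = (\<Sum>.j. M $ i $ j / r * (\<kappa> * u $ j))"
      unfolding G_def by (simp add: ev_sum ev_scaleR u ev_wvar mult_ac)
    finally have "r * ev (g i) u = r * (\<Sum>.j. M $ i $ j / r * (\<kappa> * u $ j - mseries (quad_part (a j)) (r *. z u)))"
      by (simp add: right_diff_distrib sum_subtractf)
    also have "\<dots> = (\<Sum>.j. M $ i $ j * (\<kappa> * u $ j - mseries (quad_part (a j)) (r *. z u)))"
      unfolding sum_distrib_left using r by simp
    finally show "(r *. z u) $ i = (M *v (\<kappa> *. u - (\<chi> i. mseries (quad_part (a i)) (r *. z u)))) $ i"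
      by (simp add: z_def matrix_vector_mult_def)
  qed
  have a0: "f t0 = (\<chi> i. a i (%_. 0))"
    using f[of 0] R by (simp add: mseries_0)
  have main: "f (t0 + r *. z u) = f t0 + \<kappa> *. u" if u: "u \<in> cube 1" for u
  proof -
    let ?h = "r *. z u" and ?L = "\<chi> i j. a i (unit_index j)"
    have h: "?h \<in> cube R"
    proof -
      have "\<bar>r * z u $ i\<bar> <= R * 1" for i
        unfolding abs_mult using zc[OF u] r by (intro mult_mono) (auto simp: cube_def)
      then show ?thesis by (simp add: cube_def)
    qed
    have "?L *v ?h = (?L ** M) *v (\<kappa> *. u - (\<chi> i. mseries (quad_part (a i)) ?h))"
      by (subst z_eq[OF u]) (simp add: matrix_vector_mul_assoc)
    then have L: "?L *v ?h = \<kappa> *. u - (\<chi> i. mseries (quad_part (a i)) ?h)"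
      by (simp add: inv(2) del: One_nat_def)
    have "f (t0 + ?h) = f t0 + ?L *v ?h + (\<chi> i. mseries (quad_part (a i)) ?h)"
      unfolding f[OF h] a0
      by (simp add: vec_eq_iff matrix_vector_mult_def mseries_quadratic_split[OF a _ h] R less_imp_le mult_ac)
    then show ?thesis by (simp add: L del: One_nat_def)
  qed
  \<comment> \<open>The value of z at u = 0 is a fixed point of a contraction that fixes 0. Constant
    series make the Lipschitz estimate of the algebra available for points.\<close>
  have "ev (g i) 0 = 0" for i
  proof -
    have z0: "z 0 \<in> cube 1" by (rule zc) simp
    have gz: "ev (g i) 0 = - ev (Q i) (z 0)" for i
      using ev_wcomp[of "\<chi> i. g i" 0 "Q i", OF gn]
      by (subst g_eq) (simp add: ev_diff z_def G_def ev_sum ev_scaleR ev_wvar)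
    have half: "norm ((\<chi> i. (of_real (z 0 $ i) :: 'n wiener)) $ i) <= 1 / 2" for i
      using abs_ev_le[of 0 "g i"] g(1)[of i] Gn[of i] norm_triangle_ineq[of "g i - G i" "G i"] by (simp add: z_def)
    have half0: "norm ((\<chi> i. (0 :: 'n wiener)) $ i) <= 1 / 2" for i :: 'n by simp
    have q0: "ev (Q i) 0 = 0" for i
      unfolding Q_def by (simp add: ev_sum ev_scaleR)
        (simp add: q_def ev_at_0 wcoeff_wseries[OF qc] r less_imp_le quad_part_def)
    have "\<bar>z 0 $ i\<bar> <= 1 / (8 * n ^ 3) * (\<Sum>.j. \<bar>z 0 $ j\<bar>)" for i
    proof -
      let ?w = "\<chi> i. (of_real (z 0 $ i) :: 'n wiener)" and ?o = "\<chi> i. (0 :: 'n wiener)"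
      have e1: "ev (wcomp (Q i) ?w) 0 = ev (Q i) (z 0)"
      proof -
        have w1: "norm (?w $ i) <= 1" for i
          by (rule order_trans[OF half]) simp
        have "(\<chi> i. ev (?w $ i) 0) = z 0"
          by (simp add: vec_eq_iff ev_of_real)
        then show ?thesis
          using ev_wcomp[OF w1, of 0 "Q i"] by simp
      qed
      have e2: "ev (wcomp (Q i) ?o) 0 = 0"
        using ev_wcomp[of ?o 0 "Q i"] q0 by (simp add: ev_zero zero_vec_def[symmetric])
      have "\<bar>ev (wcomp (Q i) ?w - wcomp (Q i) ?o) 0\<bar> <= norm (Q i) * (\<Sum>.j. norm (?w $ j - ?o $ j))"
        by (rule order_trans[OF abs_ev_le wcomp_lipschitz[OF half half0]]) simp
      also have "\<dots> <= 1 / (8 * n ^ 3) * (\<Sum>.j. norm (?w $ j - ?o $ j))"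
        by (intro mult_right_mono Qn sum_nonneg) auto
      finally show ?thesis
        using gz[of i] e1 e2 by (simp add: ev_diff z_def)
    qed
    then have "(\<Sum>.i. \<bar>z 0 $ i\<bar>) <= (\<Sum>i\<in>(UNIV::'n set). 1 / (8 * n ^ 3) * (\<Sum>.j. \<bar>z 0 $ j\<bar>))"
      by (rule sum_mono)
    also have "\<dots> = (1 / (8 * n ^ 2)) * (\<Sum>.j. \<bar>z 0 $ j\<bar>)"
      using n by (simp add: n_def[symmetric] power_numeral_reduce)
    also have "\<dots> <= (1 / 8) * (\<Sum>.j. \<bar>z 0 $ j\<bar>)"
      using n one_le_power[OF n, of 2] by (intro mult_right_mono sum_nonneg) (auto simp: divide_simps)
    finally have "(\<Sum>.j. \<bar>z 0 $ j\<bar>) <= 0" by simp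
    then have "(\<Sum>.j. \<bar>z 0 $ j\<bar>) = 0" by (intro antisym sum_nonneg) auto
    then have "z 0 $ i = 0" by (simp add: sum_nonneg_eq_0_iff)
    then show ?thesis by (simp add: z_def)
  qed
  then show ?thesis
    using that[OF \<kappa>, of r g] main by (simp add: z_def)
qed


text \<open>One radius for all components, small enough for the cube to lie in a ball inside
  \<open>V\<close>; the ball supplies the segments that \<open>C_omega_taylor\<close> asks
  for.\<close>

lemma real_analytic_on_taylor:
  fixes f :: "real^'n::finite => real^'m::finite"
  assumes f: "real_analytic_on S f" and t0: "t0 \<in> S"
  obtains R a where "0 < R" "!!i. mconv R (a i)" "!!h. h \<in> cube R ==> f (t0 + h) = (\<chi> i. mseries (a i) h)"
proof -
  obtain V where V: "open V" "t0 \<in> V" "f \<in> C_omega V"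
    using f t0 unfolding real_analytic_on_def by blast
  have "\<exists>r a. 0 < r \<and> mconv r a \<and> (\<forall>h\<in>cube r. (\<forall>s. 0 <= s \<and> s <= 1 --> t0 + s *. h \<in> V) --> f (t0 + h) $ i = mseries a h)" for i
    using C_omega_taylor[OF V(1) C_omega_component[OF V(1,3), of i]] V(2) by metis
  then obtain r a where r: "!!i. 0 < r i" and a: "!!i. mconv (r i) (a i)"
    and fa: "!!i h. h \<in> cube (r i) ==> (!!s. 0 <= s ==> s <= 1 ==> t0 + s *. h \<in> V) ==> f (t0 + h) $ i = mseries (a i) h"
    by metis
  obtain e where e: "0 < e" "ball t0 e \<subseteq> V"
    using V openE by blast
  define n where "n = real CARD('n)"
  have n: "0 <= n" by (simp add: n_def)
  define R where "R = min (Min (range r)) (e / (2 * (n + 1)))"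
  have "0 < Min (range r)" using r by (subst Min_gr_iff) auto
  then have R: "0 < R" using e n by (simp add: R_def)
  have Rr: "R <= r i" for i
    unfolding R_def by (rule min.coboundedI1) (rule Min_le, auto)
  have seg: "t0 + s *. h \<in> V" if "h \<in> cube R" "0 <= s" "s <= 1" for s h
  proof -
    have "norm (s *. h) <= n * R"
      using norm_le_of_cube[OF scaleR_mem_cube[OF that]] by (simp add: n_def)
    also have "\<dots> <= n * (e / (2 * (n + 1)))"
      using n by (intro mult_left_mono) (auto simp: R_def)
    also have "\<dots> < e" using e n by (simp add: divide_simps)
    finally show ?thesis using e(2) by (auto simp: dist_norm subset_iff)
  qed
  show ?thesis
  proof (rule that[OF R])
    show "mconv R (a i)" for i by (rule mconv_mono[OF a]) (use R Rr in auto)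
    show "f (t0 + h) = (\<chi> i. mseries (a i) h)" if "h \<in> cube R" for h
    proof (subst vec_eq_iff, rule allI)
      fix i
      have "h \<in> cube (r i)" using that cube_mono[OF Rr] by blast
      then show "f (t0 + h) $ i = (\<chi> i. mseries (a i) h) $ i"
        using fa seg[OF that] by simp
    qed
  qed
qed

text \<open>Near each value there is an analytic local right inverse, which takes values in
  \<open>S\<close> by continuity; injectivity on \<open>S\<close> identifies it with
  \<open>inv_into\<close>. The same neighbourhoods show that the image is open.\<close>

theorem real_analytic_inverse:
  fixes f :: "real^'n::finite => real^'n"
  assumes S: "open S" and inj: "inj_on f S" and f: "real_analytic_on S f"
    and der: "!!t. t \<in> S ==> \<exists>f'. (f has_derivative f') (at t) \<and> bij f'"
  shows "open (f ` S)" "real_analytic_on (f ` S) (inv_into S f)"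
proof -
  have *: "\<exists>W. open W \<and> y0 \<in> W \<and> W \<subseteq> f ` S \<and> inv_into S f \<in> C_omega W" if y0: "y0 \<in> f ` S" for y0
  proof -
    obtain t0 where t0: "t0 \<in> S" "f t0 = y0" using y0 by auto
    obtain R a where R: "0 < R" and a: "!!i. mconv R (a i)"
      and fa: "!!h. h \<in> cube R ==> f (t0 + h) = (\<chi> i. mseries (a i) h)"
      using real_analytic_on_taylor[OF f t0(1)] by metis
    obtain f' where f': "(f has_derivative f') (at t0)" "bij f'" using der[OF t0(1)] by blast
    define L where "L = (\<chi> i j. a i (unit_index j))"
    have "f' = (*v) L"
    proof -
      have o: "t0 - t0 \<in> open_cube R" using R by (simp add: open_cube_def)
      have "((%t. \<chi> i. mseries (a i) (t - t0)) has_derivative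
          (%h. \<chi> i. \<Sum>.j. h $ j *. mseries (dcoeff j (a i)) (t0 - t0))) (at t0)"
        by (intro has_derivative_vec mseries_translate_has_derivative[OF a o])
      moreover have "(%h. \<chi> i. \<Sum>.j. h $ j *. mseries (dcoeff j (a i)) (t0 - t0)) = (*v) L"
        by (simp add: fun_eq_iff vec_eq_iff mseries_0 dcoeff_def L_def matrix_vector_mult_def mult.commute)
      ultimately have d: "((%t. \<chi> i. mseries (a i) (t - t0)) has_derivative (*v) L) (at t0)" by simp
      have "open ((%t. t - t0) -` open_cube R)"
        by (intro open_vimage continuous_intros open_open_cube)
      from has_derivative_transform_within_open[OF d this, of f]
      moreover have "(\<chi> i. mseries (a i) (t - t0)) = f t" if "t - t0 \<in> open_cube R" for t
        using that fa[of "t - t0"] open_cube_subset_cube[of R] by auto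
      ultimately have "(f has_derivative (*v) L) (at t0)"
        using o by auto
      then show ?thesis using f'(1) has_derivative_unique by blast
    qed
    then have "invertible L" using f'(2) invertible_eq_bij by blast
    then obtain M where M: "L ** M = mat 1" "M ** L = mat 1" by (auto simp: invertible_def)
    obtain r \<kappa> g where \<kappa>: "0 < \<kappa>" and g: "!!u. u \<in> cube 1 ==> f (t0 + r *. (\<chi> i. ev (g i) u)) = f t0 + \<kappa> *. u"
      and g0: "!!i. ev (g i) 0 = 0"
      using local_analytic_inverse[OF R a fa M(2)[unfolded L_def] M(1)[unfolded L_def]] by metis
    define G where "G i = of_real (t0 $ i) + r *. g i" for i
    define c where "c = (%al. \<chi> i. unscale \<kappa> (G i) al)"
    define \<psi> where "\<psi> y = mseries c (y - y0)" for y
    note cv = mconv_vec[of \<kappa> "%i. unscale \<kappa> (G i)", OF mconv_unscale[OF \<kappa>]]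
    have conv: "mconv \<kappa> c" using cv(1) \<kappa> by (simp add: c_def)
    have \<psi>_eq: "\<psi> y = t0 + r *. (\<chi> i. ev (g i) ((1 / \<kappa>) *. (y - y0)))" and f\<psi>: "f (\<psi> y) = y"
      if "y - y0 \<in> cube \<kappa>" for y
    proof -
      have u: "(1 / \<kappa>) *. (y - y0) \<in> cube 1"
        using that \<kappa> by (auto simp: cube_def abs_mult divide_simps)
      have "\<psi> y = (\<chi> i. mseries (unscale \<kappa> (G i)) (y - y0))"
        unfolding \<psi>_def c_def using cv(3) \<kappa> that by simp
      then show e: "\<psi> y = t0 + r *. (\<chi> i. ev (g i) ((1 / \<kappa>) *. (y - y0)))"
        using u by (simp add: vec_eq_iff mseries_unscale[OF \<kappa>] G_def ev_add ev_of_real ev_scaleR)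
      show "f (\<psi> y) = y"
        unfolding e using g[OF u] t0(2) \<kappa> by simp
    qed
    have \<psi>0: "\<psi> y0 = t0"
      using \<psi>_eq[of y0] \<kappa> g0 by (simp add: zero_vec_def[symmetric])
    have "isCont \<psi> y0"
      unfolding \<psi>_def[abs_def]
      by (rule has_derivative_continuous[OF mseries_translate_has_derivative[OF conv]]) (use \<kappa> in \<open>simp add: open_cube_def\<close>)
    then obtain W0 where W0: "open W0" "y0 \<in> W0" "\<forall>y\<in>W0. \<psi> y \<in> S"
      using S t0(1) \<psi>0 unfolding continuous_at_open by metis
    \<comment> \<open>A quarter of the radius of convergence, as \<open>mseries_C_omega\<close>
      requires.\<close>
    define W where "W = W0 \<inter> (%y. y - y0) -` open_cube (\<kappa> / 4)"
    have "open W"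
      unfolding W_def by (intro open_Int W0 open_vimage continuous_intros open_open_cube)
    moreover have "y0 \<in> W" using W0 \<kappa> by (simp add: W_def open_cube_def)
    moreover have W4: "y - y0 \<in> cube (\<kappa> / 4)" if "y \<in> W" for y
      using that open_cube_subset_cube[of "\<kappa> / 4"] by (auto simp: W_def)
    then have W1: "f (\<psi> y) = y" if "y \<in> W" for y
      using that f\<psi> cube_mono[of "\<kappa> / 4" \<kappa>] \<kappa> by (auto simp: subset_iff)
    have WS: "\<psi> y \<in> S" if "y \<in> W" for y
      using that W0 by (simp add: W_def)
    have "W \<subseteq> f ` S"
      using W1 WS by (metis image_eqI subsetI)
    moreover have "inv_into S f y = mseries c (y - y0)" if "y \<in> W" for y
      using inv_into_f_f[OF inj WS[OF that]] W1[OF that] by (simp add: \<psi>_def)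
    then have "inv_into S f \<in> C_omega W"
      using W4 by (intro mseries_C_omega[OF conv \<kappa> \<open>open W\<close>]) auto
    ultimately show ?thesis by blast
  qed
  show "open (f ` S)"
    by (subst open_subopen) (use * in blast)
  show "real_analytic_on (f ` S) (inv_into S f)"
    unfolding real_analytic_on_def using * by blast
qed

context scaled_frame
begin

subsection \<open>Injectivity of the exponential map\<close>

text \<open>Passing from components to the norm costs a factor \<open>T\<close>. With the 16, a
  curve whose components are at most \<open>5 * \<eta>1\<close> stays within norm
  \<open>\<eta> / 2\<close>, where the derivative of \<open>E\<close> is known.\<close>

definition \<eta>1 :: real where "\<eta>1 = \<eta> / (16 * T)"

lemma eta1_bounds: "0 < \<eta>1" "\<eta>1 <= \<eta> / 16" "T * \<eta>1 = \<eta> / 16"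
proof -
  show "0 < \<eta>1" "T * \<eta>1 = \<eta> / 16"
    using eta T_ge_1 by (auto simp: \<eta>1_def)
  show "\<eta>1 <= \<eta> / 16"
    using eta T_ge_1 by (simp add: \<eta>1_def divide_simps)
qed

text \<open>A boundary value problem: the curve t + s \<sigma> + d (s) is to follow the pulled back
  field of \<Sum> \<sigma>_i V_i from t to t + \<Delta>. The endpoint condition forces \<sigma> =
  \<Delta> - d (1), so only the correction d is unknown, the integral of \<sigma> (A - I) along the
  curve. The index type \<open>unit\<close> makes these power series in the single variable
  s.\<close>

definition curve_sigma :: "real^'n => ('n => unit wiener) => 'n => real" where
  "curve_sigma \<Delta> d i = \<Delta> $ i - ev (d i) (\<chi> _. 1)"

definition curve_c :: "real^'n => real^'n => ('n => unit wiener) => 'n => unit wiener" where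
  "curve_c t \<Delta> d i = of_real (t $ i) + curve_sigma \<Delta> d i *. wvar () + d i"

definition A' :: "'n => 'n => 'n wiener" where "A' i j = A i j - (if i = j then 1 else 0)"

definition curve_eqn :: "real^'n => real^'n => ('n => unit wiener) => 'n => unit wiener" where
  "curve_eqn t \<Delta> d j = wrad () (\<Sum>.i. curve_sigma \<Delta> d i *. wcomp (A' i j) (\<chi> m. (1 / \<eta>) *. curve_c t \<Delta> d m))"

lemma unit_cube: "(\<chi> _. 1) \<in> (cube 1 :: (real^unit) set)"
  by (simp add: cube_def)

text \<open>The correction is driven by A - I, of size \<open>2 * T * \<epsilon>\<close>, so the
  equation contracts on a ball of radius proportional to the norm of \<Delta>.\<close>

lemma curve_exists:
  assumes t: "norm t < \<eta>1" and \<Delta>: "norm \<Delta> < 2 * \<eta>1"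
  obtains d where "!!i. norm (d i) <= norm \<Delta> / 2" "curve_eqn t \<Delta> d = d"
proof -
  have T: "1 <= T" "0 < T" using T_ge_1 by auto
  have ti: "\<bar>t $ i\<bar> <= \<eta>1" and Di: "\<bar>\<Delta> $ i\<bar> <= norm \<Delta>" for i
    using component_le_norm_cart[of t i] component_le_norm_cart[of \<Delta> i] t by auto
  have sb: "\<bar>curve_sigma \<Delta> d i\<bar> <= 3 / 2 * norm \<Delta>" if "!!i. norm (d i - 0) <= norm \<Delta> / 2" for d i
    using abs_ev_le[OF unit_cube, of "d i"] that[of i, unfolded diff_zero] Di[of i]
    unfolding curve_sigma_def by linarith
  have cb: "norm ((\<chi> m. (1 / \<eta>) *. curve_c t \<Delta> d m) $ i) <= 1 / 2" if d: "!!i. norm (d i - 0) <= norm \<Delta> / 2" for d i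
  proof -
    have "norm (curve_c t \<Delta> d i) <= \<bar>t $ i\<bar> + \<bar>curve_sigma \<Delta> d i\<bar> + norm (d i)"
      unfolding curve_c_def
      by (rule order_trans[OF norm_triangle_ineq add_mono[OF order_trans[OF norm_triangle_ineq] order_refl]])
        (simp add: norm_wvar)
    also have "\<dots> <= \<eta>1 + 3 / 2 * (2 * \<eta>1) + \<eta>1"
      using ti[of i] sb[of d i, OF d] d[of i] \<Delta> by simp
    also have "\<dots> <= \<eta> / 2" using eta1_bounds(2) eta by simp
    finally show ?thesis using eta by (simp add: divide_simps)
  qed
  have A'n: "norm (A' i j) <= 2 * T * \<epsilon>" for i j
    unfolding A'_def by (rule A_near)
  have eT: "100 * T ^ 4 * \<epsilon> <= 1" "100 * T\<^sup>2 * \<epsilon> <= 1"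
    using eps_bound[of 100 4] eps_bound[of 100 2] by auto
  obtain d where d: "!!i. norm (d i - 0) <= norm \<Delta> / 2" "curve_eqn t \<Delta> d = d"
  proof (rule family_fixpoint[of "norm \<Delta> / 2" "4 * T\<^sup>2 * \<epsilon>" "%_. 0" "curve_eqn t \<Delta>"])
    have "4 * T\<^sup>2 * \<epsilon> * (real CARD('n))\<^sup>2 <= 4 * T\<^sup>2 * \<epsilon> * T\<^sup>2"
      using card_n T eps by (intro mult_left_mono power_mono) auto
    also have "\<dots> = 4 * T ^ 4 * \<epsilon>" by (simp add: power_numeral_reduce power2_eq_square)
    finally show "4 * T\<^sup>2 * \<epsilon> * (real CARD('n))\<^sup>2 < 1" using eT by linarith
  next
    fix d :: "'n => unit wiener" and j
    assume d: "!!i. norm (d i - 0) <= norm \<Delta> / 2"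
    have c1: "norm ((\<chi> m. (1 / \<eta>) *. curve_c t \<Delta> d m) $ i) <= 1" for i
      by (rule order_trans[OF cb[of d i, OF d]]) simp
    have "norm (curve_sigma \<Delta> d i *. wcomp (A' i j) (\<chi> m. (1 / \<eta>) *. curve_c t \<Delta> d m)) <= 3 / 2 * norm \<Delta> * (2 * T * \<epsilon>)" for i
      unfolding norm_scaleR using sb[of d i, OF d] order_trans[OF norm_wcomp_le[OF c1] A'n] by (intro mult_mono) auto
    from order_trans[OF norm_wrad_le norm_sum_n_le[OF this]]
    have "norm (curve_eqn t \<Delta> d j) <= T * (3 / 2 * norm \<Delta> * (2 * T * \<epsilon>))"
      by (simp add: curve_eqn_def)
    also have "\<dots> = (3 * T\<^sup>2 * \<epsilon>) * norm \<Delta>" by (simp add: power2_eq_square)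
    also have "\<dots> <= (1 / 2) * norm \<Delta>"
      using eT eps by (intro mult_right_mono) auto
    finally show "norm (curve_eqn t \<Delta> d j - 0) <= norm \<Delta> / 2" by simp
  next
    fix d d' :: "'n => unit wiener" and j
    assume d: "!!i. norm (d i - 0) <= norm \<Delta> / 2" "!!i. norm (d' i - 0) <= norm \<Delta> / 2"
    define D where "D = (\<Sum>.j. norm (d j - d' j))"
    have D0: "0 <= D" unfolding D_def by (intro sum_nonneg) auto
    have Dj: "norm (d j - d' j) <= D" for j
      unfolding D_def by (rule member_le_sum) auto
    let ?w = "%d. \<chi> m. (1 / \<eta>) *. curve_c t \<Delta> d m" and ?s = "curve_sigma \<Delta>"
    have cbd: "norm (?w d $ i) <= 1 / 2" "norm (?w d' $ i) <= 1 / 2" for i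
      by (rule cb[OF d(1)], rule cb[OF d(2)])
    have s: "\<bar>?s d i - ?s d' i\<bar> <= norm (d i - d' i)" for i
      using abs_ev_le[OF unit_cube, of "d i - d' i"] by (simp add: curve_sigma_def ev_diff[OF unit_cube] abs_minus_commute)
    have c: "norm (?w d $ m - ?w d' $ m) <= (1 / \<eta>) * (2 * norm (d m - d' m))" for m
    proof -
      have "curve_c t \<Delta> d m - curve_c t \<Delta> d' m = (?s d m - ?s d' m) *. wvar () + (d m - d' m)"
        by (simp add: curve_c_def algebra_simps)
      then have "norm (curve_c t \<Delta> d m - curve_c t \<Delta> d' m) <= 2 * norm (d m - d' m)"
        using norm_triangle_ineq[of "(?s d m - ?s d' m) *. wvar ()" "d m - d' m"] s[of m] by (simp add: norm_wvar)
      then show ?thesis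
        using eta by (simp flip: scaleR_diff_right add: divide_right_mono)
    qed
    have wl: "norm (wcomp (A' i j) (?w d) - wcomp (A' i j) (?w d')) <= 2 * T * \<epsilon> * ((1 / \<eta>) * (2 * D))" for i
    proof -
      have "(\<Sum>.m. norm (?w d $ m - ?w d' $ m)) <= (\<Sum>.m. (1 / \<eta>) * (2 * norm (d m - d' m)))"
        by (intro sum_mono c)
      also have "\<dots> = (1 / \<eta>) * (2 * D)" by (simp add: D_def sum_distrib_left)
      finally have "norm (A' i j) * (\<Sum>.m. norm (?w d $ m - ?w d' $ m)) <= 2 * T * \<epsilon> * ((1 / \<eta>) * (2 * D))"
        using A'n T eps by (intro mult_mono sum_nonneg) auto
      then show ?thesis
        using wcomp_lipschitz[OF cbd, of "A' i j"] by linarith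
    qed
    \<comment> \<open>The product rule gives two errors. In the second one the size of \<sigma>, a
      multiple of \<eta>, cancels the factor \<open>1 / \<eta>\<close> from rescaling the
      coordinates; summed over \<open>i\<close> they amount to 2 + 3/4 times
      \<open>T\<^sup>2 * \<epsilon> * D\<close>.\<close>
    have "norm (?s d i *. wcomp (A' i j) (?w d) - ?s d' i *. wcomp (A' i j) (?w d'))
        <= D * (2 * T * \<epsilon>) + (3 / 2 * (\<eta> / 8)) * (2 * T * \<epsilon> * ((1 / \<eta>) * (2 * D)))" for i
    proof -
      have eq: "?s d i *. wcomp (A' i j) (?w d) - ?s d' i *. wcomp (A' i j) (?w d')
          = (?s d i - ?s d' i) *. wcomp (A' i j) (?w d) + ?s d' i *. (wcomp (A' i j) (?w d) - wcomp (A' i j) (?w d'))"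
        by (simp add: algebra_simps)
      have "norm (?w d $ i) <= 1" for i by (rule order_trans[OF cbd(1)[of i]]) simp
      from order_trans[OF norm_wcomp_le[OF this] A'n]
      have "norm ((?s d i - ?s d' i) *. wcomp (A' i j) (?w d)) <= D * (2 * T * \<epsilon>)"
        unfolding norm_scaleR using D0 order_trans[OF s[of i] Dj[of i]] by (intro mult_mono) auto
      moreover have "\<bar>?s d' i\<bar> <= 3 / 2 * (\<eta> / 8)"
        using sb[of d' i, OF d(2)] \<Delta> eta1_bounds(2) by linarith
      then have "norm (?s d' i *. (wcomp (A' i j) (?w d) - wcomp (A' i j) (?w d'))) <= (3 / 2 * (\<eta> / 8)) * (2 * T * \<epsilon> * ((1 / \<eta>) * (2 * D)))"
        unfolding norm_scaleR using wl eta by (intro mult_mono) auto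
      ultimately show ?thesis
        unfolding eq by (rule norm_triangle_mono)
    qed
    then have "norm ((\<Sum>.i. ?s d i *. wcomp (A' i j) (?w d)) - (\<Sum>.i. ?s d' i *. wcomp (A' i j) (?w d')))
        <= T * (D * (2 * T * \<epsilon>) + (3 / 2 * (\<eta> / 8)) * (2 * T * \<epsilon> * ((1 / \<eta>) * (2 * D))))"
      unfolding sum_subtractf[symmetric] by (rule norm_sum_n_le)
    also have "\<dots> = 11 / 4 * T\<^sup>2 * \<epsilon> * D"
      using eta by (simp add: power2_eq_square field_simps)
    also have "\<dots> <= 4 * T\<^sup>2 * \<epsilon> * D"
      using D0 T eps by (intro mult_right_mono) auto
    finally show "norm (curve_eqn t \<Delta> d j - curve_eqn t \<Delta> d' j) <= 4 * T\<^sup>2 * \<epsilon> * (\<Sum>.j. norm (d j - d' j))"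
      unfolding curve_eqn_def linear_diff[OF linear_wrad, symmetric] D_def[symmetric]
      using norm_wrad_le order_trans by blast
  qed (use T eps in auto)
  show ?thesis
    by (rule that[of d]) (use d in auto)
qed


lemma curve_bounds:
  assumes t: "norm t < \<eta>1" and \<Delta>: "norm \<Delta> < 2 * \<eta>1" and d: "!!i. norm (d i) <= norm \<Delta> / 2"
  shows "\<bar>curve_sigma \<Delta> d i\<bar> <= 3 * \<eta>1" "norm (curve_c t \<Delta> d i) <= 5 * \<eta>1"
proof -
  have ti: "\<bar>t $ i\<bar> <= \<eta>1" and Di: "\<bar>\<Delta> $ i\<bar> <= norm \<Delta>"
    using component_le_norm_cart[of t i] component_le_norm_cart[of \<Delta> i] t by auto
  show s: "\<bar>curve_sigma \<Delta> d i\<bar> <= 3 * \<eta>1"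
    using abs_ev_le[OF unit_cube, of "d i"] d[of i] Di \<Delta> unfolding curve_sigma_def by linarith
  have "norm (curve_c t \<Delta> d i) <= \<bar>t $ i\<bar> + \<bar>curve_sigma \<Delta> d i\<bar> + norm (d i)"
    unfolding curve_c_def
    by (rule order_trans[OF norm_triangle_ineq add_mono[OF order_trans[OF norm_triangle_ineq] order_refl]])
      (simp add: norm_wvar)
  then show "norm (curve_c t \<Delta> d i) <= 5 * \<eta>1"
    using ti s d[of i] \<Delta> by simp
qed

lemma linear_dE: "linear (dE t)"
  unfolding dE_def by (rule linearI) (simp_all add: vec_eq_iff vector_matrix_mult_def sum.distrib algebra_simps sum_distrib_left)

lemma dE_frame:
  assumes t: "norm t <= \<eta>"
  shows "dE t (\<sigma> v* At t) = (\<Sum>.i. \<sigma> $ i *. Z (k i) (E t))"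
proof -
  have "\<sigma> v* At t = (\<Sum>.i. \<sigma> $ i *. (At t $ i))"
    by (simp add: vec_eq_iff vector_matrix_mult_def mult.commute)
  moreover have "dE t (At t $ i) = Z (k i) (E t)" for i
    by (simp add: dE_Yt[OF t] flip: Yt_frame[OF t])
  ultimately show ?thesis
    by (simp add: linear_sum[OF linear_dE] linear_scale[OF linear_dE])
qed

text \<open>A closed orbit of the constant coefficient field \<open>\<Sum>i. \<sigma> $ i *. Z (k i)\<close>, whose derivative is small in
  the original coordinates, must be stationary.\<close>

lemma inj_on_E: "inj_on E (ball 0 \<eta>1)"
proof (rule inj_onI)
  fix t1 t2 assume t1: "t1 \<in> ball 0 \<eta>1" and t2: "t2 \<in> ball 0 \<eta>1" and eq: "E t1 = E t2"
  define \<Delta> where "\<Delta> = t2 - t1"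
  have n1: "norm t1 < \<eta>1" and \<Delta>n: "norm \<Delta> < 2 * \<eta>1"
    using t1 t2 norm_triangle_ineq4[of t2 t1] by (auto simp: \<Delta>_def)
  obtain d where d: "!!i. norm (d i) <= norm \<Delta> / 2" "curve_eqn t1 \<Delta> d = d"
    using curve_exists[OF n1 \<Delta>n] by blast
  have cb: "\<bar>curve_sigma \<Delta> d i\<bar> <= 3 * \<eta>1" "norm (curve_c t1 \<Delta> d i) <= 5 * \<eta>1" for i
    using curve_bounds[of t1 \<Delta> d i, OF n1 \<Delta>n d(1)] by auto
  define one where "one = ((\<chi> _. 1) :: real^unit)"
  define \<sigma> where "\<sigma> = (\<chi> i. curve_sigma \<Delta> d i)"
  define \<gamma> where "\<gamma> s = (\<chi> j. ev (curve_c t1 \<Delta> d j) (s *. one))" for s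
  have one: "one \<in> cube 1" by (simp add: one_def cube_def)
  have so: "s *. one \<in> cube 1" if "s \<in> {0..1}" for s
    using scaleR_mem_cube[OF one] that by auto
  have \<gamma>n: "norm (\<gamma> s) <= \<eta> / 2" if "s \<in> {0..1}" for s
  proof -
    have "norm (\<gamma> s) <= (\<Sum>.j. \<bar>\<gamma> s $ j\<bar>)" by (rule norm_le_l1_cart)
    also have "\<dots> <= T * (5 * \<eta>1)"
    proof -
      have "norm (\<bar>\<gamma> s $ j\<bar>) <= 5 * \<eta>1" for j
        using order_trans[OF abs_ev_le[OF so[OF that]] cb(2)] by (simp add: \<gamma>_def)
      from norm_sum_n_le[OF this] show ?thesis by (simp add: sum_nonneg)
    qed
    also have "\<dots> <= \<eta> / 2" using eta1_bounds(3) eta by simp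
    finally show ?thesis .
  qed
  have \<gamma>n1: "norm (\<gamma> s) <= \<eta>" if "s \<in> {0..1}" for s
    using \<gamma>n[OF that] eta by simp
  have d_eq: "d j = wrad () (\<Sum>.i. curve_sigma \<Delta> d i *. wcomp (A' i j) (\<chi> m. (1 / \<eta>) *. curve_c t1 \<Delta> d m))" for j
    using fun_cong[OF d(2), of j] by (simp add: curve_eqn_def)
  have \<gamma>': "(\<gamma> has_vector_derivative \<sigma> v* At (\<gamma> s)) (at s within {0..1})" if s: "s \<in> {0..1}" for s
  proof -
    have nn: "norm ((\<chi> m. (1 / \<eta>) *. curve_c t1 \<Delta> d m) $ m) <= 1" for m
    proof -
      have "norm (curve_c t1 \<Delta> d m) <= \<eta>" using cb(2)[of m] eta1_bounds(2) eta by linarith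
      then show ?thesis using eta by (simp add: divide_simps)
    qed
    have "(\<chi> i. ev ((\<chi> m. (1 / \<eta>) *. curve_c t1 \<Delta> d m) $ i) (s *. one)) = us (\<gamma> s)"
      by (simp add: vec_eq_iff us_def \<gamma>_def ev_scaleR so[OF s])
    then have evK: "ev (\<Sum>.i. curve_sigma \<Delta> d i *. wcomp (A' i j) (\<chi> m. (1 / \<eta>) *. curve_c t1 \<Delta> d m)) (s *. one)
        = (\<Sum>.i. \<sigma> $ i * ev (A' i j) (us (\<gamma> s)))" for j
      using ev_wcomp[OF nn so[OF s]] by (simp add: ev_sum ev_scaleR so[OF s] \<sigma>_def)
    have "((%s. ev (d j) (s *. one)) has_vector_derivative (\<Sum>.i. \<sigma> $ i * ev (A' i j) (us (\<gamma> s)))) (at s within {0..1})" for j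
      unfolding evK[symmetric] using wrad_ray_derivative[OF one s, of "()"]
      by (subst (1) d_eq) (simp add: one_def)
    then have "((%s. t1 $ j + s * \<sigma> $ j + ev (d j) (s *. one)) has_vector_derivative
        0 + 1 * \<sigma> $ j + (\<Sum>.i. \<sigma> $ i * ev (A' i j) (us (\<gamma> s)))) (at s within {0..1})" for j
      by (intro has_vector_derivative_add has_vector_derivative_const has_vector_derivative_mult_left) auto
    moreover have "ev (curve_c t1 \<Delta> d j) (r *. one) = t1 $ j + r * \<sigma> $ j + ev (d j) (r *. one)" if "r \<in> {0..1}" for r j
      by (simp add: curve_c_def ev_add ev_of_real ev_scaleR ev_wvar so[OF that] \<sigma>_def) (simp add: one_def)
    ultimately have "((%s. ev (curve_c t1 \<Delta> d j) (s *. one)) has_vector_derivative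
        0 + 1 * \<sigma> $ j + (\<Sum>.i. \<sigma> $ i * ev (A' i j) (us (\<gamma> s)))) (at s within {0..1})" for j
      by (rule has_vector_derivative_transform[OF s, rotated])
    then have "(\<gamma> has_vector_derivative (\<chi> j. 0 + 1 * \<sigma> $ j + (\<Sum>.i. \<sigma> $ i * ev (A' i j) (us (\<gamma> s))))) (at s within {0..1})"
      unfolding \<gamma>_def[abs_def] by (rule has_vector_derivative_vec)
    moreover have "(\<chi> j. 0 + 1 * \<sigma> $ j + (\<Sum>.i. \<sigma> $ i * ev (A' i j) (us (\<gamma> s)))) = \<sigma> v* At (\<gamma> s)"
    proof -
      note u = us_in(1)[OF \<gamma>n1[OF s]]
      have "\<sigma> $ i * ev (A' i j) (us (\<gamma> s)) = \<sigma> $ i * ev (A i j) (us (\<gamma> s)) - (if i = j then \<sigma> $ i else 0)" for i j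
        by (simp add: A'_def ev_diff u ev_one ev_zero right_diff_distrib)
      then show ?thesis
        by (simp add: vec_eq_iff vector_matrix_mult_def At_def sum_subtractf mult.commute)
    qed
    ultimately show ?thesis by simp
  qed
  \<comment> \<open>The image of the curve under \<open>E\<close> is an orbit with velocity
    \<open>p\<close>. Since the field has a small derivative in the original coordinates,
    \<open>p\<close> changes little relative to its own size.\<close>
  define p where "p s = (\<Sum>.i. \<sigma> $ i *. Z (k i) (E (\<gamma> s)))" for s
  have q': "((%s. E (\<gamma> s)) has_vector_derivative p s) (at s within {0..1})" if s: "s \<in> {0..1}" for s
    using vector_derivative_diff_chain_within[OF \<gamma>'[OF s] has_derivative_at_withinI[OF E_has_derivative[OF \<gamma>n[OF s]]]]
    by (simp add: comp_def dE_frame[OF \<gamma>n1[OF s]] p_def)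
  define p' where "p' s = (\<Sum>.i. \<sigma> $ i *. dZp (k i) (us (\<gamma> s)) (p s))" for s
  have p': "(p has_vector_derivative p' s) (at s within {0..1})" if s: "s \<in> {0..1}" for s
  proof -
    have "((%s. Z (k i) (E (\<gamma> s))) has_vector_derivative dZp (k i) (us (\<gamma> s)) (p s)) (at s within {0..1})" for i
      using vector_derivative_diff_chain_within[OF q'[OF s], of "Z (k i)" "dZp (k i) (us (\<gamma> s))"]
        has_derivative_at_withinI[OF Z_pt_has_derivative[OF us_in(1)[OF \<gamma>n1[OF s]], of "k i"]]
      by (simp add: comp_def E_def)
    then have "((%s. \<Sum>.i. \<sigma> $ i *. Z (k i) (E (\<gamma> s))) has_vector_derivative p' s) (at s within {0..1})"
      unfolding p'_def
      by (intro has_vector_derivative_sum bounded_linear.has_vector_derivative[OF bounded_linear_scaleR_right])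
    then show ?thesis
      by (simp add: p_def[abs_def])
  qed
  have p'_le: "norm (p' s) <= 1 / 100 * norm (p s)" if s: "s \<in> {0..1}" for s
  proof -
    have "norm (\<sigma> $ i *. dZp (k i) (us (\<gamma> s)) (p s)) <= 3 * \<eta>1 * (2 * T ^ 4 * norm (p s))" for i
      unfolding norm_scaleR using cb(1)[of i] norm_dZp_le[OF us_in(1)[OF \<gamma>n1[OF s]]] eta1_bounds
      by (intro mult_mono) (auto simp: \<sigma>_def)
    then have "norm (p' s) <= T * (3 * \<eta>1 * (2 * T ^ 4 * norm (p s)))"
      unfolding p'_def by (rule norm_sum_n_le)
    also have "\<dots> = (6 * T ^ 4 * (T * \<eta>1)) * norm (p s)" by simp
    also have "\<dots> <= 1 / 100 * norm (p s)"
    proof (rule mult_right_mono)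
      have "6 * T ^ 4 * \<eta> <= \<epsilon>" by (rule eta_bound) auto
      then show "6 * T ^ 4 * (T * \<eta>1) <= 1 / 100" unfolding eta1_bounds(3) using eps_le eps by linarith
    qed simp
    finally show ?thesis .
  qed
  have cont: "continuous_on {0..1} p"
    using p' has_vector_derivative_continuous continuous_on_eq_continuous_within by blast
  obtain s0 where s0: "s0 \<in> {0..1}" "!!s. s \<in> {0..1} ==> norm (p s) <= norm (p s0)"
    using continuous_attains_sup[of "{0..1::real}" "%s. norm (p s)", OF _ _ continuous_on_norm[OF cont]] by force
  define m where "m = norm (p s0)"
  have pd: "norm (p s - p 0) <= m / 100" if s: "s \<in> {0..1}" for s
  proof -
    have "norm (p s - p 0) <= m / 100 * norm (s - 0)"
    proof (rule differentiable_bound[of "{0..1}"])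
      show "(p has_derivative (%h. h *. p' r)) (at r within {0..1})" if "r \<in> {0..1}" for r
        using p'[OF that] by (simp add: has_vector_derivative_def)
      show "onorm (%h. h *. p' r) <= m / 100" if "r \<in> {0..1}" for r
      proof (rule onorm_bound)
        have "norm (p' r) <= m / 100" using p'_le[OF that] s0(2)[OF that] by (simp add: m_def)
        then show "norm (h *. p' r) <= m / 100 * norm h" for h
          using mult_right_mono[of "norm (p' r)" "m / 100" "\<bar>h\<bar>"] by (simp add: mult.commute)
      qed (simp add: m_def)
    qed (use s in auto)
    also have "\<dots> <= m / 100 * 1" using s by (intro mult_left_mono) (auto simp: m_def)
    finally show ?thesis by simp
  qed
  \<comment> \<open>The orbit closes up, so its total displacement is zero; the displacement also
    differs from \<open>p 0\<close> by at most the oscillation m / 100. Hence \<open>p 0\<close> is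
    small too, and the maximal speed m is at most m / 50.\<close>
  have drift: "norm ((E (\<gamma> 1) - 1 *. p 0) - (E (\<gamma> 0) - 0 *. p 0)) <= m / 100 * norm (1 - 0 :: real)"
  proof (rule differentiable_bound[of "{0..1}" "%s. E (\<gamma> s) - s *. p 0"])
    show "((%s. E (\<gamma> s) - s *. p 0) has_derivative (%h. h *. (p r - p 0))) (at r within {0..1})" if "r \<in> {0..1}" for r
      unfolding scaleR_diff_right
      by (rule has_derivative_diff[OF q'[OF that, unfolded has_vector_derivative_def] has_derivative_scaleR_left[OF has_derivative_ident]])
    show "onorm (%h. h *. (p r - p 0)) <= m / 100" if "r \<in> {0..1}" for r
    proof (rule onorm_bound)
      show "norm (h *. (p r - p 0)) <= m / 100 * norm h" for h
        using mult_right_mono[OF pd[OF that], of "\<bar>h\<bar>"] by (simp add: mult.commute)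
    qed (simp add: m_def)
  qed auto
  have d0: "ev (d j) 0 = 0" for j
    by (subst d_eq) (rule ev_wrad_0)
  then have \<gamma>0: "\<gamma> 0 = t1"
    by (simp add: \<gamma>_def vec_eq_iff curve_c_def ev_add ev_of_real ev_scaleR ev_wvar)
  have \<gamma>1: "\<gamma> 1 = t2"
    by (simp add: \<gamma>_def vec_eq_iff curve_c_def ev_add ev_of_real ev_scaleR ev_wvar one)
      (simp add: curve_sigma_def one_def \<Delta>_def)
  have p0: "norm (p 0) <= m / 100" using drift eq \<gamma>0 \<gamma>1 by (simp add: norm_minus_commute)
  have "m <= norm (p s0 - p 0) + norm (p 0)"
    unfolding m_def using norm_triangle_ineq[of "p s0 - p 0" "p 0"] by simp
  also have "\<dots> <= m / 100 + m / 100" using pd[OF s0(1)] p0 by simp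
  finally have "norm (p 0) <= 0" using p0 by linarith
  then have "p 0 = 0" by simp
  then have "dE t1 (\<sigma> v* At t1) = dE t1 0"
    using dE_frame[of t1 \<sigma>] \<gamma>n1[of 0] \<gamma>0 by (simp add: p_def linear_0[OF linear_dE])
  then have "\<sigma> v* At t1 = 0"
    using bij_dE[of t1] \<gamma>n1[of 0] \<gamma>0 by (simp add: bij_def inj_eq)
  then have "\<sigma> v* (At t1 ** Gt t1) = 0"
    by (simp add: vector_matrix_mul_assoc[symmetric])
  then have "\<sigma> = 0" using At_Gt(1)[of t1] \<gamma>n1[of 0] \<gamma>0 by simp
  \<comment> \<open>With \<sigma> = 0 the correction d vanishes, and the endpoint condition leaves
    \<Delta> = 0.\<close>
  then have \<sigma>0: "curve_sigma \<Delta> d i = 0" for i by (simp add: \<sigma>_def vec_eq_iff)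
  then have "d j = 0" for j
    by (subst d_eq) (simp add: linear_0[OF linear_wrad])
  then have "\<Delta> $ i = 0" for i
    using \<sigma>0[of i] unit_cube by (simp add: curve_sigma_def ev_zero)
  then show "t1 = t2" by (simp add: \<Delta>_def vec_eq_iff)
qed

end

section \<open>Absolutely continuous curves\<close>

lemma division_interval:
  fixes k :: "real set"
  assumes "D division_of S" "k \<in> D"
  obtains u v where "k = {u..v}" "u <= v" "Sup k = v" "Inf k = u" "u \<in> S" "v \<in> S"
proof -
  obtain u v where k: "k = cbox u v" "k \<noteq> {}" "k \<subseteq> S"
    using assms division_ofD by metis
  then have uv: "u <= v" "k = {u..v}" by auto
  then have "u \<in> S" "v \<in> S" using k(3) by auto
  then show ?thesis
    using that[of u v] uv by auto
qed

lemma lipschitz_imp_absolutely_continuous: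
  fixes f :: "real => 'b::real_normed_vector"
  assumes "!!x y. x \<in> S ==> y \<in> S ==> norm (f x - f y) <= L * \<bar>x - y\<bar>"
  shows "absolutely_continuous_on S f"
  unfolding absolutely_continuous_on_def
proof (intro allI impI)
  fix \<epsilon> :: real assume "0 < \<epsilon>"
  define \<rho> where "\<rho> = \<epsilon> / (\<bar>L\<bar> + 1)"
  have \<rho>: "\<rho> > 0" using \<open>0 < \<epsilon>\<close> by (simp add: \<rho>_def)
  have "(\<Sum>k\<in>D. norm (f (Sup k) - f (Inf k))) < \<epsilon>"
    if D: "D division_of \<Union>D" "\<Union>D \<subseteq> S" "(\<Sum>k\<in>D. Sup k - Inf k) < \<rho>" for D
  proof -
    have le: "norm (f (Sup k) - f (Inf k)) <= (\<bar>L\<bar> + 1) * (Sup k - Inf k)" if k: "k \<in> D" for k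
    proof -
      obtain u v where uv: "k = {u..v}" "u <= v" "Sup k = v" "Inf k = u" "u \<in> \<Union>D" "v \<in> \<Union>D"
        using division_interval[OF D(1) k] .
      then have "norm (f v - f u) <= L * \<bar>v - u\<bar>" using assms D(2) by blast
      also have "\<dots> <= (\<bar>L\<bar> + 1) * (v - u)" using uv by (intro mult_mono) auto
      finally show ?thesis using uv by simp
    qed
    have "(\<Sum>k\<in>D. norm (f (Sup k) - f (Inf k))) <= (\<Sum>k\<in>D. (\<bar>L\<bar> + 1) * (Sup k - Inf k))"
      by (rule sum_mono) (rule le)
    also have "\<dots> = (\<bar>L\<bar> + 1) * (\<Sum>k\<in>D. Sup k - Inf k)" by (simp add: sum_distrib_left)
    also have "\<dots> < (\<bar>L\<bar> + 1) * \<rho>" using D(3) by (intro mult_strict_left_mono) auto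
    also have "\<dots> = \<epsilon>" by (simp add: \<rho>_def)
    finally show ?thesis .
  qed
  then show "\<exists>\<rho>>0. \<forall>D. D division_of \<Union> D \<and> \<Union> D \<subseteq> S \<and> (\<Sum>k\<in>D. Sup k - Inf k) < \<rho> -->
      (\<Sum>k\<in>D. norm (f (Sup k) - f (Inf k))) < \<epsilon>"
    using \<rho> by blast
qed

lemma absolutely_continuous_on_subset:
  "absolutely_continuous_on S f ==> S' \<subseteq> S ==> absolutely_continuous_on S' f"
  unfolding absolutely_continuous_on_def by (meson order_trans)

lemma absolutely_continuous_on_add:
  assumes f: "absolutely_continuous_on S f" and g: "absolutely_continuous_on S g"
  shows "absolutely_continuous_on S (%x. f x + g x)"
  unfolding absolutely_continuous_on_def
proof (intro allI impI)
  fix \<epsilon> :: real assume "0 < \<epsilon>"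
  then have e: "0 < \<epsilon> / 2" by simp
  obtain \<rho>1 where 1: "\<rho>1 > 0" "!!D. D division_of \<Union>D ==> \<Union>D \<subseteq> S ==> (\<Sum>k\<in>D. Sup k - Inf k) < \<rho>1 ==>
      (\<Sum>k\<in>D. norm (f (Sup k) - f (Inf k))) < \<epsilon> / 2"
    using f e unfolding absolutely_continuous_on_def by meson
  obtain \<rho>2 where 2: "\<rho>2 > 0" "!!D. D division_of \<Union>D ==> \<Union>D \<subseteq> S ==> (\<Sum>k\<in>D. Sup k - Inf k) < \<rho>2 ==>
      (\<Sum>k\<in>D. norm (g (Sup k) - g (Inf k))) < \<epsilon> / 2"
    using g e unfolding absolutely_continuous_on_def by meson
  have "(\<Sum>k\<in>D. norm (f (Sup k) + g (Sup k) - (f (Inf k) + g (Inf k)))) < \<epsilon>"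
    if D: "D division_of \<Union>D" "\<Union>D \<subseteq> S" "(\<Sum>k\<in>D. Sup k - Inf k) < min \<rho>1 \<rho>2" for D
  proof -
    have "(\<Sum>k\<in>D. norm (f (Sup k) + g (Sup k) - (f (Inf k) + g (Inf k)))) <=
      (\<Sum>k\<in>D. norm (f (Sup k) - f (Inf k)) + norm (g (Sup k) - g (Inf k)))"
    proof (rule sum_mono)
      fix k
      show "norm (f (Sup k) + g (Sup k) - (f (Inf k) + g (Inf k))) <= norm (f (Sup k) - f (Inf k)) + norm (g (Sup k) - g (Inf k))"
        using norm_triangle_ineq[of "f (Sup k) - f (Inf k)" "g (Sup k) - g (Inf k)"] by (simp add: algebra_simps)
    qed
    then show ?thesis
      using 1(2)[OF D(1,2)] 2(2)[OF D(1,2)] D(3) by (simp add: sum.distrib)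
  qed
  moreover have "min \<rho>1 \<rho>2 > 0" using 1 2 by simp
  ultimately show "\<exists>\<rho>>0. \<forall>D. D division_of \<Union> D \<and> \<Union> D \<subseteq> S \<and> (\<Sum>k\<in>D. Sup k - Inf k) < \<rho> -->
      (\<Sum>k\<in>D. norm (f (Sup k) + g (Sup k) - (f (Inf k) + g (Inf k)))) < \<epsilon>"
    by blast
qed

lemma absolutely_continuous_imp_continuous:
  fixes f :: "real => 'b::real_normed_vector"
  assumes f: "absolutely_continuous_on {a..b} f"
  shows "continuous_on {a..b} f"
  unfolding continuous_on_iff
proof (intro ballI allI impI)
  fix x \<epsilon> :: real assume x: "x \<in> {a..b}" and "0 < \<epsilon>"
  then obtain \<rho> where \<rho>: "\<rho> > 0" "!!D. D division_of \<Union>D ==> \<Union>D \<subseteq> {a..b} ==> (\<Sum>k\<in>D. Sup k - Inf k) < \<rho> ==>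
      (\<Sum>k\<in>D. norm (f (Sup k) - f (Inf k))) < \<epsilon>"
    using f unfolding absolutely_continuous_on_def by meson
  have *: "norm (f v - f u) < \<epsilon>" if "u <= v" "u \<in> {a..b}" "v \<in> {a..b}" "v - u < \<rho>" for u v
  proof -
    have "{{u..v}} division_of \<Union>{{u..v}}"
      using division_of_self[of u v] that by simp
    moreover have "\<Union>{{u..v}} \<subseteq> {a..b}" using that by auto
    ultimately show ?thesis using \<rho>(2)[of "{{u..v}}"] that by simp
  qed
  have "dist (f y) (f x) < \<epsilon>" if "y \<in> {a..b}" "dist y x < \<rho>" for y
  proof (cases "x <= y")
    case True
    then show ?thesis using *[of x y] x that by (simp add: dist_norm)
  next
    case False
    then show ?thesis using *[of y x] x that by (simp add: dist_norm norm_minus_commute)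
  qed
  then show "\<exists>d>0. \<forall>x'\<in>{a..b}. dist x' x < d --> dist (f x') (f x) < \<epsilon>"
    using \<rho>(1) by blast
qed

lemma absolutely_continuous_on_lipschitz_compose:
  assumes f: "absolutely_continuous_on S f" and L: "L-lipschitz_on (f ` S) g"
  shows "absolutely_continuous_on S (%x. g (f x))"
  unfolding absolutely_continuous_on_def
proof (intro allI impI)
  fix \<epsilon> :: real assume \<epsilon>: "0 < \<epsilon>"
  have L0: "0 <= L" using L by (rule lipschitz_on_nonneg)
  then have "0 < \<epsilon> / (L + 1)" using \<epsilon> by simp
  then obtain \<rho> where \<rho>: "\<rho> > 0" "!!D. D division_of \<Union>D ==> \<Union>D \<subseteq> S ==> (\<Sum>k\<in>D. Sup k - Inf k) < \<rho> ==>
      (\<Sum>k\<in>D. norm (f (Sup k) - f (Inf k))) < \<epsilon> / (L + 1)"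
    using f unfolding absolutely_continuous_on_def by meson
  have "(\<Sum>k\<in>D. norm (g (f (Sup k)) - g (f (Inf k)))) < \<epsilon>"
    if D: "D division_of \<Union>D" "\<Union>D \<subseteq> S" "(\<Sum>k\<in>D. Sup k - Inf k) < \<rho>" for D
  proof -
    have "(\<Sum>k\<in>D. norm (g (f (Sup k)) - g (f (Inf k)))) <= (\<Sum>k\<in>D. (L + 1) * norm (f (Sup k) - f (Inf k)))"
    proof (rule sum_mono)
      fix k assume k: "k \<in> D"
      obtain u v where uv: "k = {u..v}" "u <= v" "Sup k = v" "Inf k = u" "u \<in> \<Union>D" "v \<in> \<Union>D"
        using division_interval[OF D(1) k] .
      then have "norm (g (f v) - g (f u)) <= L * norm (f v - f u)"
        using lipschitz_on_normD[OF L, of "f v" "f u"] D(2) by blast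
      also have "\<dots> <= (L + 1) * norm (f v - f u)" by (intro mult_right_mono) auto
      finally show "norm (g (f (Sup k)) - g (f (Inf k))) <= (L + 1) * norm (f (Sup k) - f (Inf k))" using uv by simp
    qed
    also have "\<dots> = (L + 1) * (\<Sum>k\<in>D. norm (f (Sup k) - f (Inf k)))" by (simp add: sum_distrib_left)
    also have "\<dots> < (L + 1) * (\<epsilon> / (L + 1))"
      using \<rho>(2)[OF D] L0 by (intro mult_strict_left_mono) auto
    also have "\<dots> = \<epsilon>" using L0 by simp
    finally show ?thesis .
  qed
  then show "\<exists>\<rho>>0. \<forall>D. D division_of \<Union> D \<and> \<Union> D \<subseteq> S \<and> (\<Sum>k\<in>D. Sup k - Inf k) < \<rho> -->
      (\<Sum>k\<in>D. norm (g (f (Sup k)) - g (f (Inf k)))) < \<epsilon>"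
    using \<rho>(1) by blast
qed

text \<open>Cousin's lemma: near points of differentiability the increments are controlled by the derivative,
  the remaining tags lie in an open set of small measure, where absolute continuity applies.\<close>

lemma absolutely_continuous_mean_value:
  fixes f :: "real => 'b::real_normed_vector"
  assumes f: "absolutely_continuous_on {a..b} f" and ab: "a <= b" and N: "negligible N" and C: "0 <= C"
    and der: "!!t. t \<in> {a..b} - N ==> \<exists>v. (f has_vector_derivative v) (at t within {a..b}) \<and> norm v <= C"
  shows "norm (f b - f a) <= C * (b - a)"
proof -
  have "norm (f b - f a) <= C * (b - a) + e" if e: "e > 0" for e
  proof -
    define e1 where "e1 = e / (2 * (b - a + 1))"
    have e1: "e1 > 0" "e1 * (b - a) <= e / 2"
      using e ab by (auto simp: e1_def divide_simps mult_left_mono)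
    obtain \<rho> where \<rho>: "\<rho> > 0" "!!D. D division_of \<Union>D ==> \<Union>D \<subseteq> {a..b} ==> (\<Sum>k\<in>D. Sup k - Inf k) < \<rho> ==>
        (\<Sum>k\<in>D. norm (f (Sup k) - f (Inf k))) < e / 2"
      using f e unfolding absolutely_continuous_on_def by (meson half_gt_zero)
    have Nl: "N \<in> null_sets lebesgue" using N by (simp add: negligible_iff_null_sets)
    then have "N \<in> sets lebesgue" by auto
    then obtain O' where O': "open O'" "N \<subseteq> O'" "O' - N \<in> lmeasurable" "emeasure lebesgue (O' - N) < ennreal \<rho>"
      using sets_lebesgue_outer_open[OF _ \<rho>(1)] by blast
    have O'm: "O' \<in> lmeasurable" "measure lebesgue O' < \<rho>"
    proof -
      have eq: "emeasure lebesgue O' = emeasure lebesgue (O' - N)"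
        using emeasure_Diff_null_set[OF Nl, of O'] O'(1) by simp
      then show m: "O' \<in> lmeasurable"
        using O' by (intro fmeasurableI) (auto intro: order.strict_trans)
      show "measure lebesgue O' < \<rho>"
        using m
        using O'(4) eq \<rho>(1) by (metis emeasure_eq_measure2 ennreal_less_iff measure_nonneg)
    qed
    have "\<exists>d>0. (t \<in> N --> ball t d \<subseteq> O') \<and> (t \<in> {a..b} - N -->
        (\<forall>u v. u \<in> {a..b} \<and> v \<in> {a..b} \<and> u <= t \<and> t <= v \<and> u \<in> ball t d \<and> v \<in> ball t d -->
          norm (f v - f u) <= (C + e1) * (v - u)))" for t
    proof (cases "t \<in> N")
      case True
      then show ?thesis using O' by (meson DiffD2 openE subsetD)
    next
      case False
      show ?thesis
      proof (cases "t \<in> {a..b}")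
        case True
        then obtain w where w: "(f has_vector_derivative w) (at t within {a..b})" "norm w <= C"
          using der False by blast
        then obtain d where d: "d > 0" "!!y. y \<in> {a..b} ==> norm (y - t) < d ==>
            norm (f y - f t - (y - t) *. w) <= e1 * norm (y - t)"
          using e1(1) unfolding has_vector_derivative_def has_derivative_within_alt by meson
        have "norm (f v - f u) <= (C + e1) * (v - u)"
          if uv: "u \<in> {a..b}" "v \<in> {a..b}" "u <= t" "t <= v" "u \<in> ball t d" "v \<in> ball t d" for u v
        proof -
          have 1: "norm (f v - f t - (v - t) *. w) <= e1 * (v - t)" "norm (f u - f t - (u - t) *. w) <= e1 * (t - u)"
            using d(2)[of v] d(2)[of u] uv by (auto simp: dist_real_def)
          have "f v - f u = (f v - f t - (v - t) *. w) - (f u - f t - (u - t) *. w) + (v - u) *. w"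
            by (simp add: algebra_simps)
          then have "norm (f v - f u) <= norm (f v - f t - (v - t) *. w) + norm (f u - f t - (u - t) *. w) + norm ((v - u) *. w)"
            by (metis norm_triangle_ineq4 norm_triangle_mono order_refl)
          also have "\<dots> <= e1 * (v - t) + e1 * (t - u) + (v - u) * C"
            using 1 w(2) uv by (intro add_mono) (auto intro: mult_left_mono)
          finally show ?thesis by (simp add: algebra_simps)
        qed
        then show ?thesis using d(1) False by blast
      qed (use False in \<open>auto intro: exI[of _ 1]\<close>)
    qed
    then obtain d where d: "!!t. d t > 0" "!!t. t \<in> N ==> ball t (d t) \<subseteq> O'"
      "!!t u v. t \<in> {a..b} - N ==> u \<in> {a..b} ==> v \<in> {a..b} ==> u <= t ==> t <= v ==> u \<in> ball t (d t) ==> v \<in> ball t (d t) ==>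
          norm (f v - f u) <= (C + e1) * (v - u)"
      by metis
    have "gauge (%t. ball t (d t))" using d(1) by (rule gauge_ball_dependent[rule_format])
    then obtain p where p: "p tagged_division_of {a..b}" "(%t. ball t (d t)) fine p"
      using fine_division_exists_real by blast
    have fin: "finite p" using p(1) by blast
    have K: "\<exists>u v. K = {u..v} \<and> u <= t \<and> t <= v \<and> Sup K = v \<and> Inf K = u \<and> u \<in> {a..b} \<and> v \<in> {a..b} \<and> t \<in> {a..b} \<and> K \<subseteq> ball t (d t)"
      if tK: "(t, K) \<in> p" for t K
    proof -
      obtain u v where "K = cbox u v" using tagged_division_ofD(4)[OF p(1) tK] by blast
      moreover have "t \<in> K" "K \<subseteq> {a..b}" using tagged_division_ofD(2,3)[OF p(1) tK] by auto
      moreover have "K \<subseteq> ball t (d t)" using fineD[OF p(2) tK] .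
      ultimately show ?thesis by (intro exI[of _ u] exI[of _ v]) auto
    qed
    \<comment> \<open>Degenerate intervals contribute nothing and are left out of \<open>p2\<close>:
      an interval with interior determines its tag, so \<open>p2\<close> projects injectively onto a
      division.\<close>
    define p1 where "p1 = {(t, K) \<in> p. t \<notin> N}"
    define p2 where "p2 = {(t, K) \<in> p. t \<in> N \<and> interior K \<noteq> {}}"
    let ?g = "%(t::real, K). f (Sup K) - f (Inf K)"
    have p12: "p1 \<subseteq> p" "p2 \<subseteq> p" "p1 \<inter> p2 = {}" by (auto simp: p1_def p2_def)
    have fin12: "finite p1" "finite p2" using fin p12 finite_subset by blast+
    have "f b - f a = sum ?g p"
      using additive_tagged_division_1[OF ab p(1), of f] by simp
    also have "\<dots> = sum ?g (p1 \<union> p2)"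
    proof (rule sum.mono_neutral_right[OF fin])
      show "\<forall>i\<in>p - (p1 \<union> p2). ?g i = 0"
      proof
        fix z assume "z \<in> p - (p1 \<union> p2)"
        then obtain t K where z: "z = (t, K)" and tK: "(t, K) \<in> p" "(t, K) \<notin> p1 \<union> p2" by (cases z) auto
        obtain u v where uv: "K = {u..v}" "u <= t" "t <= v" "Sup K = v" "Inf K = u" using K[OF tK(1)] by blast
        have "interior K = {}" using tK by (auto simp: p1_def p2_def)
        then have "u = v" using uv by (auto simp: interior_atLeastAtMost_real)
        then show "?g z = 0" using uv z by simp
      qed
    qed (use p12 in auto)
    also have "\<dots> = sum ?g p1 + sum ?g p2"
      by (rule sum.union_disjoint) (use fin12 p12 in auto)
    finally have split: "f b - f a = sum ?g p1 + sum ?g p2" .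
    have "norm (sum ?g p1) <= (C + e1) * (b - a)"
    proof -
      have "norm (sum ?g p1) <= (\<Sum>(t, K)\<in>p1. (C + e1) * (Sup K - Inf K))"
      proof (rule sum_norm_le)
        fix z assume "z \<in> p1"
        then obtain t K where z: "z = (t, K)" and tK: "(t, K) \<in> p1" by (cases z) auto
        then have tp: "(t, K) \<in> p" "t \<notin> N" by (auto simp: p1_def)
        obtain u v where uv: "K = {u..v}" "u <= t" "t <= v" "Sup K = v" "Inf K = u" "u \<in> {a..b}" "v \<in> {a..b}" "t \<in> {a..b}" "K \<subseteq> ball t (d t)"
          using K[OF tp(1)] by blast
        have "u \<in> ball t (d t)" "v \<in> ball t (d t)"
          using uv(1-3,9) by (auto simp del: mem_ball)
        then show "norm (?g z) <= (case z of (t, K) => (C + e1) * (Sup K - Inf K))"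
          using d(3)[of t u v] uv tp(2) z by simp
      qed
      also have "\<dots> <= (\<Sum>(t, K)\<in>p. (C + e1) * (Sup K - Inf K))"
      proof (rule sum_mono2[OF fin p12(1)])
        fix z assume "z \<in> p - p1"
        then obtain t K where z: "z = (t, K)" and tK: "(t, K) \<in> p" by (cases z) auto
        obtain u v where "u <= t" "t <= v" "Sup K = v" "Inf K = u" using K[OF tK] by blast
        then show "0 <= (case z of (t, K) => (C + e1) * (Sup K - Inf K))" using C e1(1) z by simp
      qed
      also have "\<dots> = (C + e1) * (\<Sum>(t, K)\<in>p. Sup K - Inf K)"
        by (simp add: sum_distrib_left split_beta)
      also have "(\<Sum>(t, K)\<in>p. Sup K - Inf K) = b - a"
        using additive_tagged_division_1[OF ab p(1), of "%x. x"] .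
      finally show ?thesis .
    qed
    moreover have "norm (sum ?g p2) <= e / 2"
    proof -
      have inj: "inj_on snd p2"
      proof (rule inj_onI, clarify)
        fix t K s L assume "(t, K) \<in> p2" "(s, L) \<in> p2" "snd (t, K) = snd (s, L)"
        then show "t = s \<and> K = L"
          using tagged_division_ofD(5)[OF p(1), of t K s L] by (auto simp: p2_def)
      qed
      define D where "D = snd ` p2"
      have D: "D division_of \<Union>D"
        unfolding division_of_def
      proof (intro conjI ballI impI)
        show "finite D" using fin12 by (simp add: D_def)
        fix K assume K': "K \<in> D"
        then obtain t where t: "(t, K) \<in> p2" by (auto simp: D_def)
        show "K \<subseteq> \<Union>D" using K' by blast
        show "K \<noteq> {}" "\<exists>a b. K = cbox a b"
          using tagged_division_ofD(2,4)[OF p(1), of t K] t by (auto simp: p2_def)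
        fix L assume L': "L \<in> D" "K \<noteq> L"
        then obtain s where s: "(s, L) \<in> p2" unfolding D_def by force
        then show "interior K \<inter> interior L = {}"
          using tagged_division_ofD(5)[OF p(1), of t K s L] t L' by (auto simp: p2_def)
      qed auto
      have DO: "\<Union>D \<subseteq> O'" and Dab: "\<Union>D \<subseteq> {a..b}"
      proof -
        have "K \<subseteq> O' \<and> K \<subseteq> {a..b}" if "K \<in> D" for K
        proof -
          obtain t where t: "(t, K) \<in> p" "t \<in> N" using \<open>K \<in> D\<close> by (auto simp: D_def p2_def)
          then show ?thesis
            using fineD[OF p(2) t(1)] d(2)[OF t(2)] tagged_division_ofD(3)[OF p(1) t(1)] by blast
        qed
        then show "\<Union>D \<subseteq> O'" "\<Union>D \<subseteq> {a..b}" by blast+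
      qed
      have "(\<Sum>k\<in>D. Sup k - Inf k) = (\<Sum>k\<in>D. measure lebesgue k)"
      proof (rule sum.cong[OF refl])
        fix k assume "k \<in> D"
        then obtain u v where "k = {u..v}" "u <= v" "Sup k = v" "Inf k = u" using division_interval[OF D] by metis
        then show "Sup k - Inf k = measure lebesgue k" by simp
      qed
      also have "\<dots> = measure lebesgue (\<Union>D)"
        by (rule content_division[OF D])
      also have "\<dots> <= measure lebesgue O'"
      proof (rule measure_mono_fmeasurable[OF DO _ O'm(1)])
        have "\<Union>D \<in> lmeasurable" using D by (rule lmeasurable_division)
        then show "\<Union>D \<in> sets lebesgue" by blast
      qed
      finally have "(\<Sum>k\<in>D. Sup k - Inf k) < \<rho>" using O'm by simp
      from \<rho>(2)[OF D Dab this] have Dsum: "(\<Sum>k\<in>D. norm (f (Sup k) - f (Inf k))) < e / 2" .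
      have "norm (sum ?g p2) <= (\<Sum>x\<in>p2. norm (f (Sup (snd x)) - f (Inf (snd x))))"
        by (rule sum_norm_le) (auto simp: split_beta)
      also have "\<dots> = (\<Sum>k\<in>D. norm (f (Sup k) - f (Inf k)))"
        unfolding D_def by (subst sum.reindex[OF inj]) (simp add: comp_def)
      finally show ?thesis using Dsum by simp
    qed
    ultimately have "norm (f b - f a) <= (C + e1) * (b - a) + e / 2"
      unfolding split by (rule norm_triangle_mono)
    then show ?thesis using e1(2) by (simp add: algebra_simps)
  qed
  then show ?thesis by (rule field_le_epsilon)
qed

subsection \<open>Lipschitz bounds and uniqueness of integral curves\<close>

text \<open>On half of the radius of convergence the differentiated series are bounded, and balls
  are convex.\<close>

lemma real_analytic_locally_lipschitz:
  fixes f :: "real^'n::finite => real^'m::finite"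
  assumes f: "real_analytic_on S f" and t0: "t0 \<in> S"
  obtains e L where "0 < e" "L-lipschitz_on (ball t0 e) f" "f differentiable (at t0)"
proof -
  obtain R a where R: "0 < R" and a: "!!i. mconv R (a i)"
    and fa: "!!h. h \<in> cube R ==> f (t0 + h) = (\<chi> i. mseries (a i) h)"
    using real_analytic_on_taylor[OF f t0] by blast
  define M where "M i k = mnorm (R / 2) (dcoeff k (a i))" for i k
  define L where "L = (\<Sum>.i. \<Sum>.k. M i k)"
  define D where "D y h = (\<chi> i. \<Sum>.k. h $ k *. mseries (dcoeff k (a i)) (y - t0))" for y h :: "real^'n"
  have in_cube: "y - t0 \<in> open_cube R" if "y \<in> ball t0 R" for y
    using that ball_subset_open_cube[of R] by (auto simp: dist_norm norm_minus_commute)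
  have der: "(f has_derivative D y) (at y)" if y: "y \<in> ball t0 R" for y
  proof (rule has_derivative_transform_within_open[OF _ open_ball y])
    show "((%y. \<chi> i. mseries (a i) (y - t0)) has_derivative D y) (at y)"
      unfolding D_def
      by (rule has_derivative_vec) (rule mseries_translate_has_derivative[OF a in_cube[OF y]])
    show "(\<chi> i. mseries (a i) (z - t0)) = f z" if "z \<in> ball t0 R" for z
      using fa[of "z - t0"] in_cube[OF that] open_cube_subset_cube[of R] by auto
  qed
  have D_le: "norm (D y h) <= L * norm h" if y: "y \<in> ball t0 (R / 2)" for y h
  proof -
    have y2: "y - t0 \<in> cube (R / 2)"
      using y cball_subset_cube[of "R / 2"] by (auto simp: dist_norm norm_minus_commute)
    have "\<bar>D y h $ i\<bar> <= (\<Sum>.k. M i k) * norm h" for i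
    proof -
      have "\<bar>D y h $ i\<bar> <= (\<Sum>.k. \<bar>h $ k *. mseries (dcoeff k (a i)) (y - t0)\<bar>)"
        unfolding D_def by (simp add: sum_abs)
      also have "\<dots> <= (\<Sum>.k. norm h * M i k)"
      proof (rule sum_mono)
        fix k
        have "norm (mseries (dcoeff k (a i)) (y - t0)) <= M i k"
          unfolding M_def by (rule norm_mseries_le[OF mconv_dcoeff[OF a] y2]) (use R in auto)
        then show "\<bar>h $ k *. mseries (dcoeff k (a i)) (y - t0)\<bar> <= norm h * M i k"
          using component_le_norm_cart[of h k] by (simp add: abs_mult mult_mono)
      qed
      finally show ?thesis by (simp add: sum_distrib_left mult.commute)
    qed
    then have "(\<Sum>.i. \<bar>D y h $ i\<bar>) <= L * norm h"
      unfolding L_def sum_distrib_right by (intro sum_mono) (simp add: sum_distrib_right)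
    then show ?thesis using norm_le_l1_cart[of "D y h"] by linarith
  qed
  have M0: "0 <= M i k" for i k
  proof -
    have "0 <= (R / 2) ^ mabs al * norm (dcoeff k (a i) al)" for al
      using R by simp
    then show ?thesis unfolding M_def mnorm_def by (rule infsum_nonneg)
  qed
  show ?thesis
  proof (rule that[of "R / 2" L])
    show "L-lipschitz_on (ball t0 (R / 2)) f"
    proof (rule lipschitz_onI)
      show "0 <= L" unfolding L_def by (intro sum_nonneg M0)
      fix y z assume yz: "y \<in> ball t0 (R / 2)" "z \<in> ball t0 (R / 2)"
      have "norm (f y - f z) <= L * norm (y - z)"
      proof (rule differentiable_bound[OF convex_ball _ _ yz])
        fix v assume v: "v \<in> ball t0 (R / 2)"
        then have "v \<in> ball t0 R" using R by auto
        then show "(f has_derivative D v) (at v within ball t0 (R / 2))"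
          by (rule has_derivative_at_withinI[OF der])
        show "onorm (D v) <= L"
          by (rule onorm_bound) (use D_le[OF v] in \<open>auto simp: L_def M0 intro!: sum_nonneg\<close>)
      qed
      then show "dist (f y) (f z) <= L * dist y z" by (simp add: dist_norm)
    qed
    show "f differentiable at t0"
      using der[of t0] R by (auto simp: differentiable_def)
  qed (use R in auto)
qed

text \<open>The local constants are combined by the compactness theorem for
  \<open>local_lipschitz\<close>, applied with the one-point time set {0}.\<close>

lemma real_analytic_lipschitz_compact:
  fixes f :: "real^'n::finite => real^'m::finite"
  assumes f: "real_analytic_on S f" and C: "compact C" "C \<subseteq> S"
  obtains L where "L-lipschitz_on C f"
proof -
  have ll: "local_lipschitz {0::real} C (%_. f)"
  proof (rule local_lipschitzI)
    fix t y assume "y \<in> C"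
    then obtain e L where e: "0 < e" "L-lipschitz_on (ball y e) f"
      using real_analytic_locally_lipschitz[OF f] C(2) by blast
    have "L-lipschitz_on (cball y (e / 2) \<inter> C) f"
      by (rule lipschitz_on_subset[OF e(2)]) (use e(1) in auto)
    then show "\<exists>u>0. \<exists>L. \<forall>t\<in>cball t u \<inter> {0::real}. L-lipschitz_on (cball y u \<inter> C) f"
      using e(1) by (intro exI[of _ "e / 2"]) auto
  qed
  obtain L where "!!t::real. t \<in> {0} ==> L-lipschitz_on C f"
    by (rule local_lipschitz_compact_implies_lipschitz[OF ll C(1)]) auto
  then show ?thesis using that by simp
qed

text \<open>The two curves trace a compact subset of \<Omega>, on which \<open>W\<close> is
  Lipschitz; Gronwall for a family with one member makes them agree.\<close>

lemma is_exp_unique: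
  fixes W :: "real^'n::finite => real^'n"
  assumes lip: "!!C. compact C ==> C \<subseteq> \<Omega> ==> \<exists>L. L-lipschitz_on C W"
    and y: "is_exp \<Omega> W x y" and z: "is_exp \<Omega> W x z"
  shows "y = z"
proof -
  obtain \<gamma> where \<gamma>: "\<gamma> 0 = x" "\<gamma> 1 = y" "!!t. t \<in> {0..1::real} ==> \<gamma> t \<in> \<Omega>"
      "!!t. t \<in> {0..1} ==> (\<gamma> has_vector_derivative W (\<gamma> t)) (at t within {0..1})"
    using y unfolding is_exp_def by blast
  obtain \<delta> where \<delta>: "\<delta> 0 = x" "\<delta> 1 = z" "!!t. t \<in> {0..1::real} ==> \<delta> t \<in> \<Omega>"
      "!!t. t \<in> {0..1} ==> (\<delta> has_vector_derivative W (\<delta> t)) (at t within {0..1})"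
    using z unfolding is_exp_def by blast
  have "continuous_on {0..1} \<gamma>" by (rule continuous_on_vector_derivative) (rule \<gamma>(4))
  moreover have "continuous_on {0..1} \<delta>" by (rule continuous_on_vector_derivative) (rule \<delta>(4))
  ultimately have "compact (\<gamma> ` {0..1} \<union> \<delta> ` {0..1})"
    by (intro compact_Un compact_continuous_image) auto
  then obtain L where L: "L-lipschitz_on (\<gamma> ` {0..1} \<union> \<delta> ` {0..1}) W"
    using lip[of "\<gamma> ` {0..1} \<union> \<delta> ` {0..1}"] \<gamma>(3) \<delta>(3) by blast
  have "(%t. \<gamma> t - \<delta> t) 1 = 0"
  proof (rule linear_ode_family_zero[of "%_::unit. %t. \<gamma> t - \<delta> t" "%_ t. W (\<gamma> t) - W (\<delta> t)" L])
    show "((%t. \<gamma> t - \<delta> t) has_vector_derivative W (\<gamma> t) - W (\<delta> t)) (at t within {0..1})" if "t \<in> {0..1}" for t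
      by (intro has_vector_derivative_diff \<gamma>(4) \<delta>(4) that)
    show "norm (W (\<gamma> t) - W (\<delta> t)) <= L * (\<Sum>j\<in>(UNIV::unit set). norm (\<gamma> t - \<delta> t))" if "t \<in> {0..1}" for t
      using lipschitz_on_normD[OF L, of "\<gamma> t" "\<delta> t"] that by simp
  qed (use \<gamma> \<delta> in auto)
  then show ?thesis using \<gamma>(2) \<delta>(2) by simp
qed

lemma exp_vf_eq:
  assumes lip: "!!C. compact C ==> C \<subseteq> \<Omega> ==> \<exists>L. L-lipschitz_on C W"
    and y: "is_exp \<Omega> W x y"
  shows "\<exists>!y. is_exp \<Omega> W x y" "exp_vf \<Omega> W x = y"
  using is_exp_unique[OF lip] y unfolding exp_vf_def by (blast intro: the_equality)+

lemma lipschitz_compact_combination: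
  fixes Z :: "'q => real^'n::finite => real^'m::finite"
  assumes Z: "!!l. real_analytic_on \<Omega> (Z l)" and C: "compact C" "C \<subseteq> \<Omega>" and I: "finite I"
  shows "\<exists>L. L-lipschitz_on C (%y. \<Sum>i\<in>I. c i *. Z (k i) y)"
  using I
proof induction
  case empty
  then show ?case using lipschitz_on_constant[of C 0] by auto
next
  case (insert i I)
  then obtain L where L: "L-lipschitz_on C (%y. \<Sum>i\<in>I. c i *. Z (k i) y)" by blast
  obtain L' where L': "L'-lipschitz_on C (Z (k i))" using real_analytic_lipschitz_compact[OF Z C] .
  show ?case
    using lipschitz_on_add[OF lipschitz_on_cmult[OF L', of "c i"] L] insert by auto
qed

subsection \<open>Carnot--Caratheodory balls in exponential coordinates\<close>

lemma AE_lebesgue_on_negligible: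
  assumes S: "S \<in> sets lebesgue"
  shows "(AE t in lebesgue_on S. Q t) \<longleftrightarrow> (\<exists>N. negligible N \<and> (\<forall>t\<in>S - N. Q t))"
proof -
  have "(AE t in lebesgue_on S. Q t) \<longleftrightarrow> (AE t in lebesgue. t \<in> S --> Q t)"
    using S by (intro AE_restrict_space_iff) auto
  also have "\<dots> \<longleftrightarrow> (\<exists>N. negligible N \<and> (\<forall>t\<in>S - N. Q t))"
    unfolding eventually_ae_filter negligible_iff_null_sets by (auto simp: subset_iff)
  finally show ?thesis .
qed

text \<open>The strict bound on the essential supremum is kept as a real number
  \<open>m < 1\<close>; the proof that the balls are open spends the room
  \<open>1 - m\<close>.\<close>

lemma cc_ballE:
  assumes "y \<in> cc_ball \<Omega> W x \<delta>"
  obtains \<gamma> a N m where "absolutely_continuous_on {0..1} \<gamma>" "\<gamma> ` {0..1} \<subseteq> \<Omega>" "\<gamma> 0 = x" "\<gamma> 1 = y" "y \<in> \<Omega>"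
    "negligible N" "!!j. a j \<in> L_infty (lebesgue_on {0..1})" "m < 1"
    "!!t. t \<in> {0..1} - N ==> (\<gamma> has_vector_derivative (\<Sum>.j. a j t *. \<delta> *. W j (\<gamma> t))) (at t)"
    "!!t. t \<in> {0..1} - N ==> (\<Sum>.j. \<bar>a j t\<bar>\<^sup>2) <= m"
    "!!t j. t \<in> {0..1} - N ==> \<bar>a j t\<bar> <= 1"
proof -
  obtain \<gamma> a where \<gamma>: "absolutely_continuous_on {0..1} \<gamma>" "\<gamma> ` {0..1} \<subseteq> \<Omega>" "\<gamma> 0 = x" "\<gamma> 1 = y" "y \<in> \<Omega>"
    and ae: "AE t in lebesgue_on {0..1}. (\<gamma> has_vector_derivative (\<Sum>.j. a j t *. \<delta> *. W j (\<gamma> t))) (at t)"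
    and a: "!!j. a j \<in> L_infty (lebesgue_on {0..1})"
    and sup: "esssup (lebesgue_on {0..1}) (%t. ennreal (\<Sum>.j. \<bar>a j t\<bar>\<^sup>2)) < 1"
    using assms unfolding cc_ball_def by blast
  define m where "m = enn2real (esssup (lebesgue_on {0..1}) (%t. ennreal (\<Sum>.j. \<bar>a j t\<bar>\<^sup>2)))"
  have m: "ennreal m = esssup (lebesgue_on {0..1}) (%t. ennreal (\<Sum>.j. \<bar>a j t\<bar>\<^sup>2))" "0 <= m"
    using sup unfolding m_def by (auto intro!: ennreal_enn2real elim: order.strict_trans)
  then have m1: "m < 1" using sup by (metis ennreal_less_one_iff)
  have "AE t in lebesgue_on {0..1}. ennreal (\<Sum>.j. \<bar>a j t\<bar>\<^sup>2) <= ennreal m"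
    unfolding m(1) by (rule esssup_AE)
  with ae have "AE t in lebesgue_on {0..1}. (\<gamma> has_vector_derivative (\<Sum>.j. a j t *. \<delta> *. W j (\<gamma> t))) (at t) \<and>
      ennreal (\<Sum>.j. \<bar>a j t\<bar>\<^sup>2) <= ennreal m"
    by (rule AE_conjI)
  then obtain N where N: "negligible N" "!!t. t \<in> {0..1} - N ==> (\<gamma> has_vector_derivative (\<Sum>.j. a j t *. \<delta> *. W j (\<gamma> t))) (at t)"
     "!!t. t \<in> {0..1} - N ==> ennreal (\<Sum>.j. \<bar>a j t\<bar>\<^sup>2) <= ennreal m"
    by (subst (asm) AE_lebesgue_on_negligible) auto
  have le: "(\<Sum>.j. \<bar>a j t\<bar>\<^sup>2) <= m" if "t \<in> {0..1} - N" for t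
    using N(3)[OF that] m(2) by (simp add: ennreal_le_iff)
  have "\<bar>a j t\<bar> <= 1" if "t \<in> {0..1} - N" for t j
  proof -
    have "\<bar>a j t\<bar>\<^sup>2 <= (\<Sum>.j. \<bar>a j t\<bar>\<^sup>2)" by (rule member_le_sum) auto
    then have "\<bar>a j t\<bar>\<^sup>2 <= 1" using le[OF that] m1 by linarith
    then show ?thesis using power2_le_imp_le[of "\<bar>a j t\<bar>" 1] by simp
  qed
  then show ?thesis using that[OF \<gamma> N(1) a m1 N(2) le] by blast
qed

lemma cc_ballI:
  assumes \<gamma>: "absolutely_continuous_on {0..1} \<gamma>" "\<gamma> ` {0..1} \<subseteq> \<Omega>" "\<gamma> 0 = x" "\<gamma> 1 = y"
    and N: "negligible N" and a: "!!j. a j \<in> borel_measurable (lebesgue_on {0..1})" and m: "m < 1"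
    and der: "!!t. t \<in> {0..1} - N ==> (\<gamma> has_vector_derivative (\<Sum>.j. a j t *. \<delta> *. W j (\<gamma> t))) (at t)"
    and le: "!!t. t \<in> {0..1} - N ==> (\<Sum>.j. \<bar>a j t\<bar>\<^sup>2) <= m"
  shows "y \<in> cc_ball \<Omega> W x \<delta>"
proof -
  have "y \<in> \<Omega>" using \<gamma>(2,4) by auto
  moreover have "AE t in lebesgue_on {0..1}. (\<gamma> has_vector_derivative (\<Sum>.j. a j t *. \<delta> *. W j (\<gamma> t))) (at t)"
    by (subst AE_lebesgue_on_negligible) (use N der in auto)
  moreover have "a j \<in> L_infty (lebesgue_on {0..1})" for j
  proof -
    have "\<bar>a j t\<bar> <= 1" if "t \<in> {0..1} - N" for t
    proof -
      have "\<bar>a j t\<bar>\<^sup>2 <= (\<Sum>.j. \<bar>a j t\<bar>\<^sup>2)" by (rule member_le_sum) auto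
      then have "\<bar>a j t\<bar>\<^sup>2 <= 1" using le[OF that] m by linarith
      then show ?thesis using power2_le_imp_le[of "\<bar>a j t\<bar>" 1] by simp
    qed
    then have "AE t in lebesgue_on {0..1}. ennreal \<bar>a j t\<bar> <= 1"
      by (subst AE_lebesgue_on_negligible) (use N in \<open>auto simp: ennreal_le_1\<close>)
    then have "esssup (lebesgue_on {0..1}) (%t. ennreal \<bar>a j t\<bar>) <= 1"
      using a[of j] by (intro esssup_I) measurable
    then show ?thesis
      using a[of j] by (auto simp: L_infty_def intro: le_less_trans)
  qed
  moreover have "esssup (lebesgue_on {0..1}) (%t. ennreal (\<Sum>.j. \<bar>a j t\<bar>\<^sup>2)) < 1"
  proof -
    have [measurable]: "a j \<in> borel_measurable (lebesgue_on {0..1})" for j by (rule a)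
    have "AE t in lebesgue_on {0..1}. ennreal (\<Sum>.j. \<bar>a j t\<bar>\<^sup>2) <= ennreal (max 0 m)"
      by (subst AE_lebesgue_on_negligible)
        (use N le in \<open>auto intro!: exI[of _ N] ennreal_leI simp: max.coboundedI2\<close>)
    then have "esssup (lebesgue_on {0..1}) (%t. ennreal (\<Sum>.j. \<bar>a j t\<bar>\<^sup>2)) <= ennreal (max 0 m)"
      by (intro esssup_I) measurable
    also have "\<dots> < 1" using m by (simp add: ennreal_less_one_iff)
    finally show ?thesis .
  qed
  ultimately show ?thesis
    using \<gamma> unfolding cc_ball_def by blast
qed

text \<open>Makes controls that are given by Cramer's formula measurable.\<close>

lemma borel_measurable_det [measurable (raw)]:
  fixes A :: "'a => real^'n^'n::finite"
  assumes [measurable]: "!!i j. (%t. A t $ i $ j) \<in> borel_measurable M"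
  shows "(%t. det (A t)) \<in> borel_measurable M"
  unfolding det_def by measurable

text \<open>The endpoint of an admissible path is moved to a nearby point by adding a linear drift; since the
  fields span, the resulting error in the equation is absorbed by a small change of the controls.\<close>

lemma cc_ball_open:
  fixes W :: "'q::finite => real^'n::finite => real^'n"
  assumes \<Omega>: "open \<Omega>" and cont: "!!l. continuous_on \<Omega> (W l)"
    and span: "!!z. z \<in> \<Omega> ==> span (range (%l. W l z)) = UNIV"
  shows "open (cc_ball \<Omega> W x 1)"
  unfolding open_contains_ball
proof
  fix y assume "y \<in> cc_ball \<Omega> W x 1"
  then obtain \<gamma> a N m where \<gamma>: "absolutely_continuous_on {0..1} \<gamma>" "\<gamma> ` {0..1} \<subseteq> \<Omega>" "\<gamma> 0 = x" "\<gamma> 1 = y" "y \<in> \<Omega>"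
    and N: "negligible N" and a: "!!j. a j \<in> L_infty (lebesgue_on {0..1})" and m: "m < 1"
    and der: "!!t. t \<in> {0..1} - N ==> (\<gamma> has_vector_derivative (\<Sum>.j. a j t *. 1 *. W j (\<gamma> t))) (at t)"
    and am: "!!t. t \<in> {0..1} - N ==> (\<Sum>.j. \<bar>a j t\<bar>\<^sup>2) <= m"
    and a1: "!!t j. t \<in> {0..1} - N ==> \<bar>a j t\<bar> <= 1"
    by (rule cc_ballE) blast
  have c\<gamma>: "continuous_on {0..1} \<gamma>" by (rule absolutely_continuous_imp_continuous[OF \<gamma>(1)])
  have C: "compact (\<gamma> ` {0..1})" by (rule compact_continuous_image[OF c\<gamma>]) auto
  obtain e0 where e0: "e0 > 0" "(\<Union>z\<in>\<gamma> ` {0..1}. cball z e0) \<subseteq> \<Omega>"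
    using compact_subset_open_imp_cball_epsilon_subset[OF C \<Omega> \<gamma>(2)] .
  \<comment> \<open>A compact neighbourhood of the path inside \<Omega>: the perturbed paths run in
    it, and all bounds are taken over it.\<close>
  define D where "D = {z + v | z v. z \<in> \<gamma> ` {0..1} \<and> v \<in> cball 0 e0}"
  have D: "compact D" unfolding D_def by (rule compact_sums[OF C]) auto
  have D\<Omega>: "D \<subseteq> \<Omega>"
  proof
    fix z assume "z \<in> D"
    then obtain t v where t: "t \<in> {0..1}" "norm v <= e0" "z = \<gamma> t + v" by (auto simp: D_def)
    then have "z \<in> cball (\<gamma> t) e0" by (simp add: dist_norm)
    then show "z \<in> \<Omega>" using e0(2) t(1) by blast
  qed
  have D_ne: "\<gamma> 0 + 0 \<in> D" unfolding D_def using e0(1) by fastforce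
  have contD: "continuous_on D (W l)" for l by (rule continuous_on_subset[OF cont D\<Omega>])
  obtain B where B: "B > 0" "!!l z. z \<in> D ==> norm (W l z) <= B"
  proof -
    have "\<exists>b>0. \<forall>z\<in>D. norm (W l z) <= b" for l
      using compact_imp_bounded[OF compact_continuous_image[OF contD D], of l] by (auto simp: bounded_pos)
    then obtain b where b: "!!l. b l > 0" "!!l z. z \<in> D ==> norm (W l z) <= b l" by metis
    have bs: "b l <= (\<Sum>.l. b l)" for l
      by (rule member_le_sum) (use b(1) in \<open>auto intro: less_imp_le\<close>)
    show ?thesis
    proof (rule that[of "\<Sum>.l. b l"])
      show "0 < (\<Sum>.l. b l)" by (rule sum_pos) (use b(1) in auto)
      show "norm (W l z) <= (\<Sum>.l. b l)" if "z \<in> D" for l z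
        using b(2)[OF that, of l] bs[of l] by linarith
    qed
  qed
  \<comment> \<open>Spanning in quantitative form: by compactness, the sum of the squares of the
    inner products with the fields has a positive minimum over \<open>D\<close> and all unit
    vectors.\<close>
  obtain \<kappa> where \<kappa>: "\<kappa> > 0" "!!z v. z \<in> D ==> norm v = 1 ==> \<kappa> <= (\<Sum>.l. (W l z \<bullet> v)\<^sup>2)"
  proof -
    define f where "f p = (\<Sum>.l. (W l (fst p) \<bullet> snd p)\<^sup>2)" for p
    have "continuous_on (D \<times> sphere 0 1) f"
      unfolding f_def
      by (intro continuous_intros continuous_on_compose2[OF contD]) auto
    moreover have "compact (D \<times> sphere (0::real^'n) 1)" using D by (intro compact_Times) auto
    moreover have "D \<times> sphere (0::real^'n) 1 \<noteq> {}" using D_ne by auto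
    ultimately obtain p where p: "p \<in> D \<times> sphere 0 1" "!!p'. p' \<in> D \<times> sphere 0 1 ==> f p <= f p'"
      using continuous_attains_inf[of "D \<times> sphere 0 1" f] by blast
    have "f p \<noteq> 0"
    proof
      assume "f p = 0"
      then have z: "W l (fst p) \<bullet> snd p = 0" for l
        unfolding f_def by (subst (asm) sum_nonneg_eq_0_iff) auto
      have "orthogonal (snd p) v" if "v \<in> span (range (%l. W l (fst p)))" for v
        by (rule orthogonal_to_span[OF that]) (use z in \<open>auto simp: orthogonal_def inner_commute\<close>)
      then have "orthogonal (snd p) (snd p)" using span[of "fst p"] p(1) D\<Omega> by auto
      then show False using p(1) by (auto simp: orthogonal_def)
    qed
    then have "0 < f p" by (simp add: f_def sum_nonneg less_le)
    then show ?thesis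
    proof (rule that)
      show "f p <= (\<Sum>.l. (W l z \<bullet> v)\<^sup>2)" if "z \<in> D" "norm v = 1" for z v
        using p(2)[of "(z, v)"] that by (simp add: f_def)
    qed
  qed
  have \<kappa>2: "\<kappa> * (norm v)\<^sup>2 <= (\<Sum>.l. (W l z \<bullet> v)\<^sup>2)" if "z \<in> D" for z v
  proof (cases "v = 0")
    case False
    have "\<kappa> <= (\<Sum>.l. (W l z \<bullet> ((1 / norm v) *. v))\<^sup>2)"
      by (rule \<kappa>(2)[OF that]) (use False in simp)
    also have "\<dots> = (\<Sum>.l. (W l z \<bullet> v)\<^sup>2) / (norm v)\<^sup>2"
      by (simp add: power_divide sum_divide_distrib)
    finally show ?thesis using False by (simp add: field_simps)
  qed simp
  \<comment> \<open>The Gram operator of the fields: solving S u = r writes r as a combination of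
    the W_l whose coefficients, the inner products of W_l and u, are controlled.\<close>
  define S where "S z = (\<chi> i j. \<Sum>.l. W l z $ i * W l z $ j)" for z
  have S: "S z *v v = (\<Sum>.l. (W l z \<bullet> v) *. W l z)" for z v
  proof -
    have "(S z *v v) $ i = (\<Sum>.j. \<Sum>.l. W l z $ i * W l z $ j * v $ j)" for i
      by (simp add: S_def matrix_vector_mult_def sum_distrib_right)
    moreover have "(\<Sum>.j. \<Sum>.l. W l z $ i * W l z $ j * v $ j) = (\<Sum>.l. \<Sum>.j. W l z $ i * W l z $ j * v $ j)" for i
      by (rule sum.swap)
    ultimately show ?thesis
      by (simp add: vec_eq_iff inner_vec_def sum_distrib_left sum_distrib_right mult_ac)
  qed
  have S_lower: "\<kappa> * norm v <= norm (S z *v v)" if "z \<in> D" for z v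
  proof (cases "v = 0")
    case False
    have "norm v * (\<kappa> * norm v) <= v \<bullet> (S z *v v)"
      using \<kappa>2[OF that, of v] by (simp add: S inner_sum_right power2_eq_square inner_commute mult_ac)
    also have "\<dots> <= norm v * norm (S z *v v)" by (rule norm_cauchy_schwarz)
    finally show ?thesis using False by simp
  qed simp
  have det_S: "det (S z) \<noteq> 0" if "z \<in> D" for z
  proof
    assume "det (S z) = 0"
    then obtain v where v: "v \<noteq> 0" "S z *v v = 0"
      using invertible_det_nz[of "S z"] matrix_left_invertible_ker[of "S z"] unfolding invertible_left_inverse by blast
    then show False using S_lower[OF that, of v] \<kappa>(1) by (simp add: mult_le_0_iff)
  qed
  \<comment> \<open>Cramer's rule gives the solution by an explicit formula, so that the new
    controls depend measurably on time.\<close>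
  define u where "u z r = (\<chi> k. det (\<chi> i j. if j = k then r $ i else S z $ i $ j) / det (S z))" for z r
  have Su: "S z *v u z r = r" if "z \<in> D" for z r
    using cramer[OF det_S[OF that], of "u z r" r] by (simp add: u_def)
  have u_le: "norm (u z r) <= norm r / \<kappa>" if "z \<in> D" for z r
    using S_lower[OF that, of "u z r"] \<kappa>(1) by (simp add: Su[OF that] field_simps)
  define q where "q = real CARD('q)"
  have q: "1 <= q" by (simp add: q_def Suc_le_eq)
  \<comment> \<open>Changing a control by at most \<epsilon> <= 1 raises its square by at most 3
    \<epsilon>; over all q controls this uses half of 1 - m.\<close>
  define \<epsilon> where "\<epsilon> = min 1 ((1 - m) / (6 * q))"
  have \<epsilon>: "0 < \<epsilon>" "\<epsilon> <= 1" "q * (3 * \<epsilon>) <= (1 - m) / 2"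
  proof -
    show "0 < \<epsilon>" "\<epsilon> <= 1" using m q by (auto simp: \<epsilon>_def)
    have "\<epsilon> <= (1 - m) / (6 * q)" by (simp add: \<epsilon>_def)
    then have "q * (3 * \<epsilon>) <= q * (3 * ((1 - m) / (6 * q)))" using q by (intro mult_left_mono) auto
    then show "q * (3 * \<epsilon>) <= (1 - m) / 2" using q by simp
  qed
  \<comment> \<open>A residual of size \<rho> is solved by a vector of size \<rho> / \<kappa>, and
    this changes each control by at most B \<rho> / \<kappa> = \<epsilon>.\<close>
  define \<rho> where "\<rho> = \<epsilon> * \<kappa> / B"
  have \<rho>: "0 < \<rho>" using \<epsilon> \<kappa> B by (simp add: \<rho>_def)
  obtain \<delta> where \<delta>: "\<delta> > 0" "!!l z z'. z \<in> D ==> z' \<in> D ==> dist z' z < \<delta> ==> norm (W l z' - W l z) <= \<rho> / (2 * q)"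
  proof -
    have pos: "0 < \<rho> / (2 * q)" using \<rho> q by simp
    have "\<exists>d>0. \<forall>z\<in>D. \<forall>z'\<in>D. dist z' z < d --> dist (W l z') (W l z) < \<rho> / (2 * q)" for l
      using compact_uniformly_continuous[OF contD D, of l] pos unfolding uniformly_continuous_on_def by blast
    then obtain d where d: "!!l. d l > 0"
      "!!l z z'. z \<in> D ==> z' \<in> D ==> dist z' z < d l ==> dist (W l z') (W l z) < \<rho> / (2 * q)"
      by metis
    show ?thesis
    proof (rule that[of "Min (range d)"])
      show "0 < Min (range d)" using d(1) by (subst Min_gr_iff) auto
      show "norm (W l z' - W l z) <= \<rho> / (2 * q)" if "z \<in> D" "z' \<in> D" "dist z' z < Min (range d)" for l z z'
      proof -
        have "Min (range d) <= d l" by (rule Min_le) auto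
        then show ?thesis using d(2)[OF that(1,2), of l] that(3) by (simp add: dist_norm)
      qed
    qed
  qed
  have "y' \<in> cc_ball \<Omega> W x 1" if y': "y' \<in> ball y (min e0 (min \<delta> (\<rho> / 2)))" for y'
  proof -
    define h where "h = y' - y"
    have h: "norm h <= e0" "norm h < \<delta>" "norm h <= \<rho> / 2"
      using y' by (auto simp: h_def dist_norm norm_minus_commute)
    define \<gamma>' where "\<gamma>' t = \<gamma> t + t *. h" for t
    have th: "norm (t *. h) <= norm h" if "t \<in> {0..1}" for t
      using that mult_right_mono[of "\<bar>t\<bar>" 1 "norm h"] by simp
    have \<gamma>'D: "\<gamma>' t \<in> D" if "t \<in> {0..1}" for t
      unfolding D_def \<gamma>'_def using that th[OF that] h(1) by (fastforce simp del: norm_scaleR)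
    have \<gamma>D: "\<gamma> t \<in> D" if "t \<in> {0..1}" for t
    proof -
      have "\<gamma> t = \<gamma> t + 0" "0 \<in> cball 0 e0" using e0 by auto
      then show ?thesis unfolding D_def using that by blast
    qed
    have c\<gamma>': "continuous_on {0..1} \<gamma>'" unfolding \<gamma>'_def by (intro continuous_intros c\<gamma>)
    \<comment> \<open>What the old controls fail to produce along the shifted path: half of \<rho>
      is reserved for the change of the fields, half for the drift.\<close>
    define r where "r t = (\<Sum>.l. a l t *. (W l (\<gamma> t) - W l (\<gamma>' t))) + h" for t
    define b where "b l t = a l t + W l (\<gamma>' t) \<bullet> u (\<gamma>' t) (r t)" for l t
    have r: "norm (r t) <= \<rho>" if t: "t \<in> {0..1} - N" for t
    proof -
      have "norm (a l t *. (W l (\<gamma> t) - W l (\<gamma>' t))) <= 1 * (\<rho> / (2 * q))" for l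
        unfolding norm_scaleR
      proof (intro mult_mono)
        have "dist (\<gamma> t) (\<gamma>' t) < \<delta>"
          using th[of t] t h(2) by (simp add: \<gamma>'_def dist_norm)
        then show "norm (W l (\<gamma> t) - W l (\<gamma>' t)) <= \<rho> / (2 * q)"
          using t by (intro \<delta>(2) \<gamma>'D \<gamma>D) auto
      qed (use a1[OF t] in auto)
      then have "norm (\<Sum>.l. a l t *. (W l (\<gamma> t) - W l (\<gamma>' t))) <= (\<Sum>l\<in>(UNIV::'q set). \<rho> / (2 * q))"
        by (intro sum_norm_le) auto
      also have "\<dots> = \<rho> / 2" using q by (simp add: q_def)
      finally show ?thesis unfolding r_def using h(3) by norm
    qed
    have e: "\<bar>W l (\<gamma>' t) \<bullet> u (\<gamma>' t) (r t)\<bar> <= \<epsilon>" if t: "t \<in> {0..1} - N" for l t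
    proof -
      have tD: "\<gamma>' t \<in> D" using t \<gamma>'D by blast
      have "\<bar>W l (\<gamma>' t) \<bullet> u (\<gamma>' t) (r t)\<bar> <= norm (W l (\<gamma>' t)) * norm (u (\<gamma>' t) (r t))" by (rule Cauchy_Schwarz_ineq2)
      also have "\<dots> <= B * (\<rho> / \<kappa>)"
      proof (rule mult_mono)
        show "norm (u (\<gamma>' t) (r t)) <= \<rho> / \<kappa>"
          using u_le[OF tD, of "r t"] divide_right_mono[OF r[OF t], of \<kappa>] \<kappa>(1) by linarith
      qed (use B tD in auto)
      also have "\<dots> = \<epsilon>" using B \<kappa> by (simp add: \<rho>_def)
      finally show ?thesis .
    qed
    show ?thesis
    proof (rule cc_ballI[where \<gamma> = \<gamma>' and a = b and N = N and m = "(1 + m) / 2"])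
      show "absolutely_continuous_on {0..1} \<gamma>'"
        unfolding \<gamma>'_def
      proof (rule absolutely_continuous_on_add[OF \<gamma>(1)], rule lipschitz_imp_absolutely_continuous)
        show "norm (s *. h - t *. h) <= norm h * \<bar>s - t\<bar>" for s t
          by (simp add: scaleR_diff_left[symmetric])
      qed
      show "\<gamma>' ` {0..1} \<subseteq> \<Omega>" using \<gamma>'D D\<Omega> by blast
      show "\<gamma>' 0 = x" "\<gamma>' 1 = y'" using \<gamma> by (auto simp: \<gamma>'_def h_def)
      show "b j \<in> borel_measurable (lebesgue_on {0..1})" for j
      proof -
        have [measurable]: "a l \<in> borel_measurable (lebesgue_on {0..1})" for l using a by (simp add: L_infty_def)
        have [measurable]: "(%t. W l (\<gamma> t) $ i) \<in> borel_measurable (lebesgue_on {0..1})" for l i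
          by (rule continuous_imp_measurable_on_sets_lebesgue)
            (auto intro!: continuous_intros continuous_on_compose2[OF contD c\<gamma>] \<gamma>D simp del: atLeastAtMost_iff)
        have [measurable]: "(%t. W l (\<gamma>' t) $ i) \<in> borel_measurable (lebesgue_on {0..1})" for l i
          by (rule continuous_imp_measurable_on_sets_lebesgue)
            (auto intro!: continuous_intros continuous_on_compose2[OF contD c\<gamma>'] \<gamma>'D simp del: atLeastAtMost_iff)
        have [measurable]: "(%t. r t $ i) \<in> borel_measurable (lebesgue_on {0..1})" for i
          unfolding r_def by simp
        have [measurable]: "(%t. S (\<gamma>' t) $ i $ j) \<in> borel_measurable (lebesgue_on {0..1})" for i j
          unfolding S_def by simp
        have [measurable]: "(%t. u (\<gamma>' t) (r t) $ k) \<in> borel_measurable (lebesgue_on {0..1})" for k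
        proof -
          have "(%t. det (\<chi> i j. if j = k then r t $ i else S (\<gamma>' t) $ i $ j)) \<in> borel_measurable (lebesgue_on {0..1})"
          proof (rule borel_measurable_det)
            fix i j
            show "(%t. (\<chi> i j. if j = k then r t $ i else S (\<gamma>' t) $ i $ j) $ i $ j) \<in> borel_measurable (lebesgue_on {0..1})"
              by (cases "j = k") simp_all
          qed
          then show ?thesis unfolding u_def by simp
        qed
        show ?thesis unfolding b_def inner_vec_def by simp
      qed
      show "(\<gamma>' has_vector_derivative (\<Sum>.j. b j t *. 1 *. W j (\<gamma>' t))) (at t)" if t: "t \<in> {0..1} - N" for t
      proof -
        have tD: "\<gamma>' t \<in> D" using t \<gamma>'D by blast
        have "(\<Sum>.j. b j t *. 1 *. W j (\<gamma>' t)) = (\<Sum>.j. a j t *. W j (\<gamma>' t)) + S (\<gamma>' t) *v u (\<gamma>' t) (r t)"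
          by (simp add: b_def S scaleR_add_left sum.distrib)
        also have "\<dots> = (\<Sum>.j. a j t *. 1 *. W j (\<gamma> t)) + h"
          by (simp add: Su[OF tD] r_def scaleR_diff_right sum_subtractf)
        finally have eq: "(\<Sum>.j. b j t *. 1 *. W j (\<gamma>' t)) = (\<Sum>.j. a j t *. 1 *. W j (\<gamma> t)) + h" .
        have "((%t. t *. h) has_vector_derivative h) (at t)"
          unfolding has_vector_derivative_def by (auto intro!: derivative_eq_intros)
        from has_vector_derivative_add[OF der[OF t] this]
        have "(\<gamma>' has_vector_derivative (\<Sum>.j. a j t *. 1 *. W j (\<gamma> t)) + h) (at t)"
          by (simp add: \<gamma>'_def[abs_def])
        then show ?thesis by (simp only: eq)
      qed
      show "(\<Sum>.j. \<bar>b j t\<bar>\<^sup>2) <= (1 + m) / 2" if t: "t \<in> {0..1} - N" for t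
      proof -
        have "\<bar>b j t\<bar>\<^sup>2 <= \<bar>a j t\<bar>\<^sup>2 + 3 * \<epsilon>" for j
        proof -
          define e' where "e' = W j (\<gamma>' t) \<bullet> u (\<gamma>' t) (r t)"
          have e': "\<bar>e'\<bar> <= \<epsilon>" using e[OF t] by (simp add: e'_def)
          have "\<bar>b j t\<bar>\<^sup>2 = \<bar>a j t\<bar>\<^sup>2 + (2 * (a j t * e') + e' * e')"
            by (simp add: b_def e'_def power2_eq_square algebra_simps)
          moreover have "\<bar>a j t * e'\<bar> <= 1 * \<epsilon>" unfolding abs_mult using a1[OF t] e' by (intro mult_mono) auto
          moreover have "\<bar>e' * e'\<bar> <= 1 * \<epsilon>" unfolding abs_mult using e' \<epsilon> by (intro mult_mono) auto
          ultimately show ?thesis by linarith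
        qed
        then have "(\<Sum>.j. \<bar>b j t\<bar>\<^sup>2) <= (\<Sum>.j. \<bar>a j t\<bar>\<^sup>2 + 3 * \<epsilon>)" by (intro sum_mono)
        also have "\<dots> = (\<Sum>.j. \<bar>a j t\<bar>\<^sup>2) + q * (3 * \<epsilon>)" by (simp add: sum.distrib q_def)
        also have "\<dots> <= m + (1 - m) / 2" using am[OF t] \<epsilon>(3) by linarith
        finally show ?thesis by (simp add: field_simps)
      qed
    qed (use N m in auto)
  qed
  then show "\<exists>e>0. ball y e \<subseteq> cc_ball \<Omega> W x 1"
    using e0(1) \<delta>(1) \<rho> by (intro exI[of _ "min e0 (min \<delta> (\<rho> / 2))"]) auto
qed

context scaled_frame
begin

lemma eta1_le: "T * \<eta>1 <= 1 / 16" "\<eta>1 <= 1" "\<eta>1 <= \<eta> / 4" "\<eta>1 <= \<eta> / 2" "\<eta>1 <= \<eta>"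
proof -
  have "1 * T ^ 0 * \<eta> <= \<epsilon>" by (rule eta_bound) auto
  moreover have "1 * T ^ 0 * \<epsilon> <= 1" by (rule eps_bound) auto
  ultimately have \<eta>: "\<eta> <= 1" by simp
  then show "T * \<eta>1 <= 1 / 16" using eta1_bounds(3) by simp
  show "\<eta>1 <= 1" "\<eta>1 <= \<eta> / 4" "\<eta>1 <= \<eta> / 2" "\<eta>1 <= \<eta>" using eta1_bounds eta(1) \<eta> by auto
qed

lemma E_component: "E t $ a = ev (of_real (x $ a) + \<rho> *. w a) (us t)" if "norm t <= \<eta>"
  using us_in(1)[OF that] by (simp add: E_def pt_def zz_def ev_add ev_of_real ev_scaleR)

lemma E_analytic: "real_analytic_on (ball 0 \<eta>1) E"
proof (rule vec_ev_power_series(3)[OF eta(1) eta1_bounds(1) eta1_le(3)])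
  fix t :: "real^'n" assume "t \<in> ball 0 \<eta>1"
  then have "norm t <= \<eta>" using eta1_le(5) by simp
  then show "E t = (\<chi> a. ev (of_real (x $ a) + \<rho> *. w a) ((1 / \<eta>) *. t))"
    using E_component[of t] by (simp add: vec_eq_iff us_def)
qed

lemma E_derivative_ball:
  assumes "t \<in> ball 0 \<eta>1"
  shows "(E has_derivative dE t) (at t)" "bij (dE t)"
  using assms eta1_le by (auto intro!: E_has_derivative bij_dE)

lemma E_image: "open (E ` ball 0 \<eta>1)" "real_analytic_on (E ` ball 0 \<eta>1) (inv_into (ball 0 \<eta>1) E)"
  using real_analytic_inverse[OF open_ball inj_on_E E_analytic] E_derivative_ball by blast+

lemma norm_Yt: "norm (Yt l t) <= T * (T * 4)" if "norm t <= \<eta>"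
proof -
  have "norm (Yt l t) <= (\<Sum>.i. \<bar>Yt l t $ i\<bar>)" by (rule norm_le_l1_cart)
  also have "\<dots> <= (\<Sum>i\<in>(UNIV::'n set). T * (2 * 2))"
    using abs_ev_le[OF us_in(1)[OF that]] norm_yc order_trans
    unfolding Yt_def by (intro sum_mono) fastforce
  also have "\<dots> = real CARD('n) * (T * 4)" by simp
  also have "\<dots> <= T * (T * 4)" using card_n T_ge_1 by (intro mult_right_mono) auto
  finally show ?thesis .
qed

text \<open>The inverse is differentiable because it is analytic; its derivative is then forced by
  composition with \<open>E\<close> being the identity on the ball.\<close>

lemma inverse_derivative:
  assumes t: "t \<in> ball 0 \<eta>1"
  shows "\<exists>D. (inv_into (ball 0 \<eta>1) E has_derivative D) (at (E t)) \<and> (\<forall>l. D (Z l (E t)) = Yt l t)"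
proof -
  let ?\<psi> = "inv_into (ball 0 \<eta>1) E"
  obtain D where D: "(?\<psi> has_derivative D) (at (E t))"
    using real_analytic_locally_lipschitz[OF E_image(2), of "E t"] t unfolding differentiable_def by blast
  have "((%s. ?\<psi> (E s)) has_derivative (%h. D (dE t h))) (at t)"
    by (rule has_derivative_compose[OF E_derivative_ball(1)[OF t] D])
  moreover have "((%s. ?\<psi> (E s)) has_derivative (%h. h)) (at t)"
    by (rule has_derivative_transform_within_open[OF has_derivative_ident open_ball t])
      (simp add: inv_into_f_f[OF inj_on_E])
  ultimately have *: "(%h. D (dE t h)) = (%h. h)"
    by (rule has_derivative_unique)
  have "D (Z l (E t)) = Yt l t" for l
    using fun_cong[OF *, of "Yt l t"] dE_Yt[of t l] t eta1_le(5) by simp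
  then show ?thesis using D by blast
qed

text \<open>An admissible path of small speed cannot leave \<open>E ` ball 0 \<eta>1\<close>: up to the exit time, its lift
  is absolutely continuous with speed so small that it stays in the ball of half the radius.\<close>

lemma cc_ball_subset_E:
  fixes W :: "'q => real^'n => real^'n"
  assumes \<xi>: "T * (\<xi> * (T * (T * 4))) <= \<eta>1 / 2" and W: "!!l y. W l y = c l *. Z l y" and c: "!!l. \<bar>c l\<bar> <= \<xi>"
  shows "cc_ball \<Omega> W x 1 \<subseteq> E ` ball 0 \<eta>1"
proof
  fix y assume "y \<in> cc_ball \<Omega> W x 1"
  then obtain \<gamma> a N m where \<gamma>: "absolutely_continuous_on {0..1} \<gamma>" "\<gamma> ` {0..1} \<subseteq> \<Omega>" "\<gamma> 0 = x" "\<gamma> 1 = y"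
    and N: "negligible N"
    and der: "!!t. t \<in> {0..1} - N ==> (\<gamma> has_vector_derivative (\<Sum>.j. a j t *. 1 *. W j (\<gamma> t))) (at t)"
    and a1: "!!t j. t \<in> {0..1} - N ==> \<bar>a j t\<bar> <= 1"
    by (rule cc_ballE) blast
  let ?O = "E ` ball 0 \<eta>1" and ?\<psi> = "inv_into (ball 0 \<eta>1) E"
  have \<xi>0: "0 <= \<xi>" using c[of undefined] by linarith
  have c\<gamma>: "continuous_on {0..1} \<gamma>" by (rule absolutely_continuous_imp_continuous[OF \<gamma>(1)])
  \<comment> \<open>As long as the path stays in the image it traces a compact part of it, so the
    inverse is Lipschitz there and the lift is absolutely continuous; the choice of \<xi> bounds its
    speed by \<open>\<eta>1 / 2\<close>.\<close>
  have lift: "\<gamma> \<tau> \<in> E ` cball 0 (\<eta>1 / 2)" if \<tau>: "\<tau> \<in> {0..1}" and O: "\<gamma> ` {0..\<tau>} \<subseteq> ?O" for \<tau>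
  proof -
    have sub: "{0..\<tau>} \<subseteq> {0..1}" using \<tau> by auto
    have "compact (\<gamma> ` {0..\<tau>})"
      by (rule compact_continuous_image[OF continuous_on_subset[OF c\<gamma> sub]]) auto
    then obtain L where L: "L-lipschitz_on (\<gamma> ` {0..\<tau>}) ?\<psi>"
      using real_analytic_lipschitz_compact[OF E_image(2) _ O] by blast
    have ac: "absolutely_continuous_on {0..\<tau>} (%t. ?\<psi> (\<gamma> t))"
      by (rule absolutely_continuous_on_lipschitz_compose[OF absolutely_continuous_on_subset[OF \<gamma>(1) sub] L])
    have "norm (?\<psi> (\<gamma> \<tau>) - ?\<psi> (\<gamma> 0)) <= \<eta>1 / 2 * (\<tau> - 0)"
    proof (rule absolutely_continuous_mean_value[OF ac _ N])
      fix t assume t: "t \<in> {0..\<tau>} - N"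
      then have t1: "t \<in> {0..1} - N" using sub by auto
      have "\<gamma> t \<in> ?O" using O t by blast
      then obtain s where s: "s \<in> ball 0 \<eta>1" "\<gamma> t = E s" by blast
      obtain D where D: "(?\<psi> has_derivative D) (at (E s))" "!!l. D (Z l (E s)) = Yt l s"
        using inverse_derivative[OF s(1)] by blast
      let ?v = "\<Sum>.j. (a j t * c j) *. Z j (E s)"
      have "(\<gamma> has_vector_derivative ?v) (at t)"
        using der[OF t1] by (simp add: W s(2))
      then have "((%t. ?\<psi> (\<gamma> t)) has_derivative (%h. D (h *. ?v))) (at t)"
        unfolding has_vector_derivative_def
        by (rule has_derivative_compose) (use D(1) s(2) in simp)
      moreover have linD: "linear D" using D(1) by (rule has_derivative_linear)
      have Dv: "D ?v = (\<Sum>.j. (a j t * c j) *. Yt j s)"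
        by (simp add: linear_sum[OF linD] linear_cmul[OF linD] D(2))
      have "(%h. D (h *. ?v)) = (%h. h *. (\<Sum>.j. (a j t * c j) *. Yt j s))"
        unfolding linear_cmul[OF linD] Dv ..
      ultimately have "((%t. ?\<psi> (\<gamma> t)) has_derivative (%h. h *. (\<Sum>.j. (a j t * c j) *. Yt j s))) (at t)"
        by (simp only:)
      then have "((%t. ?\<psi> (\<gamma> t)) has_vector_derivative (\<Sum>.j. (a j t * c j) *. Yt j s)) (at t within {0..\<tau>})"
        unfolding has_vector_derivative_def by (rule has_derivative_at_withinI)
      moreover have "norm (\<Sum>.j. (a j t * c j) *. Yt j s) <= \<eta>1 / 2"
      proof -
        have "norm ((a j t * c j) *. Yt j s) <= (1 * \<xi>) * (T * (T * 4))" for j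
          unfolding norm_scaleR abs_mult using a1[OF t1, of j] c[of j] norm_Yt[of s j] s(1) eta1_le(5) \<xi>0
          by (intro mult_mono) auto
        then have "norm (\<Sum>.j. (a j t * c j) *. Yt j s) <= (\<Sum>j\<in>(UNIV::'q set). \<xi> * (T * (T * 4)))"
          by (intro sum_norm_le) simp
        also have "\<dots> = real CARD('q) * (\<xi> * (T * (T * 4)))" by simp
        also have "\<dots> <= T * (\<xi> * (T * (T * 4)))"
          using card_q \<xi>0 T_ge_1 by (intro mult_right_mono) auto
        finally show ?thesis using \<xi> by linarith
      qed
      ultimately show "\<exists>v. ((%t. ?\<psi> (\<gamma> t)) has_vector_derivative v) (at t within {0..\<tau>}) \<and> norm v <= \<eta>1 / 2"
        by blast
    qed (use \<tau> eta1_bounds in auto)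
    moreover have "?\<psi> (\<gamma> 0) = 0"
      using inv_into_f_f[OF inj_on_E, of 0] eta1_bounds(1) by (simp add: \<gamma> E_0)
    moreover have "\<eta>1 / 2 * (\<tau> - 0) <= \<eta>1 / 2 * 1"
      using \<tau> eta1_bounds by (intro mult_left_mono) auto
    ultimately have "norm (?\<psi> (\<gamma> \<tau>)) <= \<eta>1 / 2" by simp
    moreover have "\<gamma> \<tau> = E (?\<psi> (\<gamma> \<tau>))"
    proof (rule f_inv_into_f[symmetric])
      have "\<tau> \<in> {0..\<tau>}" using \<tau> by auto
      then show "\<gamma> \<tau> \<in> ?O" using O by blast
    qed
    ultimately show ?thesis by (auto intro!: image_eqI[of _ E "?\<psi> (\<gamma> \<tau>)"])
  qed
  have half: "E ` cball 0 (\<eta>1 / 2) \<subseteq> ?O" using eta1_bounds(1) by auto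
  have "\<gamma> ` {0..1} \<subseteq> ?O"
  proof (rule ccontr)
    assume not: "\<not> \<gamma> ` {0..1} \<subseteq> ?O"
    \<comment> \<open>The set of times outside the image; its infimum is the first exit. Before that
      time the path lies in the compact image of the half ball, and by continuity it is still there
      at the exit, a contradiction.\<close>
    define B where "B = {0..1} \<inter> \<gamma> -` (- ?O)"
    have "closed B"
      using continuous_closed_preimage[OF c\<gamma> _ closed_Compl[OF E_image(1)]] by (simp add: B_def)
    moreover have B: "B \<noteq> {}" "bdd_below B" using not by (auto simp: B_def intro!: bdd_belowI[of _ 0])
    ultimately have inf: "Inf B \<in> B" by (rule closed_contains_Inf[rotated 2])
    then have i01: "Inf B \<in> {0..1}" "\<gamma> (Inf B) \<notin> ?O" by (auto simp: B_def)
    have before: "\<gamma> t \<in> ?O" if "0 <= t" "t < Inf B" for t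
    proof (rule ccontr)
      assume "\<gamma> t \<notin> ?O"
      then have "t \<in> B" using that i01 by (auto simp: B_def)
      then show False using cInf_lower[OF _ B(2)] that by fastforce
    qed
    have "0 \<noteq> Inf B"
    proof
      assume "0 = Inf B"
      then have "x \<notin> ?O" using i01 \<gamma>(3) by simp
      then show False using E_0 eta1_bounds(1) by (metis centre_in_ball image_eqI)
    qed
    then have pos: "0 < Inf B" using i01 by auto
    have cl: "closed (E ` cball 0 (\<eta>1 / 2))"
    proof (intro compact_imp_closed compact_continuous_image)
      show "continuous_on (cball 0 (\<eta>1 / 2)) E"
      proof (intro continuous_at_imp_continuous_on ballI)
        show "isCont E t" if "t \<in> cball 0 (\<eta>1 / 2)" for t
          by (rule has_derivative_continuous[OF E_derivative_ball(1)]) (use that eta1_bounds(1) in auto)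
      qed
    qed auto
    have "\<gamma> t \<in> E ` cball 0 (\<eta>1 / 2)" if t: "t \<in> {0..<Inf B}" for t
      by (rule lift) (use t i01 before in auto)
    then have sub: "\<gamma> ` {0..<Inf B} \<subseteq> E ` cball 0 (\<eta>1 / 2)" by blast
    have "continuous_on (closure {0..<Inf B}) \<gamma>"
      by (rule continuous_on_subset[OF c\<gamma>]) (use i01 pos in auto)
    from image_closure_subset[OF this cl sub] have "\<gamma> (Inf B) \<in> E ` cball 0 (\<eta>1 / 2)"
      using pos by auto
    then show False using half i01(2) by blast
  qed
  then show "y \<in> ?O" using \<gamma>(4) by auto
qed

text \<open>The rays of \<open>E\<close> are admissible with constant controls, the control of Z_l
  being the sum of the \<open>t $ i\<close> with \<open>k i = l\<close>. The bound
  \<open>T * \<eta>1 <= 1 / 16\<close> keeps the sum of their squares well below one.\<close>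

lemma E_subset_cc_ball: "E ` ball 0 \<eta>1 \<subseteq> cc_ball \<Omega> Z x 1"
proof
  fix y assume "y \<in> E ` ball 0 \<eta>1"
  then obtain t where t: "norm t < \<eta>1" "y = E t" by auto
  define a where "a l (s::real) = (\<Sum>i\<in>{i\<in>UNIV. k i = l}. t $ i)" for l s
  have st: "norm (s *. t) < \<eta>1" if "s \<in> {0..1}" for s
    using that t(1) mult_right_mono[of "\<bar>s\<bar>" 1 "norm t"] by auto
  have a_sum: "(\<Sum>.l. a l s *. 1 *. Z l z) = (\<Sum>.i. t $ i *. Z (k i) z)" for s z
  proof -
    have "(\<Sum>.l. a l s *. 1 *. Z l z) = (\<Sum>.l. \<Sum>i\<in>{i\<in>UNIV. k i = l}. t $ i *. Z (k i) z)"
      by (rule sum.cong[OF refl]) (simp add: a_def scaleR_sum_left)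
    also have "\<dots> = (\<Sum>.i. t $ i *. Z (k i) z)"
      by (rule sum.group) auto
    finally show ?thesis .
  qed
  have a_le: "\<bar>a l s\<bar> <= 1 / 16" for l s
  proof -
    have "\<bar>a l s\<bar> <= (\<Sum>i\<in>{i\<in>UNIV. k i = l}. \<bar>t $ i\<bar>)" unfolding a_def by (rule sum_abs)
    also have "\<dots> <= (\<Sum>.i. \<bar>t $ i\<bar>)" by (rule sum_mono2) auto
    also have "\<dots> <= (\<Sum>i\<in>(UNIV::'n set). \<eta>1)"
      using component_le_norm_cart[of t] t(1) by (intro sum_mono) (auto intro: order_trans less_imp_le)
    also have "\<dots> <= T * \<eta>1" using card_n eta1_bounds(1) by (simp add: mult_right_mono)
    finally show ?thesis using eta1_le(1) by linarith
  qed
  show "y \<in> cc_ball \<Omega> Z x 1"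
  \<comment> \<open>The ray is differentiated only within [0, 1], so the two endpoints go into the
    null set.\<close>
  proof (rule cc_ballI[where \<gamma> = "%s. E (s *. t)" and a = a and N = "{0, 1}" and m = "15 / 16"])
    have "compact ((%s. s *. t) ` {0..1})"
      by (intro compact_continuous_image continuous_intros) auto
    moreover have "(%s. s *. t) ` {0..1} \<subseteq> ball 0 \<eta>1" using st by auto
    ultimately obtain L where L: "L-lipschitz_on ((%s. s *. t) ` {0..1}) E"
      using real_analytic_lipschitz_compact[OF E_analytic] by blast
    show "absolutely_continuous_on {0..1} (%s. E (s *. t))"
    proof (rule lipschitz_imp_absolutely_continuous)
      show "norm (E (r *. t) - E (s *. t)) <= (L * norm t) * \<bar>r - s\<bar>" if "r \<in> {0..1}" "s \<in> {0..1}" for r s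
        using lipschitz_on_normD[OF L imageI[OF that(1)] imageI[OF that(2)]]
        by (simp add: scaleR_diff_left[symmetric] mult_ac)
    qed
    show "(%s. E (s *. t)) ` {0..1} \<subseteq> \<Omega>"
      using st eta1_le(5) by (force intro: E_in)
    show "((%s. E (s *. t)) has_vector_derivative (\<Sum>.j. a j s *. 1 *. Z j (E (s *. t)))) (at s)"
      if "s \<in> {0..1} - {0, 1}" for s
      using E_curve[of t s] t(1) eta1_le(5) that unfolding a_sum by (simp add: at_within_Icc_at)
    show "(\<Sum>.j. \<bar>a j s\<bar>\<^sup>2) <= 15 / 16" for s
    proof -
      have eq: "a j s = (\<Sum>i\<in>{i\<in>UNIV. k i = j}. t $ i)" for j by (simp add: a_def)
      have "\<bar>a j s\<bar>\<^sup>2 <= \<bar>a j s\<bar>" for j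
        using a_le[of j s] mult_right_mono[of "\<bar>a j s\<bar>" 1 "\<bar>a j s\<bar>"] by (simp add: power2_eq_square)
      then have "(\<Sum>.j. \<bar>a j s\<bar>\<^sup>2) <= (\<Sum>.j. \<bar>a j s\<bar>)" by (rule sum_mono)
      also have "\<dots> <= (\<Sum>.j. \<Sum>i\<in>{i\<in>UNIV. k i = j}. \<bar>t $ i\<bar>)"
        unfolding eq by (intro sum_mono sum_abs)
      also have "\<dots> = (\<Sum>.i. \<bar>t $ i\<bar>)" by (rule sum.group) auto
      also have "\<dots> <= (\<Sum>i\<in>(UNIV::'n set). \<eta>1)"
        using component_le_norm_cart[of t] t(1) by (intro sum_mono) (auto intro: order_trans less_imp_le)
      also have "\<dots> <= T * \<eta>1" using card_n eta1_bounds(1) by (simp add: mult_right_mono)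
      finally show ?thesis using eta1_le(1) by linarith
    qed
  qed (use t in \<open>auto simp: E_0 a_def[abs_def]\<close>)
qed

end

subsection \<open>Volumes\<close>

text \<open>The change of variables formula of the library needs a well-ordered index type; \<open>'n wo\<close> is a
  well-ordered copy of an arbitrary finite type.\<close>

typedef (overloaded) 'n wo = "UNIV :: 'n::finite set" by simp

definition wo_index :: "'n::finite wo => nat" where
  "wo_index a = (SOME f :: 'n => nat. inj f) (Rep_wo a)"

lemma inj_wo_index: "inj (wo_index :: 'n::finite wo => nat)"
proof -
  have "\<exists>f :: 'n => nat. inj f" using finite_imp_inj_to_nat_seg[of "UNIV :: 'n set"] by auto
  then have *: "inj (SOME f :: 'n => nat. inj f)" by (rule someI_ex)
  show ?thesis
  proof (rule injI)
    fix a b :: "'n wo" assume "wo_index a = wo_index b"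
    then have "Rep_wo a = Rep_wo b" unfolding wo_index_def by (rule injD[OF *])
    then show "a = b" by (simp only: Rep_wo_inject)
  qed
qed

instantiation wo :: (finite) wellorder
begin

definition "a <= b \<longleftrightarrow> wo_index a <= wo_index b"
definition "a < b \<longleftrightarrow> wo_index a < wo_index b"

instance
proof
  fix P :: "'a wo => bool" and a
  assume step: "!!a. (!!b. b < a ==> P b) ==> P a"
  show "P a"
    by (induction "wo_index a" arbitrary: a rule: less_induct) (auto intro: step simp: less_wo_def)
qed (use inj_wo_index in \<open>auto simp: less_eq_wo_def less_wo_def inj_def\<close>)

end

instance wo :: (finite) finite
proof
  have "(UNIV :: 'a wo set) = Abs_wo ` UNIV" by (metis Abs_wo_cases UNIV_I image_eqI subsetI subset_antisym)
  then show "finite (UNIV :: 'a wo set)" by (metis finite finite_imageI)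
qed

lemma bij_Abs_wo: "bij (Abs_wo :: 'n::finite => 'n wo)"
  by (rule bij_betw_byWitness[where f' = Rep_wo]) (auto simp: Abs_wo_inverse Rep_wo_inverse)

definition to_wo :: "real^'n::finite => real^'n wo" where "to_wo v = (\<chi> i. v $ Rep_wo i)"
definition of_wo :: "real^'n wo => real^'n::finite" where "of_wo v = (\<chi> i. v $ Abs_wo i)"

lemma to_wo_of_wo [simp]: "to_wo (of_wo v) = v" and of_wo_to_wo [simp]: "of_wo (to_wo u) = u"
  by (auto simp: to_wo_def of_wo_def vec_eq_iff Rep_wo_inverse Abs_wo_inverse)

lemma linear_to_wo: "linear to_wo" and linear_of_wo: "linear of_wo"
  by (auto simp: to_wo_def of_wo_def linear_iff vec_eq_iff)

lemmas to_wo_has_derivative = bounded_linear_imp_has_derivative[OF linear_to_wo[unfolded linear_conv_bounded_linear]]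
lemmas of_wo_has_derivative = bounded_linear_imp_has_derivative[OF linear_of_wo[unfolded linear_conv_bounded_linear]]

text \<open>Permutations are transported along the bijection together with their signs, so
  relabelling rows and columns simultaneously leaves the determinant unchanged.\<close>

lemma det_reindex_wo:
  fixes A :: "real^'n^'n::finite"
  shows "det (\<chi> i j. A $ Rep_wo i $ Rep_wo j) = det A"
proof -
  let ?m = "map_permutation UNIV (Abs_wo :: 'n => 'n wo)"
  have inj: "inj (Abs_wo :: 'n => 'n wo)" using bij_Abs_wo by (rule bij_is_inj)
  have bij: "bij_betw ?m {p. p permutes UNIV} {p. p permutes UNIV}"
  proof -
    have "?m = (%p x. if x \<in> UNIV then Abs_wo (p (inv_into UNIV Abs_wo x)) else x)"
      using bij_is_surj[OF bij_Abs_wo[where 'n = 'n]] by (auto simp: fun_eq_iff map_permutation_def restrict_id_def)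
    then show ?thesis using bij_betw_permutations[OF bij_Abs_wo[where 'n = 'n]] by simp
  qed
  have "det (\<chi> i j. A $ Rep_wo i $ Rep_wo j) =
      (\<Sum>p | p permutes (UNIV::'n set). of_int (sign (?m p)) * (\<Prod>i\<in>UNIV. A $ Rep_wo i $ Rep_wo (?m p i)))"
    unfolding det_def by (subst sum.reindex_bij_betw[OF bij, symmetric]) simp
  also have "\<dots> = det A"
    unfolding det_def
  proof (rule sum.cong[OF refl])
    fix p :: "'n => 'n" assume p: "p \<in> {p. p permutes UNIV}"
    have "(\<Prod>i\<in>UNIV. A $ Rep_wo i $ Rep_wo (?m p i)) = (\<Prod>i\<in>UNIV. A $ Rep_wo (Abs_wo i) $ Rep_wo (?m p (Abs_wo i)))"
      by (rule prod.reindex_bij_betw[OF bij_Abs_wo, symmetric])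
    also have "\<dots> = (\<Prod>i\<in>UNIV. A $ i $ p i)"
      by (simp add: map_permutation_apply[OF inj] Abs_wo_inverse)
    finally show "of_int (sign (?m p)) * (\<Prod>i\<in>UNIV. A $ Rep_wo i $ Rep_wo (?m p i)) = of_int (sign p) * (\<Prod>i\<in>UNIV. A $ i $ p i)"
      using sign_map_permutation[OF inj, of p] p by simp
  qed
  finally show ?thesis .
qed

text \<open>Relabelling coordinates maps boxes to boxes with the same side lengths, and Lebesgue
  measure is determined by its values on boxes.\<close>

lemma lborel_to_wo: "distr lborel borel (to_wo :: real^'n::finite => _) = lborel"
proof (rule lborel_eqI[symmetric])
  have meas: "to_wo \<in> borel_measurable (borel :: (real^'n) measure)"
    by (intro borel_measurable_continuous_onI linear_continuous_on) (simp add: linear_conv_bounded_linear[symmetric] linear_to_wo)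
  fix l u :: "real^'n wo" assume lu: "!!b. b \<in> Basis ==> l \<bullet> b <= u \<bullet> b"
  have le: "l $ i <= u $ i" for i
    using lu[of "axis i 1"] by (simp add: inner_axis axis_in_Basis_iff)
  have prod: "(\<Prod>b\<in>Basis. (u' - l') \<bullet> b) = (\<Prod>i\<in>UNIV. u' $ i - l' $ i)"
    for u' l' :: "real^'m::finite"
  proof -
    have B: "(Basis :: (real^'m) set) = (%i. axis i 1) ` UNIV" by (auto simp: Basis_vec_def)
    show ?thesis unfolding B
      by (subst prod.reindex) (auto simp: inj_on_def axis_eq_axis inner_axis)
  qed
  have "to_wo -` box l u = box (of_wo l) (of_wo u)"
  proof -
    have "(\<forall>i. l $ i < v $ Rep_wo i \<and> v $ Rep_wo i < u $ i) \<longleftrightarrow> (\<forall>i. l $ Abs_wo i < v $ i \<and> v $ i < u $ Abs_wo i)" for v :: "real^'n"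
      by (metis Abs_wo_inverse Rep_wo_inverse UNIV_I)
    then show ?thesis by (auto simp: mem_box_cart to_wo_def of_wo_def)
  qed
  then have "emeasure (distr lborel borel to_wo) (box l u) = emeasure lborel (box (of_wo l) (of_wo u))"
    using meas by (subst emeasure_distr) auto
  also have "\<dots> = (\<Prod>b\<in>Basis. (of_wo u - of_wo l) \<bullet> b)"
    by (rule emeasure_lborel_box) (auto simp: Basis_vec_def inner_axis of_wo_def le)
  also have "(\<Prod>b\<in>Basis. (of_wo u - of_wo l) \<bullet> b) = (\<Prod>i\<in>UNIV. u $ Abs_wo i - l $ Abs_wo i)"
    unfolding prod by (simp add: of_wo_def)
  also have "\<dots> = (\<Prod>i\<in>UNIV. u $ i - l $ i)"
    by (rule prod.reindex_bij_betw[OF bij_Abs_wo])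
  also have "\<dots> = (\<Prod>b\<in>Basis. (u - l) \<bullet> b)" unfolding prod ..
  finally show "emeasure (distr lborel borel to_wo) (box l u) = ennreal (\<Prod>b\<in>Basis. (u - l) \<bullet> b)" .
qed simp

lemma to_wo_image: "to_wo ` A = of_wo -` A"
  by (auto intro: image_eqI[of _ _ "of_wo _"])

lemma open_to_wo: "open A ==> open (to_wo ` A)"
  unfolding to_wo_image
  by (intro open_vimage linear_continuous_on) (simp_all add: linear_conv_bounded_linear[symmetric] linear_of_wo)

lemma emeasure_to_wo:
  assumes "open A"
  shows "emeasure lborel (to_wo ` A) = emeasure lborel A"
proof -
  have meas: "to_wo \<in> borel_measurable (borel :: (real^'a) measure)"
    by (intro borel_measurable_continuous_onI linear_continuous_on) (simp add: linear_conv_bounded_linear[symmetric] linear_to_wo)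
  have "emeasure lborel (to_wo ` A) = emeasure (distr lborel borel to_wo) (to_wo ` A)"
    by (simp only: lborel_to_wo)
  also have "\<dots> = emeasure lborel (to_wo -` to_wo ` A)"
    using meas open_to_wo[OF assms] by (subst emeasure_distr) auto
  also have "to_wo -` to_wo ` A = A" by (auto dest: arg_cong[of _ _ of_wo])
  finally show ?thesis .
qed

text \<open>The change of variables formula is applied to the conjugate of \<open>f\<close> by
  \<open>to_wo\<close>, which has the same Jacobians and the same volumes; then the integrand is
  bounded on both sides.\<close>

theorem emeasure_injective_image_bounds:
  fixes f :: "real^'n::finite => real^'n"
  assumes S: "open S" "bounded S" and inj: "inj_on f S" and fS: "open (f ` S)" "bounded (f ` S)"
    and der: "!!t. t \<in> S ==> (f has_derivative f' t) (at t)"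
    and bounds: "!!t. t \<in> S ==> lo <= \<bar>det (matrix (f' t))\<bar> \<and> \<bar>det (matrix (f' t))\<bar> <= hi"
    and hi: "0 <= lo" "0 <= hi"
  shows "ennreal lo * emeasure lebesgue S <= emeasure lebesgue (f ` S)"
    "emeasure lebesgue (f ` S) <= ennreal hi * emeasure lebesgue S"
proof -
  define g where "g u = to_wo (f (of_wo u))" for u
  define g' where "g' u h = to_wo (f' (of_wo u) (of_wo h))" for u h
  let ?S = "to_wo ` S"
  have gS: "g ` ?S = to_wo ` (f ` S)" by (simp add: g_def image_image)
  have der_g: "(g has_derivative g' u) (at u within ?S)" if u: "u \<in> ?S" for u
  proof -
    have uS: "of_wo u \<in> S" using u by auto
    have "((%u. f (of_wo u)) has_derivative (%h. f' (of_wo u) (of_wo h))) (at u)"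
      by (rule has_derivative_compose[OF of_wo_has_derivative der[OF uS]])
    from has_derivative_compose[OF this to_wo_has_derivative]
    show ?thesis unfolding g_def[abs_def] g'_def[abs_def] by (rule has_derivative_at_withinI)
  qed
  have inj_g: "inj_on g ?S"
  proof (rule inj_onI)
    fix u v assume uv: "u \<in> ?S" "v \<in> ?S" "g u = g v"
    then have "f (of_wo u) = f (of_wo v)" unfolding g_def by (metis of_wo_to_wo)
    then have "of_wo u = of_wo v" using uv inj by (auto dest: inj_onD)
    then show "u = v" by (metis to_wo_of_wo)
  qed
  have det_g: "det (matrix (g' u)) = det (matrix (f' (of_wo u)))" for u
  proof -
    have "of_wo (axis j 1) = axis (Rep_wo j) 1" for j :: "'n wo"
      by (auto simp: of_wo_def vec_eq_iff axis_def Abs_wo_inverse Rep_wo_inverse)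
    then have "matrix (g' u) = (\<chi> i j. matrix (f' (of_wo u)) $ Rep_wo i $ Rep_wo j)"
      by (simp add: matrix_def g'_def to_wo_def)
    then show ?thesis using det_reindex_wo by metis
  qed
  have lm: "A \<in> lmeasurable" if "open A" "bounded A" for A :: "(real^'m::finite) set"
    using that by (simp add: lmeasurable_open)
  have bd: "bounded (to_wo ` A)" if "bounded A" for A :: "(real^'n) set"
    by (rule bounded_linear_image[OF that]) (simp add: linear_conv_bounded_linear[symmetric] linear_to_wo)
  have m: "measure lebesgue (to_wo ` A) = measure lebesgue A" if "open A" for A :: "(real^'n) set"
    using emeasure_to_wo[OF that] that open_to_wo[OF that] by (simp add: measure_def)
  have Sl: "?S \<in> lmeasurable" by (rule lm[OF open_to_wo[OF S(1)] bd[OF S(2)]])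
  have gl: "g ` ?S \<in> lmeasurable" unfolding gS by (rule lm[OF open_to_wo[OF fS(1)] bd[OF fS(2)]])
  have int: "(%u. \<bar>det (matrix (g' u))\<bar>) integrable_on ?S"
    using measurable_differentiable_image_eq[OF _ der_g inj_g] gl Sl by blast
  have eq: "measure lebesgue (f ` S) = integral ?S (%u. \<bar>det (matrix (g' u))\<bar>)"
    using measure_differentiable_image_eq[OF _ der_g inj_g int] Sl m[OF fS(1)] by (simp add: gS fmeasurableD)
  have const: "integral ?S (%u. c) = c * measure lebesgue S" "(%u. c) integrable_on ?S" for c :: real
    using Sl lmeasure_integral[OF Sl] m[OF S(1)] integrable_on_const[OF Sl, of c]
      integral_mult_right[of ?S c "%_. 1"] by auto
  have b': "lo <= \<bar>det (matrix (g' u))\<bar>" "\<bar>det (matrix (g' u))\<bar> <= hi" if "u \<in> ?S" for u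
    using that bounds by (auto simp: det_g)
  have 1: "lo * measure lebesgue S <= measure lebesgue (f ` S)"
    unfolding eq const(1)[symmetric] by (rule integral_le[OF const(2) int b'(1)])
  have 2: "measure lebesgue (f ` S) <= hi * measure lebesgue S"
    unfolding eq const(1)[symmetric] by (rule integral_le[OF int const(2) b'(2)])
  show "ennreal lo * emeasure lebesgue S <= emeasure lebesgue (f ` S)"
    "emeasure lebesgue (f ` S) <= ennreal hi * emeasure lebesgue S"
    using 1 2 hi lm[OF S] lm[OF fS]
    by (auto simp: emeasure_eq_measure2 ennreal_mult[symmetric] intro!: ennreal_leI)
qed

context scaled_frame
begin

lemma bounded_E_image: "bounded (E ` ball 0 \<eta>1)"
proof -
  have "E t \<in> cball x (real CARD('n))" if "t \<in> ball 0 \<eta>1" for t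
  proof -
    have "norm t <= \<eta>" using that eta1_le(5) by simp
    then have "zz (us t) \<in> cube 1" using us_in(1) zz_in'(2) by blast
    then have "norm (\<rho> *. zz (us t)) <= 1 * (real CARD('n) * 1)"
      unfolding norm_scaleR using norm_le_of_cube[of "zz (us t)" 1] rho by (intro mult_mono) auto
    then show ?thesis by (simp add: E_def pt_def dist_norm)
  qed
  then show ?thesis by (intro bounded_subset[OF bounded_cball]) blast
qed

lemma emeasure_E_image:
  "ennreal (\<bar>det V0\<bar> / 8) * emeasure lebesgue (ball (0::real^'n) \<eta>1) <= emeasure lebesgue (E ` ball 0 \<eta>1)"
  "emeasure lebesgue (E ` ball 0 \<eta>1) <= ennreal (8 * \<bar>det V0\<bar>) * emeasure lebesgue (ball (0::real^'n) \<eta>1)"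
proof -
  have "\<bar>det V0\<bar> / 8 <= \<bar>det (matrix (dE t))\<bar> \<and> \<bar>det (matrix (dE t))\<bar> <= 8 * \<bar>det V0\<bar>" if "t \<in> ball 0 \<eta>1" for t
  proof -
    have t: "norm t <= \<eta>" using that eta1_le(5) by simp
    have "matrix (dE t) = transpose (Gt t ** Vt t)"
      unfolding dE_def[abs_def] by (metis matrix_of_matrix_vector_mul transpose_matrix_vector ext)
    then have "\<bar>det (matrix (dE t))\<bar> = \<bar>det V0\<bar> * \<bar>ev P (us t)\<bar>"
      by (simp add: det_transpose det_dE[OF t] abs_mult)
    moreover have "1 / 8 <= \<bar>ev P (us t)\<bar>" "\<bar>ev P (us t)\<bar> <= 8" using ev_P_bounds[OF t] by auto
    ultimately show ?thesis
      using mult_left_mono[of "1 / 8" "\<bar>ev P (us t)\<bar>" "\<bar>det V0\<bar>"] mult_left_mono[of "\<bar>ev P (us t)\<bar>" 8 "\<bar>det V0\<bar>"] by simp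
  qed
  note bounds = emeasure_injective_image_bounds[OF open_ball bounded_ball inj_on_E E_image(1) bounded_E_image
      E_derivative_ball(1) this]
  show "ennreal (\<bar>det V0\<bar> / 8) * emeasure lebesgue (ball (0::real^'n) \<eta>1) <= emeasure lebesgue (E ` ball 0 \<eta>1)"
    by (rule bounds(1)) auto
  show "emeasure lebesgue (E ` ball 0 \<eta>1) <= ennreal (8 * \<bar>det V0\<bar>) * emeasure lebesgue (ball (0::real^'n) \<eta>1)"
    by (rule bounds(2)) auto
qed

end

context scaled_frame
begin

text \<open>Statements about the exponential map only concern \<open>ball 0 \<eta>1\<close>, where it agrees with \<open>E\<close>.\<close>

context
  fixes \<Phi> :: "real^'n => real^'n"
  assumes \<Phi>: "!!t. t \<in> ball 0 \<eta>1 ==> \<Phi> t = E t"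
begin

lemma Phi_image: "\<Phi> ` ball 0 \<eta>1 = E ` ball 0 \<eta>1"
  using \<Phi> by (rule image_cong[OF refl])

lemma Phi_diffeo: "real_analytic_diffeo (ball 0 \<eta>1) (\<Phi> ` ball 0 \<eta>1) \<Phi>"
proof -
  have "inj_on \<Phi> (ball 0 \<eta>1)"
    using inj_on_E \<Phi> by (simp add: inj_on_def)
  moreover have "real_analytic_on (ball 0 \<eta>1) \<Phi>"
  proof (rule vec_ev_power_series(3)[OF eta(1) eta1_bounds(1) eta1_le(3)])
    fix t :: "real^'n" assume t: "t \<in> ball 0 \<eta>1"
    then have "norm t <= \<eta>" using eta1_le(5) by simp
    then show "\<Phi> t = (\<chi> a. ev (of_real (x $ a) + \<rho> *. w a) ((1 / \<eta>) *. t))"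
      using E_component[of t] \<Phi>[OF t] by (simp add: vec_eq_iff us_def)
  qed
  \<comment> \<open>An inverse on the ball is a choice from a predicate that involves only values on
    the ball, where the two maps agree.\<close>
  moreover have "inv_into (ball 0 \<eta>1) \<Phi> = inv_into (ball 0 \<eta>1) E"
    unfolding inv_into_def by (rule ext, rule arg_cong[where f = Eps]) (use \<Phi> in auto)
  ultimately show ?thesis
    unfolding real_analytic_diffeo_def
    using E_image by (simp add: bij_betw_def Phi_image)
qed

lemma Phi_frechet_derivative: "t \<in> ball 0 \<eta>1 ==> frechet_derivative \<Phi> (at t) = frechet_derivative E (at t)"
proof -
  assume t: "t \<in> ball 0 \<eta>1"
  have "(\<Phi> has_derivative dE t) (at t)"
    by (rule has_derivative_transform_within_open[OF E_derivative_ball(1)[OF t] open_ball t]) (simp add: \<Phi>)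
  then show ?thesis
    using frechet_derivative_at E_derivative_ball(1)[OF t] by metis
qed

lemma Phi_pullback: "pullback_vf \<Phi> (Z l) t = Yt l t" if "t \<in> ball 0 \<eta>1"
  using pullback_E[of t l] that eta1_le(4) by (simp add: pullback_vf_def Phi_frechet_derivative \<Phi>)

lemma Phi_density:
  assumes t: "t \<in> ball 0 \<eta>1"
  shows "density_function (pullback_density \<Phi> leb_density) t = \<bar>det V0\<bar> * ev P (us t)"
proof -
  have "density_function (pullback_density \<Phi> leb_density) t = density_function (pullback_density E leb_density) t"
    unfolding density_function_def pullback_density_def by (simp add: Phi_frechet_derivative[OF t] \<Phi>[OF t])
  then show ?thesis using density_E[of t] t eta1_le(4) by simp
qed

lemma Phi_density_bounds:
  assumes t: "t \<in> ball 0 \<eta>1"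
  shows "density_function (pullback_density \<Phi> leb_density) t <= 8 * \<bar>det V0\<bar>"
    "\<bar>det V0\<bar> <= 8 * density_function (pullback_density \<Phi> leb_density) t"
proof -
  have "norm t <= \<eta>" using t eta1_le(5) by simp
  note b = ev_P_bounds[OF this]
  show "density_function (pullback_density \<Phi> leb_density) t <= 8 * \<bar>det V0\<bar>"
    "\<bar>det V0\<bar> <= 8 * density_function (pullback_density \<Phi> leb_density) t"
    unfolding Phi_density[OF t]
    using mult_left_mono[of "ev P (us t)" 8 "\<bar>det V0\<bar>"] mult_left_mono[of "1 / 8" "ev P (us t)" "\<bar>det V0\<bar>"] b by auto
qed

lemma Phi_density_scrA:
  shows "(%t. complex_of_real (density_function (pullback_density \<Phi> leb_density) t)) \<in> scrA \<eta>1"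
    "scrA_norm \<eta>1 (%t. complex_of_real (density_function (pullback_density \<Phi> leb_density) t))
      <= (fact CARD('n) * 2 ^ CARD('n)) ^ 3 * \<bar>det V0\<bar>"
proof -
  have f: "complex_of_real (density_function (pullback_density \<Phi> leb_density) t) =
      complex_of_real (\<bar>det V0\<bar> * ev P ((1 / \<eta>) *. t))" if "t \<in> ball 0 \<eta>1" for t
    using Phi_density[OF that] by (simp add: us_def)
  note scrA = complex_ev_power_series[of \<eta> \<eta>1, OF eta(1) eta1_bounds(1) eta1_le(5) f]
  show "(%t. complex_of_real (density_function (pullback_density \<Phi> leb_density) t)) \<in> scrA \<eta>1" by (rule scrA(1))
  have "\<bar>\<bar>det V0\<bar>\<bar> * norm P <= (fact CARD('n) * 2 ^ CARD('n)) ^ 3 * \<bar>det V0\<bar>"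
    using mult_left_mono[OF norm_P, of "\<bar>det V0\<bar>"] by (simp add: mult.commute)
  then show "scrA_norm \<eta>1 (%t. complex_of_real (density_function (pullback_density \<Phi> leb_density) t))
      <= (fact CARD('n) * 2 ^ CARD('n)) ^ 3 * \<bar>det V0\<bar>"
    using scrA(2) by linarith
qed

lemma Phi_pullback_scrA:
  shows "real_analytic_on (ball 0 \<eta>1) (pullback_vf \<Phi> (Z l))" "pullback_vf \<Phi> (Z l) \<in> scrA \<eta>1"
    "scrA_norm \<eta>1 (pullback_vf \<Phi> (Z l)) <= T * (T * 4)"
proof -
  have f: "pullback_vf \<Phi> (Z l) t = (\<chi> i. ev (yc l i) ((1 / \<eta>) *. t))" if "t \<in> ball 0 \<eta>1" for t
    using Phi_pullback[OF that] by (simp add: Yt_def us_def)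
  note scrA = vec_ev_power_series[of \<eta> \<eta>1, OF eta(1) eta1_bounds(1) eta1_le(3) f]
  show "real_analytic_on (ball 0 \<eta>1) (pullback_vf \<Phi> (Z l))" "pullback_vf \<Phi> (Z l) \<in> scrA \<eta>1"
    using scrA(3) scrA(1) by blast+
  have "(\<Sum>.i. norm (yc l i)) <= (\<Sum>i\<in>(UNIV::'n set). T * (2 * 2))"
    by (intro sum_mono norm_yc)
  also have "\<dots> = real CARD('n) * (T * 4)" by simp
  also have "\<dots> <= T * (T * 4)" using card_n T_ge_1 by (intro mult_right_mono) auto
  finally show "scrA_norm \<eta>1 (pullback_vf \<Phi> (Z l)) <= T * (T * 4)" using scrA(2) by linarith
qed

text \<open>For the lower bound the tuple \<open>k\<close> itself is tested: its matrix is the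
  transpose of \<open>At\<close>, with determinant at least 1/2 on the whole ball. For the upper
  bound each infimum is compared with the value at 0, where the entries are bounded.\<close>

lemma Phi_pullback_det:
  defines "M \<equiv> MAX k'\<in>UNIV. INF u\<in>ball 0 \<eta>1. \<bar>det (mat_of_cols (%i::'n. pullback_vf \<Phi> (Z (k' i)) u))\<bar>"
  shows "1 / 2 <= M" "M <= fact CARD('n) * (T * 4) ^ CARD('n)"
proof -
  define f where "f k' u = \<bar>det (mat_of_cols (%i::'n. pullback_vf \<Phi> (Z (k' i)) u))\<bar>" for k' :: "'n => 'q" and u
  have M: "M = (MAX k'\<in>UNIV. INF u\<in>ball 0 \<eta>1. f k' u)" by (simp add: M_def f_def)
  have ne: "ball (0::real^'n) \<eta>1 \<noteq> {}" and z: "(0::real^'n) \<in> ball 0 \<eta>1" using eta1_bounds(1) by auto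
  have low: "1 / 2 <= f k u" if u: "u \<in> ball 0 \<eta>1" for u
  proof -
    have u': "norm u <= \<eta>" using u eta1_le(5) by simp
    have "mat_of_cols (%i. pullback_vf \<Phi> (Z (k i)) u) = transpose (At u)"
      by (simp add: vec_eq_iff mat_of_cols_def transpose_def Phi_pullback[OF u] Yt_frame[OF u'])
    then show ?thesis using det_bounds[OF u'] by (simp add: f_def det_transpose)
  qed
  have "1 / 2 <= (INF u\<in>ball 0 \<eta>1. f k u)"
    by (rule cINF_greatest[OF ne low])
  also have "\<dots> <= M"
    unfolding M by (rule Max_ge) auto
  finally show "1 / 2 <= M" .
  have "(INF u\<in>ball 0 \<eta>1. f k' u) <= fact CARD('n) * (T * 4) ^ CARD('n)" for k'
  proof -
    have "bdd_below (f k' ` ball 0 \<eta>1)" by (rule bdd_belowI[of _ 0]) (auto simp: f_def)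
    then have "(INF u\<in>ball 0 \<eta>1. f k' u) <= f k' 0" using z by (rule cINF_lower)
    also have "\<dots> <= fact CARD('n) * (T * 4) ^ CARD('n)"
      unfolding f_def
    proof (rule abs_det_real_le)
      fix i j
      have "\<bar>Yt (k' j) 0 $ i\<bar> <= T * (2 * 2)"
        unfolding Yt_def using order_trans[OF abs_ev_le[OF us_in(1)[of 0]] norm_yc[of "k' j" i]] eta(1) by simp
      then show "\<bar>mat_of_cols (%i. pullback_vf \<Phi> (Z (k' i)) 0) $ i $ j\<bar> <= T * 4"
        by (simp add: mat_of_cols_def Phi_pullback[OF z])
    qed
    finally show ?thesis .
  qed
  then show "M <= fact CARD('n) * (T * 4) ^ CARD('n)"
    unfolding M by (subst Max_le_iff) auto
qed

end

end

subsection \<open>Uniform power series representations over a compact set\<close>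

text \<open>Taylor radius and bound of a \<open>C_omega\<close> function are the same at all points
  of \<open>V\<close>, so they serve all base points near \<open>x0\<close> at once. Moving the
  series to the unit cube by a small \<rho> does not spoil the bound.\<close>

lemma local_wiener_rep:
  fixes f :: "real^'n::finite => real"
  assumes V: "open V" "x0 \<in> V" and f: "f \<in> C_omega V"
  shows "\<exists>e>0. \<exists>r>0. \<exists>B. \<forall>x\<in>ball x0 e. \<forall>\<rho>. 0 < \<rho> \<and> \<rho> <= r -->
    (\<exists>v. norm v <= B \<and> (\<forall>z\<in>cube 1. x + \<rho> *. z \<in> V \<and> f (x + \<rho> *. z) = ev v z))"
proof -
  obtain r0 B where r0: "0 < r0" and rep: "!!y. y \<in> V ==> \<exists>a. mconv r0 a \<and> mnorm r0 a <= B \<and>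
      (\<forall>h\<in>cube r0. (\<forall>s. 0 <= s \<and> s <= 1 --> y + s *. h \<in> V) --> f (y + h) = mseries a h)"
    using C_omega_taylor[OF V(1) f] by blast
  obtain e where e: "0 < e" "ball x0 e \<subseteq> V" using V openE by blast
  define n where "n = real CARD('n)"
  have n: "1 <= n" by (simp add: n_def Suc_le_eq)
  \<comment> \<open>Displacements from the cube have norm at most e / 4, which leaves room for base
    points up to e / 2 away from \<open>x0\<close>.\<close>
  define r where "r = min r0 (e / (4 * n))"
  have r: "0 < r" "r <= r0" "n * r <= e / 4"
  proof -
    show "0 < r" "r <= r0" using r0 e n by (auto simp: r_def)
    have "n * r <= n * (e / (4 * n))" using n by (intro mult_left_mono) (auto simp: r_def)
    then show "n * r <= e / 4" using n by simp
  qed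
  have "\<exists>v. norm v <= B \<and> (\<forall>z\<in>cube 1. x + \<rho> *. z \<in> V \<and> f (x + \<rho> *. z) = ev v z)"
    if x: "x \<in> ball x0 (e / 2)" and \<rho>: "0 < \<rho>" "\<rho> <= r" for x \<rho>
  proof -
    have seg: "x + s *. \<rho> *. z \<in> V" if "z \<in> cube 1" "0 <= s" "s <= 1" for s z
    proof -
      have "norm (s *. \<rho> *. z) = (s * \<rho>) * norm z" using that \<rho> by simp
      also have "\<dots> <= (1 * r) * (n * 1)"
        using that \<rho> norm_le_of_cube[OF that(1)] r by (intro mult_mono) (auto simp: n_def)
      also have "\<dots> <= e / 4" using r(3) by (simp add: mult.commute)
      finally have "norm (s *. \<rho> *. z) <= e / 4" .
      moreover have "dist x0 (x + s *. \<rho> *. z) <= dist x0 x + norm (s *. \<rho> *. z)"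
        using dist_triangle[of x0 "x + s *. \<rho> *. z" x] by (simp add: dist_norm)
      ultimately have "x + s *. \<rho> *. z \<in> ball x0 e" using x e(1) by simp
      then show ?thesis using e(2) by blast
    qed
    have "x \<in> V" using x e by auto
    then obtain a where a: "mconv r0 a" "mnorm r0 a <= B"
      and fa: "!!h. h \<in> cube r0 ==> (\<forall>s. 0 <= s \<and> s <= 1 --> x + s *. h \<in> V) ==> f (x + h) = mseries a h"
      using rep by blast
    have \<rho>0: "0 <= \<rho>" "\<rho> <= r0" using \<rho> r by auto
    have a\<rho>: "mconv \<rho> a" by (rule mconv_mono[OF a(1) \<rho>0])
    have "norm (wseries \<rho> a) <= B"
      using norm_wseries[OF a\<rho>] \<rho> mnorm_mono[OF a(1) \<rho>0] a(2) by simp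
    moreover have "x + \<rho> *. z \<in> V" if "z \<in> cube 1" for z
      using seg[OF that, of 1] by simp
    moreover have "f (x + \<rho> *. z) = ev (wseries \<rho> a) z" if z: "z \<in> cube 1" for z
    proof -
      have "\<rho> *. z \<in> cube r0"
        unfolding cube_def
      proof (clarify)
        fix i
        have "\<bar>\<rho>\<bar> * \<bar>z $ i\<bar> <= r0 * 1" using z \<rho>0 by (intro mult_mono) (auto simp: cube_def)
        then show "\<bar>(\<rho> *. z) $ i\<bar> <= r0" by (simp add: abs_mult)
      qed
      then have "f (x + \<rho> *. z) = mseries a (\<rho> *. z)" using fa seg[OF z] by blast
      then show ?thesis using ev_wseries[OF a\<rho>] \<rho> by simp
    qed
    ultimately show ?thesis by blast
  qed
  then show ?thesis using e(1) r(1) by (intro exI[of _ "e / 2"] conjI exI[of _ r] exI[of _ B]) auto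
qed

lemma local_wiener_rep_family:
  fixes f :: "'i::finite => real^'n::finite => real"
  assumes "!!i. open (V i)" "!!i. x0 \<in> V i" "!!i. f i \<in> C_omega (V i)"
  shows "\<exists>e>0. \<exists>r>0. \<exists>B. \<forall>i. \<forall>x\<in>ball x0 e. \<forall>\<rho>. 0 < \<rho> \<and> \<rho> <= r -->
    (\<exists>v. norm v <= B \<and> (\<forall>z\<in>cube 1. x + \<rho> *. z \<in> V i \<and> f i (x + \<rho> *. z) = ev v z))"
proof -
  obtain e r B where e: "!!i. 0 < e i" and r: "!!i. 0 < r i"
    and rep: "!!i x \<rho>. x \<in> ball x0 (e i) ==> 0 < \<rho> ==> \<rho> <= r i ==>
      \<exists>v. norm v <= B i \<and> (\<forall>z\<in>cube 1. x + \<rho> *. z \<in> V i \<and> f i (x + \<rho> *. z) = ev v z)"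
    using local_wiener_rep[OF assms] by metis
  have min: "Min (range e) <= e i" "Min (range r) <= r i" "B i <= Max (range B)" for i by auto
  have "\<exists>v. norm v <= Max (range B) \<and> (\<forall>z\<in>cube 1. x + \<rho> *. z \<in> V i \<and> f i (x + \<rho> *. z) = ev v z)"
    if "x \<in> ball x0 (Min (range e))" "0 < \<rho>" "\<rho> <= Min (range r)" for i x \<rho>
  proof -
    have "x \<in> ball x0 (e i)" "\<rho> <= r i" using that min[of i] by auto
    then show ?thesis using rep[of x i \<rho>] that(2) min(3)[of i] order_trans by blast
  qed
  moreover have "0 < Min (range e)" "0 < Min (range r)" using e r by (auto simp: Min_gr_iff)
  ultimately show ?thesis
    by (intro exI[of _ "Min (range e)"] conjI exI[of _ "Min (range r)"] exI[of _ "Max (range B)"]) auto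
qed

text \<open>The finite subcover argument for statements that survive a smaller radius and a larger
  bound.\<close>

lemma compact_uniform_constants:
  fixes K :: "'a::metric_space set" and Q :: "real => real => 'a => bool"
  assumes K: "compact K" and loc: "!!x0. x0 \<in> K ==> \<exists>e>0. \<exists>r>0. \<exists>B. \<forall>x\<in>ball x0 e. Q r B x"
    and mono: "!!r B r' B' x. Q r B x ==> 0 < r' ==> r' <= r ==> B <= B' ==> Q r' B' x"
  shows "\<exists>r>0. \<exists>B. \<forall>x\<in>K. Q r B x"
proof -
  obtain e r B where e: "!!x0. x0 \<in> K ==> 0 < e x0" and r: "!!x0. x0 \<in> K ==> 0 < r x0"
    and Q: "!!x0 x. x0 \<in> K ==> x \<in> ball x0 (e x0) ==> Q (r x0) (B x0) x"
    using loc by metis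
  have "K \<subseteq> (\<Union>x0\<in>K. ball x0 (e x0))" using e by force
  then obtain F where F: "F \<subseteq> K" "finite F" "K \<subseteq> (\<Union>x0\<in>F. ball x0 (e x0))"
    using compactE_image[OF K, of K "%x0. ball x0 (e x0)"] by auto
  \<comment> \<open>The inserted 1, and the 0 below, keep minimum and maximum meaningful when
    \<open>F\<close> is empty.\<close>
  define r' where "r' = Min (insert 1 (r ` F))"
  have "0 < r'" unfolding r'_def using F r by (subst Min_gr_iff) auto
  moreover have "Q r' (Max (insert 0 (B ` F))) x" if "x \<in> K" for x
  proof -
    obtain x0 where x0: "x0 \<in> F" "x \<in> ball x0 (e x0)" using F(3) \<open>x \<in> K\<close> by blast
    show ?thesis
    proof (rule mono)
      show "Q (r x0) (B x0) x" using Q x0 F(1) by blast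
      show "0 < r'" by fact
      show "r' <= r x0" unfolding r'_def using F(2) x0(1) by (intro Min_le) auto
      show "B x0 <= Max (insert 0 (B ` F))" using F(2) x0(1) by (intro Max_ge) auto
    qed
  qed
  ultimately show ?thesis by blast
qed

section \<open>Determinants of scaled frames and the growth of \<open>Lambda\<close>\<close>

lemma det_mat_of_cols_scale:
  "det (mat_of_cols (%i. c i *. v i)) = prod c UNIV * det (mat_of_cols (v :: 'n::finite => real^'n))"
proof -
  have eq: "mat_of_cols v = transpose (\<chi> i. v i)" for v :: "'n => real^'n"
    by (simp add: vec_eq_iff mat_of_cols_def transpose_def)
  show ?thesis
    unfolding eq det_transpose using det_rows_mul[of c v] by (simp add: scalar_mult_eq_scaleR)
qed

lemma span_columns_iff: "span (range v) = UNIV \<longleftrightarrow> det (mat_of_cols (v :: 'n::finite => real^'n)) \<noteq> 0"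
proof -
  have "columns (mat_of_cols v) = range v"
    by (auto simp: columns_def column_def mat_of_cols_def)
  then show ?thesis
    using matrix_right_invertible_span_columns[of "mat_of_cols v"] invertible_det_nz[of "mat_of_cols v"]
    by (simp add: invertible_right_inverse span_vec_eq)
qed

lemma spanning_frame_exists:
  fixes v :: "'q::finite => real^'n::finite"
  assumes "span (range v) = UNIV"
  obtains k where "det (mat_of_cols (%i::'n. v (k i))) \<noteq> 0"
proof -
  obtain B where B: "B \<subseteq> range v" "independent B" "range v \<subseteq> span B" "card B = dim (range v)"
    using basis_exists[of "range v"] by blast
  have spB: "span B = UNIV" using B(3) assms span_minimal[OF B(3) subspace_span] by auto
  have "card B = CARD('n)" using B(4) assms by (metis dim_span dim_UNIV DIM_cart DIM_real mult.right_neutral)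
  then have "finite B" by (metis card.infinite zero_less_card_finite less_irrefl)
  with \<open>card B = CARD('n)\<close> obtain b where b: "bij_betw b (UNIV :: 'n set) B"
    using finite_same_card_bij[of "UNIV :: 'n set" B] by auto
  have "\<exists>l. v l = b i" for i
    using b B(1) by (metis UNIV_I bij_betwE image_iff subset_iff)
  then obtain k where k: "!!i. v (k i) = b i" by metis
  have "span (range (%i. v (k i))) = UNIV"
    using spB b by (simp add: k bij_betw_def)
  then show ?thesis using that span_columns_iff by blast
qed

lemma Lambda_ge: "\<bar>det (mat_of_cols (%i::'n::finite. scale_vf X d \<delta> (k i) x))\<bar> <= Lambda X d x \<delta>"
  for X :: "'q::finite => real^'n => real^'n"
  unfolding Lambda_def by (rule Max_ge) auto

lemma span_scale_vf:
  fixes X :: "'q::finite => real^'n::finite => real^'n"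
  assumes sp: "span (range (%l. X l x)) = UNIV" and \<delta>: "0 < \<delta>"
  shows "span (range (%l. scale_vf X d \<delta> l x)) = UNIV" "0 < Lambda X d x \<delta>"
proof -
  obtain k where k: "det (mat_of_cols (%i::'n. X (k i) x)) \<noteq> 0"
    using spanning_frame_exists[OF sp] .
  have nz: "det (mat_of_cols (%i. scale_vf X d \<delta> (k i) x)) \<noteq> 0"
    unfolding scale_vf_def det_mat_of_cols_scale using k \<delta> by simp
  then have "span (range (%i. scale_vf X d \<delta> (k i) x)) = UNIV" by (simp add: span_columns_iff)
  moreover have "range (%i. scale_vf X d \<delta> (k i) x) \<subseteq> range (%l. scale_vf X d \<delta> l x)" by auto
  ultimately show "span (range (%l. scale_vf X d \<delta> l x)) = UNIV" by (metis span_mono top.extremum_unique)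
  show "0 < Lambda X d x \<delta>" using Lambda_ge[where X = X and d = d and \<delta> = \<delta> and k = k and x = x] nz by simp
qed

text \<open>Each column grows by a power of \<open>r\<close> with its own degree as exponent; since
  \<open>1 <= r\<close>, the sum of all degrees is a common bound for these exponents.\<close>

lemma Lambda_dilate:
  fixes X :: "'q::finite => real^'n::finite => real^'n"
  assumes d: "!!l. 0 <= d l" and \<delta>: "0 < \<delta>" and r: "1 <= r"
  shows "Lambda X d x (r * \<delta>) <= (r powr (\<Sum>.l. d l)) ^ CARD('n) * Lambda X d x \<delta>"
  unfolding Lambda_def[of X d x "r * \<delta>"]
proof (subst Max_le_iff, safe)
  fix k :: "'n => 'q"
  have "scale_vf X d (r * \<delta>) l x = (r powr d l) *. scale_vf X d \<delta> l x" for l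
    using r \<delta> by (simp add: scale_vf_def powr_mult)
  then have "\<bar>det (mat_of_cols (%i. scale_vf X d (r * \<delta>) (k i) x))\<bar> =
      (\<Prod>i\<in>UNIV. r powr d (k i)) * \<bar>det (mat_of_cols (%i. scale_vf X d \<delta> (k i) x))\<bar>"
    by (simp add: det_mat_of_cols_scale abs_mult prod_nonneg)
  also have "\<dots> <= (\<Prod>i\<in>(UNIV::'n set). r powr (\<Sum>.l. d l)) * Lambda X d x \<delta>"
  proof (intro mult_mono prod_mono Lambda_ge prod_nonneg conjI)
    fix i
    have "d (k i) <= (\<Sum>.l. d l)" by (rule member_le_sum) (use d in auto)
    then show "r powr d (k i) <= r powr (\<Sum>.l. d l)" using r by (intro powr_mono) auto
  qed auto
  finally show "\<bar>det (mat_of_cols (%i. scale_vf X d (r * \<delta>) (k i) x))\<bar> <=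
      (r powr (\<Sum>.l. d l)) ^ CARD('n) * Lambda X d x \<delta>" by simp
qed auto

section \<open>Brackets under scaling and power series data uniform over a compact set\<close>

lemma lie_bracket_scale:
  fixes V W :: "real^'n::finite => real^'n"
  assumes "V differentiable (at y)" "W differentiable (at y)"
  shows "lie_bracket (%y. a *. V y) (%y. b *. W y) y = (a * b) *. lie_bracket V W y"
proof -
  have fd: "frechet_derivative (%y. c *. U y) (at y) = (%h. c *. frechet_derivative U (at y) h)"
    and lin: "linear (frechet_derivative U (at y))"
    if "U differentiable (at y)" for c and U :: "real^'n => real^'n"
  proof -
    have D: "(U has_derivative frechet_derivative U (at y)) (at y)"
      using that by (simp add: frechet_derivative_works)
    show "frechet_derivative (%y. c *. U y) (at y) = (%h. c *. frechet_derivative U (at y) h)"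
      by (rule frechet_derivative_at[symmetric, OF has_derivative_scaleR_right[OF D]])
    show "linear (frechet_derivative U (at y))" using D by (rule has_derivative_linear)
  qed
  show ?thesis
    unfolding lie_bracket_def fd[OF assms(1)] fd[OF assms(2)]
    by (simp add: linear_cmul[OF lin[OF assms(1)]] linear_cmul[OF lin[OF assms(2)]] scaleR_diff_right mult.commute)
qed

text \<open>The power series hypotheses of \<open>scaled_frame\<close> before scaling, as one
  predicate to which compactness can be applied. The sum keeps the restriction on degrees, from
  which the nonnegative powers of \<delta> arise later.\<close>

definition frame_data where
  "frame_data \<Omega> X d \<rho> B x zc cc \<longleftrightarrow> (\<forall>l a. norm (zc l a) <= B) \<and> (\<forall>p l m. norm (cc p l m) <= B) \<and>
    (\<forall>z\<in>cube 1. x + \<rho> *. z \<in> \<Omega> \<and> (\<forall>l a. X l (x + \<rho> *. z) $ a = ev (zc l a) z) \<and>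
      (\<forall>p l. lie_bracket (X p) (X l) (x + \<rho> *. z) =
        (\<Sum>m | d m <= d p + d l. ev (cc p l m) z *. X m (x + \<rho> *. z))))"

lemma uniform_frame_data:
  fixes \<Omega> K :: "(real^'n::finite) set" and X :: "'q::finite => real^'n => real^'n" and d :: "'q => real"
  assumes X: "!!l. real_analytic_on \<Omega> (X l)" and d: "!!l. 1 <= d l"
    and bracket: "!!x. x \<in> \<Omega> ==> \<exists>U. open U \<and> x \<in> U \<and> U \<subseteq> \<Omega> \<and>
           (\<exists>c :: 'q => 'q => 'q => real^'n => real. \<forall>p k.
              (\<forall>l. d l <= d p + d k --> c p k l \<in> C_omega U) \<and>
              (\<forall>y\<in>U. lie_bracket (X p) (X k) y =
                 (\<Sum>l | d l <= d p + d k. c p k l y *. X l y)))"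
    and K: "compact K" "K \<subseteq> \<Omega>"
  shows "\<exists>r>0. \<exists>B. \<forall>x\<in>K. \<forall>\<rho>. 0 < \<rho> \<and> \<rho> <= r --> (\<exists>zc cc. frame_data \<Omega> X d \<rho> B x zc cc)"
proof (rule compact_uniform_constants[OF K(1)])
  fix x0 assume "x0 \<in> K"
  then have x0: "x0 \<in> \<Omega>" using K by blast
  have "\<forall>l. \<exists>V. open V \<and> x0 \<in> V \<and> V \<subseteq> \<Omega> \<and> X l \<in> C_omega V"
    using X x0 unfolding real_analytic_on_def by blast
  then obtain V where V: "!!l. open (V l)" "!!l. x0 \<in> V l" "!!l. V l \<subseteq> \<Omega>" "!!l. X l \<in> C_omega (V l)"
    by metis
  obtain U c where U: "open U" "x0 \<in> U" and c: "!!p k l. d l <= d p + d k ==> c p k l \<in> C_omega U"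
    and br: "!!p k y. y \<in> U ==> lie_bracket (X p) (X k) y = (\<Sum>l | d l <= d p + d k. c p k l y *. X l y)"
    using bracket[OF x0] by blast
  have "\<exists>e>0. \<exists>r>0. \<exists>B. \<forall>i. \<forall>x\<in>ball x0 e. \<forall>\<rho>. 0 < \<rho> \<and> \<rho> <= r -->
    (\<exists>v. norm v <= B \<and> (\<forall>z\<in>cube 1. x + \<rho> *. z \<in> V (fst i) \<and> X (fst i) (x + \<rho> *. z) $ snd i = ev v z))"
    for i :: "'q \<times> 'n"
    by (rule local_wiener_rep_family) (auto intro: V C_omega_component)
  then obtain e1 r1 B1 where 1: "0 < e1" "0 < r1" and rep1: "!!l a x \<rho>. x \<in> ball x0 e1 ==> 0 < \<rho> ==> \<rho> <= r1 ==>
     \<exists>v. norm v <= B1 \<and> (\<forall>z\<in>cube 1. x + \<rho> *. z \<in> V l \<and> X l (x + \<rho> *. z) $ a = ev v z)"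
    by (metis fst_conv snd_conv)
  \<comment> \<open>A triple excluded by its degrees has no analytic coefficient; a component of
    \<open>X m\<close> stands in, so that all triples form one family of \<open>C_omega\<close>
    functions.\<close>
  define f where "f i = (case i of (p, k, m) => if d m <= d p + d k then c p k m else (%x. X m x $ undefined))" for i
  define V' where "V' i = (case i of (p, k, m) => if d m <= d p + d k then U else V m)" for i
  have "\<exists>e>0. \<exists>r>0. \<exists>B. \<forall>i. \<forall>x\<in>ball x0 e. \<forall>\<rho>. 0 < \<rho> \<and> \<rho> <= r -->
    (\<exists>v. norm v <= B \<and> (\<forall>z\<in>cube 1. x + \<rho> *. z \<in> V' i \<and> f i (x + \<rho> *. z) = ev v z))"
    by (rule local_wiener_rep_family)
      (auto simp: V'_def f_def split: prod.splits intro: U V c C_omega_component)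
  then obtain e2 r2 B2 where 2: "0 < e2" "0 < r2" and rep2: "!!i x \<rho>. x \<in> ball x0 e2 ==> 0 < \<rho> ==> \<rho> <= r2 ==>
     \<exists>v. norm v <= B2 \<and> (\<forall>z\<in>cube 1. x + \<rho> *. z \<in> V' i \<and> f i (x + \<rho> *. z) = ev v z)"
    by metis
  have "\<exists>zc cc. frame_data \<Omega> X d \<rho> (max B1 B2) x zc cc"
    if x: "x \<in> ball x0 (min e1 e2)" and \<rho>: "0 < \<rho>" "\<rho> <= min r1 r2" for x \<rho>
  proof -
    have "\<forall>l a. \<exists>v. norm v <= B1 \<and> (\<forall>z\<in>cube 1. x + \<rho> *. z \<in> V l \<and> X l (x + \<rho> *. z) $ a = ev v z)"
      using rep1[of x \<rho>] x \<rho> by simp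
    then obtain zc where zc: "!!l a. norm (zc l a) <= B1"
      "!!l a z. z \<in> cube 1 ==> x + \<rho> *. z \<in> V l \<and> X l (x + \<rho> *. z) $ a = ev (zc l a) z"
      by metis
    have "\<forall>p k m. \<exists>v. norm v <= B2 \<and> (\<forall>z\<in>cube 1. x + \<rho> *. z \<in> V' (p, k, m) \<and> f (p, k, m) (x + \<rho> *. z) = ev v z)"
      using rep2[of x \<rho>] x \<rho> by simp
    then obtain cc where cc: "!!p k m. norm (cc p k m) <= B2"
      "!!p k m z. z \<in> cube 1 ==> x + \<rho> *. z \<in> V' (p, k, m) \<and> f (p, k, m) (x + \<rho> *. z) = ev (cc p k m) z"
      by metis
    have "lie_bracket (X p) (X l) (x + \<rho> *. z) = (\<Sum>m | d m <= d p + d l. ev (cc p l m) z *. X m (x + \<rho> *. z))"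
      if z: "z \<in> cube 1" for z p l
    proof -
      \<comment> \<open>The triple (p, l, p) always meets the degree condition, as
        \<open>d l\<close> is positive, and so places the point in \<open>U\<close>.\<close>
      have "d p <= d p + d l" using d[of l] by linarith
      then have zU: "x + \<rho> *. z \<in> U" using cc(2)[OF z, of p l p] by (simp add: V'_def)
      then show ?thesis
        unfolding br[OF zU]
      proof (intro sum.cong[OF refl])
        fix m assume "m \<in> {m. d m <= d p + d l}"
        then show "c p l m (x + \<rho> *. z) *. X m (x + \<rho> *. z) = ev (cc p l m) z *. X m (x + \<rho> *. z)"
          using cc(2)[OF z, of p l m] by (simp add: f_def)
      qed
    qed
    moreover have "norm (zc l a) <= max B1 B2" "norm (cc p k m) <= max B1 B2" for l a p k m
      using zc(1)[of l a] cc(1)[of p k m] by auto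
    moreover have "x + \<rho> *. z \<in> \<Omega>" if "z \<in> cube 1" for z
      using zc(2)[OF that] V(3) by blast
    ultimately show ?thesis
      unfolding frame_data_def using zc(2) by (intro exI[of _ zc] exI[of _ cc]) blast
  qed
  then show "\<exists>e>0. \<exists>r>0. \<exists>B. \<forall>x\<in>ball x0 e. \<forall>\<rho>. 0 < \<rho> \<and> \<rho> <= r --> (\<exists>zc cc. frame_data \<Omega> X d \<rho> B x zc cc)"
    using 1 2 by (intro exI[of _ "min e1 e2"] conjI exI[of _ "min r1 r2"] exI[of _ "max B1 B2"]) auto
next
  fix r B r' B' :: real and x
  assume Q: "\<forall>\<rho>. 0 < \<rho> \<and> \<rho> <= r --> (\<exists>zc cc. frame_data \<Omega> X d \<rho> B x zc cc)" and le: "0 < r'" "r' <= r" "B <= B'"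
  have mono: "frame_data \<Omega> X d \<rho> B' x zc cc" if "frame_data \<Omega> X d \<rho> B x zc cc" for \<rho> zc cc
    using that le(3) order_trans unfolding frame_data_def by blast
  show "\<forall>\<rho>. 0 < \<rho> \<and> \<rho> <= r' --> (\<exists>zc cc. frame_data \<Omega> X d \<rho> B' x zc cc)"
  proof (intro allI impI)
    fix \<rho> assume "0 < \<rho> \<and> \<rho> <= r'"
    then show "\<exists>zc cc. frame_data \<Omega> X d \<rho> B' x zc cc" using Q le(2) mono by (meson order_trans)
  qed
qed

lemma real_analytic_differentiable:
  fixes f :: "real^'n::finite => real^'m::finite"
  shows "real_analytic_on S f ==> t \<in> S ==> f differentiable (at t)"
  using real_analytic_locally_lipschitz by blast

text \<open>Since \<open>[\<delta>\<^sup>d\<^sup>pX\<^sub>p, \<delta>\<^sup>d\<^sup>lX\<^sub>l] = \<Sum> \<delta>\<^sup>d\<^sup>p\<^sup>+\<^sup>d\<^sup>l\<^sup>-\<^sup>d\<^sup>m c \<delta>\<^sup>d\<^sup>mX\<^sub>m\<close> has nonnegative powers of \<open>\<delta>\<close>, the bounds on the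
  unscaled data persist for all \<open>\<delta> <= 1\<close>.\<close>

lemma scaled_frame_at_scale:
  fixes X :: "'q::finite => real^'n::finite => real^'n"
  assumes X: "!!l. real_analytic_on \<Omega> (X l)" and d: "!!l. 1 <= d l"
    and data: "frame_data \<Omega> X d \<rho> B x zc cc"
    and \<rho>: "0 < \<rho>" "\<rho> <= 1" "inverse \<rho> <= T" and T: "real CARD('n) <= T" "real CARD('q) <= T" "B <= T"
    and \<delta>: "0 < \<delta>" "\<delta> <= 1" and span: "span (range (%l. X l x)) = UNIV"
    and k: "\<bar>det (mat_of_cols (%i::'n. scale_vf X d \<delta> (k i) x))\<bar> = Lambda X d x \<delta>"
    and eps: "0 < \<epsilon>" "100 * T ^ 5 * \<epsilon> <= 1"
    and eps_det: "!!M :: real^'n^'n. (!!i j. \<bar>M $ i $ j - mat 1 $ i $ j\<bar> <= 2 * T * \<epsilon>) ==> 1 / 2 <= det M \<and> det M <= 2"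
    and eta: "0 < \<eta>" "100 * T ^ 10 * \<eta> <= \<epsilon>"
  shows "scaled_frame \<Omega> x \<rho> T \<epsilon> \<eta> (scale_vf X d \<delta>) k (%l a. (\<delta> powr d l) *. zc l a)
    (%p l m. if d m <= d p + d l then (\<delta> powr (d p + d l - d m)) *. cc p l m else 0)"
proof
  have pw: "\<bar>\<delta> powr e\<bar> <= 1" if "0 <= e" for e using powr_le1[OF that] \<delta> by simp
  have zcB: "norm (zc l a) <= B" and ccB: "norm (cc p l m) <= B" for l a p m
    using data by (auto simp: frame_data_def)
  show "norm ((\<delta> powr d l) *. zc l a) <= T" for l a
    unfolding norm_scaleR using mult_mono[OF pw zcB, of "d l" l a] d[of l] T(3) by simp
  have T0: "0 <= T" using T(1) by linarith
  show "norm (if d m <= d p + d l then (\<delta> powr (d p + d l - d m)) *. cc p l m else 0) <= T" for p l m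
    using mult_mono[OF pw ccB, of "d p + d l - d m" p l m] T(3) T0 by auto
  show "x + \<rho> *. z \<in> \<Omega>" if "z \<in> cube 1" for z using data that by (auto simp: frame_data_def)
  show "scale_vf X d \<delta> l (x + \<rho> *. z) $ a = ev ((\<delta> powr d l) *. zc l a) z" if "z \<in> cube 1" for z l a
    using data that by (simp add: frame_data_def scale_vf_def ev_scaleR)
  show "lie_bracket (scale_vf X d \<delta> p) (scale_vf X d \<delta> l) (x + \<rho> *. z) =
      (\<Sum>.m. ev (if d m <= d p + d l then (\<delta> powr (d p + d l - d m)) *. cc p l m else 0) z *. scale_vf X d \<delta> m (x + \<rho> *. z))"
    if z: "z \<in> cube (1 / 2)" for z p l
  proof -
    let ?y = "x + \<rho> *. z"
    have z1: "z \<in> cube 1" using z cube_mono[of "1/2" 1] by auto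
    have y: "?y \<in> \<Omega>" using data z1 by (auto simp: frame_data_def)
    have "lie_bracket (scale_vf X d \<delta> p) (scale_vf X d \<delta> l) ?y = (\<delta> powr d p * \<delta> powr d l) *. lie_bracket (X p) (X l) ?y"
      unfolding scale_vf_def[abs_def]
      by (rule lie_bracket_scale) (rule real_analytic_differentiable[OF X y])+
    also have "\<dots> = (\<Sum>m | d m <= d p + d l. (\<delta> powr (d p + d l)) *. ev (cc p l m) z *. X m ?y)"
      using data z1 by (simp add: frame_data_def scaleR_sum_right powr_add)
    also have "\<dots> = (\<Sum>m | d m <= d p + d l. ev ((\<delta> powr (d p + d l - d m)) *. cc p l m) z *. scale_vf X d \<delta> m ?y)"
    proof (rule sum.cong[OF refl])
      fix m
      have "\<delta> powr (d p + d l) = \<delta> powr (d p + d l - d m) * \<delta> powr d m"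
        by (simp add: powr_add[symmetric])
      then show "(\<delta> powr (d p + d l)) *. ev (cc p l m) z *. X m ?y =
          ev ((\<delta> powr (d p + d l - d m)) *. cc p l m) z *. scale_vf X d \<delta> m ?y"
        by (simp add: scale_vf_def ev_scaleR[OF z1])
    qed
    also have "\<dots> = (\<Sum>.m. ev (if d m <= d p + d l then (\<delta> powr (d p + d l - d m)) *. cc p l m else 0) z *. scale_vf X d \<delta> m ?y)"
      by (rule sum.mono_neutral_cong_left) (auto simp: ev_zero[OF z1])
    finally show ?thesis .
  qed
  show "det (mat_of_cols (%i. scale_vf X d \<delta> (k i) x)) \<noteq> 0"
    using k span_scale_vf(2)[of X x \<delta> d] span \<delta>(1) by auto
  show "\<bar>det (mat_of_cols (%i. scale_vf X d \<delta> (k' i) x))\<bar> <= \<bar>det (mat_of_cols (%i. scale_vf X d \<delta> (k i) x))\<bar>" for k'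
    unfolding k by (rule Lambda_ge)
qed (use assms in auto)

section \<open>Openness of the balls and assembly of the conclusions\<close>

lemma cc_ball_deg_open:
  fixes X :: "'q::finite => real^'n::finite => real^'n"
  assumes \<Omega>: "open \<Omega>" and X: "!!l. real_analytic_on \<Omega> (X l)"
    and span: "!!x. x \<in> \<Omega> ==> span (range (%l. X l x)) = UNIV" and \<delta>: "0 < \<delta>"
  shows "open (cc_ball_deg \<Omega> X d x \<delta>)"
  unfolding cc_ball_deg_def
proof (rule cc_ball_open[OF \<Omega>])
  show "continuous_on \<Omega> (scale_vf X d \<delta> l)" for l
  proof (rule continuous_at_imp_continuous_on, rule ballI)
    fix y assume "y \<in> \<Omega>"
    from differentiable_imp_continuous_within[OF real_analytic_differentiable[OF X[of l] this]]
    show "isCont (scale_vf X d \<delta> l) y"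
      unfolding scale_vf_def[abs_def] by (intro continuous_intros)
  qed
  show "span (range (%l. scale_vf X d \<delta> l z)) = UNIV" if "z \<in> \<Omega>" for z
    using span_scale_vf(1)[of X z \<delta> d] span[OF that] \<delta> by blast
qed

text \<open>Carries the results for \<open>E\<close> over to \<open>Phi\<close>, with constants free
  of the locale. \<open>Phi\<close> is a definite description; uniqueness of integral curves
  identifies it with \<open>E\<close> on the ball.\<close>

lemma scaled_frame_conclusions:
  fixes X :: "'q::finite => real^'n::finite => real^'n" and k :: "'n => 'q"
  assumes F: "scaled_frame \<Omega> x \<rho> T \<epsilon> \<eta> (scale_vf X d \<delta>) k zc cc"
    and X: "!!l. real_analytic_on \<Omega> (X l)" and d: "!!l. 1 <= d l"
    and L: "\<bar>det (mat_of_cols (%i. scale_vf X d \<delta> (k i) x))\<bar> = L"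
    and h1: "h1 = \<eta> / (16 * T)" and \<xi>: "0 < \<xi>" "\<xi> <= 1" "T * (\<xi> * (T * (T * 4))) <= h1 / 2" and \<delta>: "0 < \<delta>"
  defines "\<Phi> \<equiv> Phi \<Omega> X d k x \<delta>"
  shows "!!t. t \<in> ball 0 h1 ==> \<exists>!y. is_exp \<Omega> (Phi_field X d k \<delta> t) x y"
    and "\<Phi> ` ball 0 h1 \<subseteq> \<Omega>" "open (\<Phi> ` ball 0 h1)" "real_analytic_diffeo (ball 0 h1) (\<Phi> ` ball 0 h1) \<Phi>"
    and "!!t. t \<in> ball 0 h1 ==> density_function (pullback_density \<Phi> leb_density) t <= 8 * L"
    and "!!t. t \<in> ball 0 h1 ==> L <= 8 * density_function (pullback_density \<Phi> leb_density) t"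
    and "(%t. complex_of_real (density_function (pullback_density \<Phi> leb_density) t)) \<in> scrA h1"
    and "scrA_norm h1 (%t. complex_of_real (density_function (pullback_density \<Phi> leb_density) t))
      <= (fact CARD('n) * 2 ^ CARD('n)) ^ 3 * L"
    and "cc_ball_deg \<Omega> X d x (\<xi> * \<delta>) \<subseteq> \<Phi> ` ball 0 h1" "\<Phi> ` ball 0 h1 \<subseteq> cc_ball_deg \<Omega> X d x \<delta>"
    and "!!l. real_analytic_on (ball 0 h1) (pullback_vf \<Phi> (scale_vf X d \<delta> l))"
    and "!!l. pullback_vf \<Phi> (scale_vf X d \<delta> l) \<in> scrA h1"
    and "!!l. scrA_norm h1 (pullback_vf \<Phi> (scale_vf X d \<delta> l)) <= T * (T * 4)"
    and "1 / 2 <= (MAX k'\<in>UNIV. INF u\<in>ball 0 h1. \<bar>det (mat_of_cols (%i::'n. pullback_vf \<Phi> (scale_vf X d \<delta> (k' i)) u))\<bar>)"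
    and "(MAX k'\<in>UNIV. INF u\<in>ball 0 h1. \<bar>det (mat_of_cols (%i::'n. pullback_vf \<Phi> (scale_vf X d \<delta> (k' i)) u))\<bar>)
      <= fact CARD('n) * (T * 4) ^ CARD('n)"
    and "ennreal (L / 8) * emeasure lebesgue (ball (0::real^'n) h1) <= emeasure lebesgue (\<Phi> ` ball 0 h1)"
    and "emeasure lebesgue (\<Phi> ` ball 0 h1) <= ennreal (8 * L) * emeasure lebesgue (ball (0::real^'n) h1)"
proof -
  interpret F: scaled_frame \<Omega> x \<rho> T \<epsilon> \<eta> "scale_vf X d \<delta>" k zc cc by (rule F)
  have h: "F.\<eta>1 = h1" by (simp add: F.\<eta>1_def h1)
  have V0: "\<bar>det F.V0\<bar> = L" using L by (simp add: F.det_V0)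
  have field: "Phi_field X d k \<delta> t = (%y. \<Sum>.i. t $ i *. scale_vf X d \<delta> (k i) y)" for t
    by (simp add: Phi_field_def fun_eq_iff)
  have ex: "is_exp \<Omega> (Phi_field X d k \<delta> t) x (F.E t)" if "t \<in> ball 0 h1" for t
    unfolding field by (rule F.E_is_exp) (use that F.eta1_le(5) h in auto)
  have lip: "\<exists>L. L-lipschitz_on C (Phi_field X d k \<delta> t)" if "compact C" "C \<subseteq> \<Omega>" for C t
    using lipschitz_compact_combination[of \<Omega> X C UNIV "%i. t $ i * \<delta> powr d (k i)" k, OF X that]
    by (simp add: field scale_vf_def)
  have \<Phi>: "\<Phi> t = F.E t" if "t \<in> ball 0 F.\<eta>1" for t
    unfolding \<Phi>_def Phi_def using exp_vf_eq(2)[OF lip ex] that h by simp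
  show "\<exists>!y. is_exp \<Omega> (Phi_field X d k \<delta> t) x y" if "t \<in> ball 0 h1" for t
    by (rule exp_vf_eq(1)[OF lip ex[OF that]])
  have im: "\<Phi> ` ball 0 h1 = F.E ` ball 0 h1" using F.Phi_image[OF \<Phi>] h by simp
  show "\<Phi> ` ball 0 h1 \<subseteq> \<Omega>" unfolding im using F.E_in F.eta1_le(5) h by force
  show "open (\<Phi> ` ball 0 h1)" using F.E_image(1) h im by simp
  show "real_analytic_diffeo (ball 0 h1) (\<Phi> ` ball 0 h1) \<Phi>" using F.Phi_diffeo[OF \<Phi>] h by simp
  show "density_function (pullback_density \<Phi> leb_density) t <= 8 * L"
    "L <= 8 * density_function (pullback_density \<Phi> leb_density) t" if "t \<in> ball 0 h1" for t
    using F.Phi_density_bounds[OF \<Phi>, of t] that h V0 by simp_all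
  show "(%t. complex_of_real (density_function (pullback_density \<Phi> leb_density) t)) \<in> scrA h1"
    "scrA_norm h1 (%t. complex_of_real (density_function (pullback_density \<Phi> leb_density) t))
      <= (fact CARD('n) * 2 ^ CARD('n)) ^ 3 * L"
    using F.Phi_density_scrA[OF \<Phi>] h V0 by simp_all
  show "cc_ball_deg \<Omega> X d x (\<xi> * \<delta>) \<subseteq> \<Phi> ` ball 0 h1"
    unfolding cc_ball_deg_def im unfolding h[symmetric]
  proof (rule F.cc_ball_subset_E)
    show "T * (\<xi> * (T * (T * 4))) <= F.\<eta>1 / 2" using \<xi> h by simp
    show "scale_vf X d (\<xi> * \<delta>) l y = (\<xi> powr d l) *. scale_vf X d \<delta> l y" for l y
      using \<xi> \<delta> by (simp add: scale_vf_def powr_mult)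
    \<comment> \<open>Every degree is at least 1 and \<xi> at most 1, so passing from \<delta> to
      \<xi> \<delta> shrinks every field at least by the factor \<xi>.\<close>
    show "\<bar>\<xi> powr d l\<bar> <= \<xi>" for l
      using powr_mono'[of 1 "d l" \<xi>] d[of l] \<xi> by simp
  qed
  show "\<Phi> ` ball 0 h1 \<subseteq> cc_ball_deg \<Omega> X d x \<delta>"
    unfolding cc_ball_deg_def im unfolding h[symmetric] by (rule F.E_subset_cc_ball)
  show "real_analytic_on (ball 0 h1) (pullback_vf \<Phi> (scale_vf X d \<delta> l))"
    "pullback_vf \<Phi> (scale_vf X d \<delta> l) \<in> scrA h1"
    "scrA_norm h1 (pullback_vf \<Phi> (scale_vf X d \<delta> l)) <= T * (T * 4)" for l
    using F.Phi_pullback_scrA[OF \<Phi>, of l] h by simp_all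
  show "1 / 2 <= (MAX k'\<in>UNIV. INF u\<in>ball 0 h1. \<bar>det (mat_of_cols (%i::'n. pullback_vf \<Phi> (scale_vf X d \<delta> (k' i)) u))\<bar>)"
    "(MAX k'\<in>UNIV. INF u\<in>ball 0 h1. \<bar>det (mat_of_cols (%i::'n. pullback_vf \<Phi> (scale_vf X d \<delta> (k' i)) u))\<bar>)
      <= fact CARD('n) * (T * 4) ^ CARD('n)"
    using F.Phi_pullback_det[OF \<Phi>] h by simp_all
  show "ennreal (L / 8) * emeasure lebesgue (ball (0::real^'n) h1) <= emeasure lebesgue (\<Phi> ` ball 0 h1)"
    "emeasure lebesgue (\<Phi> ` ball 0 h1) <= ennreal (8 * L) * emeasure lebesgue (ball (0::real^'n) h1)"
    using F.emeasure_E_image unfolding im h V0 .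
qed

theorem theorem5p1:
  fixes \<Omega> K :: "(real^'n::finite) set"
    and X :: "'q::finite \<Rightarrow> real^'n \<Rightarrow> real^'n"
    and d :: "'q \<Rightarrow> real"
    and j :: "real^'n \<Rightarrow> real \<Rightarrow> 'n \<Rightarrow> 'q"
  assumes "open \<Omega>"
    and "\<And>l. real_analytic_on \<Omega> (X l)"
    and "\<And>x. x \<in> \<Omega> \<Longrightarrow> span (range (\<lambda>l. X l x)) = UNIV"
    and "\<And>l. 1 \<le> d l"
    and "\<And>x. x \<in> \<Omega> \<Longrightarrow> \<exists>U. open U \<and> x \<in> U \<and> U \<subseteq> \<Omega> \<and>
           (\<exists>c :: 'q \<Rightarrow> 'q \<Rightarrow> 'q \<Rightarrow> real^'n \<Rightarrow> real. \<forall>p k.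
              (\<forall>l. d l \<le> d p + d k \<longrightarrow> c p k l \<in> C_omega U) \<and>
              (\<forall>y\<in>U. lie_bracket (X p) (X k) y =
                 (\<Sum>l | d l \<le> d p + d k. c p k l y *\<^sub>R X l y)))"
    and "\<And>x \<delta>. x \<in> \<Omega> \<Longrightarrow> 0 < \<delta> \<Longrightarrow> \<delta> \<le> 1 \<Longrightarrow>
           \<bar>det (mat_of_cols (\<lambda>i. scale_vf X d \<delta> (j x \<delta> i) x))\<bar> = Lambda X d x \<delta>"
    and "compact K" and "K \<subseteq> \<Omega>"
  shows "\<exists>\<eta>\<^sub>1 \<xi>\<^sub>0 s C :: real.
    0 < \<eta>\<^sub>1 \<and> 0 < \<xi>\<^sub>0 \<and> \<xi>\<^sub>0 \<le> 1 \<and> 0 < s \<and> s \<le> \<eta>\<^sub>1 \<and> 0 < C \<and>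
    (\<forall>x\<in>K.
      \<comment> \<open>(i)\<close>
      (\<forall>\<delta>\<in>{0<..\<xi>\<^sub>0}.
         emeasure lebesgue (cc_ball_deg \<Omega> X d x \<delta>) \<le> ennreal C * ennreal (Lambda X d x \<delta>) \<and>
         ennreal (Lambda X d x \<delta>) \<le> ennreal C * emeasure lebesgue (cc_ball_deg \<Omega> X d x \<delta>)) \<and>
      \<comment> \<open>(ii)\<close>
      (\<forall>\<delta>\<in>{0<..\<xi>\<^sub>0 / 2}.
         emeasure lebesgue (cc_ball_deg \<Omega> X d x (2 * \<delta>)) \<le>
           ennreal C * emeasure lebesgue (cc_ball_deg \<Omega> X d x \<delta>)) \<and>
      (\<forall>\<delta>\<in>{0<..1}.
        let \<Phi> = Phi \<Omega> X d (j x \<delta>) x \<delta>;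
            h = density_function (pullback_density \<Phi> leb_density);
            Y = (\<lambda>l. pullback_vf \<Phi> (scale_vf X d \<delta> l))
        in
          \<comment> \<open>(iii)\<close>
          (\<forall>t\<in>ball 0 \<eta>\<^sub>1. \<exists>!y. is_exp \<Omega> (Phi_field X d (j x \<delta>) \<delta> t) x y) \<and>
          \<Phi> ` ball 0 \<eta>\<^sub>1 \<subseteq> \<Omega> \<and> open (\<Phi> ` ball 0 \<eta>\<^sub>1) \<and>
          real_analytic_diffeo (ball 0 \<eta>\<^sub>1) (\<Phi> ` ball 0 \<eta>\<^sub>1) \<Phi> \<and>
          \<comment> \<open>(iv)\<close>
          (\<forall>t\<in>ball 0 \<eta>\<^sub>1. h t \<le> C * Lambda X d x \<delta> \<and> Lambda X d x \<delta> \<le> C * h t) \<and>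
          (\<lambda>t. complex_of_real (h t)) \<in> scrA s \<and>
          scrA_norm s (\<lambda>t. complex_of_real (h t)) \<le> C * Lambda X d x \<delta> \<and>
          \<comment> \<open>(v)\<close>
          cc_ball_deg \<Omega> X d x (\<xi>\<^sub>0 * \<delta>) \<subseteq> \<Phi> ` ball 0 \<eta>\<^sub>1 \<and>
          \<Phi> ` ball 0 \<eta>\<^sub>1 \<subseteq> cc_ball_deg \<Omega> X d x \<delta> \<and>
          \<comment> \<open>(vi)\<close>
          (\<forall>l. real_analytic_on (ball 0 \<eta>\<^sub>1) (Y l) \<and>
               Y l \<in> scrA \<eta>\<^sub>1 \<and> scrA_norm \<eta>\<^sub>1 (Y l) \<le> C) \<and>
          (let M = (MAX k\<in>UNIV. INF u\<in>ball 0 \<eta>\<^sub>1.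
                      \<bar>det (mat_of_cols (\<lambda>i::'n. Y (k i) u))\<bar>)
           in M \<le> C \<and> 1 \<le> C * M)))"
proof -
  note \<Omega> = assms(1) and X = assms(2) and span = assms(3) and d = assms(4) and jmax = assms(6)
  have d0: "0 <= d l" for l using d[of l] by linarith
  obtain r0 B where r0: "0 < r0"
    and data: "!!x \<rho>. x \<in> K ==> 0 < \<rho> ==> \<rho> <= r0 ==> \<exists>zc cc. frame_data \<Omega> X d \<rho> B x zc cc"
    using uniform_frame_data[OF X d assms(5) assms(7,8)] by blast
  define \<rho> where "\<rho> = min 1 r0"
  have \<rho>: "0 < \<rho>" "\<rho> <= 1" "\<rho> <= r0" using r0 by (auto simp: \<rho>_def)
  \<comment> \<open>\<open>T\<close> collects all bounds on the data over \<open>K\<close>; neither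
    it nor the constants derived from it depend on the point or the scale.\<close>
  define T where "T = inverse \<rho> + real CARD('n) + real CARD('q) + \<bar>B\<bar>"
  have T: "inverse \<rho> <= T" "real CARD('n) <= T" "real CARD('q) <= T" "B <= T"
  proof -
    have "0 < inverse \<rho>" "B <= \<bar>B\<bar>" "0 <= \<bar>B\<bar>" using \<rho>(1) by auto
    then show "inverse \<rho> <= T" "real CARD('n) <= T" "real CARD('q) <= T" "B <= T"
      unfolding T_def by linarith+
  qed
  have T1: "1 <= T"
  proof -
    have "1 <= real CARD('n)" by (simp add: Suc_le_eq)
    then show ?thesis using T(2) by linarith
  qed
  obtain e0 where e0: "0 < e0" "!!M :: real^'n^'n. (!!i j. \<bar>M $ i $ j - mat 1 $ i $ j\<bar> <= e0) ==> 1 / 2 <= det M \<and> det M <= 2"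
    by (rule det_near_identity) blast
  define \<epsilon> where "\<epsilon> = min (1 / (100 * T ^ 5)) (e0 / (2 * T))"
  have \<epsilon>: "0 < \<epsilon>" "100 * T ^ 5 * \<epsilon> <= 1" "2 * T * \<epsilon> <= e0"
  proof -
    show "0 < \<epsilon>" using T1 e0(1) by (simp add: \<epsilon>_def)
    have "\<epsilon> <= 1 / (100 * T ^ 5)" "\<epsilon> <= e0 / (2 * T)" by (auto simp: \<epsilon>_def)
    then show "100 * T ^ 5 * \<epsilon> <= 1" "2 * T * \<epsilon> <= e0" using T1 by (auto simp: field_simps)
  qed
  have eps_det: "1 / 2 <= det M \<and> det M <= 2" if "!!i j. \<bar>M $ i $ j - mat 1 $ i $ j\<bar> <= 2 * T * \<epsilon>" for M :: "real^'n^'n"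
    by (rule e0(2)) (use that \<epsilon>(3) order_trans in blast)
  define \<eta> where "\<eta> = \<epsilon> / (100 * T ^ 10)"
  have \<eta>: "0 < \<eta>" "100 * T ^ 10 * \<eta> <= \<epsilon>" using T1 \<epsilon>(1) by (auto simp: \<eta>_def)
  define h1 where "h1 = \<eta> / (16 * T)"
  have h1: "0 < h1" using \<eta> T1 by (simp add: h1_def)
  \<comment> \<open>Obtained by solving \<open>4 * T ^ 3 * \<xi> <= h1 / 2\<close>, the speed
    condition under which admissible paths lift.\<close>
  define \<xi> where "\<xi> = min 1 (h1 / (8 * T ^ 3))"
  have \<xi>: "0 < \<xi>" "\<xi> <= 1" "T * (\<xi> * (T * (T * 4))) <= h1 / 2"
  proof -
    show "0 < \<xi>" "\<xi> <= 1" using h1 T1 by (auto simp: \<xi>_def)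
    have "T * (\<xi> * (T * (T * 4))) = 4 * T ^ 3 * \<xi>" by (simp add: power3_eq_cube)
    also have "\<dots> <= 4 * T ^ 3 * (h1 / (8 * T ^ 3))" using T1 by (intro mult_left_mono) (auto simp: \<xi>_def)
    also have "\<dots> = h1 / 2" using T1 by simp
    finally show "T * (\<xi> * (T * (T * 4))) <= h1 / 2" .
  qed
  have frame: "\<exists>zc cc. scaled_frame \<Omega> x \<rho> T \<epsilon> \<eta> (scale_vf X d \<delta>) (j x \<delta>) zc cc"
    if xK: "x \<in> K" and \<delta>: "0 < \<delta>" "\<delta> <= 1" for x \<delta>
  proof -
    have x: "x \<in> \<Omega>" using xK assms(8) by blast
    obtain zc cc where fd: "frame_data \<Omega> X d \<rho> B x zc cc" using data[OF xK \<rho>(1,3)] by blast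
    from scaled_frame_at_scale[OF X d fd \<rho>(1,2) T \<delta> span[OF x] jmax[OF x \<delta>] \<epsilon>(1,2) eps_det \<eta>]
    show ?thesis by blast
  qed
  define \<mu> where "\<mu> = measure lebesgue (ball (0::real^'n) h1)"
  have \<mu>: "0 < \<mu>" "emeasure lebesgue (ball (0::real^'n) h1) = ennreal \<mu>"
  proof -
    show "0 < \<mu>" unfolding \<mu>_def using content_ball_pos[OF h1, of "0::real^'n"] by simp
    show "emeasure lebesgue (ball (0::real^'n) h1) = ennreal \<mu>"
      unfolding \<mu>_def by (rule emeasure_eq_measure2[OF lmeasurable_ball])
  qed
  have leb: "S \<in> sets lebesgue" if "open S" for S :: "(real^'n) set"
    using borel_open[OF that] by (simp add: sets_completionI_sets)
  have cc_sets: "cc_ball_deg \<Omega> X d x \<delta> \<in> sets lebesgue" if "0 < \<delta>" for x \<delta>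
    using leb cc_ball_deg_open[OF \<Omega> X span that] by blast
  define D where "D = (\<Sum>.l. d l)"
  define \<kappa> where "\<kappa> r = (r powr D) ^ CARD('n)" for r
  have \<kappa>: "0 <= \<kappa> r" for r by (simp add: \<kappa>_def)
  have dil: "Lambda X d x (r * \<delta>) <= \<kappa> r * Lambda X d x \<delta>" if "0 < \<delta>" "1 <= r" for x r \<delta>
    unfolding \<kappa>_def D_def by (rule Lambda_dilate[OF d0 that])
  have Lpos: "0 < Lambda X d x \<delta>" if "x \<in> K" "0 < \<delta>" for x \<delta>
    using span_scale_vf(2)[of X x \<delta> d] span assms(8) that by blast
  \<comment> \<open>The first summand is for the upper bound, where \<open>Lambda\<close> at the
    scale \<delta> / \<xi> is compared with its value at \<delta>; the second one inverts the lower
    volume bound.\<close>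
  define C1 where "C1 = 8 * \<mu> * \<kappa> (1 / \<xi>) + 8 / \<mu>"
  have C1: "0 < C1" "8 * \<mu> * \<kappa> (1 / \<xi>) <= C1" "8 / \<mu> <= C1" using \<mu>(1) \<kappa> by (auto simp: C1_def intro: add_nonneg_pos)
  have upper: "emeasure lebesgue (cc_ball_deg \<Omega> X d x \<delta>) <= ennreal C1 * ennreal (Lambda X d x \<delta>)"
    if x: "x \<in> K" and \<delta>: "0 < \<delta>" "\<delta> <= \<xi>" for x \<delta>
  proof -
    \<comment> \<open>The ball at scale \<delta> lies in the image belonging to \<delta> / \<xi>,
      which must be at most 1; this is the reason for the restriction to \<delta> <= \<xi>.\<close>
    define \<delta>' where "\<delta>' = \<delta> / \<xi>"
    have \<delta>': "0 < \<delta>'" "\<delta>' <= 1" "\<delta> = \<xi> * \<delta>'" "\<delta>' = (1 / \<xi>) * \<delta>" using \<delta> \<xi>(1) by (auto simp: \<delta>'_def)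
    obtain zc cc where F: "scaled_frame \<Omega> x \<rho> T \<epsilon> \<eta> (scale_vf X d \<delta>') (j x \<delta>') zc cc" using frame[OF x \<delta>'(1,2)] by blast
    have x\<Omega>: "x \<in> \<Omega>" using x assms(8) by blast
    note c = scaled_frame_conclusions[OF F X d jmax[OF x\<Omega> \<delta>'(1,2)] h1_def \<xi> \<delta>'(1)]
    have "emeasure lebesgue (cc_ball_deg \<Omega> X d x \<delta>) <= emeasure lebesgue (Phi \<Omega> X d (j x \<delta>') x \<delta>' ` ball 0 h1)"
      using c(9) c(3) \<delta>'(3) by (intro emeasure_mono) (auto intro: leb)
    also have "\<dots> <= ennreal (8 * Lambda X d x \<delta>') * ennreal \<mu>" using c(17) by (simp add: \<mu>(2))
    also have "\<dots> = ennreal (8 * \<mu> * Lambda X d x \<delta>')"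
      using \<mu>(1) Lpos[OF x \<delta>'(1)] by (simp add: ennreal_mult[symmetric] mult_ac)
    also have "\<dots> <= ennreal (C1 * Lambda X d x \<delta>)"
    proof (rule ennreal_leI)
      have "8 * \<mu> * Lambda X d x \<delta>' <= 8 * \<mu> * (\<kappa> (1 / \<xi>) * Lambda X d x \<delta>)"
        unfolding \<delta>'(4) using \<mu>(1) \<xi> by (intro mult_left_mono dil \<delta>) auto
      also have "\<dots> = (8 * \<mu> * \<kappa> (1 / \<xi>)) * Lambda X d x \<delta>" by simp
      also have "\<dots> <= C1 * Lambda X d x \<delta>" using C1(2) Lpos[OF x \<delta>(1)] by (intro mult_right_mono) auto
      finally show "8 * \<mu> * Lambda X d x \<delta>' <= C1 * Lambda X d x \<delta>" .
    qed
    finally show ?thesis using C1 Lpos[OF x \<delta>(1)] by (simp add: ennreal_mult)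
  qed
  have lower: "ennreal (Lambda X d x \<delta>) <= ennreal C1 * emeasure lebesgue (cc_ball_deg \<Omega> X d x \<delta>)"
    if x: "x \<in> K" and \<delta>: "0 < \<delta>" "\<delta> <= 1" for x \<delta>
  proof -
    obtain zc cc where F: "scaled_frame \<Omega> x \<rho> T \<epsilon> \<eta> (scale_vf X d \<delta>) (j x \<delta>) zc cc" using frame[OF x \<delta>] by blast
    have x\<Omega>: "x \<in> \<Omega>" using x assms(8) by blast
    note c = scaled_frame_conclusions[OF F X d jmax[OF x\<Omega> \<delta>] h1_def \<xi> \<delta>(1)]
    have L: "0 < Lambda X d x \<delta>" by (rule Lpos[OF x \<delta>(1)])
    have "ennreal (Lambda X d x \<delta>) = ennreal (8 / \<mu>) * (ennreal (Lambda X d x \<delta> / 8) * ennreal \<mu>)"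
      using \<mu>(1) L by (simp add: ennreal_mult[symmetric])
    also have "\<dots> <= ennreal C1 * emeasure lebesgue (cc_ball_deg \<Omega> X d x \<delta>)"
    proof (intro mult_mono ennreal_leI C1(3))
      have "ennreal (Lambda X d x \<delta> / 8) * ennreal \<mu> <= emeasure lebesgue (Phi \<Omega> X d (j x \<delta>) x \<delta> ` ball 0 h1)"
        using c(16) by (simp add: \<mu>(2))
      also have "\<dots> <= emeasure lebesgue (cc_ball_deg \<Omega> X d x \<delta>)"
        by (rule emeasure_mono[OF c(10) cc_sets[OF \<delta>(1)]])
      finally show "ennreal (Lambda X d x \<delta> / 8) * ennreal \<mu> <= emeasure lebesgue (cc_ball_deg \<Omega> X d x \<delta>)" .
    qed auto
    finally show ?thesis .
  qed
  \<comment> \<open>Upper volume bound at 2 \<delta>, growth of \<open>Lambda\<close> under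
    doubling, lower volume bound at \<delta>.\<close>
  define C2 where "C2 = C1 * \<kappa> 2 * C1"
  have C2: "0 <= C2" using C1(1) \<kappa>[of 2] by (simp add: C2_def)
  have doubling: "emeasure lebesgue (cc_ball_deg \<Omega> X d x (2 * \<delta>)) <= ennreal C2 * emeasure lebesgue (cc_ball_deg \<Omega> X d x \<delta>)"
    if x: "x \<in> K" and \<delta>: "0 < \<delta>" "\<delta> <= \<xi> / 2" for x \<delta>
  proof -
    have "emeasure lebesgue (cc_ball_deg \<Omega> X d x (2 * \<delta>)) <= ennreal C1 * ennreal (Lambda X d x (2 * \<delta>))"
      by (rule upper[OF x]) (use \<delta> in auto)
    also have "\<dots> <= ennreal C1 * ennreal (\<kappa> 2 * Lambda X d x \<delta>)"
      by (intro mult_left_mono ennreal_leI dil) (use \<delta> in auto)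
    also have "\<dots> = ennreal (C1 * \<kappa> 2) * ennreal (Lambda X d x \<delta>)"
      using C1(1) \<kappa>[of 2] Lpos[OF x \<delta>(1)] by (simp add: ennreal_mult mult_ac)
    also have "\<dots> <= ennreal (C1 * \<kappa> 2) * (ennreal C1 * emeasure lebesgue (cc_ball_deg \<Omega> X d x \<delta>))"
      by (intro mult_left_mono lower[OF x]) (use \<delta> \<xi>(2) in auto)
    also have "\<dots> = ennreal C2 * emeasure lebesgue (cc_ball_deg \<Omega> X d x \<delta>)"
      using C1(1) \<kappa>[of 2] by (simp add: C2_def ennreal_mult mult_ac)
    finally show ?thesis .
  qed
  define c3 where "c3 = (fact CARD('n) * 2 ^ CARD('n) :: real) ^ 3"
  define c4 where "c4 = T * (T * 4)"
  define c5 where "c5 = fact CARD('n) * (T * 4) ^ CARD('n)"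
  define C where "C = 8 + C1 + C2 + c3 + c4 + c5"
  have "0 <= c3" "0 <= c4" "0 <= c5" using T1 by (auto simp: c3_def c4_def c5_def)
  then have C: "0 < C" "8 <= C" "C1 <= C" "C2 <= C" "c3 <= C" "c4 <= C" "c5 <= C"
    using C1(1) C2 by (auto simp: C_def)
  have le: "b * a <= C * a" if "b <= C" "0 <= a" for a b using that by (rule mult_right_mono)
  have le': "y <= ennreal C * m" if "y <= ennreal b * m" "b <= C" for y m b
    using that(1) mult_right_mono[OF ennreal_leI[OF that(2)], of m] by simp
  show ?thesis
  \<comment> \<open>The series of the density converges on the full ball, so the radius s is again
    \<open>h1\<close>.\<close>
  proof (rule exI[of _ h1], rule exI[of _ \<xi>], rule exI[of _ h1], rule exI[of _ C], intro conjI ballI)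
    show "0 < h1" "0 < \<xi>" "\<xi> <= 1" "0 < h1" "h1 <= h1" "0 < C" using h1 \<xi> C by auto
    fix x assume x: "x \<in> K"
    have x\<Omega>: "x \<in> \<Omega>" using x assms(8) by blast
    show "emeasure lebesgue (cc_ball_deg \<Omega> X d x \<delta>) <= ennreal C * ennreal (Lambda X d x \<delta>)"
      "ennreal (Lambda X d x \<delta>) <= ennreal C * emeasure lebesgue (cc_ball_deg \<Omega> X d x \<delta>)" if "\<delta> \<in> {0<..\<xi>}" for \<delta>
      using le'[OF upper[OF x] C(3)] le'[OF lower[OF x] C(3)] that \<xi>(2) by auto
    show "emeasure lebesgue (cc_ball_deg \<Omega> X d x (2 * \<delta>)) <= ennreal C * emeasure lebesgue (cc_ball_deg \<Omega> X d x \<delta>)"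
      if "\<delta> \<in> {0<..\<xi> / 2}" for \<delta>
      using le'[OF doubling[OF x] C(4)] that by auto
    fix \<delta> :: real assume "\<delta> \<in> {0<..1}"
    then have \<delta>: "0 < \<delta>" "\<delta> <= 1" by auto
    have L: "0 <= Lambda X d x \<delta>" using Lpos[OF x \<delta>(1)] by simp
    obtain zc cc where F: "scaled_frame \<Omega> x \<rho> T \<epsilon> \<eta> (scale_vf X d \<delta>) (j x \<delta>) zc cc" using frame[OF x \<delta>] by blast
    note c = scaled_frame_conclusions[OF F X d jmax[OF x\<Omega> \<delta>] h1_def \<xi> \<delta>(1)]
    have M: "1 <= C * M" if "1 / 2 <= M" for M :: real
      using mult_mono[of 8 C "1 / 2" M] that C by simp
    show "let \<Phi> = Phi \<Omega> X d (j x \<delta>) x \<delta>;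
            h = density_function (pullback_density \<Phi> leb_density);
            Y = (%l. pullback_vf \<Phi> (scale_vf X d \<delta> l))
        in
          (\<forall>t\<in>ball 0 h1. \<exists>!y. is_exp \<Omega> (Phi_field X d (j x \<delta>) \<delta> t) x y) \<and>
          \<Phi> ` ball 0 h1 \<subseteq> \<Omega> \<and> open (\<Phi> ` ball 0 h1) \<and>
          real_analytic_diffeo (ball 0 h1) (\<Phi> ` ball 0 h1) \<Phi> \<and>
          (\<forall>t\<in>ball 0 h1. h t <= C * Lambda X d x \<delta> \<and> Lambda X d x \<delta> <= C * h t) \<and>
          (%t. complex_of_real (h t)) \<in> scrA h1 \<and>
          scrA_norm h1 (%t. complex_of_real (h t)) <= C * Lambda X d x \<delta> \<and>
          cc_ball_deg \<Omega> X d x (\<xi> * \<delta>) \<subseteq> \<Phi> ` ball 0 h1 \<and>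
          \<Phi> ` ball 0 h1 \<subseteq> cc_ball_deg \<Omega> X d x \<delta> \<and>
          (\<forall>l. real_analytic_on (ball 0 h1) (Y l) \<and> Y l \<in> scrA h1 \<and> scrA_norm h1 (Y l) <= C) \<and>
          (let M = (MAX k\<in>UNIV. INF u\<in>ball 0 h1. \<bar>det (mat_of_cols (%i::'n. Y (k i) u))\<bar>)
           in M <= C \<and> 1 <= C * M)"
      unfolding Let_def
    proof (intro conjI ballI allI)
      fix t :: "real^'n" assume t: "t \<in> ball 0 h1"
      show "density_function (pullback_density (Phi \<Omega> X d (j x \<delta>) x \<delta>) leb_density) t <= C * Lambda X d x \<delta>"
        using c(5)[OF t] le[OF C(2) L] by linarith
      have "0 <= density_function (pullback_density (Phi \<Omega> X d (j x \<delta>) x \<delta>) leb_density) t"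
        using c(6)[OF t] L by linarith
      from le[OF C(2) this] c(6)[OF t]
      show "Lambda X d x \<delta> <= C * density_function (pullback_density (Phi \<Omega> X d (j x \<delta>) x \<delta>) leb_density) t"
        by linarith
    next
      show "scrA_norm h1 (%t. complex_of_real (density_function (pullback_density (Phi \<Omega> X d (j x \<delta>) x \<delta>) leb_density) t)) <= C * Lambda X d x \<delta>"
        using c(8) le[OF C(5) L] unfolding c3_def by linarith
      show "scrA_norm h1 (pullback_vf (Phi \<Omega> X d (j x \<delta>) x \<delta>) (scale_vf X d \<delta> l)) <= C" for l
        using c(13)[of l] C(6) unfolding c4_def by linarith
      show "(MAX k\<in>UNIV. INF u\<in>ball 0 h1. \<bar>det (mat_of_cols (%i::'n. pullback_vf (Phi \<Omega> X d (j x \<delta>) x \<delta>) (scale_vf X d \<delta> (k i)) u))\<bar>) <= C"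
        using c(15) C(7) unfolding c5_def by linarith
      show "1 <= C * (MAX k\<in>UNIV. INF u\<in>ball 0 h1. \<bar>det (mat_of_cols (%i::'n. pullback_vf (Phi \<Omega> X d (j x \<delta>) x \<delta>) (scale_vf X d \<delta> (k i)) u))\<bar>)"
        by (rule M[OF c(14)])
    qed (fact c(1) c(2) c(3) c(4) c(7) c(9) c(10) c(11) c(12))+
  qed
qed

end
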